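(* Let $\{(\mathbf u^{n},r^{n})\}_{1\le n\le N}$ be generated by Algorithm 1 (described in the context) with $N\in\mathbb N$ time steps of size $k=T/N$. There exists a constant $C>0$ (independent of $k$) such that $$\max_{1\le n\le N}\mathbb E\bigl[\|\nabla\mathbf u^n\|^2\bigr]+\mathbb E\Bigl[\sum_{n=1}^N\|\nabla(\mathbf u^n-\mathbf u^{n-1})\|^2\Bigr]+\mathbb E\Bigl[k\sum_{n=1}^N\|\mathbf A\mathbf u^n\|^2\Bigr]\le C$$ and $$\mathbb E\Bigl[k\sum_{n=1}^N\|\nabla r^n\|^2\Bigr]\le C .$$
   Context: Setting. Let $d\in\{2,3\}$, $L,T>0$, $D=(0,L)^d$. The subscript "per" denotes functions that are periodic with period $L$ in each coordinate direction ($L^2_{per}$, $H^\ell_{per}$); $(\cdot,\cdot)$ and $\|\cdot\|$ are the $L^2(D)$ inner product and norm; spaces "$/\mathbb R$" are identified with mean-zero functions. Put $\mathbb H=\{\mathbf v\in L^2_{per}(D;\mathbb R^d):\operatorname{div}\mathbf v=0\}$, $\mathbb V=\{\mathbf v\in H^1_{per}(D;\mathbb R^d):\operatorname{div}\mathbf v=0\}$. $\mathbf P_{\mathbb H}:L^2_{per}(D;\mathbb R^d)\to\mathbb H$ is the orthogonal (Helmholtz) projection and $\mathbf A:=\mathbf P_{\mathbb H}\Delta$ is the Stokes operator. Let $(\Omega,\mathcal F,\{\mathcal F_t\},\mathbb P)$ be a filtered probability space with a continuous filtration, and $W$ a real-valued Wiener process on it. Data. $\mathbf u_0\in L^2(\Omega;\mathbb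 V\cap H^2_{per}(D;\mathbb R^d))$ is $\mathcal F_0$-measurable; $\mathbf f\in L^2(\Omega;C^{1/2}([0,T];H^1_{per}(D;\mathbb R^d)))$ is $\{\mathcal F_t\}$-adapted. The map $\mathbf B$ (taking $L^2(\Omega;H^1_{per}(D;\mathbb R^d))$ into itself) satisfies, for some constant $C>0$ and all $\mathbf v,\mathbf w\in L^2_{per}(D;\mathbb R^d)$: $\|\mathbf B(\mathbf v)-\mathbf B(\mathbf w)\|\le C\|\mathbf v-\mathbf w\|$, $\|\mathbf B(\mathbf v)\|\le C(1+\|\mathbf v\|)$, and $\|\mathcal D\mathbf B\|_*\le C$, where $\mathcal D\mathbf B$ is the Gateaux derivative of $\mathbf B$ and $\|\cdot\|_*$ its operator norm. Time mesh. $N\in\mathbb N$, $k=T/N$, $t_n=nk$, $\Delta_{n+1}W=W(t_{n+1})-W(t_n)$, $\mathbf f^{n+1}=\mathbf f(t_{n+1},\cdot)$. Algorithm 1. Let $\mathbf u^0=\mathbf u_0$. For $n=0,\dots,N-1$: (1) find $\xi^n\in L^2(\Omega;H^1_{per}(D)/\mathbb R)$ with $(\nabla\xi^n,\nabla\phi)=(\mathbf B(\mathbf u^n),\nabla\phi)$ for all $\phi\in H^1_{per}(D)$; (2) set $\boldsymbol\eta^n:=\mathbf B(\mathbf u^n)-\nabla\xi^n$ and find $(\mathbf u^{n+1},r^{n+1})\in L^2(\Omega;\mathbb V\times L^2_{per}(D)/\mathbb R)$ such that for all $\mathbf v\in H^1_{per}(D;\mathbb R^d)$, $q\in L^2_{per}(D)$,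 $$(\mathbf u^{n+1},\mathbf v)+k(\nabla\mathbf u^{n+1},\nabla\mathbf v)-k(\operatorname{div}\mathbf v,r^{n+1})=(\mathbf u^n,\mathbf v)+k(\mathbf f^{n+1},\mathbf v)+(\boldsymbol\eta^n\Delta_{n+1}W,\mathbf v),\qquad(\operatorname{div}\mathbf u^{n+1},q)=0.$$ Constants. $C$ is a generic positive constant that may depend on $T,\mathbf u_0,\mathbf f,D$ (and the fixed $\mathbf B$) but not on $k$. *)

theory Defs
  imports "HOL-Probability.Probability"
begin

section \<open>Periodic function spaces\<close>

text \<open>
  Functions on the cell \<open>D = (0, L)^d\<close> are represented by their \<open>L\<close>-periodic extensions to
  \<open>\<real>^d\<close>, where \<open>d = CARD('n)\<close>.  Elements of \<open>L\<^sup>2\<close> are represented by functions, not by classes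
  modulo null sets, so every "norm" below is a seminorm that vanishes on a.e. zero functions.  The
  codomain \<open>'b\<close> is \<open>real\<close> for scalar fields and \<open>real^'n\<close> for vector fields.
\<close>

definition cell :: "real \<Rightarrow> (real^'n) set" where
  "cell L = box 0 (\<chi> i. L)"

definition periodic :: "real \<Rightarrow> (real^'n \<Rightarrow> 'b) \<Rightarrow> bool" where
  "periodic L v \<longleftrightarrow> (\<forall>i x. v (x + L *\<^sub>R axis i 1) = v x)"

definition L2per :: "real \<Rightarrow> (real^'n \<Rightarrow> 'b::euclidean_space) set" where
  "L2per L = {v. periodic L v \<and> v \<in> borel_measurable lebesgue \<and>
                 integrable (lebesgue_on (cell L)) (\<lambda>x. (norm (v x))\<^sup>2)}"

definition L2_ip :: "real \<Rightarrow> (real^'n \<Rightarrow> 'b::euclidean_space) \<Rightarrow> (real^'n \<Rightarrow> 'b) \<Rightarrow> real" where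
  "L2_ip L v w = (LINT x|lebesgue_on (cell L). v x \<bullet> w x)"

definition L2_nrm :: "real \<Rightarrow> (real^'n \<Rightarrow> 'b::euclidean_space) \<Rightarrow> real" where
  "L2_nrm L v = sqrt (L2_ip L v v)"

text \<open>The quotient by constants is identified with the functions of mean zero.\<close>

definition mean_zero :: "real \<Rightarrow> (real^'n \<Rightarrow> real) set" where
  "mean_zero L = {q. (LINT x|lebesgue_on (cell L). q x) = 0}"

definition partial_deriv :: "'n \<Rightarrow> (real^'n \<Rightarrow> real) \<Rightarrow> real^'n \<Rightarrow> real" where
  "partial_deriv i \<phi> x = frechet_derivative \<phi> (at x) (axis i 1)"

primrec Ck :: "nat \<Rightarrow> (real^'n \<Rightarrow> real) \<Rightarrow> bool" where
  "Ck 0 \<phi> \<longleftrightarrow> continuous_on UNIV \<phi>"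
| "Ck (Suc m) \<phi> \<longleftrightarrow> (\<forall>x. \<phi> differentiable (at x)) \<and> (\<forall>i. Ck m (partial_deriv i \<phi>))"

definition test_functions :: "(real^'n \<Rightarrow> real) set" where
  "test_functions = {\<phi>. (\<forall>m. Ck m \<phi>) \<and> compact (closure {x. \<phi> x \<noteq> 0})}"

text \<open>
  Weak derivatives are distributional derivatives on all of \<open>\<real>^d\<close>; applied to periodic functions
  this yields \<open>H^l_per(D) = {v \<in> H^l_loc(\<real>^d). v is periodic}\<close>.  The function \<open>wderiv L i v\<close> is
  a representative of the weak derivative, unique up to null sets, and is meaningful only if
  \<open>v\<close> has a weak derivative in \<open>L2per L\<close>.
\<close>

definition is_wderiv :: "'n \<Rightarrow> (real^'n \<Rightarrow> 'b::euclidean_space) \<Rightarrow> (real^'n \<Rightarrow> 'b) \<Rightarrow> bool" where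
  "is_wderiv i v g \<longleftrightarrow> (\<forall>\<phi>\<in>test_functions.
     (LINT x|lebesgue. \<phi> x *\<^sub>R g x) = - (LINT x|lebesgue. partial_deriv i \<phi> x *\<^sub>R v x))"

definition wderiv :: "real \<Rightarrow> 'n \<Rightarrow> (real^'n \<Rightarrow> 'b::euclidean_space) \<Rightarrow> real^'n \<Rightarrow> 'b" where
  "wderiv L i v = (SOME g. g \<in> L2per L \<and> is_wderiv i v g)"

primrec Hper :: "nat \<Rightarrow> real \<Rightarrow> (real^'n \<Rightarrow> 'b::euclidean_space) set" where
  "Hper 0 L = L2per L"
| "Hper (Suc l) L = {v \<in> L2per L. \<forall>i. \<exists>g\<in>Hper l L. is_wderiv i v g}"

text \<open>\<open>H_seminorm_sq l L v\<close> is the square of the \<open>L\<^sup>2\<close> norm of the tensor of \<open>l\<close>-th derivatives.\<close>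

primrec H_seminorm_sq :: "nat \<Rightarrow> real \<Rightarrow> (real^'n \<Rightarrow> 'b::euclidean_space) \<Rightarrow> real" where
  "H_seminorm_sq 0 L v = (L2_nrm L v)\<^sup>2"
| "H_seminorm_sq (Suc l) L v = (\<Sum>i\<in>UNIV. H_seminorm_sq l L (wderiv L i v))"

definition H_nrm :: "nat \<Rightarrow> real \<Rightarrow> (real^'n \<Rightarrow> 'b::euclidean_space) \<Rightarrow> real" where
  "H_nrm l L v = sqrt (\<Sum>j\<le>l. H_seminorm_sq j L v)"

definition grad :: "real \<Rightarrow> (real^'n \<Rightarrow> real) \<Rightarrow> real^'n \<Rightarrow> real^'n" where
  "grad L q x = (\<chi> i. wderiv L i q x)"

definition divergence :: "real \<Rightarrow> (real^'n \<Rightarrow> real^'n) \<Rightarrow> real^'n \<Rightarrow> real" where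
  "divergence L v x = (\<Sum>i\<in>UNIV. wderiv L i v x $ i)"

definition laplacian :: "real \<Rightarrow> (real^'n \<Rightarrow> real^'n) \<Rightarrow> real^'n \<Rightarrow> real^'n" where
  "laplacian L v x = (\<Sum>i\<in>UNIV. wderiv L i (wderiv L i v) x)"

text \<open>\<open>(\<nabla>v, \<nabla>w)\<close> and \<open>\<parallel>\<nabla>v\<parallel>\<close> for scalar fields and, with the Frobenius product, vector fields.\<close>

definition grad_ip :: "real \<Rightarrow> (real^'n \<Rightarrow> 'b::euclidean_space) \<Rightarrow> (real^'n \<Rightarrow> 'b) \<Rightarrow> real" where
  "grad_ip L v w = (\<Sum>i\<in>UNIV. L2_ip L (wderiv L i v) (wderiv L i w))"

definition grad_nrm :: "real \<Rightarrow> (real^'n \<Rightarrow> 'b::euclidean_space) \<Rightarrow> real" where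
  "grad_nrm L v = sqrt (grad_ip L v v)"

text \<open>The condition \<open>div v = 0\<close> for \<open>L\<^sup>2\<close> fields is understood in the sense of distributions.\<close>

definition div_free :: "(real^'n \<Rightarrow> real^'n) \<Rightarrow> bool" where
  "div_free v \<longleftrightarrow> (\<forall>\<phi>\<in>test_functions. (LINT x|lebesgue. v x \<bullet> (\<chi> i. partial_deriv i \<phi> x)) = 0)"

definition Hdiv :: "real \<Rightarrow> (real^'n \<Rightarrow> real^'n) set" where
  "Hdiv L = {v \<in> L2per L. div_free v}"

definition Vdiv :: "real \<Rightarrow> (real^'n \<Rightarrow> real^'n) set" where
  "Vdiv L = {v \<in> Hper 1 L. div_free v}"

definition helmholtz_proj :: "real \<Rightarrow> (real^'n \<Rightarrow> real^'n) \<Rightarrow> real^'n \<Rightarrow> real^'n" where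
  "helmholtz_proj L v =
     (SOME w. w \<in> Hdiv L \<and> (\<forall>z\<in>Hdiv L. L2_ip L (\<lambda>x. v x - w x) z = 0))"

text \<open>The Stokes operator, with domain \<open>Vdiv L \<inter> Hper 2 L\<close>.\<close>

definition stokes :: "real \<Rightarrow> (real^'n \<Rightarrow> real^'n) \<Rightarrow> real^'n \<Rightarrow> real^'n" where
  "stokes L v = helmholtz_proj L (laplacian L v)"

definition holder_H1 :: "real \<Rightarrow> real \<Rightarrow> real \<Rightarrow> (real \<Rightarrow> real^'n \<Rightarrow> real^'n) set" where
  "holder_H1 a T L = {g. (\<forall>t\<in>{0..T}. g t \<in> Hper 1 L) \<and>
     (\<exists>K. \<forall>s\<in>{0..T}. \<forall>t\<in>{0..T}. H_nrm 1 L (g t - g s) \<le> K * \<bar>t - s\<bar> powr a)}"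

definition holder_H1_nrm :: "real \<Rightarrow> real \<Rightarrow> real \<Rightarrow> (real \<Rightarrow> real^'n \<Rightarrow> real^'n) \<Rightarrow> real" where
  "holder_H1_nrm a T L g = (SUP t\<in>{0..T}. H_nrm 1 L (g t)) +
     (SUP (s, t)\<in>{(s, t). s \<in> {0..T} \<and> t \<in> {0..T} \<and> s \<noteq> t}.
        H_nrm 1 L (g t - g s) / \<bar>t - s\<bar> powr a)"


section \<open>Stochastic setting\<close>

text \<open>
  Strong (Bochner) measurability of \<open>U\<close> as a map into the space \<open>X\<close> normed by \<open>nrm\<close>, with respect
  to the sub-\<open>\<sigma>\<close>-algebra of \<open>G\<close>; only \<open>sets G\<close> matters, null sets refer to \<open>M\<close>.
\<close>

definition strongly_measurable ::
  "'w measure \<Rightarrow> 'w measure \<Rightarrow> 'v::minus set \<Rightarrow> ('v \<Rightarrow> real) \<Rightarrow> ('w \<Rightarrow> 'v) \<Rightarrow> bool" where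
  "strongly_measurable M G X nrm U \<longleftrightarrow> (AE \<omega> in M. U \<omega> \<in> X) \<and>
     (\<exists>s. (\<forall>j. simple_function G (s j) \<and> s j ` space M \<subseteq> X) \<and>
          (AE \<omega> in M. (\<lambda>j::nat. nrm (s j \<omega> - U \<omega>)) \<longlonglongrightarrow> 0))"

definition L2_Omega :: "'w measure \<Rightarrow> 'v::minus set \<Rightarrow> ('v \<Rightarrow> real) \<Rightarrow> ('w \<Rightarrow> 'v) set" where
  "L2_Omega M X nrm = {U. strongly_measurable M M X nrm U \<and>
                          (\<integral>\<^sup>+\<omega>. ennreal ((nrm (U \<omega>))\<^sup>2) \<partial>M) < \<infinity>}"

text \<open>A filtration on \<open>[0, T]\<close> that is continuous from the right and from the left.\<close>

definition continuous_filtration :: "real \<Rightarrow> 'w measure \<Rightarrow> (real \<Rightarrow> 'w measure) \<Rightarrow> bool" where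
  "continuous_filtration T M F \<longleftrightarrow>
     (\<forall>t\<in>{0..T}. subalgebra M (F t)) \<and>
     (\<forall>s\<in>{0..T}. \<forall>t\<in>{0..T}. s \<le> t \<longrightarrow> sets (F s) \<subseteq> sets (F t)) \<and>
     (\<forall>t\<in>{0..<T}. sets (F t) = (\<Inter>s\<in>{t<..T}. sets (F s))) \<and>
     (\<forall>t\<in>{0<..T}. sets (F t) = sigma_sets (space M) (\<Union>s\<in>{0..<t}. sets (F s)))"

definition wiener_process ::
  "real \<Rightarrow> 'w measure \<Rightarrow> (real \<Rightarrow> 'w measure) \<Rightarrow> (real \<Rightarrow> 'w \<Rightarrow> real) \<Rightarrow> bool" where
  "wiener_process T M F W \<longleftrightarrow>
     (\<forall>t\<in>{0..T}. W t \<in> borel_measurable (F t)) \<and>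
     (AE \<omega> in M. W 0 \<omega> = 0) \<and>
     (AE \<omega> in M. continuous_on {0..T} (\<lambda>t. W t \<omega>)) \<and>
     (\<forall>s\<in>{0..T}. \<forall>t\<in>{0..T}. s < t \<longrightarrow>
        distributed M lborel (\<lambda>\<omega>. W t \<omega> - W s \<omega>) (normal_density 0 (sqrt (t - s))) \<and>
        prob_space.indep_set M (sets (F s))
          {(\<lambda>\<omega>. W t \<omega> - W s \<omega>) -` A \<inter> space M | A. A \<in> sets borel})"


section \<open>The noise coefficient\<close>

text \<open>\<open>DB\<close> is the Gateaux derivative of \<open>B\<close> at \<open>v\<close>: a linear map on \<open>L\<^sup>2\<close> (modulo null sets)
  that gives all directional derivatives as limits in \<open>L\<^sup>2\<close>.\<close>

definition has_gateaux_derivative ::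
  "real \<Rightarrow> ((real^'n \<Rightarrow> real^'n) \<Rightarrow> real^'n \<Rightarrow> real^'n) \<Rightarrow>
   ((real^'n \<Rightarrow> real^'n) \<Rightarrow> real^'n \<Rightarrow> real^'n) \<Rightarrow> (real^'n \<Rightarrow> real^'n) \<Rightarrow> bool" where
  "has_gateaux_derivative L B DB v \<longleftrightarrow>
     (\<forall>h\<in>L2per L. DB h \<in> L2per L) \<and>
     (\<forall>h\<in>L2per L. \<forall>g\<in>L2per L. \<forall>a b.
        L2_nrm L (\<lambda>x. DB (\<lambda>y. a *\<^sub>R h y + b *\<^sub>R g y) x - (a *\<^sub>R DB h x + b *\<^sub>R DB g x)) = 0) \<and>
     (\<forall>h\<in>L2per L.
        ((\<lambda>\<epsilon>. L2_nrm L (\<lambda>x. (1 / \<epsilon>) *\<^sub>R (B (\<lambda>y. v y + \<epsilon> *\<^sub>R h y) x - B v x) - DB h x))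
           \<longlongrightarrow> 0) (at 0))"

definition L2_opnorm ::
  "real \<Rightarrow> ((real^'n \<Rightarrow> real^'n) \<Rightarrow> real^'n \<Rightarrow> real^'n) \<Rightarrow> ennreal" where
  "L2_opnorm L A = (SUP h\<in>{h \<in> L2per L. L2_nrm L h \<le> 1}. ennreal (L2_nrm L (A h)))"

definition noise_coefficient ::
  "'w measure \<Rightarrow> real \<Rightarrow> ((real^'n \<Rightarrow> real^'n) \<Rightarrow> real^'n \<Rightarrow> real^'n) \<Rightarrow> bool" where
  "noise_coefficient M L B \<longleftrightarrow>
     (\<forall>v\<in>L2per L. B v \<in> L2per L) \<and>
     (\<forall>U\<in>L2_Omega M (Hper 1 L) (H_nrm 1 L). (\<lambda>\<omega>. B (U \<omega>)) \<in> L2_Omega M (Hper 1 L) (H_nrm 1 L)) \<and>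
     (\<exists>C>0. \<forall>v\<in>L2per L.
        (\<forall>w\<in>L2per L. L2_nrm L (\<lambda>x. B v x - B w x) \<le> C * L2_nrm L (\<lambda>x. v x - w x)) \<and>
        L2_nrm L (B v) \<le> C * (1 + L2_nrm L v) \<and>
        (\<exists>DB. has_gateaux_derivative L B DB v \<and> L2_opnorm L DB \<le> ennreal C))"


section \<open>The time-stepping scheme\<close>

text \<open>
  The variational equations hold pathwise: almost surely, for all test functions.  Only
  \<open>\<xi> 0, ..., \<xi> (N - 1)\<close>, \<open>u 0, ..., u N\<close> and \<open>r 1, ..., r N\<close> are constrained.
\<close>

definition algorithm1 ::
  "'w measure \<Rightarrow> real \<Rightarrow> real \<Rightarrow> ('w \<Rightarrow> real \<Rightarrow> real^'n \<Rightarrow> real^'n) \<Rightarrow>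
   ((real^'n \<Rightarrow> real^'n) \<Rightarrow> real^'n \<Rightarrow> real^'n) \<Rightarrow> ('w \<Rightarrow> real^'n \<Rightarrow> real^'n) \<Rightarrow>
   (real \<Rightarrow> 'w \<Rightarrow> real) \<Rightarrow> nat \<Rightarrow>
   (nat \<Rightarrow> 'w \<Rightarrow> real^'n \<Rightarrow> real) \<Rightarrow> (nat \<Rightarrow> 'w \<Rightarrow> real^'n \<Rightarrow> real^'n) \<Rightarrow>
   (nat \<Rightarrow> 'w \<Rightarrow> real^'n \<Rightarrow> real) \<Rightarrow> bool" where
  "algorithm1 M T L f B u0 W N \<xi> u r \<longleftrightarrow>
     (let k = T / real N;
          t = (\<lambda>n. real n * k);
          \<Delta>W = (\<lambda>n \<omega>. W (t (Suc n)) \<omega> - W (t n) \<omega>);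
          \<eta> = (\<lambda>n \<omega> x. B (u n \<omega>) x - grad L (\<xi> n \<omega>) x)
      in u 0 = u0 \<and>
         (\<forall>n<N.
            \<xi> n \<in> L2_Omega M (Hper 1 L \<inter> mean_zero L) (H_nrm 1 L) \<and>
            (AE \<omega> in M. \<forall>\<phi>\<in>Hper 1 L.
               L2_ip L (grad L (\<xi> n \<omega>)) (grad L \<phi>) = L2_ip L (B (u n \<omega>)) (grad L \<phi>)) \<and>
            u (Suc n) \<in> L2_Omega M (Vdiv L) (H_nrm 1 L) \<and>
            r (Suc n) \<in> L2_Omega M (L2per L \<inter> mean_zero L) (L2_nrm L) \<and>
            (AE \<omega> in M. \<forall>v\<in>Hper 1 L. \<forall>q\<in>L2per L.
               L2_ip L (u (Suc n) \<omega>) v + k * grad_ip L (u (Suc n) \<omega>) v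
                 - k * L2_ip L (divergence L v) (r (Suc n) \<omega>)
               = L2_ip L (u n \<omega>) v + k * L2_ip L (f \<omega> (t (Suc n))) v
                 + L2_ip L (\<lambda>x. \<Delta>W n \<omega> *\<^sub>R \<eta> n \<omega> x) v \<and>
               L2_ip L (divergence L (u (Suc n) \<omega>)) q = 0)))"

end

theory Submission
  imports Defs
begin

text \<open>
  In the real orthonormal basis \<open>h\<^sub>m = L\<^bsup>-d/2\<^esup> (cos (\<kappa>\<^sub>m \<bullet> x) + sin (\<kappa>\<^sub>m \<bullet> x))\<close>, \<open>\<kappa>\<^sub>m = 2 \<pi> m / L\<close>, the scheme
  decouples: with \<open>\<lambda>\<^sub>m = |\<kappa>\<^sub>m|\<^sup>2\<close> and the projection \<open>P\<^sub>m\<close> onto the complement of \<open>\<kappa>\<^sub>m\<close>, the coefficients satisfy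
  \<open>(1 + k \<lambda>\<^sub>m) c\<^sub>m(u\<^sup>n\<^sup>+\<^sup>1) = c\<^sub>m(u\<^sup>n) + k P\<^sub>m c\<^sub>m(f) + \<Delta>W P\<^sub>m c\<^sub>m(B(u\<^sup>n))\<close>, and the pressure gradient is the part of \<open>f\<close>
  removed by \<open>P\<^sub>m\<close>.  Squaring, taking expectations (the increment \<open>\<Delta>W\<close> is independent of the other factors at
  time \<open>t\<^sub>n\<close>), multiplying by \<open>1 + \<lambda>\<^sub>m\<close> and summing over \<open>m\<close> bounds the \<open>H\<^sup>1\<close> energy of a step by
  \<open>(1 + C k)\<close> times the previous one plus \<open>C k\<close>; the factor \<open>(1 + k \<lambda>\<^sub>m)\<^sup>2\<close> on the left also yields the
  bounds for \<open>Au\<close> and for the increments, and a discrete Gronwall argument concludes.  Regularity,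
  measurability and all integrations by parts are read off the coefficients.
\<close>

section \<open>Smooth functions\<close>

text \<open>No hypothesis controls the gradient of \<open>B(v)\<close>: the Lipschitz and derivative
  bounds live in L2. Growth of \<open>B\<close> in H1 has to be extracted from the self-mapping
  property on random fields, and it comes only for the full H1 norm; this is why the energy carries
  the weight \<open>1 + \<lambda>\<close> instead of \<open>\<lambda>\<close>. A second obstacle is
  that H2 regularity of the iterates and H1 regularity of the pressure must be proved as well, so
  the scheme cannot be tested with \<open>A u\<close> directly. Mode by mode every operation is
  finite-dimensional, and regularity becomes finiteness of a series in \<open>ennreal\<close>, where
  no prior integrability is required. Third, step (1) of the scheme is what makes the pressure bound
  possible: a gradient part of the noise would enter the pressure as a multiple of
  \<open>\<Delta>W / k\<close>, whose square has expectation of order \<open>1 / k\<close>. With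
  that part removed, the pressure gradient is estimated path by path. Fields are not identified
  almost everywhere and \<open>wderiv\<close> is a choice, so equalities between fields are obtained
  by comparing coefficients.\<close>

lemma partial_deriv_eqI:
  assumes "(\<phi> has_derivative \<phi>') (at x)"
  shows "partial_deriv i \<phi> x = \<phi>' (axis i 1)"
  unfolding partial_deriv_def using frechet_derivative_at[OF assms] by simp

lemma Ck_differentiable_imp_continuous:
  assumes "\<And>x. \<phi> differentiable (at x)"
  shows "continuous_on UNIV \<phi>"
  using assms by (simp add: continuous_at_imp_continuous_on differentiable_imp_continuous_within)

text \<open>A set of differentiable functions that is closed under partial derivatives consists of
  smooth functions. This gives all orders at once for constants, functions of one coordinate and
  Hartley functions.\<close>

lemma Ck_coinduct:
  assumes "\<phi> \<in> S"
    and "\<And>\<phi>. \<phi> \<in> S \<Longrightarrow> (\<forall>x. \<phi> differentiable (at x)) \<and> (\<forall>i. partial_deriv i \<phi> \<in> S)"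
  shows "Ck m \<phi>"
  using assms(1)
proof (induction m arbitrary: \<phi>)
  case 0
  then show ?case using assms(2) by (auto intro: Ck_differentiable_imp_continuous)
next
  case (Suc m)
  then show ?case using assms(2) by auto
qed

lemma Ck_SucD: "Ck (Suc m) \<phi> \<Longrightarrow> Ck m \<phi>"
proof (induction m arbitrary: \<phi>)
  case 0
  then show ?case by (auto intro: Ck_differentiable_imp_continuous)
next
  case (Suc m)
  then show ?case by auto
qed

lemma Ck_const: "Ck m (\<lambda>x. c)"
  by (rule Ck_coinduct[where S = "range (\<lambda>c x. c)"])
    (auto simp: partial_deriv_eqI[OF has_derivative_const] fun_eq_iff)

lemma partial_deriv_add:
  assumes "f differentiable (at x)" "g differentiable (at x)"
  shows "partial_deriv i (\<lambda>x. f x + g x) x = partial_deriv i f x + partial_deriv i g x"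
  by (subst partial_deriv_eqI[OF has_derivative_add])
    (use assms in \<open>auto simp: partial_deriv_def frechet_derivative_works[symmetric]\<close>)

lemma partial_deriv_mult:
  assumes "f differentiable (at x)" "g differentiable (at x)"
  shows "partial_deriv i (\<lambda>x. f x * g x) x = f x * partial_deriv i g x + partial_deriv i f x * g x"
  by (subst partial_deriv_eqI[OF has_derivative_mult])
    (use assms in \<open>auto simp: partial_deriv_def frechet_derivative_works[symmetric]\<close>)

lemma Ck_add: "Ck m f \<Longrightarrow> Ck m g \<Longrightarrow> Ck m (\<lambda>x. f x + g x)"
proof (induction m arbitrary: f g)
  case 0
  then show ?case by (auto intro!: continuous_intros)
next
  case (Suc m)
  then have "partial_deriv i (\<lambda>x. f x + g x) = (\<lambda>x. partial_deriv i f x + partial_deriv i g x)" for i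
    by (auto simp: fun_eq_iff partial_deriv_add)
  with Suc show ?case by auto
qed

lemma Ck_mult: "Ck m f \<Longrightarrow> Ck m g \<Longrightarrow> Ck m (\<lambda>x. f x * g x)"
proof (induction m arbitrary: f g)
  case 0
  then show ?case by (auto intro!: continuous_intros)
next
  case (Suc m)
  then have eq: "partial_deriv i (\<lambda>x. f x * g x) = (\<lambda>x. f x * partial_deriv i g x + partial_deriv i f x * g x)" for i
    by (auto simp: fun_eq_iff partial_deriv_mult)
  have "Ck m f" "Ck m g" using Suc.prems by (auto dest: Ck_SucD simp del: Ck.simps)
  with Suc show ?case by (auto simp: eq intro!: Ck_add)
qed

lemma Ck_prod: "finite A \<Longrightarrow> (\<And>i. i \<in> A \<Longrightarrow> Ck m (f i)) \<Longrightarrow> Ck m (\<lambda>x. \<Prod>i\<in>A. f i x)"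
  by (induction A rule: finite_induct) (auto intro: Ck_const Ck_mult)

subsection \<open>A smooth partition of unity\<close>

text \<open>The classical flat function \<open>exp (-1/t)\<close>, multiplied by powers of
  \<open>1/t\<close> so that the derivative of each member is a linear combination of the next
  two.\<close>

definition flat_exp :: "nat \<Rightarrow> real \<Rightarrow> real" where
  "flat_exp j t = (if t > 0 then exp (- inverse t) * inverse t ^ j else 0)"

lemma flat_exp_tendsto_0: "(flat_exp j \<longlongrightarrow> 0) (at 0)"
proof -
  have "((\<lambda>x::real. x ^ j / exp x) \<longlongrightarrow> 0) at_top"
    by (rule tendsto_power_div_exp_0)
  then have "((\<lambda>t::real. inverse t ^ j / exp (inverse t)) \<longlongrightarrow> 0) (at_right 0)"
    by (rule filterlim_compose[OF _ filterlim_inverse_at_top_right])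
  then have "(flat_exp j \<longlongrightarrow> 0) (at_right 0)"
    by (rule Lim_transform_eventually)
      (auto simp: flat_exp_def eventually_at_filter exp_minus divide_inverse)
  moreover have "(flat_exp j \<longlongrightarrow> 0) (at_left 0)"
    by (rule tendsto_eventually) (auto simp: flat_exp_def eventually_at_filter)
  ultimately show ?thesis by (simp add: filterlim_split_at)
qed

lemma flat_exp_has_derivative:
  "(flat_exp j has_real_derivative (flat_exp (j + 2) t - real j * flat_exp (j + 1) t)) (at t)"
proof -
  consider "t > 0" | "t < 0" | "t = 0" by linarith
  then show ?thesis
  proof cases
    case 1
    have "((\<lambda>t. exp (- inverse t) * inverse t ^ j) has_real_derivative
        (exp (- inverse t) * (- (- (inverse t * 1 * inverse t)))) * inverse t ^ j
        + (real j * inverse t ^ (j - 1) * (- (inverse t * 1 * inverse t))) * exp (- inverse t)) (at t)"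
      using 1 by (auto intro!: derivative_eq_intros simp: power2_eq_square)
    also have "(exp (- inverse t) * (- (- (inverse t * 1 * inverse t)))) * inverse t ^ j
        + (real j * inverse t ^ (j - 1) * (- (inverse t * 1 * inverse t))) * exp (- inverse t)
        = flat_exp (j + 2) t - real j * flat_exp (j + 1) t"
      using 1 by (cases j) (auto simp: flat_exp_def algebra_simps)
    finally show ?thesis
      by (rule DERIV_cong_ev[THEN iffD1, rotated 3])
        (use 1 in \<open>auto simp: flat_exp_def eventually_nhds intro!: exI[of _ "{0<..}"]\<close>)
  next
    case 2
    have "((\<lambda>t. 0) has_real_derivative 0) (at t)" by simp
    also have "0 = flat_exp (j + 2) t - real j * flat_exp (j + 1) t" using 2 by (simp add: flat_exp_def)
    finally show ?thesis
      by (rule DERIV_cong_ev[THEN iffD1, rotated 3])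
        (use 2 in \<open>auto simp: flat_exp_def eventually_nhds intro!: exI[of _ "{..<0}"]\<close>)
  next
    case 3
    have "((\<lambda>h. flat_exp j h / h) \<longlongrightarrow> 0) (at 0)"
      by (rule Lim_transform_eventually[OF flat_exp_tendsto_0[of "Suc j"]])
        (auto simp: flat_exp_def eventually_at_filter divide_inverse)
    then show ?thesis using 3 by (simp add: DERIV_def flat_exp_def[of _ 0])
  qed
qed

text \<open>These rules keep the class closed under differentiation, so that the cut-off below is
  smooth by rule induction, without a formula for its higher derivatives. The rule
  \<open>antiderivative\<close> is what admits an integrated bump.\<close>

inductive smooth1 :: "(real \<Rightarrow> real) \<Rightarrow> bool" where
  flat: "smooth1 (flat_exp j)"
| const: "smooth1 (\<lambda>t. c)"
| add: "smooth1 f \<Longrightarrow> smooth1 g \<Longrightarrow> smooth1 (\<lambda>t. f t + g t)"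
| mult: "smooth1 f \<Longrightarrow> smooth1 g \<Longrightarrow> smooth1 (\<lambda>t. f t * g t)"
| affine: "smooth1 f \<Longrightarrow> smooth1 (\<lambda>t. f (a * t + b))"
| antiderivative: "smooth1 f \<Longrightarrow> (\<And>t. (g has_real_derivative f t) (at t)) \<Longrightarrow> smooth1 g"

lemma smooth1_derivative:
  "smooth1 f \<Longrightarrow> \<exists>g. smooth1 g \<and> (\<forall>t. (f has_real_derivative g t) (at t))"
proof (induction rule: smooth1.induct)
  case (flat j)
  have "smooth1 (\<lambda>t. flat_exp (j + 2) t + (- real j) * flat_exp (j + 1) t)"
    by (intro smooth1.add smooth1.mult smooth1.const smooth1.flat)
  with flat_exp_has_derivative[of j] show ?case by (intro exI) auto
next
  case (const c)
  show ?case by (intro exI[of _ "\<lambda>t. 0"]) (auto intro: smooth1.const)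
next
  case (add f g)
  then obtain f' g' where "smooth1 f'" "smooth1 g'" "\<And>t. (f has_real_derivative f' t) (at t)"
    "\<And>t. (g has_real_derivative g' t) (at t)" by blast
  then show ?case
    by (intro exI[of _ "\<lambda>t. f' t + g' t"]) (auto intro: smooth1.add derivative_intros)
next
  case (mult f g)
  then obtain f' g' where "smooth1 f'" "smooth1 g'" "\<And>t. (f has_real_derivative f' t) (at t)"
    "\<And>t. (g has_real_derivative g' t) (at t)" by blast
  with mult show ?case
    by (intro exI[of _ "\<lambda>t. f' t * g t + g' t * f t"]) (auto intro: smooth1.add smooth1.mult DERIV_mult)
next
  case (affine f a b)
  then obtain f' where f': "smooth1 f'" "\<And>t. (f has_real_derivative f' t) (at t)" by blast
  have "((\<lambda>t. f (a * t + b)) has_real_derivative f' (a * t + b) * a) (at t)" for t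
    by (rule DERIV_chain2[OF f'(2)]) (auto intro!: derivative_eq_intros)
  then show ?case
    by (intro exI[of _ "\<lambda>t. f' (a * t + b) * a"]) (use f'(1) in \<open>auto intro!: smooth1.mult smooth1.const smooth1.affine\<close>)
next
  case (antiderivative f g)
  then show ?case by blast
qed

lemma Ck_smooth1_coord:
  assumes "smooth1 f"
  shows "Ck m (\<lambda>x::real^'n. f (x $ i))"
proof (rule Ck_coinduct[where S = "{\<lambda>x. f (x $ i) | f. smooth1 f}"])
  fix \<phi> :: "real^'n \<Rightarrow> real" assume "\<phi> \<in> {\<lambda>x. f (x $ i) | f. smooth1 f}"
  then obtain f where f: "smooth1 f" and [simp]: "\<phi> = (\<lambda>x. f (x $ i))" by auto
  then obtain g where g: "smooth1 g" "\<And>t. (f has_real_derivative g t) (at t)"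
    using smooth1_derivative by blast
  have d: "(\<phi> has_derivative (\<lambda>y. g (x $ i) * y $ i)) (at x)" for x
    unfolding \<open>\<phi> = _\<close>
    by (rule has_derivative_compose[of "\<lambda>x. x $ i" "\<lambda>y. y $ i" x UNIV f, simplified])
      (use g(2)[of "x $ i"] in \<open>auto simp: has_field_derivative_def intro: bounded_linear_imp_has_derivative bounded_linear_vec_nth\<close>)
  have eq: "partial_deriv j \<phi> = (\<lambda>x. g (x $ i) * (if i = j then 1 else 0))" for j
    using partial_deriv_eqI[OF d] by (auto simp: axis_def)
  have "smooth1 (\<lambda>t. g t * (if i = j then 1 else 0))" for j
    by (intro smooth1.mult smooth1.const g)
  then have "\<exists>h. partial_deriv j \<phi> = (\<lambda>x. h (x $ i)) \<and> smooth1 h" for j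
    unfolding eq by (intro exI[of _ "\<lambda>t. g t * (if i = j then 1 else 0)"]) auto
  then show "(\<forall>x. \<phi> differentiable (at x)) \<and> (\<forall>j. partial_deriv j \<phi> \<in> {\<lambda>x. f (x $ i) | f. smooth1 f})"
    using d by (auto simp: differentiable_def)
qed (use assms in auto)

lemma smooth1_unit_step:
  obtains \<theta> where "smooth1 \<theta>" "\<And>t. t \<le> 0 \<Longrightarrow> \<theta> t = 0" "\<And>t. t \<ge> 1 \<Longrightarrow> \<theta> t = 1"
proof -
  \<comment> \<open>A bump that is positive exactly on the open unit interval; its antiderivative is
    constant on either side and increases in between, and only has to be normalised.\<close>
  define b where "b = (\<lambda>t. flat_exp 0 t * flat_exp 0 ((-1) * t + 1))"
  have sb: "smooth1 b" unfolding b_def by (intro smooth1.mult smooth1.affine smooth1.flat)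
  then have "isCont b t" for t
    using smooth1_derivative DERIV_isCont by blast
  then obtain F where F: "\<And>t. (F has_real_derivative b t) (at t)"
    using einterval_antiderivative[of "-\<infinity>" \<infinity> b]
    by (auto simp: has_real_derivative_iff_has_vector_derivative)
  have b0: "b t = 0" if "t \<le> 0 \<or> t \<ge> 1" for t using that by (auto simp: b_def flat_exp_def)
  have F0: "(F has_real_derivative 0) (at t within S)" if "t \<le> 0 \<or> t \<ge> 1" for t S
    using F[of t] b0[OF that] by (auto intro: has_field_derivative_at_within)
  have "\<exists>c. \<forall>t\<in>{..0}. F t = c"
    by (rule has_field_derivative_zero_constant) (auto intro: F0)
  then have Fl: "F t = F 0" if "t \<le> 0" for t
    using that by auto
  have "\<exists>c. \<forall>t\<in>{1..}. F t = c"
    by (rule has_field_derivative_zero_constant) (auto intro: F0)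
  then have Fr: "F t = F 1" if "t \<ge> 1" for t
    using that by auto
  have lt: "F 0 < F 1"
    by (rule DERIV_pos_imp_increasing_open)
      (use F in \<open>auto simp: b_def flat_exp_def intro: DERIV_isCont intro!: exI continuous_at_imp_continuous_on\<close>)
  let ?\<theta> = "\<lambda>t. F t * (1 / (F 1 - F 0)) + (- F 0 / (F 1 - F 0))"
  have "smooth1 ?\<theta>"
    by (intro smooth1.add smooth1.mult smooth1.const smooth1.antiderivative[OF sb] F)
  then show ?thesis
  proof (rule that)
    show "?\<theta> t = 0" if "t \<le> 0" for t
      unfolding Fl[OF that] using lt by (simp add: divide_simps)
    show "?\<theta> t = 1" if "t \<ge> 1" for t
      unfolding Fr[OF that] using lt by (simp add: divide_simps)
  qed
qed

definition lattice_vec :: "real \<Rightarrow> ('n \<Rightarrow> int) \<Rightarrow> real^'n" where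
  "lattice_vec L z = (\<chi> i. L * of_int (z i))"

lemma test_functionsD:
  assumes "\<phi> \<in> test_functions"
  shows "\<phi> differentiable (at x)" "continuous_on S \<phi>" "bounded {x. \<phi> x \<noteq> 0}"
proof -
  have "Ck (Suc 0) \<phi>" using assms by (auto simp: test_functions_def simp del: Ck.simps)
  then show d: "\<phi> differentiable (at x)" by auto
  have "Ck 0 \<phi>" using assms by (auto simp: test_functions_def simp del: Ck.simps)
  then show "continuous_on S \<phi>" by (auto intro: continuous_on_subset)
  show "bounded {x. \<phi> x \<noteq> 0}"
    using assms by (auto simp: test_functions_def simp del: Ck.simps)
qed

lemma partial_deriv_support:
  assumes "partial_deriv i \<phi> x \<noteq> 0"
  shows "x \<in> closure {x. \<phi> x \<noteq> 0}"
proof (rule ccontr)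
  assume x: "x \<notin> closure {x. \<phi> x \<noteq> 0}"
  have "(\<phi> has_derivative (\<lambda>_. 0)) (at x)"
    by (rule has_derivative_transform_within_open[OF has_derivative_const[of 0], of "- closure {x. \<phi> x \<noteq> 0}"])
      (use x closure_subset[of "{x. \<phi> x \<noteq> 0}"] in auto)
  then show False using assms partial_deriv_eqI by fastforce
qed

lemma partial_deriv_test_functions:
  fixes \<phi> :: "real^'n \<Rightarrow> real"
  assumes "\<phi> \<in> test_functions"
  shows "partial_deriv i \<phi> \<in> test_functions"
proof -
  have "Ck m (partial_deriv i \<phi>)" for m
  proof -
    have "Ck (Suc m) \<phi>" using assms by (auto simp: test_functions_def simp del: Ck.simps)
    then show ?thesis by simp
  qed
  moreover have "{x. partial_deriv i \<phi> x \<noteq> 0} \<subseteq> closure {x. \<phi> x \<noteq> 0}"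
    using partial_deriv_support by blast
  then have "bounded {x. partial_deriv i \<phi> x \<noteq> 0}"
    using test_functionsD(3)[OF assms] by (meson bounded_closure bounded_subset)
  ultimately show ?thesis by (auto simp: test_functions_def)
qed

lemma test_functions_mult:
  assumes "\<phi> \<in> test_functions" "\<And>m. Ck m e"
  shows "(\<lambda>x. \<phi> x * e x) \<in> test_functions"
proof -
  have "{x. \<phi> x * e x \<noteq> 0} \<subseteq> {x. \<phi> x \<noteq> 0}" by auto
  then have "bounded {x. \<phi> x * e x \<noteq> 0}"
    using test_functionsD(3)[OF assms(1)] by (meson bounded_subset)
  then show ?thesis using assms by (auto simp: test_functions_def intro: Ck_mult simp del: Ck.simps)
qed

text \<open>In one dimension \<open>\<theta>(t/L) - \<theta>(t/L - 1)\<close> vanishes outside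
  \<open>(0, 2L)\<close> and its translates by multiples of \<open>L\<close> telescope to 1; the
  product over the coordinates does the same in all dimensions, since a product of sums expands into
  a sum over multi-indices. The shift 2 contributes nothing here, but it makes the index set cover
  the closed support, where the derivatives of \<open>\<psi>\<close> are located.\<close>

lemma partition_of_unity:
  fixes L :: real
  assumes "L > 0"
  obtains \<psi> :: "real^'n \<Rightarrow> real" where "\<psi> \<in> test_functions"
    "\<And>x i. \<psi> x \<noteq> 0 \<Longrightarrow> 0 < x $ i \<and> x $ i < 2 * L"
    "\<And>x. (\<And>i. 0 \<le> x $ i \<and> x $ i \<le> L) \<Longrightarrow>
       (\<Sum>z\<in>PiE UNIV (\<lambda>_. {0, 1, 2}). \<psi> (x + lattice_vec L z)) = 1"
proof -
  obtain \<theta> where \<theta>: "smooth1 \<theta>" "\<And>t. t \<le> 0 \<Longrightarrow> \<theta> t = 0" "\<And>t. t \<ge> 1 \<Longrightarrow> \<theta> t = 1"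
    using smooth1_unit_step by blast
  define p where "p = (\<lambda>t. \<theta> ((1 / L) * t + 0) + (-1) * \<theta> ((1 / L) * t + (-1)))"
  have "smooth1 p" unfolding p_def
    by (intro smooth1.add smooth1.mult smooth1.const smooth1.affine \<theta>)
  have p0: "p t = 0" if "\<not> (0 < t \<and> t < 2 * L)" for t
  proof (cases "t \<le> 0")
    case True
    then have "t / L \<le> 0" using assms by (simp add: divide_nonpos_pos)
    then show ?thesis by (simp add: p_def \<theta>)
  next
    case False
    then have "t / L \<ge> 2" using assms that by (simp add: field_simps)
    then show ?thesis by (simp add: p_def \<theta>)
  qed
  have p1: "p t + (p (t + L) + p (t + L * 2)) = 1" if "0 \<le> t" "t \<le> L" for t
  proof -
    have "t / L \<ge> 0" "t / L \<le> 1" "(t + L) / L = t / L + 1" using assms that by (auto simp: field_simps)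
    moreover have "p (t + L * 2) = 0" using p0[of "t + L * 2"] that assms by auto
    ultimately show ?thesis by (simp add: p_def \<theta>)
  qed
  define \<psi> :: "real^'n \<Rightarrow> real" where "\<psi> = (\<lambda>x. \<Prod>i\<in>UNIV. p (x $ i))"
  have supp: "0 < x $ i \<and> x $ i < 2 * L" if "\<psi> x \<noteq> 0" for x i
    using that p0[of "x $ i"] by (auto simp: \<psi>_def)
  have "{x. \<psi> x \<noteq> 0} \<subseteq> cbox 0 (\<chi> i. 2 * L)"
    using supp less_imp_le by (simp add: mem_box_cart subset_iff) blast
  then have "bounded {x. \<psi> x \<noteq> 0}" by (meson bounded_cbox bounded_subset)
  moreover have "Ck m \<psi>" for m
    unfolding \<psi>_def by (intro Ck_prod Ck_smooth1_coord \<open>smooth1 p\<close>) auto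
  ultimately have "\<psi> \<in> test_functions" by (auto simp: test_functions_def)
  moreover have "(\<Sum>z\<in>PiE UNIV (\<lambda>_. {0, 1, 2}). \<psi> (x + lattice_vec L z)) = 1"
    if "\<And>i. 0 \<le> x $ i \<and> x $ i \<le> L" for x
  proof -
    have "(\<Sum>z\<in>PiE UNIV (\<lambda>_. {0, 1, 2}). \<psi> (x + lattice_vec L z))
        = (\<Prod>i\<in>(UNIV::'n set). \<Sum>b\<in>{0, 1, 2::int}. p (x $ i + L * of_int b))"
      by (subst prod_sum_PiE) (auto simp: \<psi>_def lattice_vec_def)
    also have "\<dots> = 1" using that by (simp add: p1)
    finally show ?thesis .
  qed
  ultimately show ?thesis using supp that by blast
qed

section \<open>The Hartley system\<close>

definition wavevec :: "real \<Rightarrow> int^'n \<Rightarrow> real^'n" where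
  "wavevec L m = (\<chi> i. 2 * pi / L * of_int (m $ i))"

text \<open>The functions \<open>cos + sin\<close> form a real orthonormal basis indexed by the whole dual lattice,
  and differentiation acts by \<open>m \<mapsto> - m\<close>; this avoids complex coefficients.\<close>

definition hartley :: "real \<Rightarrow> int^'n \<Rightarrow> real^'n \<Rightarrow> real" where
  "hartley L m x = (cos (wavevec L m \<bullet> x) + sin (wavevec L m \<bullet> x)) / sqrt (L ^ CARD('n))"

lemma wavevec_minus [simp]: "wavevec L (- m) = - wavevec L m"
  by (simp add: wavevec_def vec_eq_iff)

lemma wavevec_add: "wavevec L (m + n) = wavevec L m + wavevec L n"
  by (simp add: wavevec_def vec_eq_iff algebra_simps)

lemma wavevec_diff: "wavevec L (m - n) = wavevec L m - wavevec L n"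
  by (simp add: wavevec_def vec_eq_iff algebra_simps)

lemma wavevec_0 [simp]: "wavevec L 0 = 0"
  by (simp add: wavevec_def vec_eq_iff)

lemma hartley_has_derivative:
  "(hartley L m has_derivative (\<lambda>y. (wavevec L m \<bullet> y) * hartley L (- m) x)) (at x)"
  unfolding hartley_def divide_inverse
  by (rule has_derivative_eq_rhs[OF has_derivative_mult_left])
    (auto intro!: derivative_eq_intros simp: algebra_simps)

lemma hartley_differentiable: "hartley L m differentiable (at x)"
  using hartley_has_derivative differentiable_def by blast

lemma partial_deriv_hartley:
  "partial_deriv i (hartley L m) = (\<lambda>x. wavevec L m $ i * hartley L (- m) x)"
  by (rule ext) (simp add: partial_deriv_eqI[OF hartley_has_derivative] inner_axis)

lemma Ck_hartley: "Ck k (hartley L m)"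
proof (rule Ck_coinduct[where S = "{\<lambda>x. a * hartley L m x | a m. True}"])
  fix \<phi> :: "real^'n \<Rightarrow> real" assume "\<phi> \<in> {\<lambda>x. a * hartley L m x | a m. True}"
  then obtain a m where \<phi>: "\<phi> = (\<lambda>x. a * hartley L m x)" by auto
  have d: "(\<phi> has_derivative (\<lambda>y. a * ((wavevec L m \<bullet> y) * hartley L (- m) x))) (at x)" for x
    unfolding \<phi> by (intro has_derivative_mult_right hartley_has_derivative)
  have "partial_deriv i \<phi> = (\<lambda>x. (a * wavevec L m $ i) * hartley L (- m) x)" for i
    by (rule ext) (simp add: partial_deriv_eqI[OF d] inner_axis)
  with d show "(\<forall>x. \<phi> differentiable (at x)) \<and> (\<forall>i. partial_deriv i \<phi> \<in> {\<lambda>x. a * hartley L m x | a m. True})"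
    by (auto simp: differentiable_def)
next
  have "hartley L m = (\<lambda>x. 1 * hartley L m x)" by simp
  then show "hartley L m \<in> {\<lambda>x. a * hartley L m x | a m. True}" by blast
qed

lemma continuous_on_hartley: "continuous_on S (hartley L m)"
  unfolding hartley_def divide_inverse by (intro continuous_intros)

lemma hartley_measurable [measurable]: "hartley L m \<in> borel_measurable borel"
  by (rule borel_measurable_continuous_onI) (rule continuous_on_hartley)

lemma hartley_bound:
  fixes m :: "int^'n"
  assumes "L > 0"
  shows "\<bar>hartley L m x\<bar> \<le> 2 / sqrt (L ^ CARD('n))"
proof -
  have "\<bar>cos (wavevec L m \<bullet> x) + sin (wavevec L m \<bullet> x)\<bar> \<le> 2"
    using abs_cos_le_one[of "wavevec L m \<bullet> x"] abs_sin_le_one[of "wavevec L m \<bullet> x"] by linarith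
  then show ?thesis using assms by (simp add: hartley_def divide_right_mono)
qed

lemma hartley_periodic:
  assumes "L > 0"
  shows "periodic L (hartley L m)"
proof -
  have "hartley L m (x + L *\<^sub>R axis i 1) = hartley L m x" for i x
  proof -
    have "wavevec L m \<bullet> (x + L *\<^sub>R axis i 1) = wavevec L m \<bullet> x + 2 * pi * of_int (m $ i)"
      using assms by (simp add: inner_right_distrib inner_axis wavevec_def)
    then show ?thesis by (simp add: hartley_def cos_add sin_add)
  qed
  then show ?thesis by (simp add: periodic_def)
qed

section \<open>Integration of periodic functions\<close>

lemma lebesgue_translation:
  fixes a :: "'a::euclidean_space"
  shows "(\<lambda>x. a + x) \<in> lebesgue \<rightarrow>\<^sub>M lebesgue" "distr lebesgue lebesgue (\<lambda>x. a + x) = lebesgue"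
proof -
  have eq: "(\<lambda>x. a + (\<Sum>j\<in>Basis. (1 * (x \<bullet> j)) *\<^sub>R j)) = (\<lambda>x::'a. a + x)"
    by (simp add: euclidean_representation)
  show "(\<lambda>x. a + x) \<in> lebesgue \<rightarrow>\<^sub>M lebesgue"
    using lebesgue_affine_measurable[of "\<lambda>_. 1" a] unfolding eq by simp
  show "distr lebesgue lebesgue (\<lambda>x. a + x) = lebesgue"
    using lebesgue_affine_euclidean[of "\<lambda>_. 1" a] unfolding eq by (simp add: density_1)
qed

lemma has_bochner_integral_translation:
  fixes f :: "'a::euclidean_space \<Rightarrow> 'b::{banach, second_countable_topology}"
  assumes "has_bochner_integral lebesgue f I"
  shows "has_bochner_integral lebesgue (\<lambda>x. f (a + x)) I"
proof -
  have f: "f \<in> borel_measurable lebesgue" using assms by (auto simp: has_bochner_integral_iff)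
  show ?thesis
    using integral_distr[OF lebesgue_translation(1) f, of a]
      integrable_distr_eq[OF lebesgue_translation(1) f, of a] assms
    by (simp add: lebesgue_translation(2) has_bochner_integral_iff)
qed

lemma mem_cell: "x \<in> cell L \<longleftrightarrow> (\<forall>i. 0 < x $ i \<and> x $ i < L)"
  by (simp add: cell_def mem_box_cart)

lemma cell_measurable [measurable, simp]: "cell L \<in> sets lebesgue" "cell L \<in> sets borel"
  by (auto simp: cell_def)

lemma emeasure_cell:
  "L > 0 \<Longrightarrow> emeasure lebesgue (cell L :: (real^'n) set) = ennreal (L ^ CARD('n))"
proof -
  assume "L > 0"
  have "\<And>b. b \<in> Basis \<Longrightarrow> (\<chi> i. L) \<bullet> (b :: real^'n) = L"
    by (auto simp: Basis_vec_def inner_axis)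
  then show ?thesis using \<open>L > 0\<close> by (simp add: cell_def emeasure_lborel_box_eq)
qed

lemma finite_measure_cell: "finite_measure (lebesgue_on (cell L :: (real^'n) set))"
  by (rule finite_measureI) (simp add: space_restrict_space emeasure_restrict_space cell_def emeasure_lborel_box_eq)

lemma periodic_lattice_vec:
  assumes "periodic L v"
  shows "v (x + lattice_vec L z) = v x"
proof -
  have nat: "v (x + (real k * L) *\<^sub>R axis i 1) = v x" for x i k
  proof (induction k)
    case (Suc k)
    have "v (x + (real (Suc k) * L) *\<^sub>R axis i 1) = v ((x + (real k * L) *\<^sub>R axis i 1) + L *\<^sub>R axis i 1)"
      by (simp add: algebra_simps)
    also have "\<dots> = v x" using assms Suc by (simp add: periodic_def)
    finally show ?case .
  qed simp
  have int: "v (x + (of_int k * L) *\<^sub>R axis i 1) = v x" for x i k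
  proof (cases k)
    case (nonneg n)
    then show ?thesis using nat[of x n i] by simp
  next
    case (neg n)
    then have "of_int k * L = - (real (Suc n) * L)"
      by (simp only: of_int_minus of_int_of_nat_eq mult_minus_left)
    then show ?thesis using nat[of "x + (of_int k * L) *\<^sub>R axis i 1" "Suc n" i]
      by (simp del: of_nat_Suc)
  qed
  have "v (x + (\<Sum>i\<in>A. (of_int (z i) * L) *\<^sub>R axis i 1)) = v x" if "finite A" for A
    using that
  proof (induction A)
    case (insert i A)
    then show ?case
      using int[of "x + (\<Sum>i\<in>A. (of_int (z i) * L) *\<^sub>R axis i 1)" "z i" i]
      by (simp add: algebra_simps)
  qed simp
  moreover have "lattice_vec L z = (\<Sum>i\<in>UNIV. (of_int (z i) * L) *\<^sub>R axis i 1)"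
    by (simp add: vec_eq_iff lattice_vec_def axis_def if_distrib sum.delta cong: if_cong)
  ultimately show ?thesis by simp
qed

text \<open>The cell is open, so its translates tile the space only up to these countably many
  hyperplanes.\<close>

lemma AE_off_lattice_planes:
  "AE x in lebesgue. \<forall>i k. (x :: real^'n) $ i \<noteq> L * of_int k"
proof -
  have "AE x in lebesgue. (x :: real^'n) $ i \<noteq> a" for i a
  proof -
    have "negligible {x :: real^'n. x \<bullet> axis i 1 = a}" by (rule negligible_standard_hyperplane) simp
    then have "negligible {x :: real^'n. x $ i = a}" by (simp add: inner_axis)
    then show ?thesis by (auto simp: negligible_iff_null_sets dest: AE_not_in)
  qed
  then have "AE x in lebesgue. \<forall>i\<in>UNIV. \<forall>k. (x :: real^'n) $ i \<noteq> L * of_int k"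
    by (intro AE_finite_allI AE_all_countable[THEN iffD2]) auto
  then show ?thesis by simp
qed

lemma shift_mem_cell_iff:
  assumes "L > 0" and "\<And>i k. x $ i \<noteq> L * of_int k"
  shows "- lattice_vec L z + x \<in> cell L \<longleftrightarrow> z = (\<lambda>i. \<lfloor>x $ i / L\<rfloor>)"
proof -
  have "0 < x $ i - L * of_int k \<and> x $ i - L * of_int k < L \<longleftrightarrow> \<lfloor>x $ i / L\<rfloor> = k" for i k
  proof -
    have "\<lfloor>x $ i / L\<rfloor> = k \<longleftrightarrow> L * of_int k \<le> x $ i \<and> x $ i < L * of_int k + L"
      using assms(1) by (auto simp: floor_eq_iff field_simps)
    then show ?thesis using assms(2)[of i k] by auto
  qed
  then show ?thesis by (auto simp: mem_cell lattice_vec_def fun_eq_iff)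
qed

lemma integrable_bounded_scaleR:
  fixes G :: "'a \<Rightarrow> 'b::{banach, second_countable_topology}"
  assumes "integrable M G" "h \<in> borel_measurable M" "\<And>x. x \<in> space M \<Longrightarrow> \<bar>h x\<bar> \<le> b"
  shows "integrable M (\<lambda>x. h x *\<^sub>R G x)"
proof (rule Bochner_Integration.integrable_bound)
  show "integrable M (\<lambda>x. b *\<^sub>R G x)" using assms by simp
  show "(\<lambda>x. h x *\<^sub>R G x) \<in> borel_measurable M" using assms by measurable
  show "AE x in M. norm (h x *\<^sub>R G x) \<le> norm (b *\<^sub>R G x)"
  proof (rule AE_I2)
    fix x assume "x \<in> space M"
    then have "\<bar>h x\<bar> \<le> \<bar>b\<bar>" using assms(3)[of x] by linarith
    then show "norm (h x *\<^sub>R G x) \<le> norm (b *\<^sub>R G x)" by (simp add: mult_right_mono)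
  qed
qed

text \<open>The integral over the whole space is cut along the cells, and periodicity of
  \<open>G\<close> moves every piece back to the base cell. The finite index set \<open>Z\<close> is
  left free: the partition of unity needs a specific one, a general test function any one that
  covers its support.\<close>

lemma has_bochner_integral_tiling:
  fixes G :: "real^'n \<Rightarrow> 'b::euclidean_space" and \<phi> :: "real^'n \<Rightarrow> real"
  assumes "L > 0" "periodic L G" "G \<in> borel_measurable lebesgue" "integrable (lebesgue_on (cell L)) G"
    and \<phi>: "\<phi> \<in> borel_measurable lebesgue" "\<And>x. \<bar>\<phi> x\<bar> \<le> b"
    and Z: "finite Z" "\<And>x. \<phi> x \<noteq> 0 \<Longrightarrow> (\<lambda>i. \<lfloor>x $ i / L\<rfloor>) \<in> Z"
  shows "has_bochner_integral lebesgue (\<lambda>x. \<phi> x *\<^sub>R G x)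
    (\<Sum>z\<in>Z. LINT x|lebesgue_on (cell L). \<phi> (x + lattice_vec L z) *\<^sub>R G x)"
proof -
  let ?I = "\<lambda>z. LINT x|lebesgue_on (cell L). \<phi> (x + lattice_vec L z) *\<^sub>R G x"
  let ?F = "\<lambda>z x. indicator (cell L) (- lattice_vec L z + x) *\<^sub>R (\<phi> x *\<^sub>R G (- lattice_vec L z + x))"
  have "has_bochner_integral lebesgue (?F z) (?I z)" for z
  proof -
    have "(\<lambda>x. \<phi> (lattice_vec L z + x)) \<in> borel_measurable lebesgue"
      using measurable_compose[OF lebesgue_translation(1) \<phi>(1)] .
    then have "(\<lambda>x. \<phi> (x + lattice_vec L z)) \<in> borel_measurable (lebesgue_on (cell L))"
      by (intro measurable_restrict_space1) (simp add: add.commute)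
    then have "integrable (lebesgue_on (cell L)) (\<lambda>x. \<phi> (x + lattice_vec L z) *\<^sub>R G x)"
      by (intro integrable_bounded_scaleR[where b = b] assms) auto
    then have "has_bochner_integral (lebesgue_on (cell L)) (\<lambda>x. \<phi> (x + lattice_vec L z) *\<^sub>R G x) (?I z)"
      by (rule has_bochner_integral_integrable)
    then have "has_bochner_integral lebesgue
        (\<lambda>x. indicator (cell L) x *\<^sub>R (\<phi> (x + lattice_vec L z) *\<^sub>R G x)) (?I z)"
      by (subst (asm) has_bochner_integral_restrict_space) auto
    from has_bochner_integral_translation[OF this, of "- lattice_vec L z"]
    show ?thesis by simp
  qed
  then have sum: "has_bochner_integral lebesgue (\<lambda>x. \<Sum>z\<in>Z. ?F z x) (\<Sum>z\<in>Z. ?I z)"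
    by (intro has_bochner_integral_sum)
  \<comment> \<open>Off the hyperplanes exactly one summand survives, namely the one indexed by the
    coordinatewise floors of \<open>x / L\<close>.\<close>
  have eq: "AE x in lebesgue. (\<Sum>z\<in>Z. ?F z x) = \<phi> x *\<^sub>R G x"
    using AE_off_lattice_planes[of L]
  proof eventually_elim
    case (elim x)
    let ?z = "\<lambda>i. \<lfloor>x $ i / L\<rfloor>"
    have "?F z x = (if z = ?z then \<phi> x *\<^sub>R G x else 0)" for z
      using shift_mem_cell_iff[OF assms(1), of x z] elim
        periodic_lattice_vec[OF assms(2), of "- lattice_vec L z + x" z]
      by (auto simp: indicator_def add.commute)
    then have "(\<Sum>z\<in>Z. ?F z x) = (if ?z \<in> Z then \<phi> x *\<^sub>R G x else 0)"
      using Z(1) by (simp add: sum.delta)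
    then show ?case using Z(2)[of x] by auto
  qed
  show ?thesis
    by (rule has_bochner_integral_cong_AE[THEN iffD1, OF _ _ eq sum])
      (use sum assms in \<open>auto simp: has_bochner_integral_iff intro: borel_measurable_integrable\<close>)
qed

lemma finite_support_cells:
  fixes \<phi> :: "real^'n \<Rightarrow> real"
  assumes "L > 0" "bounded {x. \<phi> x \<noteq> 0}"
  obtains Z where "finite Z" "\<And>x. \<phi> x \<noteq> 0 \<Longrightarrow> (\<lambda>i. \<lfloor>x $ i / L\<rfloor>) \<in> Z"
proof -
  obtain R where R: "\<And>x. \<phi> x \<noteq> 0 \<Longrightarrow> norm x \<le> R"
    using assms(2) by (auto simp: bounded_iff)
  let ?Z = "PiE (UNIV::'n set) (\<lambda>_. {\<lfloor>- R / L\<rfloor>..\<lfloor>R / L\<rfloor>})"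
  have "(\<lambda>i. \<lfloor>x $ i / L\<rfloor>) \<in> ?Z" if "\<phi> x \<noteq> 0" for x
  proof -
    have "\<bar>x $ i\<bar> \<le> R" for i using R[OF that] component_le_norm_cart[of x i] by linarith
    then have "- R \<le> x $ i" "x $ i \<le> R" for i by (auto simp: abs_le_iff minus_le_iff)
    then have "- R / L \<le> x $ i / L" "x $ i / L \<le> R / L" for i
      using assms(1) by (meson divide_right_mono less_imp_le)+
    then show ?thesis by (auto intro!: floor_mono)
  qed
  moreover have "finite ?Z" by (intro finite_PiE) auto
  ultimately show ?thesis using that by blast
qed

section \<open>Integration of test functions\<close>

lemma test_function_integrable:
  fixes \<phi> :: "real^'n \<Rightarrow> real"
  assumes "\<phi> \<in> test_functions"
  shows "integrable lebesgue \<phi>" "\<phi> \<in> borel_measurable lebesgue"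
proof -
  obtain R where R: "\<And>x. \<phi> x \<noteq> 0 \<Longrightarrow> norm x \<le> R"
    using test_functionsD(3)[OF assms] by (auto simp: bounded_iff)
  have "integrable lborel (\<lambda>x. indicator (cball 0 R) x *\<^sub>R \<phi> x)"
    by (rule borel_integrable_compact) (auto intro: test_functionsD assms)
  moreover have "(\<lambda>x. indicator (cball 0 R) x *\<^sub>R \<phi> x) = \<phi>"
    using R by (auto simp: fun_eq_iff indicator_def)
  ultimately have "integrable lborel \<phi>" by simp
  then show "integrable lebesgue \<phi>" using integrable_completion by blast
  then show "\<phi> \<in> borel_measurable lebesgue" by (rule borel_measurable_integrable)
qed

lemma test_function_bounded:
  fixes \<phi> :: "real^'n \<Rightarrow> real"
  assumes "\<phi> \<in> test_functions"
  obtains b where "b \<ge> 0" "\<And>x. \<bar>\<phi> x\<bar> \<le> b"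
proof -
  obtain R where R: "\<And>x. \<phi> x \<noteq> 0 \<Longrightarrow> norm x \<le> R"
    using test_functionsD(3)[OF assms] by (auto simp: bounded_iff)
  have "bounded (\<phi> ` cball 0 R)"
    by (intro compact_imp_bounded compact_continuous_image test_functionsD assms compact_cball)
  then obtain b where "\<forall>y\<in>\<phi> ` cball 0 R. norm y \<le> b"
    unfolding bounded_iff by blast
  then have b: "\<And>x. norm x \<le> R \<Longrightarrow> \<bar>\<phi> x\<bar> \<le> b" by simp
  show ?thesis
  proof (rule that[of "max b 0"])
    show "\<bar>\<phi> x\<bar> \<le> max b 0" for x using R[of x] b[of x] by (cases "\<phi> x = 0") auto
  qed simp
qed

text \<open>Every difference quotient of \<open>\<phi>\<close> has integral zero by translation
  invariance of Lebesgue measure, and the quotients converge dominatedly to the derivative.\<close>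

lemma integral_partial_deriv_test_function:
  fixes \<phi> :: "real^'n \<Rightarrow> real"
  assumes "\<phi> \<in> test_functions"
  shows "(LINT x|lebesgue. partial_deriv i \<phi> x) = 0"
proof -
  let ?e = "axis i 1 :: real^'n"
  define q where "q n x = (\<phi> (inverse (real (Suc n)) *\<^sub>R ?e + x) - \<phi> x) / inverse (real (Suc n))" for n x
  obtain R where R: "\<And>x. \<phi> x \<noteq> 0 \<Longrightarrow> norm x \<le> R"
    using test_functionsD(3)[OF assms] by (auto simp: bounded_iff)
  obtain b where b: "b \<ge> 0" "\<And>x. \<bar>partial_deriv i \<phi> x\<bar> \<le> b"
    using test_function_bounded[OF partial_deriv_test_functions[OF assms]] by blast
  have D: "((\<lambda>t. \<phi> (x + t *\<^sub>R ?e)) has_real_derivative partial_deriv i \<phi> (x + t *\<^sub>R ?e)) (at t)" for x t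
  proof -
    let ?\<phi>' = "frechet_derivative \<phi> (at (x + t *\<^sub>R ?e))"
    have d: "(\<phi> has_derivative ?\<phi>') (at (x + t *\<^sub>R ?e))"
      using test_functionsD(1)[OF assms] frechet_derivative_works by blast
    have "((\<lambda>t. x + t *\<^sub>R ?e) has_derivative (\<lambda>h. h *\<^sub>R ?e)) (at t)"
      by (auto intro!: derivative_eq_intros)
    from has_derivative_compose[OF this d]
    have "((\<lambda>t. \<phi> (x + t *\<^sub>R ?e)) has_derivative (\<lambda>h. ?\<phi>' (h *\<^sub>R ?e))) (at t)" .
    moreover have "?\<phi>' (h *\<^sub>R ?e) = partial_deriv i \<phi> (x + t *\<^sub>R ?e) * h" for h
      using linear_scale[OF has_derivative_linear[OF d]] by (simp add: partial_deriv_def)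
    ultimately show ?thesis by (simp add: has_field_derivative_def)
  qed
  have int: "integrable lebesgue \<phi>" "\<phi> \<in> borel_measurable lebesgue"
    using test_function_integrable[OF assms] by auto
  have tr: "has_bochner_integral lebesgue (\<lambda>x. \<phi> (a + x)) (integral\<^sup>L lebesgue \<phi>)" for a
    by (intro has_bochner_integral_translation has_bochner_integral_integrable int)
  have q0: "has_bochner_integral lebesgue (q n) 0" for n
  proof -
    have "has_bochner_integral lebesgue (\<lambda>x. \<phi> (inverse (real (Suc n)) *\<^sub>R ?e + x) - \<phi> x)
        (integral\<^sup>L lebesgue \<phi> - integral\<^sup>L lebesgue \<phi>)"
      by (intro has_bochner_integral_diff tr has_bochner_integral_integrable int)
    then have "has_bochner_integral lebesgue (q n) ((integral\<^sup>L lebesgue \<phi> - integral\<^sup>L lebesgue \<phi>) / inverse (real (Suc n)))"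
      unfolding q_def by (intro has_bochner_integral_divide) auto
    then show ?thesis by simp
  qed
  \<comment> \<open>Inside the ball the mean value theorem applies; outside it both values of
    \<open>\<phi>\<close> vanish, because the shift has length at most 1.\<close>
  have bound: "\<bar>q n x\<bar> \<le> b * indicator (cball 0 (R + 1)) x" for n x
  proof (cases "x \<in> cball 0 (R + 1)")
    case True
    let ?h = "inverse (real (Suc n))"
    obtain s where "\<phi> (x + ?h *\<^sub>R ?e) - \<phi> (x + 0 *\<^sub>R ?e) = (?h - 0) * partial_deriv i \<phi> (x + s *\<^sub>R ?e)"
      using MVT2[of 0 ?h "\<lambda>t. \<phi> (x + t *\<^sub>R ?e)" "\<lambda>t. partial_deriv i \<phi> (x + t *\<^sub>R ?e)"] D by auto
    then have "q n x = partial_deriv i \<phi> (x + s *\<^sub>R ?e)"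
      unfolding q_def by (simp add: add.commute)
    then show ?thesis using b True by simp
  next
    case False
    have "norm x \<le> norm (inverse (real (Suc n)) *\<^sub>R ?e + x) + norm (inverse (real (Suc n)) *\<^sub>R ?e)"
      using norm_triangle_ineq4[of "inverse (real (Suc n)) *\<^sub>R ?e + x" "inverse (real (Suc n)) *\<^sub>R ?e"] by simp
    moreover have "norm (inverse (real (Suc n)) *\<^sub>R ?e) \<le> 1"
      by (simp add: divide_simps)
    ultimately have "\<phi> x = 0" "\<phi> (inverse (real (Suc n)) *\<^sub>R ?e + x) = 0"
      using False R[of x] R[of "inverse (real (Suc n)) *\<^sub>R ?e + x"] by (force simp: not_le)+
    then show ?thesis using False by (simp add: q_def)
  qed
  have "(\<lambda>n. q n x) \<longlonglongrightarrow> partial_deriv i \<phi> x" for x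
  proof -
    have "((\<lambda>h. (\<phi> (x + (0 + h) *\<^sub>R ?e) - \<phi> (x + 0 *\<^sub>R ?e)) / h) \<longlongrightarrow> partial_deriv i \<phi> (x + 0 *\<^sub>R ?e)) (at 0)"
      using D[of x 0] unfolding DERIV_def .
    moreover have "filterlim (\<lambda>n. inverse (real (Suc n))) (at 0) sequentially"
      using LIMSEQ_inverse_real_of_nat by (auto simp: filterlim_at)
    ultimately have "(\<lambda>n. (\<phi> (x + (0 + inverse (real (Suc n))) *\<^sub>R ?e) - \<phi> (x + 0 *\<^sub>R ?e)) / inverse (real (Suc n)))
        \<longlonglongrightarrow> partial_deriv i \<phi> (x + 0 *\<^sub>R ?e)"
      by (rule filterlim_compose)
    then show ?thesis by (simp add: q_def add.commute)
  qed
  moreover have "integrable lborel (\<lambda>x. b * indicator (cball (0::real^'n) (R + 1)) x)"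
    by (intro integrable_mult_right integrable_real_indicator) (use emeasure_lborel_cball_finite[of "0::real^'n" "R + 1"] in auto)
  then have "integrable lebesgue (\<lambda>x. b * indicator (cball (0::real^'n) (R + 1)) x)"
    using integrable_completion by blast
  ultimately have "(\<lambda>n. integral\<^sup>L lebesgue (q n)) \<longlonglongrightarrow> integral\<^sup>L lebesgue (partial_deriv i \<phi>)"
    using bound q0
    by (intro integral_dominated_convergence[where w = "\<lambda>x. b * indicator (cball 0 (R + 1)) x"])
      (auto simp: has_bochner_integral_iff intro: borel_measurable_integrable
        test_function_integrable(2)[OF partial_deriv_test_functions[OF assms]])
  then show ?thesis
    using q0 LIMSEQ_unique[OF _ tendsto_const] by (force simp: has_bochner_integral_iff)
qed

subsection \<open>The spaces \<open>L2per\<close>\<close>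

lemma L2perD:
  assumes "v \<in> L2per L"
  shows "periodic L v" "v \<in> borel_measurable lebesgue" "v \<in> borel_measurable (lebesgue_on (cell L))"
    "integrable (lebesgue_on (cell L)) (\<lambda>x. (norm (v x))\<^sup>2)" "integrable (lebesgue_on (cell L)) v"
proof -
  show v: "periodic L v" "v \<in> borel_measurable lebesgue"
    "integrable (lebesgue_on (cell L)) (\<lambda>x. (norm (v x))\<^sup>2)"
    using assms by (auto simp: L2per_def)
  then show m: "v \<in> borel_measurable (lebesgue_on (cell L))"
    by (intro measurable_restrict_space1)
  interpret finite_measure "lebesgue_on (cell L)" by (rule finite_measure_cell)
  have "integrable (lebesgue_on (cell L)) (\<lambda>x. 1 + (norm (v x))\<^sup>2)"
    using v by (intro Bochner_Integration.integrable_add) auto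
  then show "integrable (lebesgue_on (cell L)) v"
  proof (rule Bochner_Integration.integrable_bound[OF _ m], intro AE_I2)
    fix x
    have "0 \<le> (norm (v x) - 1)\<^sup>2" by simp
    then have "2 * norm (v x) \<le> 1 + (norm (v x))\<^sup>2"
      by (simp add: power2_eq_square algebra_simps)
    then have "norm (v x) \<le> 1 + (norm (v x))\<^sup>2"
      using norm_ge_zero[of "v x"] by linarith
    then show "norm (v x) \<le> norm (1 + (norm (v x))\<^sup>2)" by simp
  qed
qed

lemma integrable_inner_square:
  fixes v w :: "'a \<Rightarrow> 'b::euclidean_space"
  assumes "v \<in> borel_measurable M" "w \<in> borel_measurable M"
    "integrable M (\<lambda>x. (norm (v x))\<^sup>2)" "integrable M (\<lambda>x. (norm (w x))\<^sup>2)"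
  shows "integrable M (\<lambda>x. v x \<bullet> w x)"
proof (rule Bochner_Integration.integrable_bound)
  show "integrable M (\<lambda>x. (norm (v x))\<^sup>2 + (norm (w x))\<^sup>2)" using assms by simp
  show "(\<lambda>x. v x \<bullet> w x) \<in> borel_measurable M" using assms by measurable
  show "AE x in M. norm (v x \<bullet> w x) \<le> norm ((norm (v x))\<^sup>2 + (norm (w x))\<^sup>2)"
  proof (intro AE_I2)
    fix x
    have "\<bar>v x \<bullet> w x\<bar> \<le> norm (v x) * norm (w x)" by (rule Cauchy_Schwarz_ineq2)
    also have "\<dots> \<le> (norm (v x))\<^sup>2 + (norm (w x))\<^sup>2"
      using sum_squares_bound[of "norm (v x)" "norm (w x)"] mult_nonneg_nonneg[OF norm_ge_zero norm_ge_zero, of "v x" "w x"]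
      by linarith
    finally show "norm (v x \<bullet> w x) \<le> norm ((norm (v x))\<^sup>2 + (norm (w x))\<^sup>2)" by simp
  qed
qed

lemma integrable_L2_inner:
  "v \<in> L2per L \<Longrightarrow> w \<in> L2per L \<Longrightarrow> integrable (lebesgue_on (cell L)) (\<lambda>x. v x \<bullet> w x)"
  by (rule integrable_inner_square) (auto intro: L2perD)

lemma L2per_add:
  assumes "v \<in> L2per L" "w \<in> L2per L"
  shows "(\<lambda>x. v x + w x) \<in> L2per L"
proof -
  have "integrable (lebesgue_on (cell L)) (\<lambda>x. (norm (v x))\<^sup>2 + (2 * (v x \<bullet> w x) + (norm (w x))\<^sup>2))"
    by (intro Bochner_Integration.integrable_add integrable_mult_right integrable_L2_inner L2perD assms)
  moreover have "(norm (v x))\<^sup>2 + (2 * (v x \<bullet> w x) + (norm (w x))\<^sup>2) = (norm (v x + w x))\<^sup>2" for x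
    by (simp add: power2_norm_eq_inner inner_add_left inner_add_right inner_commute)
  ultimately show ?thesis
    using L2perD[OF assms(1)] L2perD[OF assms(2)] by (auto simp: L2per_def periodic_def)
qed

lemma L2per_scaleR: "v \<in> L2per L \<Longrightarrow> (\<lambda>x. c *\<^sub>R v x) \<in> L2per L"
  by (auto simp: L2per_def periodic_def power_mult_distrib)

lemma L2per_diff:
  assumes "v \<in> L2per L" "w \<in> L2per L"
  shows "(\<lambda>x. v x - w x) \<in> L2per L"
  using L2per_add[OF assms(1) L2per_scaleR[OF assms(2), of "-1"]] by simp

lemma L2per_zero: "(\<lambda>x. 0) \<in> L2per L"
  by (auto simp: L2per_def periodic_def)

lemma L2per_sum: "(\<And>i. i \<in> A \<Longrightarrow> v i \<in> L2per L) \<Longrightarrow> (\<lambda>x. \<Sum>i\<in>A. v i x) \<in> L2per L"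
  by (induction A rule: infinite_finite_induct) (auto intro: L2per_zero L2per_add)

lemma L2per_inner: "v \<in> L2per L \<Longrightarrow> (\<lambda>x. v x \<bullet> b) \<in> L2per L"
proof -
  assume v: "v \<in> L2per L"
  have "integrable (lebesgue_on (cell L)) (\<lambda>x. (norm (v x \<bullet> b))\<^sup>2)"
  proof (rule Bochner_Integration.integrable_bound)
    show "integrable (lebesgue_on (cell L)) (\<lambda>x. (norm b)\<^sup>2 * (norm (v x))\<^sup>2)"
      using L2perD(4)[OF v] by simp
    show "(\<lambda>x. (norm (v x \<bullet> b))\<^sup>2) \<in> borel_measurable (lebesgue_on (cell L))"
      using L2perD(3)[OF v] by measurable
    show "AE x in lebesgue_on (cell L). norm ((norm (v x \<bullet> b))\<^sup>2) \<le> norm ((norm b)\<^sup>2 * (norm (v x))\<^sup>2)"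
    proof (intro AE_I2)
      fix x
      have "\<bar>v x \<bullet> b\<bar> \<le> norm b * norm (v x)" using Cauchy_Schwarz_ineq2[of "v x" b] by (simp add: mult.commute)
      then have "\<bar>v x \<bullet> b\<bar>\<^sup>2 \<le> (norm b * norm (v x))\<^sup>2" by (intro power_mono) auto
      then show "norm ((norm (v x \<bullet> b))\<^sup>2) \<le> norm ((norm b)\<^sup>2 * (norm (v x))\<^sup>2)"
        by (simp add: power_mult_distrib)
    qed
  qed
  then show ?thesis using L2perD[OF v] by (auto simp: L2per_def periodic_def)
qed

lemma bounded_continuous_L2per:
  assumes "periodic L v" "continuous_on UNIV v" "\<And>x. norm (v x) \<le> b"
  shows "v \<in> L2per L"
proof -
  interpret finite_measure "lebesgue_on (cell L)" by (rule finite_measure_cell)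
  have m: "v \<in> borel_measurable lebesgue"
    by (intro measurable_completion) (simp add: borel_measurable_continuous_onI assms)
  then have m': "v \<in> borel_measurable (lebesgue_on (cell L))" by (intro measurable_restrict_space1)
  have "integrable (lebesgue_on (cell L)) (\<lambda>x. (norm (v x))\<^sup>2)"
    by (rule integrable_const_bound[where B = "b\<^sup>2"]) (use m' assms in \<open>auto intro!: AE_I2 power_mono\<close>)
  then show ?thesis using assms m by (auto simp: L2per_def)
qed

lemma hartley_L2per: "L > 0 \<Longrightarrow> (\<lambda>x. hartley L m x *\<^sub>R b) \<in> L2per L"
proof (rule bounded_continuous_L2per)
  assume L: "L > 0"
  show "periodic L (\<lambda>x. hartley L m x *\<^sub>R b)" using hartley_periodic[OF L, of m] by (auto simp: periodic_def)
  show "continuous_on UNIV (\<lambda>x. hartley L m x *\<^sub>R b)" by (intro continuous_intros continuous_on_hartley)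
  show "norm (hartley L m x *\<^sub>R b) \<le> (2 / sqrt (L ^ CARD('a))) * norm b" for x
    using mult_right_mono[OF hartley_bound[OF L, of m x] norm_ge_zero[of b]] by simp
qed

lemma L2_nrm_power2: "(L2_nrm L v)\<^sup>2 = (LINT x|lebesgue_on (cell L). (norm (v x))\<^sup>2)"
proof -
  have "0 \<le> (LINT x|lebesgue_on (cell L). v x \<bullet> v x)" by (rule Bochner_Integration.integral_nonneg) simp
  then show ?thesis by (simp add: L2_nrm_def L2_ip_def power2_norm_eq_inner)
qed

lemma L2_nrm_nonneg [simp]: "L2_nrm L v \<ge> 0"
  by (auto simp: L2_nrm_def L2_ip_def intro!: real_sqrt_ge_zero Bochner_Integration.integral_nonneg)

lemma L2_nrm_cong_AE:
  assumes "v \<in> L2per L" "w \<in> L2per L" "AE x in lebesgue_on (cell L). v x = w x"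
  shows "L2_nrm L v = L2_nrm L w"
proof -
  have "L2_ip L v v = L2_ip L w w" unfolding L2_ip_def
    by (rule integral_cong_AE)
      (use assms in \<open>auto intro!: borel_measurable_integrable integrable_L2_inner\<close>)
  then show ?thesis by (simp add: L2_nrm_def)
qed

lemma L2_nrm_eq_0_iff:
  assumes "v \<in> L2per L"
  shows "L2_nrm L v = 0 \<longleftrightarrow> (AE x in lebesgue_on (cell L). v x = 0)"
proof -
  have "L2_nrm L v = 0 \<longleftrightarrow> (LINT x|lebesgue_on (cell L). (norm (v x))\<^sup>2) = 0"
    by (simp flip: L2_nrm_power2)
  also have "\<dots> \<longleftrightarrow> (AE x in lebesgue_on (cell L). v x = 0)"
    by (subst integral_nonneg_eq_0_iff_AE) (auto intro: L2perD assms)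
  finally show ?thesis .
qed

section \<open>Hartley coefficients\<close>

definition fcoef :: "real \<Rightarrow> int^'n \<Rightarrow> (real^'n \<Rightarrow> 'b::euclidean_space) \<Rightarrow> 'b" where
  "fcoef L m v = (LINT x|lebesgue_on (cell L). hartley L m x *\<^sub>R v x)"

lemma integrable_hartley:
  fixes v :: "real^'n \<Rightarrow> 'b::{banach, second_countable_topology}" and m :: "int^'n"
  assumes "L > 0" "integrable (lebesgue_on (cell L)) v"
  shows "integrable (lebesgue_on (cell L)) (\<lambda>x. hartley L m x *\<^sub>R v x)"
proof (rule integrable_bounded_scaleR[OF assms(2)])
  show "\<bar>hartley L m x\<bar> \<le> 2 / sqrt (L ^ CARD('n))" for x by (rule hartley_bound[OF assms(1)])
  have "hartley L m \<in> borel_measurable lebesgue" by (intro measurable_completion) simp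
  then show "hartley L m \<in> borel_measurable (lebesgue_on (cell L))" by (rule measurable_restrict_space1)
qed

lemma fcoef_add:
  "L > 0 \<Longrightarrow> v \<in> L2per L \<Longrightarrow> w \<in> L2per L \<Longrightarrow> fcoef L m (\<lambda>x. v x + w x) = fcoef L m v + fcoef L m w"
  unfolding fcoef_def scaleR_add_right
  by (rule Bochner_Integration.integral_add) (auto intro!: integrable_hartley[OF _ L2perD(5)])

lemma fcoef_diff:
  "L > 0 \<Longrightarrow> v \<in> L2per L \<Longrightarrow> w \<in> L2per L \<Longrightarrow> fcoef L m (\<lambda>x. v x - w x) = fcoef L m v - fcoef L m w"
  unfolding fcoef_def scaleR_diff_right
  by (rule Bochner_Integration.integral_diff) (auto intro!: integrable_hartley[OF _ L2perD(5)])

lemma fcoef_scaleR: "fcoef L m (\<lambda>x. c *\<^sub>R v x) = c *\<^sub>R fcoef L m v"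
proof -
  have "(\<lambda>x. hartley L m x *\<^sub>R c *\<^sub>R v x) = (\<lambda>x. c *\<^sub>R hartley L m x *\<^sub>R v x)"
    by (simp add: mult.commute)
  then show ?thesis by (simp only: fcoef_def integral_scaleR_right)
qed

lemma fcoef_zero [simp]: "fcoef L m (\<lambda>x. 0) = 0"
  by (simp add: fcoef_def)

lemma fcoef_sum:
  "L > 0 \<Longrightarrow> (\<And>i. i \<in> A \<Longrightarrow> v i \<in> L2per L) \<Longrightarrow> fcoef L m (\<lambda>x. \<Sum>i\<in>A. v i x) = (\<Sum>i\<in>A. fcoef L m (v i))"
  by (induction A rule: infinite_finite_induct) (simp_all add: fcoef_add L2per_sum)

lemma fcoef_inner: "L > 0 \<Longrightarrow> v \<in> L2per L \<Longrightarrow> fcoef L m (\<lambda>x. v x \<bullet> b) = fcoef L m v \<bullet> b"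
  unfolding fcoef_def
  by (subst integral_inner_left[symmetric]) (auto intro!: integrable_hartley[OF _ L2perD(5)])

lemma L2_ip_hartley:
  "L > 0 \<Longrightarrow> v \<in> L2per L \<Longrightarrow> L2_ip L v (\<lambda>x. hartley L m x *\<^sub>R b) = fcoef L m v \<bullet> b"
  by (simp add: fcoef_inner[symmetric]) (simp add: L2_ip_def fcoef_def)

text \<open>Multiplying by the partition of unity turns integrals over the cell into integrals over
  the whole space, so that periodic functions can be tested with compactly supported ones.\<close>

lemma periodization:
  fixes L :: real
  assumes "L > 0"
  obtains \<psi> :: "real^'n \<Rightarrow> real" where "\<psi> \<in> test_functions"
    "\<And>G :: real^'n \<Rightarrow> 'b::euclidean_space. periodic L G \<Longrightarrow> G \<in> borel_measurable lebesgue \<Longrightarrow>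
       integrable (lebesgue_on (cell L)) G \<Longrightarrow>
       has_bochner_integral lebesgue (\<lambda>x. \<psi> x *\<^sub>R G x) (LINT x|lebesgue_on (cell L). G x)"
    "\<And>(G :: real^'n \<Rightarrow> 'b) i. periodic L G \<Longrightarrow> G \<in> borel_measurable lebesgue \<Longrightarrow>
       integrable (lebesgue_on (cell L)) G \<Longrightarrow>
       has_bochner_integral lebesgue (\<lambda>x. partial_deriv i \<psi> x *\<^sub>R G x) 0"
proof -
  obtain \<psi> :: "real^'n \<Rightarrow> real" where \<psi>: "\<psi> \<in> test_functions"
    and supp: "\<And>x i. \<psi> x \<noteq> 0 \<Longrightarrow> 0 < x $ i \<and> x $ i < 2 * L"
    and sum: "\<And>x. (\<And>i. 0 \<le> x $ i \<and> x $ i \<le> L) \<Longrightarrow>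
       (\<Sum>z\<in>PiE UNIV (\<lambda>_. {0, 1, 2}). \<psi> (x + lattice_vec L z)) = 1"
    using partition_of_unity[OF assms] by blast
  let ?Z = "PiE (UNIV :: 'n set) (\<lambda>_. {0, 1, 2 :: int})"
  have finZ: "finite ?Z" by (intro finite_PiE) auto
  have floor: "(\<lambda>i. \<lfloor>x $ i / L\<rfloor>) \<in> ?Z" if "\<And>i. 0 \<le> x $ i \<and> x $ i \<le> 2 * L" for x :: "real^'n"
  proof -
    have "\<lfloor>x $ i / L\<rfloor> \<in> {0, 1, 2}" for i
    proof -
      have "0 \<le> x $ i / L" "x $ i / L \<le> 2" using that[of i] assms by (auto simp: field_simps)
      then have "0 \<le> \<lfloor>x $ i / L\<rfloor>" "\<lfloor>x $ i / L\<rfloor> \<le> 2" by linarith+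
      then have "\<lfloor>x $ i / L\<rfloor> = 0 \<or> \<lfloor>x $ i / L\<rfloor> = 1 \<or> \<lfloor>x $ i / L\<rfloor> = 2" by presburger
      then show ?thesis by blast
    qed
    then show ?thesis by (simp add: PiE_UNIV_domain)
  qed
  have Z0: "(\<lambda>i. \<lfloor>x $ i / L\<rfloor>) \<in> ?Z" if "\<psi> x \<noteq> 0" for x
    by (rule floor) (use supp[OF that] in \<open>auto intro: less_imp_le\<close>)
  have "{x. \<psi> x \<noteq> 0} \<subseteq> cbox 0 (\<chi> i. 2 * L)"
    using supp less_imp_le by (simp add: mem_box_cart subset_iff) blast
  then have "closure {x. \<psi> x \<noteq> 0} \<subseteq> cbox 0 (\<chi> i. 2 * L)"
    by (rule closure_minimal[OF _ closed_cbox])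
  then have Z1: "(\<lambda>j. \<lfloor>x $ j / L\<rfloor>) \<in> ?Z" if "partial_deriv i \<psi> x \<noteq> 0" for i x
    using partial_deriv_support[OF that] by (intro floor) (auto simp: mem_box_cart)
  have d: "((\<lambda>x. \<psi> (x + a)) has_derivative frechet_derivative \<psi> (at (x + a))) (at x)" for x a
  proof -
    have "(\<psi> has_derivative frechet_derivative \<psi> (at (x + a))) (at (x + a))"
      using test_functionsD(1)[OF \<psi>] frechet_derivative_works by blast
    moreover have "((\<lambda>x. x + a) has_derivative (\<lambda>h. h)) (at x)"
      by (auto intro!: derivative_eq_intros)
    ultimately show ?thesis
      using has_derivative_compose[of "\<lambda>x. x + a" "\<lambda>h. h" x UNIV \<psi>] by blast
  qed
  \<comment> \<open>The translates of \<open>\<psi>\<close> add up to the constant 1 on the open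
    cell, so their derivatives add up to 0 there. This is why terms in which the derivative falls on
    \<open>\<psi>\<close> disappear.\<close>
  have sum0: "(\<Sum>z\<in>?Z. partial_deriv i \<psi> (x + lattice_vec L z)) = 0" if "x \<in> cell L" for i x
  proof -
    have "((\<lambda>x. \<Sum>z\<in>?Z. \<psi> (x + lattice_vec L z)) has_derivative
        (\<lambda>h. \<Sum>z\<in>?Z. frechet_derivative \<psi> (at (x + lattice_vec L z)) h)) (at x)"
      by (intro has_derivative_sum d)
    moreover have "((\<lambda>x. \<Sum>z\<in>?Z. \<psi> (x + lattice_vec L z)) has_derivative (\<lambda>h. 0)) (at x)"
    proof (rule has_derivative_transform_within_open[OF has_derivative_const[of 1], of "cell L"])
      show "open (cell L :: (real^'n) set)" unfolding cell_def by (rule open_box)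
      fix y :: "real^'n" assume "y \<in> cell L"
      then show "1 = (\<Sum>z\<in>?Z. \<psi> (y + lattice_vec L z))"
        by (intro sum[symmetric]) (auto simp: mem_cell intro: less_imp_le)
    qed (rule that)
    ultimately have "(\<lambda>h. \<Sum>z\<in>?Z. frechet_derivative \<psi> (at (x + lattice_vec L z)) h) = (\<lambda>h. 0)"
      by (rule has_derivative_unique)
    then show ?thesis by (auto simp: partial_deriv_def dest: fun_cong)
  qed
  have *: "has_bochner_integral lebesgue (\<lambda>x. \<phi> x *\<^sub>R G x) (LINT x|lebesgue_on (cell L). c *\<^sub>R G x)"
    if \<phi>: "\<phi> \<in> test_functions" and Z: "\<And>x. \<phi> x \<noteq> 0 \<Longrightarrow> (\<lambda>i. \<lfloor>x $ i / L\<rfloor>) \<in> ?Z"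
      and s: "\<And>x. x \<in> cell L \<Longrightarrow> (\<Sum>z\<in>?Z. \<phi> (x + lattice_vec L z)) = c"
      and G: "periodic L G" "G \<in> borel_measurable lebesgue" "integrable (lebesgue_on (cell L)) G"
    for \<phi> :: "real^'n \<Rightarrow> real" and G :: "real^'n \<Rightarrow> 'b" and c
  proof -
    obtain b where b: "\<And>x. \<bar>\<phi> x\<bar> \<le> b" using test_function_bounded[OF \<phi>] by blast
    have "has_bochner_integral lebesgue (\<lambda>x. \<phi> x *\<^sub>R G x)
      (\<Sum>z\<in>?Z. LINT x|lebesgue_on (cell L). \<phi> (x + lattice_vec L z) *\<^sub>R G x)"
      by (rule has_bochner_integral_tiling[OF assms G test_function_integrable(2)[OF \<phi>] b finZ Z])
    also have "(\<Sum>z\<in>?Z. LINT x|lebesgue_on (cell L). \<phi> (x + lattice_vec L z) *\<^sub>R G x)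
        = (LINT x|lebesgue_on (cell L). (\<Sum>z\<in>?Z. \<phi> (x + lattice_vec L z) *\<^sub>R G x))"
    proof (rule Bochner_Integration.integral_sum[symmetric])
      fix z
      have "(\<lambda>x. \<phi> (lattice_vec L z + x)) \<in> borel_measurable lebesgue"
        using measurable_compose[OF lebesgue_translation(1) test_function_integrable(2)[OF \<phi>]] .
      then have "(\<lambda>x. \<phi> (x + lattice_vec L z)) \<in> borel_measurable (lebesgue_on (cell L))"
        by (intro measurable_restrict_space1) (simp add: add.commute)
      then show "integrable (lebesgue_on (cell L)) (\<lambda>x. \<phi> (x + lattice_vec L z) *\<^sub>R G x)"
        by (intro integrable_bounded_scaleR[where b = b] G b)
    qed
    also have "\<dots> = (LINT x|lebesgue_on (cell L). c *\<^sub>R G x)"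
      by (rule Bochner_Integration.integral_cong)
        (auto simp: s space_restrict_space simp flip: scaleR_left.sum)
    finally show ?thesis .
  qed
  have s1: "\<And>x. x \<in> cell L \<Longrightarrow> (\<Sum>z\<in>?Z. \<psi> (x + lattice_vec L z)) = 1"
    by (intro sum) (auto simp: mem_cell intro: less_imp_le)
  show ?thesis
  proof (rule that[OF \<psi>])
    fix G :: "real^'n \<Rightarrow> 'b" and i
    assume G: "periodic L G" "G \<in> borel_measurable lebesgue" "integrable (lebesgue_on (cell L)) G"
    show "has_bochner_integral lebesgue (\<lambda>x. \<psi> x *\<^sub>R G x) (LINT x|lebesgue_on (cell L). G x)"
      using *[OF \<psi> Z0 s1 G] by simp
    show "has_bochner_integral lebesgue (\<lambda>x. partial_deriv i \<psi> x *\<^sub>R G x) 0"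
      using *[OF partial_deriv_test_functions[OF \<psi>] Z1 sum0 G] by simp
  qed
qed

lemma hartley_mult_periodic:
  assumes "L > 0" "v \<in> L2per L"
  shows "periodic L (\<lambda>x. hartley L m x *\<^sub>R v x)" "(\<lambda>x. hartley L m x *\<^sub>R v x) \<in> borel_measurable lebesgue"
    "integrable (lebesgue_on (cell L)) (\<lambda>x. hartley L m x *\<^sub>R v x)"
proof -
  show "periodic L (\<lambda>x. hartley L m x *\<^sub>R v x)"
    using hartley_periodic[OF assms(1), of m] L2perD(1)[OF assms(2)] by (simp add: periodic_def)
  have "hartley L m \<in> borel_measurable lebesgue" by (intro measurable_completion) simp
  then show "(\<lambda>x. hartley L m x *\<^sub>R v x) \<in> borel_measurable lebesgue"
    using L2perD(2)[OF assms(2)] by measurable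
  show "integrable (lebesgue_on (cell L)) (\<lambda>x. hartley L m x *\<^sub>R v x)"
    by (intro integrable_hartley[OF _ L2perD(5)] assms)
qed

lemma partial_deriv_mult_hartley:
  "\<phi> \<in> test_functions \<Longrightarrow> partial_deriv i (\<lambda>x. \<phi> x * hartley L m x) x
     = \<phi> x * (wavevec L m $ i * hartley L (- m) x) + partial_deriv i \<phi> x * hartley L m x"
  by (subst partial_deriv_mult) (auto simp: test_functionsD hartley_differentiable partial_deriv_hartley)

text \<open>The weak derivative is tested with \<open>\<psi>\<close> times a Hartley function. The
  term with the derivative of \<open>\<psi>\<close> integrates to zero against periodic functions,
  and in the other one differentiation turns mode \<open>m\<close> into mode
  \<open>- m\<close>.\<close>

lemma fcoef_weak_derivative:
  fixes v g :: "real^'n \<Rightarrow> 'b::euclidean_space"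
  assumes "L > 0" "v \<in> L2per L" "g \<in> L2per L" "is_wderiv i v g"
  shows "fcoef L m g = - (wavevec L m $ i) *\<^sub>R fcoef L (- m) v"
proof -
  obtain \<psi> :: "real^'n \<Rightarrow> real" where \<psi>: "\<psi> \<in> test_functions"
    "\<And>G :: real^'n \<Rightarrow> 'b. periodic L G \<Longrightarrow> G \<in> borel_measurable lebesgue \<Longrightarrow>
       integrable (lebesgue_on (cell L)) G \<Longrightarrow>
       has_bochner_integral lebesgue (\<lambda>x. \<psi> x *\<^sub>R G x) (LINT x|lebesgue_on (cell L). G x)"
    "\<And>(G :: real^'n \<Rightarrow> 'b) i. periodic L G \<Longrightarrow> G \<in> borel_measurable lebesgue \<Longrightarrow>
       integrable (lebesgue_on (cell L)) G \<Longrightarrow>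
       has_bochner_integral lebesgue (\<lambda>x. partial_deriv i \<psi> x *\<^sub>R G x) 0"
    using periodization[OF assms(1)] by blast
  note hv = hartley_mult_periodic[OF assms(1,2)] and hg = hartley_mult_periodic[OF assms(1,3)]
  have 1: "has_bochner_integral lebesgue (\<lambda>x. \<psi> x *\<^sub>R hartley L m x *\<^sub>R g x) (fcoef L m g)"
    using \<psi>(2)[OF hg] by (simp add: fcoef_def)
  have 2: "has_bochner_integral lebesgue (\<lambda>x. \<psi> x *\<^sub>R hartley L (- m) x *\<^sub>R v x) (fcoef L (- m) v)"
    using \<psi>(2)[OF hv] by (simp add: fcoef_def)
  have 3: "has_bochner_integral lebesgue (\<lambda>x. partial_deriv i \<psi> x *\<^sub>R hartley L m x *\<^sub>R v x) 0"
    using \<psi>(3)[OF hv] .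
  have "(\<lambda>x. \<psi> x * hartley L m x) \<in> test_functions"
    by (intro test_functions_mult \<psi> Ck_hartley)
  from bspec[OF assms(4)[unfolded is_wderiv_def] this]
  have "(LINT x|lebesgue. (\<psi> x * hartley L m x) *\<^sub>R g x)
      = - (LINT x|lebesgue. partial_deriv i (\<lambda>x. \<psi> x * hartley L m x) x *\<^sub>R v x)"
    .
  also have "(LINT x|lebesgue. (\<psi> x * hartley L m x) *\<^sub>R g x) = fcoef L m g"
    using 1 by (simp add: has_bochner_integral_iff)
  also have "(\<lambda>x. partial_deriv i (\<lambda>x. \<psi> x * hartley L m x) x *\<^sub>R v x)
      = (\<lambda>x. (wavevec L m $ i) *\<^sub>R (\<psi> x *\<^sub>R hartley L (- m) x *\<^sub>R v x) + partial_deriv i \<psi> x *\<^sub>R hartley L m x *\<^sub>R v x)"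
    by (simp add: partial_deriv_mult_hartley[OF \<psi>(1)] algebra_simps)
  also have "(LINT x|lebesgue. \<dots> x) = (wavevec L m $ i) *\<^sub>R fcoef L (- m) v + 0"
    using has_bochner_integral_add[OF has_bochner_integral_scaleR_right[OF 2, of "wavevec L m $ i"] 3]
    by (simp add: has_bochner_integral_iff)
  finally show ?thesis by simp
qed

lemma fcoef_div_free:
  assumes "L > 0" "v \<in> Hdiv L"
  shows "wavevec L m \<bullet> fcoef L m v = 0"
proof -
  have v: "v \<in> L2per L" "div_free v" using assms(2) by (auto simp: Hdiv_def)
  have vi: "(\<lambda>x. v x $ i) \<in> L2per L" for i
    using L2per_inner[OF v(1), of "axis i 1"] by (simp add: inner_axis)
  obtain \<psi> :: "real^'a \<Rightarrow> real" where \<psi>: "\<psi> \<in> test_functions"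
    "\<And>G :: real^'a \<Rightarrow> real. periodic L G \<Longrightarrow> G \<in> borel_measurable lebesgue \<Longrightarrow>
       integrable (lebesgue_on (cell L)) G \<Longrightarrow>
       has_bochner_integral lebesgue (\<lambda>x. \<psi> x *\<^sub>R G x) (LINT x|lebesgue_on (cell L). G x)"
    "\<And>(G :: real^'a \<Rightarrow> real) i. periodic L G \<Longrightarrow> G \<in> borel_measurable lebesgue \<Longrightarrow>
       integrable (lebesgue_on (cell L)) G \<Longrightarrow>
       has_bochner_integral lebesgue (\<lambda>x. partial_deriv i \<psi> x *\<^sub>R G x) 0"
    using periodization[OF assms(1)] by blast
  \<comment> \<open>The test function is built from mode \<open>- m\<close>, because its gradient is
    the one proportional to mode \<open>m\<close>.\<close>
  have "wavevec L (- m) \<bullet> fcoef L m v = 0"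
  proof -
    have 2: "has_bochner_integral lebesgue (\<lambda>x. \<psi> x *\<^sub>R hartley L m x *\<^sub>R (v x $ i)) (fcoef L m v $ i)" for i
      using \<psi>(2)[OF hartley_mult_periodic[OF assms(1) vi[of i]], of m] fcoef_inner[OF assms(1) v(1), of m "axis i 1"]
      by (simp add: fcoef_def inner_axis)
    have 3: "has_bochner_integral lebesgue (\<lambda>x. partial_deriv i \<psi> x *\<^sub>R hartley L (- m) x *\<^sub>R (v x $ i)) 0" for i
      using \<psi>(3)[OF hartley_mult_periodic[OF assms(1) vi[of i]]] .
    have "has_bochner_integral lebesgue (\<lambda>x. \<Sum>i\<in>UNIV. wavevec L (- m) $ i * (\<psi> x *\<^sub>R hartley L m x *\<^sub>R (v x $ i))
        + partial_deriv i \<psi> x *\<^sub>R hartley L (- m) x *\<^sub>R (v x $ i))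
        (\<Sum>i\<in>UNIV. wavevec L (- m) $ i * fcoef L m v $ i + 0)"
      by (intro has_bochner_integral_sum has_bochner_integral_add has_bochner_integral_mult_right 2 3)
    moreover have "(\<lambda>x. \<Sum>i\<in>UNIV. wavevec L (- m) $ i * (\<psi> x *\<^sub>R hartley L m x *\<^sub>R (v x $ i))
        + partial_deriv i \<psi> x *\<^sub>R hartley L (- m) x *\<^sub>R (v x $ i))
        = (\<lambda>x. v x \<bullet> (\<chi> i. partial_deriv i (\<lambda>x. \<psi> x * hartley L (- m) x) x))"
      by (simp add: partial_deriv_mult_hartley[OF \<psi>(1)] inner_vec_def algebra_simps)
    ultimately have "(LINT x|lebesgue. v x \<bullet> (\<chi> i. partial_deriv i (\<lambda>x. \<psi> x * hartley L (- m) x) x))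
        = wavevec L (- m) \<bullet> fcoef L m v"
      by (simp add: has_bochner_integral_iff inner_vec_def)
    moreover have "(\<lambda>x. \<psi> x * hartley L (- m) x) \<in> test_functions"
      by (intro test_functions_mult \<psi> Ck_hartley)
    note bspec[OF v(2)[unfolded div_free_def] this]
    ultimately show ?thesis by simp
  qed
  then show ?thesis by simp
qed

subsection \<open>Orthonormality\<close>

lemma is_wderiv_const: "is_wderiv i (\<lambda>x. c) (\<lambda>x. 0)"
  unfolding is_wderiv_def
proof
  fix \<phi> :: "real^'a \<Rightarrow> real" assume "\<phi> \<in> test_functions"
  then have "(LINT x|lebesgue. partial_deriv i \<phi> x *\<^sub>R c) = 0 *\<^sub>R c"
    by (subst integral_scaleR_left)
      (auto intro: test_function_integrable partial_deriv_test_functions simp: integral_partial_deriv_test_function)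
  then show "(LINT x|lebesgue. \<phi> x *\<^sub>R 0) = - (LINT x|lebesgue. partial_deriv i \<phi> x *\<^sub>R c)" by simp
qed

text \<open>Orthogonality to constants without computing an integral: the weak derivative of 1 is 0,
  but its coefficient is also the coefficient of 1 times a component of the wave vector, and some
  component is nonzero.\<close>

lemma fcoef_one_nonzero_mode:
  fixes m :: "int^'n"
  assumes "L > 0" "m \<noteq> 0"
  shows "fcoef L m (\<lambda>x. 1 :: real) = 0"
proof -
  obtain i where i: "m $ i \<noteq> 0" using assms(2) by (auto simp: vec_eq_iff)
  have "(\<lambda>x::real^'n. 1 :: real) \<in> L2per L"
    by (rule bounded_continuous_L2per[where b = 1]) (auto simp: periodic_def)
  from fcoef_weak_derivative[OF assms(1) this L2per_zero is_wderiv_const, of "- m" i]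
  show ?thesis using i assms(1) by (simp add: wavevec_def)
qed

lemma integrable_cos_sin:
  "integrable (lebesgue_on (cell L)) (\<lambda>x::real^'n. cos (a \<bullet> x))"
  "integrable (lebesgue_on (cell L)) (\<lambda>x::real^'n. sin (a \<bullet> x))"
proof -
  interpret finite_measure "lebesgue_on (cell L :: (real^'n) set)" by (rule finite_measure_cell)
  have "(\<lambda>x::real^'n. cos (a \<bullet> x)) \<in> borel_measurable lebesgue" "(\<lambda>x::real^'n. sin (a \<bullet> x)) \<in> borel_measurable lebesgue"
    by (intro measurable_completion, simp)+
  then have "(\<lambda>x::real^'n. cos (a \<bullet> x)) \<in> borel_measurable (lebesgue_on (cell L))"
    "(\<lambda>x::real^'n. sin (a \<bullet> x)) \<in> borel_measurable (lebesgue_on (cell L))"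
    by (auto intro: measurable_restrict_space1)
  then show "integrable (lebesgue_on (cell L)) (\<lambda>x::real^'n. cos (a \<bullet> x))"
    "integrable (lebesgue_on (cell L)) (\<lambda>x::real^'n. sin (a \<bullet> x))"
    by (auto intro!: integrable_const_bound[where B = 1])
qed

text \<open>Up to normalisation, the coefficients of 1 at \<open>m\<close> and \<open>- m\<close>
  are the sum and the difference of the two integrals; for \<open>m \<noteq> 0\<close> both vanish,
  hence so do the integrals.\<close>

lemma integral_cos_sin:
  fixes m :: "int^'n"
  assumes "L > 0"
  shows "(LINT x|lebesgue_on (cell L). cos (wavevec L m \<bullet> x)) = (if m = 0 then L ^ CARD('n) else 0)"
    "(LINT x|lebesgue_on (cell L). sin (wavevec L m \<bullet> x)) = 0"
proof -
  let ?c = "LINT x|lebesgue_on (cell L). cos (wavevec L m \<bullet> x)"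
  let ?s = "LINT x|lebesgue_on (cell L). sin (wavevec L m \<bullet> x)"
  have pos: "sqrt (L ^ CARD('n)) > 0" using assms by simp
  have cs: "?c + ?s = 0" "?c - ?s = 0" if "m \<noteq> 0"
  proof -
    have "fcoef L m (\<lambda>x. 1 :: real) = (?c + ?s) / sqrt (L ^ CARD('n))"
      "fcoef L (- m) (\<lambda>x. 1 :: real) = (?c - ?s) / sqrt (L ^ CARD('n))"
      by (simp_all add: fcoef_def hartley_def integrable_cos_sin)
    with fcoef_one_nonzero_mode[OF assms that] fcoef_one_nonzero_mode[OF assms, of "- m"] that pos assms
    show "?c + ?s = 0" "?c - ?s = 0" by auto
  qed
  have "measure lebesgue (cell L :: (real^'n) set) = L ^ CARD('n)"
    using emeasure_cell[OF assms, where 'n = 'n] assms by (simp add: measure_def)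
  then have "measure (lebesgue_on (cell L)) (space (lebesgue_on (cell L :: (real^'n) set))) = L ^ CARD('n)"
    by (simp add: space_restrict_space measure_restrict_space)
  then have "m = 0 \<Longrightarrow> ?c = L ^ CARD('n)" "m = 0 \<Longrightarrow> ?s = 0" by simp_all
  with cs show "?c = (if m = 0 then L ^ CARD('n) else 0)" "?s = 0" by (cases "m = 0"; simp)+
qed

lemma hartley_mult_hartley:
  fixes m :: "int^'n"
  assumes "L > 0"
  shows "hartley L m x * hartley L n x
    = (cos (wavevec L (m - n) \<bullet> x) + sin (wavevec L (m + n) \<bullet> x)) / L ^ CARD('n)"
proof -
  have "sqrt (L ^ CARD('n)) * sqrt (L ^ CARD('n)) = L ^ CARD('n)" using assms by simp
  then have "hartley L m x * hartley L n x
    = ((cos (wavevec L m \<bullet> x) + sin (wavevec L m \<bullet> x)) * (cos (wavevec L n \<bullet> x) + sin (wavevec L n \<bullet> x))) / L ^ CARD('n)"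
    by (simp add: hartley_def)
  also have "(cos (wavevec L m \<bullet> x) + sin (wavevec L m \<bullet> x)) * (cos (wavevec L n \<bullet> x) + sin (wavevec L n \<bullet> x))
     = cos (wavevec L (m - n) \<bullet> x) + sin (wavevec L (m + n) \<bullet> x)"
    by (simp add: wavevec_diff wavevec_add inner_diff_left inner_add_left cos_diff sin_add algebra_simps)
  finally show ?thesis .
qed

lemma fcoef_hartley:
  fixes m n :: "int^'n"
  assumes "L > 0"
  shows "fcoef L m (\<lambda>x. hartley L n x *\<^sub>R b) = (if m = n then b else 0)"
proof -
  have "fcoef L m (\<lambda>x. hartley L n x *\<^sub>R b)
      = (LINT x|lebesgue_on (cell L). (cos (wavevec L (m - n) \<bullet> x) + sin (wavevec L (m + n) \<bullet> x)) / L ^ CARD('n)) *\<^sub>R b"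
    unfolding fcoef_def
    by (subst integral_scaleR_left[symmetric])
      (auto simp: hartley_mult_hartley[OF assms] integrable_cos_sin intro!: integrable_divide)
  also have "(LINT x|lebesgue_on (cell L). (cos (wavevec L (m - n) \<bullet> x) + sin (wavevec L (m + n) \<bullet> x)) / L ^ CARD('n))
      = (if m = n then 1 else 0)"
    using assms by (simp add: integrable_cos_sin integral_cos_sin)
  finally show ?thesis by simp
qed

subsection \<open>Completeness\<close>

text \<open>The class of functions orthogonal to all Hartley functions is stable under multiplication by
  trigonometric polynomials, hence by Stone--Weierstrass on the torus under multiplication by
  indicators of open subsets of the cell.\<close>

definition annihilated :: "real \<Rightarrow> (real^'n \<Rightarrow> real) \<Rightarrow> bool" where
  "annihilated L w \<longleftrightarrow> integrable (lebesgue_on (cell L)) w \<and> (\<forall>m. fcoef L m w = 0)"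

text \<open>The standard embedding of the torus. Trigonometric polynomials become restrictions of
  ordinary polynomials to a compact set, which is the form required by the Stone--Weierstrass
  theorem.\<close>

definition torus_map :: "real \<Rightarrow> real^'n \<Rightarrow> (real^'n) \<times> (real^'n)" where
  "torus_map L x = ((\<chi> i. cos (2 * pi / L * x $ i)), (\<chi> i. sin (2 * pi / L * x $ i)))"

lemma wavevec_axis: "wavevec L (axis i 1) \<bullet> x = 2 * pi / L * x $ i"
proof -
  have "wavevec L (axis i 1) = axis i (2 * pi / L)" by (simp add: wavevec_def axis_def vec_eq_iff)
  then show ?thesis by (simp add: inner_axis')
qed

lemma annihilated_add: "L > 0 \<Longrightarrow> annihilated L v \<Longrightarrow> annihilated L w \<Longrightarrow> annihilated L (\<lambda>x. v x + w x)"
  unfolding annihilated_def fcoef_def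
  by (simp add: distrib_left) (subst Bochner_Integration.integral_add,
    use integrable_hartley[of L v] integrable_hartley[of L w] in auto)

lemma annihilated_cmult: "annihilated L w \<Longrightarrow> annihilated L (\<lambda>x. c * w x)"
  using fcoef_scaleR[of L _ c w] by (auto simp: annihilated_def)

text \<open>Common core of the cosine and the sine case: in both, a product-to-sum formula writes
  \<open>t\<close> times a Hartley function as half the sum or difference of two others, with
  \<open>s\<close> the sign.\<close>

lemma annihilated_mult_hartley_combination:
  assumes "L > 0" "annihilated L w" "continuous_on UNIV t" "\<And>x. \<bar>t x\<bar> \<le> 1"
    and eq: "\<And>m x. hartley L m x * t x = (hartley L (p m) x + s * hartley L (q m) x) / 2"
  shows "annihilated L (\<lambda>x. t x * w x)"
proof -
  have w: "integrable (lebesgue_on (cell L)) w" "\<And>m. (LINT x|lebesgue_on (cell L). hartley L m x * w x) = 0"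
    using assms(2) by (auto simp: annihilated_def fcoef_def)
  note hw = integrable_hartley[OF assms(1) w(1), unfolded real_scaleR_def]
  have "t \<in> borel_measurable (lebesgue_on (cell L))"
    by (intro measurable_restrict_space1 measurable_completion) (simp add: borel_measurable_continuous_onI assms)
  then have "integrable (lebesgue_on (cell L)) (\<lambda>x. t x *\<^sub>R w x)"
    by (intro integrable_bounded_scaleR[where b = 1] w assms)
  moreover have "fcoef L m (\<lambda>x. t x * w x) = 0" for m
  proof -
    have "hartley L m x * (t x * w x) = (hartley L (p m) x * w x + s * (hartley L (q m) x * w x)) / 2" for x
    proof -
      have "hartley L m x * (t x * w x) = (hartley L m x * t x) * w x" by simp
      also have "\<dots> = (hartley L (p m) x * w x + s * (hartley L (q m) x * w x)) / 2"
        unfolding eq by (simp add: algebra_simps)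
      finally show ?thesis .
    qed
    then have "fcoef L m (\<lambda>x. t x * w x)
        = (LINT x|lebesgue_on (cell L). (hartley L (p m) x * w x + s * (hartley L (q m) x * w x)) / 2)"
      by (simp only: fcoef_def real_scaleR_def)
    also have "\<dots> = 0" using hw w(2) by simp
    finally show ?thesis .
  qed
  ultimately show ?thesis by (simp add: annihilated_def)
qed

lemma annihilated_cos:
  assumes "L > 0" "annihilated L w"
  shows "annihilated L (\<lambda>x. cos (2 * pi / L * x $ i) * w x)"
proof (rule annihilated_mult_hartley_combination[OF assms, where p = "\<lambda>m. m + axis i 1" and q = "\<lambda>m. m - axis i 1" and s = 1])
  show "hartley L m x * cos (2 * pi / L * x $ i)
    = (hartley L (m + axis i 1) x + 1 * hartley L (m - axis i 1) x) / 2" for m x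
  proof -
    have trig: "(cos a + sin a) * cos b = ((cos (a + b) + sin (a + b)) + (cos (a - b) + sin (a - b))) / 2" for a b :: real
      by (simp add: cos_add sin_add cos_diff sin_diff algebra_simps)
    have "hartley L m x * cos (2 * pi / L * x $ i)
        = ((cos (wavevec L m \<bullet> x) + sin (wavevec L m \<bullet> x)) * cos (2 * pi / L * x $ i)) / sqrt (L ^ CARD('a))"
      by (simp add: hartley_def)
    then show ?thesis unfolding trig
      by (simp add: hartley_def wavevec_add wavevec_diff inner_add_left inner_diff_left wavevec_axis add_divide_distrib)
  qed
qed (use assms in \<open>auto intro!: continuous_intros\<close>)

text \<open>With \<open>cas = cos + sin\<close> the formula behind the choice of modes is
  \<open>2 cas(a) sin(b) = cas(b - a) - cas(-(b + a))\<close>: multiplication by a sine reflects the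
  frequency \<open>a\<close>.\<close>

lemma annihilated_sin:
  assumes "L > 0" "annihilated L w"
  shows "annihilated L (\<lambda>x. sin (2 * pi / L * x $ i) * w x)"
proof (rule annihilated_mult_hartley_combination[OF assms, where p = "\<lambda>m. axis i 1 - m" and q = "\<lambda>m. - (axis i 1 + m)" and s = "-1"])
  show "hartley L m x * sin (2 * pi / L * x $ i)
    = (hartley L (axis i 1 - m) x + - 1 * hartley L (- (axis i 1 + m)) x) / 2" for m x
  proof -
    have trig: "(cos a + sin a) * sin b = ((cos (b - a) + sin (b - a)) - (cos (- (b + a)) + sin (- (b + a)))) / 2" for a b :: real
      unfolding cos_minus sin_minus by (simp add: cos_add sin_add cos_diff sin_diff algebra_simps)
    have "hartley L m x * sin (2 * pi / L * x $ i)
        = ((cos (wavevec L m \<bullet> x) + sin (wavevec L m \<bullet> x)) * sin (2 * pi / L * x $ i)) / sqrt (L ^ CARD('a))"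
      by (simp add: hartley_def)
    moreover have "hartley L (axis i 1 - m) x
        = (cos (2 * pi / L * x $ i - wavevec L m \<bullet> x) + sin (2 * pi / L * x $ i - wavevec L m \<bullet> x)) / sqrt (L ^ CARD('a))"
      "hartley L (- (axis i 1 + m)) x
        = (cos (- (2 * pi / L * x $ i + wavevec L m \<bullet> x)) + sin (- (2 * pi / L * x $ i + wavevec L m \<bullet> x))) / sqrt (L ^ CARD('a))"
      unfolding hartley_def wavevec_minus inner_minus_left wavevec_add wavevec_diff
        inner_add_left inner_diff_left wavevec_axis by (rule refl)+
    moreover have "(X - Y) / 2 / s = (X / s + - 1 * (Y / s)) / 2" for X Y s :: real
      by (simp add: diff_divide_distrib)
    ultimately show ?thesis unfolding trig by (simp only:)
  qed
qed (use assms in \<open>auto intro!: continuous_intros\<close>)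

text \<open>The function \<open>w\<close> is generalised in the induction because a product of
  polynomials is handled by multiplying with one factor after the other.\<close>

lemma annihilated_torus_polynomial:
  fixes P :: "(real^'n) \<times> (real^'n) \<Rightarrow> real"
  assumes "L > 0" "real_polynomial_function P" "annihilated L w"
  shows "annihilated L (\<lambda>x. P (torus_map L x) * w x)"
  using assms(2,3)
proof (induction P arbitrary: w rule: real_polynomial_function.induct)
  case (linear F)
  have lin: "linear F" using linear(1) by (rule bounded_linear.linear)
  have "F (torus_map L x) = (\<Sum>i\<in>UNIV. cos (2 * pi / L * x $ i) * F (axis i 1, 0) + sin (2 * pi / L * x $ i) * F (0, axis i 1))" for x
  proof -
    have "torus_map L x = (\<Sum>i\<in>UNIV. cos (2 * pi / L * x $ i) *\<^sub>R (axis i 1, 0) + sin (2 * pi / L * x $ i) *\<^sub>R (0, axis i 1))"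
      by (simp add: torus_map_def prod_eq_iff fst_sum snd_sum vec_eq_iff axis_def if_distrib sum.delta cong: if_cong)
    then show ?thesis by (simp only: linear_sum[OF lin] linear_add[OF lin] linear_scale[OF lin] real_scaleR_def)
  qed
  moreover have "annihilated L (\<lambda>x. \<Sum>i\<in>A. F (axis i 1, 0) * (cos (2 * pi / L * x $ i) * w x) + F (0, axis i 1) * (sin (2 * pi / L * x $ i) * w x))"
    if "finite A" for A
    using that
  proof (induction A rule: finite_induct)
    case empty
    then show ?case using annihilated_cmult[OF linear(2), of 0] by simp
  next
    case (insert i A)
    then show ?case
      unfolding sum.insert[OF insert.hyps(1,2)]
      by (intro annihilated_add annihilated_cmult annihilated_cos annihilated_sin assms linear)
  qed
  ultimately show ?case by (simp add: sum_distrib_left algebra_simps)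
next
  case (const c)
  then show ?case by (rule annihilated_cmult)
next
  case (add f g)
  then show ?case
    unfolding distrib_right by (intro annihilated_add[OF assms(1)]) auto
next
  case (mult f g)
  then show ?case by (simp add: mult.assoc)
qed

lemma integral_annihilated:
  fixes w :: "real^'n \<Rightarrow> real"
  assumes "L > 0" "annihilated L w"
  shows "(LINT x|lebesgue_on (cell L). w x) = 0"
proof -
  have "fcoef L 0 w = (LINT x|lebesgue_on (cell L). w x) / sqrt (L ^ CARD('n))"
    by (simp add: fcoef_def hartley_def)
  moreover have "sqrt (L ^ CARD('n)) \<noteq> 0" using assms(1) by simp
  ultimately show ?thesis using assms(2) by (simp add: annihilated_def)
qed

lemma continuous_on_torus_map: "continuous_on S (torus_map L)"
  unfolding torus_map_def divide_inverse by (intro continuous_intros)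

text \<open>\<open>G\<close> is uniformly close to a polynomial on the compact image of the closed
  box, so the integral is bounded by an arbitrarily small multiple of the L1 norm of
  \<open>w\<close>.\<close>

lemma integral_annihilated_torus_continuous:
  fixes w :: "real^'n \<Rightarrow> real"
  assumes "L > 0" "annihilated L w" "continuous_on UNIV G"
  shows "(LINT x|lebesgue_on (cell L). G (torus_map L x) * w x) = 0"
proof -
  let ?D = "lebesgue_on (cell L :: (real^'n) set)"
  let ?K = "torus_map L ` cbox (0::real^'n) (\<chi> i. L)"
  have K: "compact ?K" by (intro compact_continuous_image continuous_on_torus_map compact_cbox)
  have w: "integrable ?D w" using assms(2) by (simp add: annihilated_def)
  have mem: "torus_map L x \<in> ?K" if "x \<in> cell L" for x
    using that by (auto simp: mem_cell mem_box_cart intro!: imageI less_imp_le)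
  have bound: "\<bar>LINT x|?D. G (torus_map L x) * w x\<bar> \<le> e * (LINT x|?D. \<bar>w x\<bar>)" if "e > 0" for e
  proof -
    obtain P where P: "real_polynomial_function P" "\<And>y. y \<in> ?K \<Longrightarrow> \<bar>G y - P y\<bar> < e"
      using Stone_Weierstrass_real_polynomial_function[OF K continuous_on_subset[OF assms(3)] \<open>e > 0\<close>] by blast
    have contP: "continuous_on UNIV P" using P(1) by (simp add: continuous_on_polymonial_function real_polynomial_function_eq)
    have Pw: "annihilated L (\<lambda>x. P (torus_map L x) * w x)"
      using annihilated_torus_polynomial[OF assms(1) P(1) assms(2)] .
    then have intP: "integrable ?D (\<lambda>x. P (torus_map L x) * w x)" by (simp add: annihilated_def)
    have "(\<lambda>x. G (torus_map L x) - P (torus_map L x)) \<in> borel_measurable borel"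
      by (intro borel_measurable_continuous_onI continuous_intros continuous_on_compose2[OF assms(3) continuous_on_torus_map]
          continuous_on_compose2[OF contP continuous_on_torus_map]) auto
    then have m: "(\<lambda>x. G (torus_map L x) - P (torus_map L x)) \<in> borel_measurable ?D"
      by (intro measurable_restrict_space1 measurable_completion) simp
    have d: "integrable ?D (\<lambda>x. (G (torus_map L x) - P (torus_map L x)) *\<^sub>R w x)"
      by (rule integrable_bounded_scaleR[OF w m, of e])
        (auto simp: space_restrict_space intro!: less_imp_le[OF P(2)] mem)
    have "(\<lambda>x. G (torus_map L x) * w x)
        = (\<lambda>x. (G (torus_map L x) - P (torus_map L x)) * w x + P (torus_map L x) * w x)"
      by (simp add: algebra_simps)
    then have "(LINT x|?D. G (torus_map L x) * w x)
        = (LINT x|?D. (G (torus_map L x) - P (torus_map L x)) * w x)"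
      using d intP integral_annihilated[OF assms(1) Pw] by simp
    also have "\<bar>\<dots>\<bar> \<le> (LINT x|?D. \<bar>(G (torus_map L x) - P (torus_map L x)) * w x\<bar>)"
      using integral_norm_bound[of ?D "\<lambda>x. (G (torus_map L x) - P (torus_map L x)) * w x"] by simp
    also have "\<dots> \<le> (LINT x|?D. e * \<bar>w x\<bar>)"
    proof (rule integral_mono)
      show "integrable ?D (\<lambda>x. \<bar>(G (torus_map L x) - P (torus_map L x)) * w x\<bar>)" "integrable ?D (\<lambda>x. e * \<bar>w x\<bar>)"
        using d w by auto
      fix x assume "x \<in> space ?D"
      then have "\<bar>G (torus_map L x) - P (torus_map L x)\<bar> \<le> e"
        by (intro less_imp_le[OF P(2)] mem) (simp add: space_restrict_space)
      then show "\<bar>(G (torus_map L x) - P (torus_map L x)) * w x\<bar> \<le> e * \<bar>w x\<bar>"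
        unfolding abs_mult by (rule mult_right_mono) simp
    qed
    finally show ?thesis by simp
  qed
  have "\<bar>LINT x|?D. G (torus_map L x) * w x\<bar> \<le> 0 + e" if "e > 0" for e
  proof -
    \<comment> \<open>Division by \<open>W + 1\<close> instead of \<open>W\<close> covers the case
      in which the L1 norm is zero.\<close>
    define W where "W = (LINT x|?D. \<bar>w x\<bar>)"
    have W: "0 \<le> W" by (simp add: W_def)
    then have "e / (W + 1) > 0" using that by (intro divide_pos_pos) auto
    from bound[OF this] have "\<bar>LINT x|?D. G (torus_map L x) * w x\<bar> \<le> e / (W + 1) * W"
      unfolding W_def .
    also have "\<dots> \<le> e" using W that by (simp add: field_simps)
    finally show ?thesis by simp
  qed
  then show ?thesis using field_le_epsilon[of _ 0] by force
qed

text \<open>Opposite faces of the closed box have the same image, so one of the two points has to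
  lie in the open cell: the coordinates then differ by a multiple of \<open>L\<close> that is
  smaller than \<open>L\<close> in absolute value.\<close>

lemma torus_map_inj:
  assumes "L > 0" "x \<in> cell L" "y \<in> cbox 0 (\<chi> i. L)" "torus_map L x = torus_map L y"
  shows "x = y"
proof -
  have "x $ i = y $ i" for i
  proof -
    have "cos (2 * pi / L * x $ i) = cos (2 * pi / L * y $ i)" "sin (2 * pi / L * x $ i) = sin (2 * pi / L * y $ i)"
      using assms(4) by (auto simp: torus_map_def vec_eq_iff)
    then obtain n :: int where n: "2 * pi / L * x $ i = 2 * pi / L * y $ i + 2 * pi * of_int n"
      using sin_cos_eq_iff by (metis mult.commute mult.assoc)
    then have "2 * pi / L * x $ i = 2 * pi / L * (y $ i + L * of_int n)"
      using assms(1) by (simp add: distrib_left)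
    then have eq: "x $ i = y $ i + L * of_int n"
      using assms(1) by (subst (asm) mult_left_cancel) auto
    have "0 < x $ i" "x $ i < L" "0 \<le> y $ i" "y $ i \<le> L"
      using assms(2,3) by (auto simp: mem_cell mem_box_cart)
    then have "L * of_int n < L * 1" "L * of_int n > L * (-1)" using eq by linarith+
    then have "real_of_int n < 1" "real_of_int n > -1" using assms(1) mult_less_cancel_left_pos by blast+
    then have "n = 0" by linarith
    with eq show ?thesis by simp
  qed
  then show ?thesis by (simp add: vec_eq_iff)
qed

lemma integral_annihilated_open:
  fixes w :: "real^'n \<Rightarrow> real"
  assumes "L > 0" "annihilated L w" "open U" "U \<subseteq> cell L"
  shows "(LINT x|lebesgue_on (cell L). indicator U x * w x) = 0"
proof -
  let ?D = "lebesgue_on (cell L :: (real^'n) set)"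
  let ?Q = "cbox (0::real^'n) (\<chi> i. L)"
  let ?C = "torus_map L ` (?Q - U)"
  have w: "integrable ?D w" using assms(2) by (simp add: annihilated_def)
  have C: "closed ?C" "?C \<noteq> {}"
  proof -
    have "compact (?Q - U)" by (rule compact_diff[OF compact_cbox assms(3)])
    then show "closed ?C" by (intro compact_imp_closed compact_continuous_image continuous_on_torus_map)
    have "(0::real^'n) \<in> ?Q" "(0::real^'n) \<notin> cell L" using assms(1) by (auto simp: mem_box_cart mem_cell)
    then show "?C \<noteq> {}" using assms(4) by blast
  qed
  \<comment> \<open>Continuous functions on the torus that increase to the indicator of
    \<open>U\<close>. By \<open>torus_map_inj\<close> a point of \<open>U\<close> has positive
    distance from the image of the complement, which is closed as the complement is taken in the
    closed box.\<close>
  define G where "G n y = min 1 (real n * infdist y ?C)" for n y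
  have cont: "continuous_on UNIV (G n)" for n
    unfolding G_def by (intro continuous_intros)
  have lim: "(\<lambda>n. G n (torus_map L x)) \<longlonglongrightarrow> indicator U x" if "x \<in> cell L" for x
  proof (cases "x \<in> U")
    case True
    have "torus_map L x \<notin> ?C" using torus_map_inj[OF assms(1) that] True by auto
    then have pos: "infdist (torus_map L x) ?C > 0"
      using in_closed_iff_infdist_zero[OF C] infdist_nonneg[of "torus_map L x" ?C] by (metis less_eq_real_def)
    obtain N where N: "1 \<le> real N * infdist (torus_map L x) ?C"
      using ex_less_of_nat_mult[OF pos, of 1] by (auto intro: less_imp_le)
    have "G n (torus_map L x) = 1" if "n \<ge> N" for n
    proof -
      have "real N * infdist (torus_map L x) ?C \<le> real n * infdist (torus_map L x) ?C"
        using that pos by (intro mult_right_mono) auto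
      then show ?thesis using N by (simp add: G_def)
    qed
    then have "eventually (\<lambda>n. G n (torus_map L x) = indicator U x) sequentially"
      using True by (auto simp: eventually_sequentially)
    then show ?thesis by (rule tendsto_eventually)
  next
    case False
    have "x \<in> ?Q" using that by (auto simp: mem_cell mem_box_cart intro: less_imp_le)
    then have "infdist (torus_map L x) ?C = 0" using False in_closed_iff_infdist_zero[OF C] by blast
    then show ?thesis using False by (simp add: G_def)
  qed
  have "(\<lambda>n. LINT x|?D. G n (torus_map L x) * w x) \<longlonglongrightarrow> (LINT x|?D. indicator U x * w x)"
  proof (rule integral_dominated_convergence[where w = "\<lambda>x. \<bar>w x\<bar>"])
    have "indicator U \<in> borel_measurable ?D"
      by (intro measurable_restrict_space1 measurable_completion) (use assms(3) in auto)
    then show "(\<lambda>x. indicator U x * w x) \<in> borel_measurable ?D"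
      using w by (intro borel_measurable_times) auto
    have "(\<lambda>x. G n (torus_map L x)) \<in> borel_measurable ?D" for n
      by (intro measurable_restrict_space1 measurable_completion)
        (simp add: borel_measurable_continuous_onI continuous_on_compose2[OF cont continuous_on_torus_map])
    then show "(\<lambda>x. G n (torus_map L x) * w x) \<in> borel_measurable ?D" for n
      using w by (intro borel_measurable_times) auto
    show "integrable ?D (\<lambda>x. \<bar>w x\<bar>)" using w by simp
    show "AE x in ?D. (\<lambda>n. G n (torus_map L x) * w x) \<longlonglongrightarrow> indicator U x * w x"
      using lim by (intro AE_I2 tendsto_mult tendsto_const) (auto simp: space_restrict_space)
    show "AE x in ?D. norm (G n (torus_map L x) * w x) \<le> \<bar>w x\<bar>" for n
    proof (intro AE_I2)
      fix x
      have "0 \<le> real n * infdist (torus_map L x) ?C" by (simp add: infdist_nonneg)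
      then have "\<bar>G n (torus_map L x)\<bar> \<le> 1" by (auto simp: G_def min_def)
      then show "norm (G n (torus_map L x) * w x) \<le> \<bar>w x\<bar>"
        using mult_right_mono[of "\<bar>G n (torus_map L x)\<bar>" 1 "\<bar>w x\<bar>"] by (simp add: abs_mult)
    qed
  qed
  moreover have "(LINT x|?D. G n (torus_map L x) * w x) = 0" for n
    by (rule integral_annihilated_torus_continuous[OF assms(1,2) cont])
  ultimately show ?thesis using LIMSEQ_unique[OF _ tendsto_const] by force
qed


lemma annihilated_uminus: "annihilated L w \<Longrightarrow> annihilated L (\<lambda>x. - w x)"
  using annihilated_cmult[of L w "-1"] by simp

text \<open>Up to a null set the positivity set of \<open>w\<close> is a countable intersection of
  open sets. Integrals of \<open>w\<close> over open sets vanish, so in the limit the positive part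
  of \<open>w\<close> has integral zero. Applied to \<open>- w\<close> as well, this gives
  completeness.\<close>

lemma annihilated_AE_nonpos:
  fixes w :: "real^'n \<Rightarrow> real"
  assumes "L > 0" "annihilated L w" and m: "w \<in> borel_measurable lebesgue"
  shows "AE x in lebesgue_on (cell L). w x \<le> 0"
proof -
  let ?D = "lebesgue_on (cell L :: (real^'n) set)"
  have w: "integrable ?D w" using assms(2) by (simp add: annihilated_def)
  define A where "A = {x. w x > 0} \<inter> cell L"
  have A: "A \<in> sets lebesgue"
    unfolding A_def using borel_measurable_less[OF borel_measurable_const[of 0] m] by auto
  obtain C T where C: "gdelta C" "T \<in> null_sets lebesgue" "A \<union> T = C"
    using lebesgue_set_almost_gdelta[OF A] by metis
  from C(1) obtain U :: "nat \<Rightarrow> (real^'n) set" where U: "\<And>n. open (U n)" "C = (\<Inter>n. U n)"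
    by (cases rule: gdelta.cases) blast
  \<comment> \<open>Finite intersections are still open and decrease to \<open>C\<close> within the
    cell, so their indicators converge pointwise.\<close>
  define V where "V n = (\<Inter>j\<le>n. U j) \<inter> cell L" for n
  have V: "open (V n)" "V n \<subseteq> cell L" for n
    using U(1) open_box by (auto simp: V_def cell_def)
  have lim: "(\<lambda>n. indicator (V n) x :: real) \<longlonglongrightarrow> indicator (C \<inter> cell L) x" for x
  proof (cases "x \<in> C \<inter> cell L")
    case True
    then have "x \<in> V n" for n by (auto simp: V_def U)
    then show ?thesis using True by simp
  next
    case False
    then consider "x \<notin> cell L" | N where "x \<notin> U N" by (auto simp: U)
    then have "\<exists>N. \<forall>n\<ge>N. x \<notin> V n" by cases (auto simp: V_def)
    then have "eventually (\<lambda>n. indicator (V n) x = indicator (C \<inter> cell L) x) sequentially"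
      using False by (auto simp: eventually_sequentially indicator_def)
    then show ?thesis by (rule tendsto_eventually)
  qed
  have meas: "(\<lambda>x. indicator S x * w x) \<in> borel_measurable ?D" if "S \<in> sets lebesgue" for S
    using that m by (intro measurable_restrict_space1 borel_measurable_times) auto
  have CL: "C \<inter> cell L \<in> sets lebesgue"
    using C(3) A C(2) by (metis cell_measurable(1) null_setsD2 sets.Int sets.Un)
  have "(\<lambda>n. LINT x|?D. indicator (V n) x * w x) \<longlonglongrightarrow> (LINT x|?D. indicator (C \<inter> cell L) x * w x)"
  proof (rule integral_dominated_convergence[where w = "\<lambda>x. \<bar>w x\<bar>"])
    show "AE x in ?D. (\<lambda>n. indicator (V n) x * w x) \<longlonglongrightarrow> indicator (C \<inter> cell L) x * w x"
      by (intro AE_I2 tendsto_mult tendsto_const lim)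
    show "AE x in ?D. norm (indicator (V n) x * w x) \<le> \<bar>w x\<bar>" for n
      by (intro AE_I2) (auto simp: indicator_def)
    show "(\<lambda>x. indicator (V n) x * w x) \<in> borel_measurable ?D" for n
      using V by (intro meas) auto
  qed (use w meas CL in auto)
  moreover have "(LINT x|?D. indicator (V n) x * w x) = 0" for n
    by (rule integral_annihilated_open[OF assms(1,2) V])
  ultimately have "(LINT x|?D. indicator (C \<inter> cell L) x * w x) = 0"
    using LIMSEQ_unique[OF _ tendsto_const] by force
  moreover have "AE x in ?D. indicator (C \<inter> cell L) x * w x = max 0 (w x)"
  proof -
    have "AE x in lebesgue. x \<in> cell L \<longrightarrow> indicator (C \<inter> cell L) x * w x = max 0 (w x)"
      using AE_not_in[OF C(2)]
    proof eventually_elim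
      case (elim x)
      then have "x \<in> C \<longleftrightarrow> x \<in> A" using C(3) by auto
      then show ?case by (auto simp: A_def indicator_def)
    qed
    then show ?thesis by (subst AE_restrict_space_iff) auto
  qed
  then have "(LINT x|?D. indicator (C \<inter> cell L) x * w x) = (LINT x|?D. max 0 (w x))"
    using w meas[OF CL] by (intro integral_cong_AE) auto
  ultimately have "(LINT x|?D. max 0 (w x)) = 0" by simp
  then have "AE x in ?D. max 0 (w x) = 0"
    using w by (subst (asm) integral_nonneg_eq_0_iff_AE) auto
  then show ?thesis by eventually_elim (auto simp: max_def split: if_splits)
qed

theorem fcoef_eq_0_imp_AE_0:
  fixes v :: "real^'n \<Rightarrow> 'b::euclidean_space"
  assumes "L > 0" "v \<in> L2per L" "\<And>m. fcoef L m v = 0"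
  shows "AE x in lebesgue_on (cell L). v x = 0"
proof -
  have "AE x in lebesgue_on (cell L). v x \<bullet> b = 0" for b
  proof -
    let ?w = "\<lambda>x. v x \<bullet> b"
    have w: "?w \<in> L2per L" by (rule L2per_inner[OF assms(2)])
    have "annihilated L ?w"
      using L2perD(5)[OF w] fcoef_inner[OF assms(1,2)] assms(3) by (simp add: annihilated_def)
    from annihilated_AE_nonpos[OF assms(1) this L2perD(2)[OF w]]
      annihilated_AE_nonpos[OF assms(1) annihilated_uminus[OF this]] L2perD(2)[OF w]
    have "AE x in lebesgue_on (cell L). ?w x \<le> 0" "AE x in lebesgue_on (cell L). - ?w x \<le> 0"
      by auto
    then show ?thesis by eventually_elim simp
  qed
  then have "AE x in lebesgue_on (cell L). \<forall>b\<in>Basis. v x \<bullet> b = 0"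
    by (intro AE_finite_allI) auto
  then show ?thesis by eventually_elim (simp add: euclidean_all_zero_iff)
qed

lemma fcoef_eq_imp_AE_eq:
  fixes v :: "real^'n \<Rightarrow> 'b::euclidean_space"
  assumes "L > 0" "v \<in> L2per L" "w \<in> L2per L" "\<And>m. fcoef L m v = fcoef L m w"
  shows "AE x in lebesgue_on (cell L). v x = w x"
  using fcoef_eq_0_imp_AE_0[OF assms(1) L2per_diff[OF assms(2,3)]] assms by (simp add: fcoef_diff)

subsection \<open>Riesz--Fischer and Parseval\<close>

text \<open>Partial sums run over boxes that are symmetric about the origin, so the reflection of
  modes caused by differentiation leaves the index set unchanged.\<close>

definition cube :: "nat \<Rightarrow> (int^'n) set" where
  "cube K = {m. \<forall>i. \<bar>m $ i\<bar> \<le> int K}"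

definition psum :: "real \<Rightarrow> nat \<Rightarrow> (int^'n \<Rightarrow> 'b::euclidean_space) \<Rightarrow> real^'n \<Rightarrow> 'b" where
  "psum L K a x = (\<Sum>m\<in>cube K. hartley L m x *\<^sub>R a m)"

lemma finite_cube [simp]: "finite (cube K :: (int^'n) set)"
proof (rule finite_subset)
  show "cube K \<subseteq> (\<lambda>f. \<chi> i. f i) ` PiE (UNIV :: 'n set) (\<lambda>_. {- int K..int K})"
  proof
    fix m :: "int^'n" assume m: "m \<in> cube K"
    then have "(\<lambda>i. m $ i) \<in> PiE (UNIV :: 'n set) (\<lambda>_. {- int K..int K})"
      by (auto simp: cube_def abs_le_iff minus_le_iff)
    moreover have "m = (\<chi> i. m $ i)" by (simp add: vec_eq_iff)
    ultimately show "m \<in> (\<lambda>f. \<chi> i. f i) ` PiE (UNIV :: 'n set) (\<lambda>_. {- int K..int K})" by blast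
  qed
qed (intro finite_imageI finite_PiE; simp)

lemma cube_mono: "J \<le> K \<Longrightarrow> cube J \<subseteq> (cube K :: (int^'n) set)"
proof
  fix m :: "int^'n" assume "J \<le> K" "m \<in> cube J"
  then have "int J \<le> int K" "\<And>i. \<bar>m $ i\<bar> \<le> int J" by (auto simp: cube_def)
  then show "m \<in> cube K" unfolding cube_def mem_Collect_eq by (meson order_trans)
qed

lemma uminus_mem_cube [simp]: "- m \<in> cube K \<longleftrightarrow> m \<in> cube K"
  by (simp add: cube_def)

lemma sum_cube_uminus: "(\<Sum>m\<in>cube K. f (- m)) = (\<Sum>m\<in>cube K. f m)"
  by (rule sum.reindex_bij_witness[of _ uminus uminus]) auto

lemma eventually_mem_cube: "\<exists>K0. \<forall>K\<ge>K0. (m :: int^'n) \<in> cube K"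
proof -
  have le: "x \<le> int (nat x)" for x by linarith
  have "\<bar>m $ i\<bar> \<le> (MAX i. \<bar>m $ i\<bar>)" for i
    by (rule Max_ge) auto
  then have "m \<in> cube (nat (MAX i. \<bar>m $ i\<bar>))"
    using order_trans[OF _ le] by (auto simp: cube_def)
  then show ?thesis using cube_mono by blast
qed

lemma psum_L2per: "L > 0 \<Longrightarrow> psum L K a \<in> L2per L"
  unfolding psum_def[abs_def] by (intro L2per_sum hartley_L2per)

lemma L2_ip_commute: "L2_ip L v w = L2_ip L w v"
  by (simp add: L2_ip_def inner_commute)

lemma L2_ip_sum_right:
  "v \<in> L2per L \<Longrightarrow> (\<And>i. i \<in> A \<Longrightarrow> w i \<in> L2per L) \<Longrightarrow> L2_ip L v (\<lambda>x. \<Sum>i\<in>A. w i x) = (\<Sum>i\<in>A. L2_ip L v (w i))"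
  unfolding L2_ip_def inner_sum_right
  by (rule Bochner_Integration.integral_sum) (auto intro: integrable_L2_inner)

lemma L2_ip_hartley_sum:
  assumes "L > 0" "v \<in> L2per L"
  shows "L2_ip L v (\<lambda>x. \<Sum>m\<in>A. hartley L m x *\<^sub>R a m) = (\<Sum>m\<in>A. fcoef L m v \<bullet> a m)"
  using assms by (simp add: L2_ip_sum_right hartley_L2per L2_ip_hartley)

lemma fcoef_hartley_sum:
  assumes "L > 0" "finite A"
  shows "fcoef L m (\<lambda>x. \<Sum>n\<in>A. hartley L n x *\<^sub>R a n) = (if m \<in> A then a m else 0)"
  using assms by (simp add: fcoef_sum hartley_L2per fcoef_hartley sum.delta)

lemma L2_nrm_hartley_sum:
  assumes "L > 0" "finite A"
  shows "(L2_nrm L (\<lambda>x. \<Sum>m\<in>A. hartley L m x *\<^sub>R a m))\<^sup>2 = (\<Sum>m\<in>A. (norm (a m))\<^sup>2)"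
proof -
  let ?v = "\<lambda>x. \<Sum>m\<in>A. hartley L m x *\<^sub>R a m"
  have v: "?v \<in> L2per L" using assms(1) by (intro L2per_sum hartley_L2per)
  have "(L2_nrm L ?v)\<^sup>2 = L2_ip L ?v ?v"
    unfolding L2_nrm_def by (simp add: L2_ip_def)
  also have "\<dots> = (\<Sum>m\<in>A. (norm (a m))\<^sup>2)"
    by (subst L2_ip_hartley_sum[OF assms(1) v]) (simp add: fcoef_hartley_sum[OF assms] power2_norm_eq_inner)
  finally show ?thesis .
qed

lemma L2_nrm_diff_power2:
  assumes "v \<in> L2per L" "w \<in> L2per L"
  shows "(L2_nrm L (\<lambda>x. v x - w x))\<^sup>2 = (L2_nrm L v)\<^sup>2 - 2 * L2_ip L v w + (L2_nrm L w)\<^sup>2"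
proof -
  note i = integrable_L2_inner[OF assms] L2perD(4)[OF assms(1)] L2perD(4)[OF assms(2)]
  have eq: "(norm (v x - w x))\<^sup>2 = (norm (v x))\<^sup>2 - 2 * (v x \<bullet> w x) + (norm (w x))\<^sup>2" for x
    by (simp add: power2_norm_eq_inner inner_diff_left inner_diff_right inner_commute)
  show ?thesis unfolding L2_nrm_power2 eq using i by (simp add: L2_ip_def)
qed

lemma L2_nrm_diff_psum:
  assumes "L > 0" "v \<in> L2per L"
  shows "(L2_nrm L (\<lambda>x. v x - psum L K (\<lambda>m. fcoef L m v) x))\<^sup>2
    = (L2_nrm L v)\<^sup>2 - (\<Sum>m\<in>cube K. (norm (fcoef L m v))\<^sup>2)"
  using L2_nrm_diff_power2[OF assms(2) psum_L2per[OF assms(1)], of K "\<lambda>m. fcoef L m v"]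
  by (simp add: psum_def[abs_def] L2_nrm_hartley_sum[OF assms(1)] L2_ip_hartley_sum[OF assms] power2_norm_eq_inner)

lemma Bessel:
  assumes "L > 0" "v \<in> L2per L"
  shows "(\<Sum>m\<in>cube K. (norm (fcoef L m v))\<^sup>2) \<le> (L2_nrm L v)\<^sup>2"
  using L2_nrm_diff_psum[OF assms, of K] zero_le_power2[of "L2_nrm L (\<lambda>x. v x - psum L K (\<lambda>m. fcoef L m v) x)"]
  by linarith

lemma norm_fcoef_le:
  assumes "L > 0" "v \<in> L2per L"
  shows "norm (fcoef L m v) \<le> L2_nrm L v"
proof -
  obtain K where "m \<in> cube K" using eventually_mem_cube by blast
  then have "(norm (fcoef L m v))\<^sup>2 \<le> (\<Sum>m\<in>cube K. (norm (fcoef L m v))\<^sup>2)"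
    by (intro member_le_sum) auto
  also have "\<dots> \<le> (L2_nrm L v)\<^sup>2" by (rule Bessel[OF assms])
  finally show ?thesis by (rule power2_le_imp_le) simp
qed

text \<open>\<open>L2per\<close> is a set of functions and not a complete space, so the limit is
  constructed pointwise: the partial sums are Cauchy in L2, hence in L1 of the cell, a subsequence
  converges almost everywhere, and Fatou's lemma brings the limit back to L2.\<close>

theorem Riesz_Fischer:
  fixes a :: "int^'n \<Rightarrow> 'b::euclidean_space"
  assumes L: "L > 0" and bound: "\<And>K. (\<Sum>m\<in>cube K. (norm (a m))\<^sup>2) \<le> C"
  obtains g where "g \<in> L2per L" "\<And>m. fcoef L m g = a m"
    "(\<lambda>K. L2_nrm L (\<lambda>x. g x - psum L K a x)) \<longlonglongrightarrow> 0"
proof -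
  let ?D = "lebesgue_on (cell L :: (real^'n) set)"
  interpret finite_measure ?D by (rule finite_measure_cell)
  define s where "s K = (\<Sum>m\<in>cube K. (norm (a m))\<^sup>2)" for K
  have "incseq s" unfolding s_def incseq_def by (auto intro!: sum_mono2 dest: cube_mono)
  then obtain S where S: "s \<longlonglongrightarrow> S" "\<And>K. s K \<le> S"
    using incseq_convergent[of s C] bound by (auto simp: s_def)
  have P: "psum L K a \<in> L2per L" for K by (rule psum_L2per[OF L])
  have diff_eq: "psum L K a x - psum L J a x = (\<Sum>m\<in>cube K - cube J. hartley L m x *\<^sub>R a m)" if "J \<le> K" for J K x
    unfolding psum_def by (rule sum_diff[symmetric, OF finite_cube cube_mono[OF that]])
  have n1: "(L2_nrm L (\<lambda>x. psum L K a x - psum L J a x))\<^sup>2 = s K - s J" if "J \<le> K" for J K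
    unfolding diff_eq[OF that] by (subst L2_nrm_hartley_sum[OF L]) (auto simp: s_def sum_diff[OF finite_cube cube_mono[OF that]])
  have n2: "(L2_nrm L (\<lambda>x. psum L K a x - psum L J a x))\<^sup>2 \<le> S - s (min J K)" for J K
  proof (cases "J \<le> K")
    case True
    then show ?thesis using n1[OF True] S(2)[of K] by (simp add: min_def)
  next
    case False
    then have "(L2_nrm L (\<lambda>x. psum L K a x - psum L J a x))\<^sup>2 = s J - s K"
      using n1[of K J] by (simp add: L2_nrm_power2 norm_minus_commute)
    then show ?thesis using S(2)[of J] False by (simp add: min_def)
  qed
  have cauchy: "\<exists>N. \<forall>i\<ge>N. \<forall>j\<ge>N. (LINT x|?D. norm (psum L i a x - psum L j a x)) < e" if "e > 0" for e
  proof -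
    define \<mu> where "\<mu> = measure ?D (space ?D)"
    \<comment> \<open>With \<open>|d| \<le> \<delta> + |d|^2 / \<delta>\<close> the L1 distance
      splits into a part controlled by the measure of the cell and one controlled by the L2
      distance; \<open>\<delta>\<close> makes the first at most \<open>e / 2\<close>.\<close>
    define \<delta> where "\<delta> = e / (2 * (\<mu> + 1))"
    have \<mu>: "\<mu> \<ge> 0" by (simp add: \<mu>_def)
    then have \<delta>: "\<delta> > 0" using that by (auto simp: \<delta>_def intro!: divide_pos_pos)
    then have "S - \<delta> * (e / 2) < S" using that by simp
    then have "eventually (\<lambda>n. S - \<delta> * (e / 2) < s n) sequentially" by (rule order_tendstoD(1)[OF S(1)])
    then obtain N where "\<forall>n\<ge>N. S - \<delta> * (e / 2) < s n"
      unfolding eventually_sequentially by blast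
    then have N: "S - s n < \<delta> * (e / 2)" if "n \<ge> N" for n
      using that less_diff_eq[of "S - s n" 0] by (auto simp: algebra_simps dest!: spec[of _ n])
    have "(LINT x|?D. norm (psum L i a x - psum L j a x)) < e" if "i \<ge> N" "j \<ge> N" for i j
    proof -
      let ?d = "\<lambda>x. psum L i a x - psum L j a x"
      have d: "?d \<in> L2per L" by (intro L2per_diff P)
      have "(LINT x|?D. norm (?d x)) \<le> (LINT x|?D. \<delta> + (norm (?d x))\<^sup>2 / \<delta>)"
      proof (rule integral_mono)
        show "integrable ?D (\<lambda>x. norm (?d x))" using L2perD(5)[OF d] by simp
        show "integrable ?D (\<lambda>x. \<delta> + (norm (?d x))\<^sup>2 / \<delta>)" using L2perD(4)[OF d] by simp
        fix x
        have "norm (?d x) * \<delta> \<le> \<delta> * \<delta> + (norm (?d x))\<^sup>2"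
          using sum_squares_bound[of "norm (?d x)" \<delta>] mult_nonneg_nonneg[OF norm_ge_zero[of "?d x"] less_imp_le[OF \<delta>]]
          unfolding power2_eq_square by linarith
        then show "norm (?d x) \<le> \<delta> + (norm (?d x))\<^sup>2 / \<delta>" using \<delta> by (simp add: field_simps)
      qed
      also have "\<dots> = \<delta> * \<mu> + (L2_nrm L ?d)\<^sup>2 / \<delta>"
        using L2perD(4)[OF d] by (simp add: \<mu>_def L2_nrm_power2)
      also have "\<dots> < e / 2 + e / 2"
      proof (rule add_le_less_mono)
        show "\<delta> * \<mu> \<le> e / 2" using \<mu> \<open>e > 0\<close> by (simp add: \<delta>_def field_simps)
        have "(L2_nrm L ?d)\<^sup>2 < \<delta> * (e / 2)"
          using n2[of i j] N[of "min j i"] that by (simp add: min_def split: if_splits)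
        then show "(L2_nrm L ?d)\<^sup>2 / \<delta> < e / 2" using \<delta> by (simp add: field_simps)
      qed
      finally show ?thesis by simp
    qed
    then show ?thesis by blast
  qed
  obtain r where r: "strict_mono r" "AE x in ?D. Cauchy (\<lambda>i. psum L (r i) a x)"
    using cauchy_L1_AE_cauchy_subseq[of ?D "\<lambda>K. psum L K a", OF L2perD(5)[OF P] cauchy] by blast
  \<comment> \<open>Taking \<open>lim\<close> at every point keeps \<open>g\<close> exactly
    periodic: where the sequence diverges, the default value is the same at all translates.\<close>
  define g where "g x = lim (\<lambda>i. psum L (r i) a x)" for x
  have gm: "g \<in> borel_measurable lebesgue"
    unfolding g_def by (rule borel_measurable_lim_metric) (rule L2perD(2)[OF P])
  then have gmD: "g \<in> borel_measurable ?D" by (rule measurable_restrict_space1)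
  have gp: "periodic L g" using L2perD(1)[OF P] by (simp add: g_def periodic_def)
  have conv: "AE x in ?D. (\<lambda>i. psum L (r i) a x) \<longlonglongrightarrow> g x"
    using r(2) by eventually_elim (simp add: g_def Cauchy_convergent_iff convergent_LIMSEQ_iff)
  \<comment> \<open>This estimate gives both square integrability of \<open>g\<close> and
    convergence of the full sequence of partial sums.\<close>
  have fatou: "(\<integral>\<^sup>+x. ennreal ((norm (g x - psum L J a x))\<^sup>2) \<partial>?D) \<le> ennreal (S - s J)" for J
  proof -
    have "(\<integral>\<^sup>+x. ennreal ((norm (g x - psum L J a x))\<^sup>2) \<partial>?D)
        = (\<integral>\<^sup>+x. liminf (\<lambda>i. ennreal ((norm (psum L (r i) a x - psum L J a x))\<^sup>2)) \<partial>?D)"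
    proof (rule nn_integral_cong_AE)
      show "AE x in ?D. ennreal ((norm (g x - psum L J a x))\<^sup>2) = liminf (\<lambda>i. ennreal ((norm (psum L (r i) a x - psum L J a x))\<^sup>2))"
        using conv
      proof eventually_elim
        case (elim x)
        then have "(\<lambda>i. ennreal ((norm (psum L (r i) a x - psum L J a x))\<^sup>2)) \<longlonglongrightarrow> ennreal ((norm (g x - psum L J a x))\<^sup>2)"
          by (intro tendsto_ennrealI tendsto_power tendsto_norm tendsto_diff tendsto_const)
        then show ?case by (metis lim_imp_Liminf trivial_limit_sequentially)
      qed
    qed
    also have "\<dots> \<le> liminf (\<lambda>i. \<integral>\<^sup>+x. ennreal ((norm (psum L (r i) a x - psum L J a x))\<^sup>2) \<partial>?D)"
      by (rule nn_integral_liminf) (use L2perD(3)[OF P] in measurable)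
    also have "\<dots> \<le> ennreal (S - s J)"
    proof (rule Liminf_le)
      have "(\<integral>\<^sup>+x. ennreal ((norm (psum L (r i) a x - psum L J a x))\<^sup>2) \<partial>?D) \<le> ennreal (S - s J)" if "i \<ge> J" for i
      proof -
        have "J \<le> r i" using that seq_suble[OF r(1), of i] by linarith
        have "(\<integral>\<^sup>+x. ennreal ((norm (psum L (r i) a x - psum L J a x))\<^sup>2) \<partial>?D)
          = ennreal ((L2_nrm L (\<lambda>x. psum L (r i) a x - psum L J a x))\<^sup>2)"
          unfolding L2_nrm_power2 by (rule nn_integral_eq_integral) (auto intro!: L2perD(4) L2per_diff P)
        then show ?thesis using n1[OF \<open>J \<le> r i\<close>] S(2)[of "r i"] by (auto intro!: ennreal_leI)
      qed
      then show "eventually (\<lambda>i. (\<integral>\<^sup>+x. ennreal ((norm (psum L (r i) a x - psum L J a x))\<^sup>2) \<partial>?D) \<le> ennreal (S - s J)) sequentially"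
        by (auto simp: eventually_sequentially)
    qed simp
    finally show ?thesis .
  qed
  have diff: "(\<lambda>x. g x - psum L J a x) \<in> L2per L" for J
  proof -
    have "integrable ?D (\<lambda>x. (norm (g x - psum L J a x))\<^sup>2)"
      by (rule integrableI_bounded) (use gmD L2perD(3)[OF P] fatou[of J] in \<open>auto simp: ennreal_less_top intro: le_less_trans\<close>)
    then show ?thesis
      using gm gp L2perD(1,2)[OF P] by (auto simp: L2per_def periodic_def)
  qed
  have g: "g \<in> L2per L" using L2per_add[OF diff[of 0] P[of 0]] by simp
  have nrm: "(L2_nrm L (\<lambda>x. g x - psum L J a x))\<^sup>2 \<le> S - s J" for J
  proof -
    have "ennreal ((L2_nrm L (\<lambda>x. g x - psum L J a x))\<^sup>2) = (\<integral>\<^sup>+x. ennreal ((norm (g x - psum L J a x))\<^sup>2) \<partial>?D)"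
      unfolding L2_nrm_power2 by (rule nn_integral_eq_integral[symmetric]) (auto intro: L2perD diff)
    then have "ennreal ((L2_nrm L (\<lambda>x. g x - psum L J a x))\<^sup>2) \<le> ennreal (S - s J)"
      using fatou[of J] by (simp only:)
    then show ?thesis using S(2)[of J] by (subst (asm) ennreal_le_iff) auto
  qed
  have lim: "(\<lambda>K. L2_nrm L (\<lambda>x. g x - psum L K a x)) \<longlonglongrightarrow> 0"
  proof -
    have "(\<lambda>K. S - s K) \<longlonglongrightarrow> 0" using tendsto_diff[OF tendsto_const S(1), of S] by simp
    then have "(\<lambda>K. (L2_nrm L (\<lambda>x. g x - psum L K a x))\<^sup>2) \<longlonglongrightarrow> 0"
      by (rule tendsto_sandwich[OF _ _ tendsto_const, rotated 2]) (auto intro!: always_eventually nrm)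
    then have "(\<lambda>K. sqrt ((L2_nrm L (\<lambda>x. g x - psum L K a x))\<^sup>2)) \<longlonglongrightarrow> sqrt 0"
      by (rule tendsto_real_sqrt)
    then show ?thesis by simp
  qed
  have "fcoef L m g = a m" for m
  proof -
    obtain K0 where K0: "\<And>K. K \<ge> K0 \<Longrightarrow> m \<in> cube K" using eventually_mem_cube by blast
    have "norm (fcoef L m g - a m) \<le> L2_nrm L (\<lambda>x. g x - psum L K a x)" if "K \<ge> K0" for K
      using norm_fcoef_le[OF L diff[of K], of m] K0[OF that]
      by (simp add: fcoef_diff[OF L g P]) (simp add: psum_def[abs_def] fcoef_hartley_sum[OF L])
    then have "norm (fcoef L m g - a m) \<le> 0"
      by (intro LIMSEQ_le_const[OF lim]) auto
    then show ?thesis by simp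
  qed
  then show ?thesis using that g lim by blast
qed

text \<open>Riesz--Fischer yields a function with the coefficients of \<open>v\<close> to which the
  partial sums converge; by completeness it equals \<open>v\<close> almost everywhere.\<close>

lemma psum_fcoef_tendsto:
  fixes v :: "real^'n \<Rightarrow> 'b::euclidean_space"
  assumes "L > 0" "v \<in> L2per L"
  shows "(\<lambda>K. L2_nrm L (\<lambda>x. v x - psum L K (\<lambda>m. fcoef L m v) x)) \<longlonglongrightarrow> 0"
proof -
  obtain g :: "real^'n \<Rightarrow> 'b" where g: "g \<in> L2per L" "\<And>m. fcoef L m g = fcoef L m v"
    "(\<lambda>K. L2_nrm L (\<lambda>x. g x - psum L K (\<lambda>m. fcoef L m v) x)) \<longlonglongrightarrow> 0"
    by (rule Riesz_Fischer[OF assms(1) Bessel[OF assms]]) (rule that)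
  have "L2_nrm L (\<lambda>x. v x - psum L K (\<lambda>m. fcoef L m v) x) = L2_nrm L (\<lambda>x. g x - psum L K (\<lambda>m. fcoef L m v) x)" for K
    using fcoef_eq_imp_AE_eq[OF assms(1,2) g(1) g(2)[symmetric]]
    by (intro L2_nrm_cong_AE L2per_diff assms g psum_L2per) (auto elim: eventually_mono)
  then show ?thesis using g(3) by simp
qed

text \<open>Links finite sums over cubes with the counting integral over the lattice, in which all
  later estimates are written because it is defined without any summability assumption.\<close>

lemma sum_cube_tendsto_nn_integral:
  fixes f :: "int^'n \<Rightarrow> ennreal"
  shows "(\<lambda>K. \<Sum>m\<in>cube K. f m) \<longlonglongrightarrow> (\<integral>\<^sup>+m. f m \<partial>count_space UNIV)"
proof -
  have "(\<lambda>K. \<integral>\<^sup>+m. f m * indicator (cube K) m \<partial>count_space UNIV) \<longlonglongrightarrow> (\<integral>\<^sup>+m. f m \<partial>count_space UNIV)"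
  proof (rule nn_integral_LIMSEQ)
    show "incseq (\<lambda>K m. f m * indicator (cube K) m)"
      using cube_mono by (auto simp: incseq_def le_fun_def indicator_def)
    show "(\<lambda>K. f m * indicator (cube K) m) \<longlonglongrightarrow> f m" for m
    proof -
      obtain K0 where "\<And>K. K \<ge> K0 \<Longrightarrow> m \<in> cube K" using eventually_mem_cube by blast
      then have "eventually (\<lambda>K. f m * indicator (cube K) m = f m) sequentially"
        by (intro eventually_sequentiallyI[of K0]) simp
      then show ?thesis by (rule tendsto_eventually)
    qed
  qed auto
  moreover have "(\<integral>\<^sup>+m. f m * indicator (cube K) m \<partial>count_space UNIV) = (\<Sum>m\<in>cube K. f m)" for K
    by (subst nn_integral_count_space'[of "cube K"]) (auto simp: indicator_def)
  ultimately show ?thesis by simp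
qed

theorem Parseval:
  assumes "L > 0" "v \<in> L2per L"
  shows "(\<integral>\<^sup>+m. ennreal ((norm (fcoef L m v))\<^sup>2) \<partial>count_space UNIV) = ennreal ((L2_nrm L v)\<^sup>2)"
proof -
  have "(\<lambda>K. (L2_nrm L v)\<^sup>2 - (L2_nrm L (\<lambda>x. v x - psum L K (\<lambda>m. fcoef L m v) x))\<^sup>2) \<longlonglongrightarrow> (L2_nrm L v)\<^sup>2 - 0\<^sup>2"
    by (intro tendsto_diff tendsto_const tendsto_power psum_fcoef_tendsto assms)
  then have "(\<lambda>K. \<Sum>m\<in>cube K. (norm (fcoef L m v))\<^sup>2) \<longlonglongrightarrow> (L2_nrm L v)\<^sup>2"
    by (simp add: L2_nrm_diff_psum[OF assms])
  then have "(\<lambda>K. \<Sum>m\<in>cube K. ennreal ((norm (fcoef L m v))\<^sup>2)) \<longlonglongrightarrow> ennreal ((L2_nrm L v)\<^sup>2)"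
    by (subst sum_ennreal) (auto intro: tendsto_ennrealI)
  then show ?thesis using sum_cube_tendsto_nn_integral LIMSEQ_unique by blast
qed

lemma L2per_of_coefs:
  fixes a :: "int^'n \<Rightarrow> 'b::euclidean_space"
  assumes "L > 0" "(\<integral>\<^sup>+m. ennreal ((norm (a m))\<^sup>2) \<partial>count_space UNIV) < \<infinity>"
  obtains g where "g \<in> L2per L" "\<And>m. fcoef L m g = a m"
proof -
  let ?I = "\<integral>\<^sup>+m. ennreal ((norm (a m))\<^sup>2) \<partial>count_space UNIV"
  have "(\<Sum>m\<in>cube K. (norm (a m))\<^sup>2) \<le> enn2real ?I" for K
  proof -
    have "ennreal (\<Sum>m\<in>cube K. (norm (a m))\<^sup>2) = (\<integral>\<^sup>+m. ennreal ((norm (a m))\<^sup>2) * indicator (cube K) m \<partial>count_space UNIV)"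
      by (subst nn_integral_count_space'[of "cube K"]) (auto simp: indicator_def)
    also have "\<dots> \<le> ?I" by (intro nn_integral_mono) (auto simp: indicator_def)
    also have "\<dots> = ennreal (enn2real ?I)" using assms(2) by simp
    finally show ?thesis by (simp add: ennreal_le_iff)
  qed
  from Riesz_Fischer[OF assms(1) this] that show ?thesis by metis
qed

section \<open>Sobolev spaces in terms of coefficients\<close>

text \<open>The bound \<open>|v| \<le> t + |v|^2 / t\<close>, integrated with \<open>t\<close> equal
  to the L2 norm, plays the role of the Cauchy--Schwarz inequality; the crude constant
  suffices.\<close>

lemma integral_norm_le_L2_nrm:
  fixes v :: "real^'n \<Rightarrow> 'b::euclidean_space"
  assumes "v \<in> L2per L"
  shows "(LINT x|lebesgue_on (cell L). norm (v x)) \<le> (measure (lebesgue_on (cell L :: (real^'n) set)) (space (lebesgue_on (cell L :: (real^'n) set))) + 1) * L2_nrm L v"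
proof (cases "L2_nrm L v = 0")
  case True
  then have "AE x in lebesgue_on (cell L). norm (v x) = 0"
    using L2_nrm_eq_0_iff[OF assms] by simp
  then have "(LINT x|lebesgue_on (cell L). norm (v x)) = 0"
    by (rule integral_eq_zero_AE)
  then show ?thesis using True by simp
next
  case False
  interpret finite_measure "lebesgue_on (cell L :: (real^'n) set)" by (rule finite_measure_cell)
  define t where "t = L2_nrm L v"
  have t: "t > 0" using False L2_nrm_nonneg[of L v] unfolding t_def by linarith
  have "(LINT x|lebesgue_on (cell L). norm (v x)) \<le> (LINT x|lebesgue_on (cell L). t + (norm (v x))\<^sup>2 / t)"
  proof (rule integral_mono)
    show "integrable (lebesgue_on (cell L)) (\<lambda>x. norm (v x))" using L2perD(5)[OF assms] by simp
    show "integrable (lebesgue_on (cell L)) (\<lambda>x. t + (norm (v x))\<^sup>2 / t)" using L2perD(4)[OF assms] by simp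
    fix x
    have "norm (v x) * t \<le> t * t + (norm (v x))\<^sup>2"
      using sum_squares_bound[of "norm (v x)" t] mult_nonneg_nonneg[OF norm_ge_zero[of "v x"] less_imp_le[OF t]]
      unfolding power2_eq_square by linarith
    then show "norm (v x) \<le> t + (norm (v x))\<^sup>2 / t" using t by (simp add: field_simps)
  qed
  also have "\<dots> = t * measure (lebesgue_on (cell L :: (real^'n) set)) (space (lebesgue_on (cell L :: (real^'n) set))) + t\<^sup>2 / t"
    using L2perD(4)[OF assms] by (simp add: t_def L2_nrm_power2)
  also have "t\<^sup>2 / t = t" using t by (simp add: power2_eq_square)
  finally show ?thesis by (simp add: t_def algebra_simps)
qed

text \<open>Pairing with a fixed test function is continuous for the L2 seminorm of the cell. This
  transfers identities from partial sums to arbitrary periodic functions.\<close>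

lemma test_integral_bound:
  fixes \<phi> :: "real^'n \<Rightarrow> real"
  assumes "L > 0" and \<phi>: "\<phi> \<in> test_functions"
  obtains C where "\<And>v :: real^'n \<Rightarrow> 'b::euclidean_space. v \<in> L2per L \<Longrightarrow>
    integrable lebesgue (\<lambda>x. \<phi> x *\<^sub>R v x) \<and> norm (LINT x|lebesgue. \<phi> x *\<^sub>R v x) \<le> C * L2_nrm L v"
proof -
  let ?D = "lebesgue_on (cell L :: (real^'n) set)"
  define \<mu> where "\<mu> = measure ?D (space ?D) + 1"
  obtain b where b: "b \<ge> 0" "\<And>x. \<bar>\<phi> x\<bar> \<le> b" using test_function_bounded[OF \<phi>] by blast
  obtain Z where Z: "finite Z" "\<And>x. \<phi> x \<noteq> 0 \<Longrightarrow> (\<lambda>i. \<lfloor>x $ i / L\<rfloor>) \<in> Z"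
    using finite_support_cells[OF assms(1) test_functionsD(3)[OF \<phi>]] by blast
  have "integrable lebesgue (\<lambda>x. \<phi> x *\<^sub>R v x) \<and> norm (LINT x|lebesgue. \<phi> x *\<^sub>R v x) \<le> (real (card Z) * b * \<mu>) * L2_nrm L v"
    if v: "v \<in> L2per L" for v :: "real^'n \<Rightarrow> 'b"
  proof -
    let ?I = "\<lambda>z. LINT x|?D. \<phi> (x + lattice_vec L z) *\<^sub>R v x"
    have hb: "has_bochner_integral lebesgue (\<lambda>x. \<phi> x *\<^sub>R v x) (\<Sum>z\<in>Z. ?I z)"
      by (rule has_bochner_integral_tiling[OF assms(1) L2perD(1,2,5)[OF v] test_function_integrable(2)[OF \<phi>] b(2) Z])
    have "norm (?I z) \<le> b * (\<mu> * L2_nrm L v)" for z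
    proof -
      have "(\<lambda>x. \<phi> (lattice_vec L z + x)) \<in> borel_measurable lebesgue"
        using measurable_compose[OF lebesgue_translation(1) test_function_integrable(2)[OF \<phi>]] .
      then have "(\<lambda>x. \<phi> (x + lattice_vec L z)) \<in> borel_measurable ?D"
        by (intro measurable_restrict_space1) (simp add: add.commute)
      then have i: "integrable ?D (\<lambda>x. \<phi> (x + lattice_vec L z) *\<^sub>R v x)"
        by (intro integrable_bounded_scaleR[where b = b] L2perD(5) v b)
      have "norm (?I z) \<le> (LINT x|?D. norm (\<phi> (x + lattice_vec L z) *\<^sub>R v x))"
        by (rule integral_norm_bound)
      also have "\<dots> \<le> (LINT x|?D. b * norm (v x))"
      proof (rule integral_mono[OF integrable_norm[OF i]])
        show "integrable ?D (\<lambda>x. b * norm (v x))" using L2perD(5)[OF v] by simp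
        show "norm (\<phi> (x + lattice_vec L z) *\<^sub>R v x) \<le> b * norm (v x)" for x
          using b(2)[of "x + lattice_vec L z"] by (simp add: mult_right_mono)
      qed
      also have "\<dots> \<le> b * (\<mu> * L2_nrm L v)"
        using mult_left_mono[OF integral_norm_le_L2_nrm[OF v] b(1)] by (simp add: \<mu>_def)
      finally show ?thesis .
    qed
    then have "norm (\<Sum>z\<in>Z. ?I z) \<le> real (card Z) * (b * (\<mu> * L2_nrm L v))"
      by (intro order_trans[OF norm_sum] sum_bounded_above)
    with hb show ?thesis by (simp add: has_bochner_integral_iff mult.assoc)
  qed
  then show ?thesis by (rule that)
qed

lemma test_function_hartley_integrable:
  "\<phi> \<in> test_functions \<Longrightarrow> integrable lebesgue (\<lambda>x. \<phi> x * hartley L m x)"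
  by (intro test_function_integrable test_functions_mult Ck_hartley)

lemma integral_test_psum:
  "\<phi> \<in> test_functions \<Longrightarrow> (LINT x|lebesgue. \<phi> x *\<^sub>R psum L K a x)
     = (\<Sum>m\<in>cube K. (LINT x|lebesgue. \<phi> x * hartley L m x) *\<^sub>R a m)"
proof -
  assume \<phi>: "\<phi> \<in> test_functions"
  have "(LINT x|lebesgue. \<phi> x *\<^sub>R psum L K a x) = (LINT x|lebesgue. (\<Sum>m\<in>cube K. (\<phi> x * hartley L m x) *\<^sub>R a m))"
    by (simp add: psum_def scaleR_sum_right)
  also have "\<dots> = (\<Sum>m\<in>cube K. (LINT x|lebesgue. (\<phi> x * hartley L m x) *\<^sub>R a m))"
    by (rule Bochner_Integration.integral_sum) (intro integrable_scaleR_left test_function_hartley_integrable \<phi>)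
  also have "\<dots> = (\<Sum>m\<in>cube K. (LINT x|lebesgue. \<phi> x * hartley L m x) *\<^sub>R a m)"
    by (intro sum.cong integral_scaleR_left test_function_hartley_integrable \<phi> refl)
  finally show ?thesis .
qed

lemma integral_test_psum_tendsto:
  fixes v :: "real^'n \<Rightarrow> 'b::euclidean_space"
  assumes "L > 0" "\<phi> \<in> test_functions" "v \<in> L2per L"
  shows "(\<lambda>K. LINT x|lebesgue. \<phi> x *\<^sub>R psum L K (\<lambda>m. fcoef L m v) x) \<longlonglongrightarrow> (LINT x|lebesgue. \<phi> x *\<^sub>R v x)"
proof -
  obtain C where C: "\<And>v :: real^'n \<Rightarrow> 'b. v \<in> L2per L \<Longrightarrow>
    integrable lebesgue (\<lambda>x. \<phi> x *\<^sub>R v x) \<and> norm (LINT x|lebesgue. \<phi> x *\<^sub>R v x) \<le> C * L2_nrm L v"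
    using test_integral_bound[OF assms(1,2)] by blast
  let ?S = "\<lambda>K. psum L K (\<lambda>m. fcoef L m v)"
  have "norm ((LINT x|lebesgue. \<phi> x *\<^sub>R ?S K x) - (LINT x|lebesgue. \<phi> x *\<^sub>R v x)) \<le> C * L2_nrm L (\<lambda>x. v x - ?S K x)" for K
  proof -
    have "(LINT x|lebesgue. \<phi> x *\<^sub>R v x) - (LINT x|lebesgue. \<phi> x *\<^sub>R ?S K x) = (LINT x|lebesgue. \<phi> x *\<^sub>R (v x - ?S K x))"
      using C[OF assms(3)] C[OF psum_L2per[OF assms(1)]] by (simp add: scaleR_diff_right)
    then show ?thesis
      unfolding norm_minus_commute[of "LINT x|lebesgue. \<phi> x *\<^sub>R ?S K x"]
      using C[OF L2per_diff[OF assms(3) psum_L2per[OF assms(1)]]] by simp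
  qed
  then have "eventually (\<lambda>K. norm ((LINT x|lebesgue. \<phi> x *\<^sub>R ?S K x) - (LINT x|lebesgue. \<phi> x *\<^sub>R v x)) \<le> C * L2_nrm L (\<lambda>x. v x - ?S K x)) sequentially"
    by (intro always_eventually allI)
  moreover have "(\<lambda>K. C * L2_nrm L (\<lambda>x. v x - ?S K x)) \<longlonglongrightarrow> C * 0"
    by (intro tendsto_mult tendsto_const psum_fcoef_tendsto assms)
  ultimately have "(\<lambda>K. (LINT x|lebesgue. \<phi> x *\<^sub>R ?S K x) - (LINT x|lebesgue. \<phi> x *\<^sub>R v x)) \<longlonglongrightarrow> 0"
    unfolding mult_zero_right by (rule Lim_null_comparison)
  then show ?thesis by (simp add: LIM_zero_iff)
qed

lemma integral_partial_deriv_hartley: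
  assumes "\<phi> \<in> test_functions"
  shows "(LINT x|lebesgue. partial_deriv i \<phi> x * hartley L m x)
    = - (wavevec L m $ i) * (LINT x|lebesgue. \<phi> x * hartley L (- m) x)"
proof -
  have "0 = (LINT x|lebesgue. partial_deriv i (\<lambda>x. \<phi> x * hartley L m x) x)"
    by (intro integral_partial_deriv_test_function[symmetric] test_functions_mult assms Ck_hartley)
  also have "\<dots> = (LINT x|lebesgue. wavevec L m $ i * (\<phi> x * hartley L (- m) x) + partial_deriv i \<phi> x * hartley L m x)"
    unfolding partial_deriv_mult_hartley[OF assms] by (simp add: algebra_simps)
  also have "\<dots> = wavevec L m $ i * (LINT x|lebesgue. \<phi> x * hartley L (- m) x) + (LINT x|lebesgue. partial_deriv i \<phi> x * hartley L m x)"
    using test_function_hartley_integrable[OF assms] test_function_hartley_integrable[OF partial_deriv_test_functions[OF assms]]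
    by simp
  finally show ?thesis by simp
qed

text \<open>Converse of \<open>fcoef_weak_derivative\<close>. For partial sums over a cube the
  identity is exact after reflecting the modes, and both sides pass to the limit by continuity of
  the pairing.\<close>

lemma is_wderivI_fcoef:
  fixes v g :: "real^'n \<Rightarrow> 'b::euclidean_space"
  assumes "L > 0" "v \<in> L2per L" "g \<in> L2per L"
    and coef: "\<And>m. fcoef L m g = - (wavevec L m $ i) *\<^sub>R fcoef L (- m) v"
  shows "is_wderiv i v g"
  unfolding is_wderiv_def
proof
  fix \<phi> :: "real^'n \<Rightarrow> real" assume \<phi>: "\<phi> \<in> test_functions"
  let ?p = "\<lambda>m. LINT x|lebesgue. \<phi> x * hartley L m x"
  have "(LINT x|lebesgue. \<phi> x *\<^sub>R psum L K (\<lambda>m. fcoef L m g) x)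
      = - (LINT x|lebesgue. partial_deriv i \<phi> x *\<^sub>R psum L K (\<lambda>m. fcoef L m v) x)" for K
  proof -
    have "(LINT x|lebesgue. \<phi> x *\<^sub>R psum L K (\<lambda>m. fcoef L m g) x)
        = (\<Sum>m\<in>cube K. ?p m *\<^sub>R (- (wavevec L m $ i) *\<^sub>R fcoef L (- m) v))"
      unfolding integral_test_psum[OF \<phi>] coef ..
    also have "\<dots> = (\<Sum>m\<in>cube K. ?p (- m) *\<^sub>R (- (wavevec L (- m) $ i) *\<^sub>R fcoef L (- (- m)) v))"
      by (rule sum_cube_uminus[symmetric])
    also have "\<dots> = (\<Sum>m\<in>cube K. (wavevec L m $ i * ?p (- m)) *\<^sub>R fcoef L m v)"
      by (simp add: mult.commute)
    also have "\<dots> = - (LINT x|lebesgue. partial_deriv i \<phi> x *\<^sub>R psum L K (\<lambda>m. fcoef L m v) x)"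
      unfolding integral_test_psum[OF partial_deriv_test_functions[OF \<phi>]] integral_partial_deriv_hartley[OF \<phi>]
      by (simp add: sum_negf)
    finally show ?thesis .
  qed
  then have "(\<lambda>K. - (LINT x|lebesgue. partial_deriv i \<phi> x *\<^sub>R psum L K (\<lambda>m. fcoef L m v) x))
      \<longlonglongrightarrow> (LINT x|lebesgue. \<phi> x *\<^sub>R g x)"
    using integral_test_psum_tendsto[OF assms(1) \<phi> assms(3)] by simp
  moreover have "(\<lambda>K. - (LINT x|lebesgue. partial_deriv i \<phi> x *\<^sub>R psum L K (\<lambda>m. fcoef L m v) x))
      \<longlonglongrightarrow> - (LINT x|lebesgue. partial_deriv i \<phi> x *\<^sub>R v x)"
    by (intro tendsto_minus integral_test_psum_tendsto partial_deriv_test_functions assms \<phi>)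
  ultimately show "(LINT x|lebesgue. \<phi> x *\<^sub>R g x) = - (LINT x|lebesgue. partial_deriv i \<phi> x *\<^sub>R v x)"
    by (rule LIMSEQ_unique)
qed

text \<open>Each partial sum is divergence-free mode by mode, and the distributional condition is
  stable under L2 limits.\<close>

lemma div_freeI_fcoef:
  fixes v :: "real^'n \<Rightarrow> real^'n"
  assumes "L > 0" "v \<in> L2per L" and coef: "\<And>m. wavevec L m \<bullet> fcoef L m v = 0"
  shows "div_free v"
  unfolding div_free_def
proof
  fix \<phi> :: "real^'n \<Rightarrow> real" assume \<phi>: "\<phi> \<in> test_functions"
  let ?S = "\<lambda>K. psum L K (\<lambda>m. fcoef L m v)"
  let ?d = "\<lambda>i w. (LINT x|lebesgue. partial_deriv i \<phi> x *\<^sub>R w x) \<bullet> axis i (1::real)"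
  let ?p = "\<lambda>m. LINT x|lebesgue. \<phi> x * hartley L m x"
  have int: "integrable lebesgue (\<lambda>x. partial_deriv i \<phi> x *\<^sub>R v x)" for i
  proof -
    obtain C where "\<And>v :: real^'n \<Rightarrow> real^'n. v \<in> L2per L \<Longrightarrow>
      integrable lebesgue (\<lambda>x. partial_deriv i \<phi> x *\<^sub>R v x) \<and> norm (LINT x|lebesgue. partial_deriv i \<phi> x *\<^sub>R v x) \<le> C * L2_nrm L v"
      using test_integral_bound[OF assms(1) partial_deriv_test_functions[OF \<phi>]] by blast
    then show ?thesis using assms(2) by blast
  qed
  have "(LINT x|lebesgue. v x \<bullet> (\<chi> i. partial_deriv i \<phi> x))
      = (LINT x|lebesgue. (\<Sum>i\<in>UNIV. (partial_deriv i \<phi> x *\<^sub>R v x) \<bullet> axis i 1))"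
    by (simp add: inner_vec_def[of "v _"] inner_axis mult.commute)
  also have "\<dots> = (\<Sum>i\<in>UNIV. (LINT x|lebesgue. (partial_deriv i \<phi> x *\<^sub>R v x) \<bullet> axis i 1))"
    using int by (intro Bochner_Integration.integral_sum integrable_inner_left) auto
  also have "\<dots> = (\<Sum>i\<in>UNIV. ?d i v)"
    using int by (intro sum.cong integral_inner_left refl) auto
  finally have eq: "(LINT x|lebesgue. v x \<bullet> (\<chi> i. partial_deriv i \<phi> x)) = (\<Sum>i\<in>UNIV. ?d i v)" .
  have "(\<lambda>K. \<Sum>i\<in>UNIV. ?d i (?S K)) \<longlonglongrightarrow> (\<Sum>i\<in>UNIV. ?d i v)"
    by (intro tendsto_sum tendsto_inner tendsto_const integral_test_psum_tendsto partial_deriv_test_functions assms \<phi>)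
  moreover have "(\<Sum>i\<in>UNIV. ?d i (?S K)) = 0" for K
  proof -
    have "(\<Sum>i\<in>UNIV. ?d i (?S K)) = (\<Sum>i\<in>UNIV. \<Sum>m\<in>cube K. - (wavevec L m $ i * fcoef L m v $ i) * ?p (- m))"
      unfolding integral_test_psum[OF partial_deriv_test_functions[OF \<phi>]] integral_partial_deriv_hartley[OF \<phi>]
      by (simp add: inner_sum_left inner_axis algebra_simps)
    also have "\<dots> = (\<Sum>m\<in>cube K. \<Sum>i\<in>UNIV. - (wavevec L m $ i * fcoef L m v $ i) * ?p (- m))"
      by (rule sum.swap)
    also have "\<dots> = (\<Sum>m\<in>cube K. - (wavevec L m \<bullet> fcoef L m v) * ?p (- m))"
      by (simp add: inner_vec_def sum_distrib_right sum_negf)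
    also have "\<dots> = 0" by (simp add: coef)
    finally show ?thesis .
  qed
  ultimately have "(\<Sum>i\<in>UNIV. ?d i v) = 0" using LIMSEQ_unique[OF _ tendsto_const] by force
  then show "(LINT x|lebesgue. v x \<bullet> (\<chi> i. partial_deriv i \<phi> x)) = 0" using eq by simp
qed

section \<open>Sobolev regularity and norms by Parseval\<close>

lemma Hper_L2per: "v \<in> Hper l L \<Longrightarrow> v \<in> L2per L"
  by (cases l) auto

lemma Hper_Suc_wderiv:
  assumes "v \<in> Hper (Suc l) L"
  shows "wderiv L i v \<in> L2per L" "is_wderiv i v (wderiv L i v)"
proof -
  obtain g where "g \<in> Hper l L" "is_wderiv i v g" using assms by auto
  then have "\<exists>g. g \<in> L2per L \<and> is_wderiv i v g" using Hper_L2per by blast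
  from someI_ex[OF this] show "wderiv L i v \<in> L2per L" "is_wderiv i v (wderiv L i v)"
    by (auto simp: wderiv_def)
qed

lemma fcoef_wderiv:
  assumes "L > 0" "v \<in> Hper (Suc l) L"
  shows "fcoef L m (wderiv L i v) = - (wavevec L m $ i) *\<^sub>R fcoef L (- m) v"
  using fcoef_weak_derivative[OF assms(1) Hper_L2per[OF assms(2)] Hper_Suc_wderiv[OF assms(2)]] .

abbreviation stokes_ev :: "real \<Rightarrow> int^'n \<Rightarrow> real" where
  "stokes_ev L m \<equiv> (norm (wavevec L m))\<^sup>2"

lemma stokes_ev_sum: "stokes_ev L m = (\<Sum>i\<in>UNIV. (wavevec L m $ i)\<^sup>2)"
  unfolding power2_norm_eq_inner by (simp add: inner_vec_def power2_eq_square)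

lemma nn_integral_uminus_mode:
  fixes f :: "int^'n \<Rightarrow> ennreal"
  shows "(\<integral>\<^sup>+m. f (- m) \<partial>count_space UNIV) = (\<integral>\<^sup>+m. f m \<partial>count_space UNIV)"
  by (rule nn_integral_bij_count_space) (auto intro!: bij_betw_byWitness[where f' = uminus])

lemma nn_integral_wderiv_coef:
  fixes v :: "real^'n \<Rightarrow> 'b::euclidean_space"
  shows "(\<integral>\<^sup>+m. ennreal ((norm (- (wavevec L m $ i) *\<^sub>R fcoef L (- m) v))\<^sup>2) \<partial>count_space UNIV)
    = (\<integral>\<^sup>+m. ennreal ((wavevec L m $ i)\<^sup>2 * (norm (fcoef L m v))\<^sup>2) \<partial>count_space UNIV)"
  using nn_integral_uminus_mode[of "\<lambda>m. ennreal ((wavevec L m $ i)\<^sup>2 * (norm (fcoef L m v))\<^sup>2)"]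
  by (simp add: power_mult_distrib)

text \<open>The derivative is produced by Riesz--Fischer and is known only through its coefficients;
  the last assumption therefore speaks of every function that has them. The rule serves the first
  and the second order alike.\<close>

lemma Hper_SucI:
  fixes v :: "real^'n \<Rightarrow> 'b::euclidean_space"
  assumes "L > 0" "v \<in> L2per L"
    "(\<integral>\<^sup>+m. ennreal (stokes_ev L m * (norm (fcoef L m v))\<^sup>2) \<partial>count_space UNIV) < \<infinity>"
    and "\<And>g i. g \<in> L2per L \<Longrightarrow> (\<And>m. fcoef L m g = - (wavevec L m $ i) *\<^sub>R fcoef L (- m) v) \<Longrightarrow> g \<in> Hper l L"
  shows "v \<in> Hper (Suc l) L"
proof -
  have "\<exists>g\<in>Hper l L. is_wderiv i v g" for i
  proof -
    have "(\<integral>\<^sup>+m. ennreal ((wavevec L m $ i)\<^sup>2 * (norm (fcoef L m v))\<^sup>2) \<partial>count_space UNIV)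
        \<le> (\<integral>\<^sup>+m. ennreal (stokes_ev L m * (norm (fcoef L m v))\<^sup>2) \<partial>count_space UNIV)"
      unfolding stokes_ev_sum
      by (intro nn_integral_mono ennreal_leI mult_right_mono member_le_sum) auto
    also note assms(3)
    finally have "(\<integral>\<^sup>+m. ennreal ((norm (- (wavevec L m $ i) *\<^sub>R fcoef L (- m) v))\<^sup>2) \<partial>count_space UNIV) < \<infinity>"
      unfolding nn_integral_wderiv_coef .
    from L2per_of_coefs[OF assms(1) this] obtain g
      where g: "g \<in> L2per L" "\<And>m. fcoef L m g = - (wavevec L m $ i) *\<^sub>R fcoef L (- m) v" by blast
    then show ?thesis using assms(4)[OF g] is_wderivI_fcoef[OF assms(1,2) g] by blast
  qed
  then show ?thesis using assms(2) by auto
qed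

lemma Hper_1I:
  assumes "L > 0" "v \<in> L2per L"
    "(\<integral>\<^sup>+m. ennreal (stokes_ev L m * (norm (fcoef L m v))\<^sup>2) \<partial>count_space UNIV) < \<infinity>"
  shows "v \<in> Hper 1 L"
  unfolding One_nat_def by (rule Hper_SucI[OF assms]) auto

lemma nn_integral_sum_wderiv:
  fixes v :: "real^'n \<Rightarrow> 'b::euclidean_space"
  assumes "L > 0" "v \<in> Hper (Suc l) L"
  shows "ennreal (\<Sum>i\<in>UNIV. (L2_nrm L (wderiv L i v))\<^sup>2)
    = (\<integral>\<^sup>+m. ennreal (stokes_ev L m * (norm (fcoef L m v))\<^sup>2) \<partial>count_space UNIV)"
proof -
  have "ennreal (\<Sum>i\<in>UNIV. (L2_nrm L (wderiv L i v))\<^sup>2) = (\<Sum>i\<in>UNIV. ennreal ((L2_nrm L (wderiv L i v))\<^sup>2))"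
    by simp
  also have "\<dots> = (\<Sum>i\<in>UNIV. \<integral>\<^sup>+m. ennreal ((wavevec L m $ i)\<^sup>2 * (norm (fcoef L m v))\<^sup>2) \<partial>count_space UNIV)"
    using Parseval[OF assms(1) Hper_Suc_wderiv(1)[OF assms(2)]]
    by (simp only: fcoef_wderiv[OF assms] nn_integral_wderiv_coef)
  also have "\<dots> = (\<integral>\<^sup>+m. (\<Sum>i\<in>UNIV. ennreal ((wavevec L m $ i)\<^sup>2 * (norm (fcoef L m v))\<^sup>2)) \<partial>count_space UNIV)"
    by (rule nn_integral_sum[symmetric]) auto
  also have "\<dots> = (\<integral>\<^sup>+m. ennreal (stokes_ev L m * (norm (fcoef L m v))\<^sup>2) \<partial>count_space UNIV)"
    by (simp add: stokes_ev_sum sum_distrib_right)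
  finally show ?thesis .
qed

lemma grad_nrm_power2:
  fixes v :: "real^'n \<Rightarrow> 'b::euclidean_space"
  shows "(grad_nrm L v)\<^sup>2 = (\<Sum>i\<in>UNIV. (L2_nrm L (wderiv L i v))\<^sup>2)"
proof -
  have "L2_ip L w w = (L2_nrm L w)\<^sup>2" for w :: "real^'n \<Rightarrow> 'b"
    by (simp add: L2_nrm_power2 L2_ip_def power2_norm_eq_inner)
  then show ?thesis by (simp add: grad_nrm_def grad_ip_def sum_nonneg)
qed

lemma Parseval_grad:
  assumes "L > 0" "v \<in> Hper 1 L"
  shows "ennreal ((grad_nrm L v)\<^sup>2)
    = (\<integral>\<^sup>+m. ennreal (stokes_ev L m * (norm (fcoef L m v))\<^sup>2) \<partial>count_space UNIV)"
  unfolding grad_nrm_power2 by (rule nn_integral_sum_wderiv[OF assms[unfolded One_nat_def]])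

lemma H_nrm_1_power2: "(H_nrm 1 L v)\<^sup>2 = (L2_nrm L v)\<^sup>2 + (grad_nrm L v)\<^sup>2"
  by (simp add: H_nrm_def grad_nrm_power2 sum_nonneg)

lemma Parseval_H1:
  assumes "L > 0" "v \<in> Hper 1 L"
  shows "ennreal ((H_nrm 1 L v)\<^sup>2)
    = (\<integral>\<^sup>+m. ennreal ((1 + stokes_ev L m) * (norm (fcoef L m v))\<^sup>2) \<partial>count_space UNIV)"
proof -
  have "ennreal ((H_nrm 1 L v)\<^sup>2) = ennreal ((L2_nrm L v)\<^sup>2) + ennreal ((grad_nrm L v)\<^sup>2)"
    unfolding H_nrm_1_power2 by simp
  then show ?thesis
    unfolding Parseval_grad[OF assms] Parseval[OF assms(1) Hper_L2per[OF assms(2)], symmetric]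
    by (simp add: nn_integral_add[symmetric] distrib_right)
qed

lemma Hper_2I:
  fixes v :: "real^'n \<Rightarrow> 'b::euclidean_space"
  assumes "L > 0" "v \<in> L2per L"
    and fin: "(\<integral>\<^sup>+m. ennreal ((stokes_ev L m)\<^sup>2 * (norm (fcoef L m v))\<^sup>2) \<partial>count_space UNIV) < \<infinity>"
  shows "v \<in> Hper 2 L"
proof -
  have "v \<in> Hper (Suc (Suc 0)) L"
  proof (rule Hper_SucI[OF assms(1,2)])
    have "(\<integral>\<^sup>+m. ennreal (stokes_ev L m * (norm (fcoef L m v))\<^sup>2) \<partial>count_space UNIV)
        \<le> (\<integral>\<^sup>+m. ennreal ((norm (fcoef L m v))\<^sup>2) + ennreal ((stokes_ev L m)\<^sup>2 * (norm (fcoef L m v))\<^sup>2) \<partial>count_space UNIV)"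
    proof (rule nn_integral_mono)
      fix m :: "int^'n"
      have "x \<le> 1 + x\<^sup>2" for x :: real using zero_le_power2[of "x - 1 / 2"] by (simp add: power2_eq_square algebra_simps)
      from this[of "stokes_ev L m"]
      have "stokes_ev L m * (norm (fcoef L m v))\<^sup>2 \<le> (1 + (stokes_ev L m)\<^sup>2) * (norm (fcoef L m v))\<^sup>2"
        by (rule mult_right_mono) simp
      from ennreal_leI[OF this]
      show "ennreal (stokes_ev L m * (norm (fcoef L m v))\<^sup>2)
          \<le> ennreal ((norm (fcoef L m v))\<^sup>2) + ennreal ((stokes_ev L m)\<^sup>2 * (norm (fcoef L m v))\<^sup>2)"
        by (simp add: distrib_right)
    qed
    also have "\<dots> < \<infinity>"
      using fin by (simp add: nn_integral_add Parseval[OF assms(1,2)])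
    finally show "(\<integral>\<^sup>+m. ennreal (stokes_ev L m * (norm (fcoef L m v))\<^sup>2) \<partial>count_space UNIV) < \<infinity>" .
  next
    fix g :: "real^'n \<Rightarrow> 'b" and i
    assume g: "g \<in> L2per L" "\<And>m. fcoef L m g = - (wavevec L m $ i) *\<^sub>R fcoef L (- m) v"
    have "g \<in> Hper 1 L"
    proof (rule Hper_1I[OF assms(1) g(1)])
      have "(\<integral>\<^sup>+m. ennreal (stokes_ev L m * (norm (fcoef L m g))\<^sup>2) \<partial>count_space UNIV)
          = (\<integral>\<^sup>+m. ennreal (stokes_ev L (- m) * ((wavevec L (- m) $ i)\<^sup>2 * (norm (fcoef L (- m) v))\<^sup>2)) \<partial>count_space UNIV)"
        by (simp add: g(2) power_mult_distrib)
      also have "\<dots> = (\<integral>\<^sup>+m. ennreal (stokes_ev L m * ((wavevec L m $ i)\<^sup>2 * (norm (fcoef L m v))\<^sup>2)) \<partial>count_space UNIV)"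
        by (rule nn_integral_uminus_mode)
      also have "\<dots> \<le> (\<integral>\<^sup>+m. ennreal ((stokes_ev L m)\<^sup>2 * (norm (fcoef L m v))\<^sup>2) \<partial>count_space UNIV)"
      proof (intro nn_integral_mono ennreal_leI)
        fix m :: "int^'n"
        have "(wavevec L m $ i)\<^sup>2 \<le> stokes_ev L m" unfolding stokes_ev_sum by (intro member_le_sum) auto
        then have "(wavevec L m $ i)\<^sup>2 * (norm (fcoef L m v))\<^sup>2 \<le> stokes_ev L m * (norm (fcoef L m v))\<^sup>2"
          by (intro mult_right_mono) auto
        from mult_left_mono[OF this, of "stokes_ev L m"]
        show "stokes_ev L m * ((wavevec L m $ i)\<^sup>2 * (norm (fcoef L m v))\<^sup>2) \<le> (stokes_ev L m)\<^sup>2 * (norm (fcoef L m v))\<^sup>2"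
          unfolding power2_eq_square[of "stokes_ev L m"] mult.assoc by simp
      qed
      finally show "(\<integral>\<^sup>+m. ennreal (stokes_ev L m * (norm (fcoef L m g))\<^sup>2) \<partial>count_space UNIV) < \<infinity>"
        using fin by (rule le_less_trans)
    qed
    then show "g \<in> Hper (Suc 0) L" by simp
  qed
  then show ?thesis by (simp only: numeral_2_eq_2)
qed

text \<open>The choice made by \<open>wderiv\<close> need not be the representative that witnesses
  membership in \<open>Hper 2 L\<close>. The two have the same coefficients, and these determine
  first-order regularity.\<close>

lemma wderiv_Hper_1:
  assumes "L > 0" "v \<in> Hper 2 L"
  shows "wderiv L i v \<in> Hper 1 L"
proof (rule Hper_1I[OF assms(1)])
  have v: "v \<in> Hper (Suc (Suc 0)) L" using assms(2) by (simp only: numeral_2_eq_2)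
  then show "wderiv L i v \<in> L2per L" by (rule Hper_Suc_wderiv)
  obtain g where g: "g \<in> Hper (Suc 0) L" "is_wderiv i v g"
    using v unfolding Hper.simps(2)[of "Suc 0"] by blast
  have "fcoef L m (wderiv L i v) = fcoef L m g" for m
    unfolding fcoef_wderiv[OF assms(1) v]
    by (rule fcoef_weak_derivative[OF assms(1) Hper_L2per[OF v] Hper_L2per[OF g(1)] g(2), symmetric])
  then show "(\<integral>\<^sup>+m. ennreal (stokes_ev L m * (norm (fcoef L m (wderiv L i v)))\<^sup>2) \<partial>count_space UNIV) < \<infinity>"
    by (simp only: nn_integral_sum_wderiv[OF assms(1) g(1), symmetric]) simp
qed

lemma laplacian_coef:
  fixes v :: "real^'n \<Rightarrow> real^'n"
  assumes "L > 0" "v \<in> Hper 2 L"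
  shows "laplacian L v \<in> L2per L" "fcoef L m (laplacian L v) = - stokes_ev L m *\<^sub>R fcoef L m v"
proof -
  have v: "v \<in> Hper (Suc (Suc 0)) L" using assms(2) by (simp only: numeral_2_eq_2)
  have w: "wderiv L i v \<in> Hper (Suc 0) L" for i using wderiv_Hper_1[OF assms] by simp
  show "laplacian L v \<in> L2per L"
    unfolding laplacian_def[abs_def] by (intro L2per_sum Hper_Suc_wderiv[OF w])
  have "fcoef L m (laplacian L v) = (\<Sum>i\<in>UNIV. fcoef L m (wderiv L i (wderiv L i v)))"
    unfolding laplacian_def[abs_def] by (intro fcoef_sum assms Hper_Suc_wderiv[OF w])
  also have "\<dots> = (\<Sum>i\<in>UNIV. - ((wavevec L m $ i)\<^sup>2) *\<^sub>R fcoef L m v)"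
    by (simp add: fcoef_wderiv[OF assms(1) w] fcoef_wderiv[OF assms(1) v] power2_eq_square)
  also have "\<dots> = - stokes_ev L m *\<^sub>R fcoef L m v"
    by (simp add: stokes_ev_sum scaleR_left.sum sum_negf)
  finally show "fcoef L m (laplacian L v) = - stokes_ev L m *\<^sub>R fcoef L m v" .
qed

lemma Vdiv_Hdiv: "Vdiv L \<subseteq> Hdiv L"
  using Hper_L2per by (auto simp: Vdiv_def Hdiv_def)

text \<open>On divergence-free fields the Laplacian is already divergence-free, so that the projection
  in the Stokes operator changes it only on a null set.\<close>

lemma Parseval_stokes:
  fixes v :: "real^'n \<Rightarrow> real^'n"
  assumes "L > 0" "v \<in> Vdiv L \<inter> Hper 2 L"
  shows "ennreal ((L2_nrm L (stokes L v))\<^sup>2)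
    = (\<integral>\<^sup>+m. ennreal ((stokes_ev L m)\<^sup>2 * (norm (fcoef L m v))\<^sup>2) \<partial>count_space UNIV)"
proof -
  let ?l = "laplacian L v" and ?s = "stokes L v"
  have v2: "v \<in> Hper 2 L" and vH: "v \<in> Hdiv L" using assms(2) Vdiv_Hdiv by auto
  note lc = laplacian_coef[OF assms(1) v2]
  have "div_free ?l"
    by (rule div_freeI_fcoef[OF assms(1) lc(1)]) (simp add: lc(2) fcoef_div_free[OF assms(1) vH])
  then have lH: "?l \<in> Hdiv L" using lc(1) by (simp add: Hdiv_def)
  have "\<exists>w. w \<in> Hdiv L \<and> (\<forall>z\<in>Hdiv L. L2_ip L (\<lambda>x. ?l x - w x) z = 0)"
    using lH by (intro exI[of _ ?l]) (simp add: L2_ip_def)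
  from someI_ex[OF this] have s: "?s \<in> Hdiv L" "\<And>z. z \<in> Hdiv L \<Longrightarrow> L2_ip L (\<lambda>x. ?l x - ?s x) z = 0"
    by (auto simp: stokes_def helmholtz_proj_def)
  have sL: "?s \<in> L2per L" using s(1) by (simp add: Hdiv_def)
  have dL: "(\<lambda>x. ?l x - ?s x) \<in> L2per L" by (intro L2per_diff lc sL)
  \<comment> \<open>As the difference is itself divergence-free, the orthogonality that defines the
    projection may be tested with it.\<close>
  have "div_free (\<lambda>x. ?l x - ?s x)"
    by (rule div_freeI_fcoef[OF assms(1) dL])
      (simp add: fcoef_diff[OF assms(1) lc(1) sL] inner_diff_right fcoef_div_free[OF assms(1) lH] fcoef_div_free[OF assms(1) s(1)])
  then have "L2_ip L (\<lambda>x. ?l x - ?s x) (\<lambda>x. ?l x - ?s x) = 0"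
    using s(2) dL by (simp add: Hdiv_def)
  then have "L2_nrm L (\<lambda>x. ?l x - ?s x) = 0" by (simp add: L2_nrm_def)
  then have "AE x in lebesgue_on (cell L). ?s x = ?l x"
    unfolding L2_nrm_eq_0_iff[OF dL] by (rule eventually_mono) auto
  then have "L2_nrm L ?s = L2_nrm L ?l" by (intro L2_nrm_cong_AE sL lc(1))
  then show ?thesis
    by (simp add: Parseval[OF assms(1) lc(1), symmetric] lc(2) power_mult_distrib)
qed

section \<open>Growth of the noise coefficient\<close>

text \<open>\<open>wderiv\<close> of the zero function is an unspecified almost everywhere zero
  function, so the value is read off the coefficients.\<close>

lemma H_nrm_1_zero: "L > 0 \<Longrightarrow> H_nrm 1 L (\<lambda>x. 0 :: 'b::euclidean_space) = 0"
proof -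
  assume L: "L > 0"
  have "(\<lambda>x. 0 :: 'b) \<in> Hper 1 L"
    by (rule Hper_1I[OF L L2per_zero]) simp
  from Parseval_H1[OF L this] have "ennreal ((H_nrm 1 L (\<lambda>x. 0 :: 'b))\<^sup>2) = 0" by simp
  then have "(H_nrm 1 L (\<lambda>x. 0 :: 'b))\<^sup>2 \<le> 0" by (simp only: ennreal_eq_0_iff)
  then show ?thesis by simp
qed

lemma zero_Hper_1: "L > 0 \<Longrightarrow> (\<lambda>x. 0) \<in> Hper 1 L"
  by (rule Hper_1I[OF _ L2per_zero]) auto

text \<open>A law with a density has no atoms, hence a continuous distribution function, and the
  intermediate value theorem supplies the quantile.\<close>

lemma (in prob_space) cdf_surj:
  fixes X :: "'a \<Rightarrow> real"
  assumes "distributed M lborel X (\<lambda>x. ennreal (g x))" "0 < s" "s < 1"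
  shows "\<exists>a. prob {\<omega> \<in> space M. X \<omega> \<le> a} = s"
proof -
  have X: "X \<in> borel_measurable M" "distr M lborel X = density lborel (\<lambda>x. ennreal (g x))"
    and g: "(\<lambda>x. ennreal (g x)) \<in> borel_measurable lborel"
    using assms(1) by (auto simp: distributed_def)
  let ?D = "distr M borel X"
  interpret D: real_distribution ?D by (rule real_distribution_distr) (use X in simp)
  have "measure ?D {x} = 0" for x
  proof -
    have "emeasure ?D {x} = emeasure (distr M lborel X) {x}" using X(1) by (simp add: emeasure_distr)
    also have "\<dots> = (\<integral>\<^sup>+y. ennreal (g y) * indicator {x} y \<partial>lborel)"
      using g by (simp add: X(2) emeasure_density)
    also have "\<dots> = (\<integral>\<^sup>+(y::real). 0 \<partial>lborel)"
    proof (rule nn_integral_cong_AE)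
      have "AE y in lborel. y \<noteq> x" by (rule AE_lborel_singleton)
      then show "AE y in lborel. ennreal (g y) * indicator {x} y = 0" by eventually_elim simp
    qed
    finally show ?thesis by (simp add: measure_def)
  qed
  then have cont: "isCont (cdf ?D) x" for x by (simp add: D.isCont_cdf)
  obtain a where a: "cdf ?D a < s"
    using order_tendstoD(2)[OF D.cdf_lim_at_bot assms(2)] by (auto simp: eventually_at_bot_linorder)
  obtain b where b: "s < cdf ?D b"
    using order_tendstoD(1)[OF D.cdf_lim_at_top_prob assms(3)] by (auto simp: eventually_at_top_linorder)
  have "a \<le> b"
  proof (rule ccontr)
    assume "\<not> a \<le> b"
    then have "cdf ?D b \<le> cdf ?D a" by (intro D.cdf_nondecreasing) simp
    then show False using a b by simp
  qed
  then obtain c where "cdf ?D c = s"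
    using IVT[of "cdf ?D" a s b] a b cont by auto
  moreover have "cdf ?D c = prob {\<omega> \<in> space M. X \<omega> \<le> c}"
    using X(1) by (simp add: cdf_def measure_distr vimage_def Int_def conj_commute)
  ultimately show ?thesis by (intro exI[of _ c]) simp
qed

text \<open>The events are slices of \<open>X\<close> between consecutive quantiles. Halving the
  probabilities and starting at level \<open>1/2\<close> keeps all levels strictly between 0 and 1,
  where quantiles exist.\<close>

lemma (in prob_space) disjoint_events_of_prob:
  fixes X :: "'a \<Rightarrow> real"
  assumes X: "distributed M lborel X (\<lambda>x. ennreal (g x))"
    and p: "\<And>j::nat. p j > 0" "\<And>n. (\<Sum>j<n. p j) < 1"
  obtains A where "\<And>j. A j \<in> sets M" "\<And>j. prob (A j) = p j / 2" "disjoint_family A"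
proof -
  have Xm: "X \<in> borel_measurable M" using X by (auto simp: distributed_def)
  define s where "s n = 1 / 2 + (\<Sum>j<n. p j) / 2" for n
  have s: "0 < s n" "s n < 1" for n
    using p(2)[of n] sum_nonneg[of "{..<n}" p] p(1) by (auto simp: s_def less_imp_le add_pos_nonneg)
  have "\<forall>n. \<exists>a. prob {\<omega> \<in> space M. X \<omega> \<le> a} = s n" using cdf_surj[OF X s] by blast
  then obtain a where a: "\<And>n. prob {\<omega> \<in> space M. X \<omega> \<le> a n} = s n" by metis
  have step: "a n < a (Suc n)" for n
  proof (rule ccontr)
    assume "\<not> a n < a (Suc n)"
    then have "prob {\<omega> \<in> space M. X \<omega> \<le> a (Suc n)} \<le> prob {\<omega> \<in> space M. X \<omega> \<le> a n}"
      using Xm by (intro finite_measure_mono) auto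
    then show False using p(1)[of n] by (simp add: a s_def)
  qed
  then have mono: "a m \<le> a n" if "m \<le> n" for m n
    using lift_Suc_mono_le[of a, OF less_imp_le[OF step] that] by simp
  define A where "A n = {\<omega> \<in> space M. X \<omega> \<le> a (Suc n)} - {\<omega> \<in> space M. X \<omega> \<le> a n}" for n
  show ?thesis
  proof (rule that)
    show "A j \<in> sets M" for j unfolding A_def using Xm by auto
    show "prob (A j) = p j / 2" for j
    proof -
      have "prob (A j) = prob {\<omega> \<in> space M. X \<omega> \<le> a (Suc j)} - prob {\<omega> \<in> space M. X \<omega> \<le> a j}"
        unfolding A_def using Xm step[of j] by (intro finite_measure_Diff) auto
      then show ?thesis by (simp add: a s_def add_divide_distrib)
    qed
    have "A m \<inter> A n = {}" if "m < n" for m n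
      using mono[of "Suc m" n] that by (auto simp: A_def)
    then show "disjoint_family A"
      unfolding disjoint_family_on_def by (metis Int_commute linorder_neqE_nat)
  qed
qed

lemma noise_coefficient_L2per: "noise_coefficient M L B \<Longrightarrow> v \<in> L2per L \<Longrightarrow> B v \<in> L2per L"
  by (auto simp: noise_coefficient_def)

lemma const_L2_Omega:
  assumes "prob_space M" "L > 0" "v \<in> Hper 1 L"
  shows "(\<lambda>\<omega>. v) \<in> L2_Omega M (Hper 1 L) (H_nrm 1 L)"
proof -
  interpret prob_space M by fact
  have "H_nrm 1 L (v - v) = 0" using H_nrm_1_zero[OF assms(2)] by (simp add: fun_diff_def)
  then have "strongly_measurable M M (Hper 1 L) (H_nrm 1 L) (\<lambda>\<omega>. v)"
    unfolding strongly_measurable_def using assms(3)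
    by (auto intro!: exI[of _ "\<lambda>j \<omega>. v"])
  then show ?thesis by (simp add: L2_Omega_def emeasure_space_1 ennreal_mult_less_top)
qed

text \<open>The hypothesis concerns random fields; for a constant one an almost sure statement on a
  probability space is a plain one.\<close>

lemma noise_coefficient_Hper_1:
  assumes "prob_space M" "L > 0" "noise_coefficient M L B" "v \<in> Hper 1 L"
  shows "B v \<in> Hper 1 L"
proof -
  interpret prob_space M by fact
  have "(\<lambda>\<omega>. B v) \<in> L2_Omega M (Hper 1 L) (H_nrm 1 L)"
  proof -
    have "\<forall>U\<in>L2_Omega M (Hper 1 L) (H_nrm 1 L). (\<lambda>\<omega>. B (U \<omega>)) \<in> L2_Omega M (Hper 1 L) (H_nrm 1 L)"
      using assms(3) unfolding noise_coefficient_def by (elim conjE)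
    from bspec[OF this const_L2_Omega[OF assms(1,2,4)]] show ?thesis .
  qed
  then have "AE \<omega> in M. B v \<in> Hper 1 L" by (simp add: L2_Omega_def strongly_measurable_def)
  then show ?thesis by simp
qed

text \<open>The bound \<open>\<parallel>\<D>B\<parallel> \<le> C\<close> concerns \<open>L\<^sup>2\<close> only, so it gives no control of \<open>\<nabla>B(v)\<close> when \<open>B\<close> is not a
  superposition operator.  Linear growth in \<open>H\<^sup>1\<close> follows instead, as for Nemytskii operators, from
  the fact that \<open>U \<mapsto> B(U)\<close> maps \<open>L\<^sup>2(\<Omega>; H\<^sup>1)\<close> into itself and that \<open>\<Omega>\<close> carries a continuous random
  variable: if the growth condition failed along \<open>v\<^sub>j\<close>, a random field taking the values \<open>v\<^sub>j\<close> with
  suitable probabilities would be in \<open>L\<^sup>2(\<Omega>; H\<^sup>1)\<close> while its image is not.\<close>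

theorem noise_coefficient_H1_growth:
  fixes B :: "(real^'n \<Rightarrow> real^'n) \<Rightarrow> real^'n \<Rightarrow> real^'n" and X :: "'w \<Rightarrow> real"
  assumes "prob_space M" "L > 0" "noise_coefficient M L B"
    and X: "distributed M lborel X (\<lambda>x. ennreal (g x))"
  obtains K where "K \<ge> 0"
    "\<And>v. v \<in> Hper 1 L \<Longrightarrow> (H_nrm 1 L (B v))\<^sup>2 \<le> K * (1 + (H_nrm 1 L v)\<^sup>2)"
proof -
  interpret prob_space M by fact
  let ?H = "\<lambda>v :: real^'n \<Rightarrow> real^'n. (H_nrm 1 L v)\<^sup>2"
  have "\<exists>j::nat. \<forall>v\<in>Hper 1 L. ?H (B v) \<le> 2 ^ j * (1 + ?H v)"
  proof (rule ccontr)
    assume "\<not> (\<exists>j::nat. \<forall>v\<in>Hper 1 L. ?H (B v) \<le> 2 ^ j * (1 + ?H v))"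
    then have "\<forall>j::nat. \<exists>v. v \<in> Hper 1 L \<and> 2 ^ j * (1 + ?H v) < ?H (B v)" by (auto simp: not_le)
    then obtain v where v: "\<And>j. v j \<in> Hper 1 L" "\<And>j. 2 ^ j * (1 + ?H (v j)) < ?H (B (v j))" by metis
    \<comment> \<open>Then \<open>p j * (1 + H(v j))\<close> is summable, whereas
      \<open>p j * H(B (v j))\<close> exceeds \<open>2^j / 2^(j+1) = 1/2\<close> for every
      \<open>j\<close>. The events below have half of these probabilities, which turns
      \<open>1/2\<close> into \<open>1/4\<close>.\<close>
    define p where "p j = (1 / 2) ^ Suc j / (1 + ?H (v j))" for j
    have pos: "1 + ?H w > 0" for w by (simp add: add_pos_nonneg)
    have p0: "p j > 0" for j using pos[of "v j"] by (simp add: p_def)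
    have p1: "p j \<le> (1 / 2) ^ Suc j" for j
    proof -
      have "(1 / 2) ^ Suc j / (1 + ?H (v j)) \<le> (1 / 2) ^ Suc j / 1" by (intro divide_left_mono) (use pos[of "v j"] in auto)
      then show ?thesis by (simp add: p_def)
    qed
    have "(\<Sum>j<n. p j) < 1" for n
    proof -
      have "(\<Sum>j<n. p j) \<le> (\<Sum>j<n. (1 / 2) ^ Suc j)" by (intro sum_mono p1)
      also have "\<dots> = 1 - (1 / 2 :: real) ^ n" by (induction n) (auto simp: field_simps)
      also have "\<dots> < 1" by simp
      finally show ?thesis .
    qed
    then obtain A where A: "\<And>j. A j \<in> sets M" "\<And>j. prob (A j) = p j / 2" "disjoint_family A"
      by (rule disjoint_events_of_prob[OF X p0]) (rule that)
    have int_ind: "(\<integral>\<^sup>+\<omega>. ennreal c * indicator (A j) \<omega> \<partial>M) = ennreal (c * (p j / 2))" if "c \<ge> 0" for c j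
    proof -
      have "(\<integral>\<^sup>+\<omega>. ennreal c * indicator (A j) \<omega> \<partial>M) = ennreal c * ennreal (p j / 2)"
        using A(1)[of j] by (simp only: nn_integral_cmult_indicator emeasure_eq_measure A(2))
      also have "\<dots> = ennreal (c * (p j / 2))" using that p0[of j] by (intro ennreal_mult[symmetric]) auto
      finally show ?thesis .
    qed
    \<comment> \<open>Simple approximations of \<open>U\<close> that add one event at a time; at
      each sample point they are eventually equal to \<open>U\<close>, so strong measurability is
      immediate.\<close>
    define s where "s = rec_nat (\<lambda>\<omega>. \<lambda>x. 0) (\<lambda>J sJ \<omega>. if \<omega> \<in> A J then v J else sJ \<omega>)"
    have s0: "s 0 = (\<lambda>\<omega> x. 0)" and sS: "s (Suc J) = (\<lambda>\<omega>. if \<omega> \<in> A J then v J else s J \<omega>)" for J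
      unfolding s_def by simp_all
    define U where "U \<omega> = (if \<exists>j. \<omega> \<in> A j then v (SOME j. \<omega> \<in> A j) else (\<lambda>x. 0))" for \<omega>
    have UA: "U \<omega> = v j" if "\<omega> \<in> A j" for \<omega> j
    proof -
      have "\<omega> \<in> A (SOME j. \<omega> \<in> A j)" using that by (rule someI)
      then have "(SOME j. \<omega> \<in> A j) = j" using A(3) that by (auto simp: disjoint_family_on_def)
      then show ?thesis using that by (auto simp: U_def)
    qed
    have sA: "s J \<omega> = (if \<exists>j<J. \<omega> \<in> A j then U \<omega> else (\<lambda>x. 0))" for J \<omega>
    proof (induction J)
      case (Suc J)
      show ?case
      proof (cases "\<omega> \<in> A J")
        case True
        then show ?thesis unfolding sS UA[OF True] by auto
      next
        case False
        then have "(\<exists>j<Suc J. \<omega> \<in> A j) \<longleftrightarrow> (\<exists>j<J. \<omega> \<in> A j)" by (auto simp: less_Suc_eq)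
        then show ?thesis using False Suc by (simp only: sS if_False)
      qed
    qed (simp add: s0)
    have simple: "simple_function M (s J)" for J
    proof (induction J)
      case (Suc J)
      have "A J \<inter> space M = A J" using A(1) sets.sets_into_space by blast
      then have "A J \<inter> space M \<in> sets M" using A(1)[of J] by (simp only:)
      then show ?case unfolding sS by (rule simple_function_If_set[OF simple_function_const Suc])
    qed (simp add: s0)
    have Umem: "U \<omega> \<in> Hper 1 L" for \<omega> using v(1) zero_Hper_1[OF assms(2)] by (auto simp: U_def)
    have lim: "(\<lambda>J. H_nrm 1 L (s J \<omega> - U \<omega>)) \<longlonglongrightarrow> 0" for \<omega>
    proof -
      have "\<exists>J0. \<forall>J\<ge>J0. s J \<omega> = U \<omega>"
      proof (cases "\<exists>j. \<omega> \<in> A j")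
        case True
        then obtain j where "\<omega> \<in> A j" by blast
        then show ?thesis by (intro exI[of _ "Suc j"]) (auto simp: sA Suc_le_eq)
      next
        case False
        then show ?thesis by (simp add: sA U_def)
      qed
      then obtain J0 where "\<And>J. J \<ge> J0 \<Longrightarrow> s J \<omega> = U \<omega>" by blast
      then have "H_nrm 1 L (s J \<omega> - U \<omega>) = 0" if "J \<ge> J0" for J
        using that H_nrm_1_zero[OF assms(2)] by (simp add: fun_diff_def)
      then show ?thesis by (intro tendsto_eventually eventually_sequentiallyI[of J0])
    qed
    have "strongly_measurable M M (Hper 1 L) (H_nrm 1 L) U"
      unfolding strongly_measurable_def
    proof (intro conjI exI[of _ s] allI AE_I2 Umem lim simple)
      show "s j ` space M \<subseteq> Hper 1 L" for j
        using Umem zero_Hper_1[OF assms(2)] by (auto simp: sA)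
    qed
    moreover have "(\<integral>\<^sup>+\<omega>. ennreal (?H (U \<omega>)) \<partial>M) < \<infinity>"
    proof -
      have "ennreal (?H (U \<omega>)) \<le> (\<Sum>j. ennreal (?H (v j)) * indicator (A j) \<omega>)" for \<omega>
      proof (cases "\<exists>j. \<omega> \<in> A j")
        case True
        then obtain j where j: "\<omega> \<in> A j" by blast
        have "ennreal (?H (v j)) * indicator (A j) \<omega> \<le> (\<Sum>j. ennreal (?H (v j)) * indicator (A j) \<omega>)"
        proof -
          have "f j \<le> suminf f" for f :: "nat \<Rightarrow> ennreal"
            using sum_le_suminf[of f "{j}"] by simp
          then show ?thesis .
        qed
        then show ?thesis using j UA[OF j] by simp
      next
        case False
        then have "U \<omega> = (\<lambda>x. 0)" unfolding U_def by (rule if_not_P)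
        have "?H (\<lambda>x. 0) = 0" unfolding H_nrm_1_zero[OF assms(2)] by simp
        then show ?thesis unfolding \<open>U \<omega> = (\<lambda>x. 0)\<close> by simp
      qed
      then have "(\<integral>\<^sup>+\<omega>. ennreal (?H (U \<omega>)) \<partial>M) \<le> (\<integral>\<^sup>+\<omega>. (\<Sum>j. ennreal (?H (v j)) * indicator (A j) \<omega>) \<partial>M)"
        by (intro nn_integral_mono)
      also have "\<dots> = (\<Sum>j. \<integral>\<^sup>+\<omega>. ennreal (?H (v j)) * indicator (A j) \<omega> \<partial>M)"
        using A(1) by (intro nn_integral_suminf) auto
      also have "\<dots> = (\<Sum>j. ennreal (?H (v j) * (p j / 2)))"
        by (simp only: int_ind[OF zero_le_power2])
      also have "\<dots> \<le> (\<Sum>j. ennreal ((1 / 2) ^ Suc j))"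
      proof (intro suminf_le ennreal_leI)
        fix j
        have "?H (v j) / (1 + ?H (v j)) \<le> 1" using pos[of "v j"] by (simp add: divide_simps)
        then have "(1 / 2) ^ Suc j * (?H (v j) / (1 + ?H (v j))) \<le> (1 / 2) ^ Suc j * 1"
          by (intro mult_left_mono) auto
        moreover have "?H (v j) * (p j / 2) \<le> ?H (v j) * p j" using p0[of j] by (intro mult_left_mono) auto
        ultimately show "?H (v j) * (p j / 2) \<le> (1 / 2) ^ Suc j" by (simp add: p_def mult.commute)
      qed auto
      also have "\<dots> = ennreal (\<Sum>j. (1 / 2) ^ Suc j)"
        by (rule suminf_ennreal2) (auto intro!: summable_mult summable_geometric)
      finally show ?thesis by (rule le_less_trans) simp
    qed
    ultimately have "U \<in> L2_Omega M (Hper 1 L) (H_nrm 1 L)" by (simp add: L2_Omega_def)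
    then have "(\<lambda>\<omega>. B (U \<omega>)) \<in> L2_Omega M (Hper 1 L) (H_nrm 1 L)"
      using assms(3) unfolding noise_coefficient_def by blast
    then have fin: "(\<integral>\<^sup>+\<omega>. ennreal (?H (B (U \<omega>))) \<partial>M) < \<infinity>" by (simp add: L2_Omega_def)
    \<comment> \<open>Each of the first \<open>n\<close> disjoint events contributes at least
      \<open>1/4\<close> to the second moment of the image, so this moment is infinite.\<close>
    have "ennreal (real n / 4) \<le> (\<integral>\<^sup>+\<omega>. ennreal (?H (B (U \<omega>))) \<partial>M)" for n
    proof -
      have "ennreal (real n / 4) = (\<Sum>j<n. ennreal (1 / 4))"
        by (subst sum_ennreal) auto
      also have "\<dots> \<le> (\<Sum>j<n. ennreal (?H (B (v j)) * (p j / 2)))"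
      proof (intro sum_mono ennreal_leI)
        fix j
        have "(2 ^ j * (1 + ?H (v j))) * (p j / 2) \<le> ?H (B (v j)) * (p j / 2)"
          using v(2)[of j] p0[of j] by (intro mult_right_mono) auto
        moreover have "(2 ^ j * (1 + ?H (v j))) * (p j / 2) = 1 / 4"
        proof -
          have "(2 ^ j * D) * ((1 / 2) ^ Suc j / D / 2) = 1 / 4" if "D > 0" for D :: real
            using that by (simp add: power_one_over field_simps)
          from this[OF pos] show ?thesis unfolding p_def .
        qed
        ultimately show "1 / 4 \<le> ?H (B (v j)) * (p j / 2)" by (simp only:)
      qed
      also have "\<dots> = (\<Sum>j<n. \<integral>\<^sup>+\<omega>. ennreal (?H (B (v j))) * indicator (A j) \<omega> \<partial>M)"
        by (simp only: int_ind[OF zero_le_power2])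
      also have "\<dots> = (\<integral>\<^sup>+\<omega>. (\<Sum>j<n. ennreal (?H (B (v j))) * indicator (A j) \<omega>) \<partial>M)"
        using A(1) by (intro nn_integral_sum[symmetric]) auto
      also have "\<dots> \<le> (\<integral>\<^sup>+\<omega>. ennreal (?H (B (U \<omega>))) \<partial>M)"
      proof (intro nn_integral_mono)
        fix \<omega>
        show "(\<Sum>j<n. ennreal (?H (B (v j))) * indicator (A j) \<omega>) \<le> ennreal (?H (B (U \<omega>)))"
        proof (cases "\<exists>j<n. \<omega> \<in> A j")
          case True
          then obtain j where j: "j < n" "\<omega> \<in> A j" by blast
          then have "i \<in> {..<n} \<Longrightarrow> ennreal (?H (B (v i))) * indicator (A i) \<omega> = (if i = j then ennreal (?H (B (v j))) else 0)" for i
            using A(3) by (auto simp: indicator_def disjoint_family_on_def)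
          then have "(\<Sum>i<n. ennreal (?H (B (v i))) * indicator (A i) \<omega>) = (\<Sum>i<n. if i = j then ennreal (?H (B (v j))) else 0)"
            by (intro sum.cong) auto
          also have "\<dots> = ennreal (?H (B (v j)))" using j(1) by (simp add: sum.delta)
          finally show ?thesis using UA[OF j(2)] by simp
        next
          case False
          then have "(\<Sum>j<n. ennreal (?H (B (v j))) * indicator (A j) \<omega>) = 0"
            by (intro sum.neutral) auto
          then show ?thesis by simp
        qed
      qed
      finally show ?thesis .
    qed
    moreover obtain c where c: "c \<ge> 0" "(\<integral>\<^sup>+\<omega>. ennreal (?H (B (U \<omega>))) \<partial>M) = ennreal c"
      using fin by (cases "\<integral>\<^sup>+\<omega>. ennreal (?H (B (U \<omega>))) \<partial>M") auto
    ultimately have "real n / 4 \<le> c" for n by (simp add: ennreal_le_iff)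
    moreover obtain n where "4 * c < real n" using reals_Archimedean2 by blast
    ultimately show False by (metis (no_types) divide_le_eq_numeral1(1) mult.commute not_le)
  qed
  then obtain j :: nat where "\<forall>v\<in>Hper 1 L. ?H (B v) \<le> 2 ^ j * (1 + ?H v)" ..
  then show ?thesis using that[of "2 ^ j"] by simp
qed

section \<open>One step of the scheme in coefficients\<close>

text \<open>The Helmholtz projection acts on the coefficient at \<open>m\<close> by orthogonal projection onto the
  complement of the wave vector; at \<open>m = 0\<close> it is the identity (through \<open>x / 0 = 0\<close>).\<close>

definition leray :: "real \<Rightarrow> int^'n \<Rightarrow> real^'n \<Rightarrow> real^'n" where
  "leray L m a = a - ((wavevec L m \<bullet> a) / stokes_ev L m) *\<^sub>R wavevec L m"

lemma leray_add: "leray L m (a + b) = leray L m a + leray L m b"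
  by (simp add: leray_def inner_add_right add_divide_distrib scaleR_add_left)

lemma leray_scaleR: "leray L m (c *\<^sub>R a) = c *\<^sub>R leray L m a"
  by (simp add: leray_def scaleR_diff_right)

lemma inner_leray [simp]: "wavevec L m \<bullet> leray L m a = 0"
proof (cases "wavevec L m = 0")
  case False
  then have "stokes_ev L m \<noteq> 0" by simp
  then show ?thesis by (simp add: leray_def inner_diff_right flip: power2_norm_eq_inner)
qed simp

lemma leray_ident: "wavevec L m \<bullet> a = 0 \<Longrightarrow> leray L m a = a"
  by (simp add: leray_def)

lemma leray_wavevec [simp]: "leray L m (c *\<^sub>R wavevec L m) = 0"
proof (cases "wavevec L m = 0")
  case False
  then have "stokes_ev L m \<noteq> 0" by simp
  then show ?thesis by (simp add: leray_def flip: power2_norm_eq_inner)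
qed (simp add: leray_def)

lemma norm_leray_power2: "(norm (leray L m a))\<^sup>2 + (norm (a - leray L m a))\<^sup>2 = (norm a)\<^sup>2"
proof -
  have "leray L m a \<bullet> (a - leray L m a) = 0"
    by (subst (2) leray_def) (simp add: inner_commute[of "leray L m a"])
  moreover have "(norm (p + q))\<^sup>2 = (norm p)\<^sup>2 + (norm q)\<^sup>2" if "p \<bullet> q = 0" for p q :: "real^'a"
    using that by (simp add: power2_norm_eq_inner inner_add_left inner_add_right inner_commute)
  ultimately have "(norm (leray L m a + (a - leray L m a)))\<^sup>2 = (norm (leray L m a))\<^sup>2 + (norm (a - leray L m a))\<^sup>2"
    by blast
  then show ?thesis by simp
qed

lemma norm_leray_le: "norm (leray L m a) \<le> norm a" "norm (a - leray L m a) \<le> norm a"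
proof -
  have "(norm (leray L m a))\<^sup>2 \<le> (norm a)\<^sup>2" "(norm (a - leray L m a))\<^sup>2 \<le> (norm a)\<^sup>2"
    unfolding norm_leray_power2[of L m a, symmetric] by simp_all
  then show "norm (leray L m a) \<le> norm a" "norm (a - leray L m a) \<le> norm a"
    by (auto intro: power2_le_imp_le)
qed

lemma continuous_leray: "continuous_on UNIV (leray L m)"
  unfolding leray_def[abs_def] divide_inverse by (intro continuous_intros)

lemma leray_measurable [measurable]: "leray L m \<in> borel_measurable borel"
  by (rule borel_measurable_continuous_onI) (rule continuous_leray)

section \<open>Testing the scheme with single modes\<close>

lemma L2per_scaleR_left:
  fixes v :: "real^'n \<Rightarrow> real"
  assumes "v \<in> L2per L"
  shows "(\<lambda>x. v x *\<^sub>R b) \<in> L2per L"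
proof -
  have "integrable (lebesgue_on (cell L)) (\<lambda>x. (norm b)\<^sup>2 * (norm (v x))\<^sup>2)"
    using L2perD(4)[OF assms] by (rule integrable_mult_right)
  moreover have "(norm b)\<^sup>2 * (norm (v x))\<^sup>2 = (norm (v x *\<^sub>R b))\<^sup>2" for x
    by (simp add: power_mult_distrib mult.commute)
  ultimately have "integrable (lebesgue_on (cell L)) (\<lambda>x. (norm (v x *\<^sub>R b))\<^sup>2)" by (simp only:)
  then show ?thesis
    using L2perD(1,2)[OF assms] unfolding L2per_def periodic_def by simp
qed

lemma fcoef_scaleR_left:
  fixes v :: "real^'n \<Rightarrow> real"
  assumes "L > 0" "v \<in> L2per L"
  shows "fcoef L m (\<lambda>x. v x *\<^sub>R b) = fcoef L m v *\<^sub>R b"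
  unfolding fcoef_def
  using integral_scaleR_left[of b "lebesgue_on (cell L)" "\<lambda>x. hartley L m x *\<^sub>R v x"]
    integrable_hartley[OF assms(1) L2perD(5)[OF assms(2)]] by simp

lemma L2_ip_cong_AE:
  assumes "v \<in> L2per L" "w \<in> L2per L" "w' \<in> L2per L" "AE x in lebesgue_on (cell L). w x = w' x"
  shows "L2_ip L v w = L2_ip L v w'"
  unfolding L2_ip_def
proof (rule integral_cong_AE)
  show "AE x in lebesgue_on (cell L). v x \<bullet> w x = v x \<bullet> w' x"
    using assms(4) by eventually_elim simp
qed (intro borel_measurable_integrable integrable_L2_inner assms)+

lemma is_wderiv_hartley:
  assumes "L > 0"
  shows "is_wderiv i (\<lambda>x. hartley L m x *\<^sub>R b) (\<lambda>x. hartley L (- m) x *\<^sub>R (wavevec L m $ i *\<^sub>R b))"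
proof (rule is_wderivI_fcoef[OF assms hartley_L2per[OF assms] hartley_L2per[OF assms]])
  fix n
  have "n = - m \<longleftrightarrow> - n = m" by auto
  then show "fcoef L n (\<lambda>x. hartley L (- m) x *\<^sub>R (wavevec L m $ i *\<^sub>R b))
      = - (wavevec L n $ i) *\<^sub>R fcoef L (- n) (\<lambda>x. hartley L m x *\<^sub>R b)"
    unfolding fcoef_hartley[OF assms] by auto
qed

lemma hartley_Hper_1:
  assumes "L > 0"
  shows "(\<lambda>x. hartley L m x *\<^sub>R b) \<in> Hper (Suc 0) L"
proof -
  have "\<exists>g\<in>L2per L. is_wderiv i (\<lambda>x. hartley L m x *\<^sub>R b) g" for i
    using is_wderiv_hartley[OF assms, of i m b] hartley_L2per[OF assms, of "- m" "wavevec L m $ i *\<^sub>R b"] by blast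
  then show ?thesis using hartley_L2per[OF assms] by simp
qed

text \<open>The chosen weak derivative agrees with the classical one only almost everywhere, which
  is all that inner products can see.\<close>

lemma wderiv_hartley_AE:
  assumes "L > 0"
  shows "AE x in lebesgue_on (cell L). wderiv L i (\<lambda>x. hartley L m x *\<^sub>R b) x = hartley L (- m) x *\<^sub>R (wavevec L m $ i *\<^sub>R b)"
proof (rule fcoef_eq_imp_AE_eq[OF assms Hper_Suc_wderiv(1)[OF hartley_Hper_1[OF assms]] hartley_L2per[OF assms]])
  fix n
  show "fcoef L n (wderiv L i (\<lambda>x. hartley L m x *\<^sub>R b)) = fcoef L n (\<lambda>x. hartley L (- m) x *\<^sub>R (wavevec L m $ i *\<^sub>R b))"
    unfolding fcoef_wderiv[OF assms hartley_Hper_1[OF assms]]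
    by (rule fcoef_weak_derivative[OF assms hartley_L2per[OF assms] hartley_L2per[OF assms] is_wderiv_hartley[OF assms], symmetric])
qed

lemma grad_coef:
  fixes q :: "real^'n \<Rightarrow> real"
  assumes "L > 0" "q \<in> Hper 1 L"
  shows "grad L q \<in> L2per L" "fcoef L m (grad L q) = - fcoef L (- m) q *\<^sub>R wavevec L m"
proof -
  have q: "q \<in> Hper (Suc 0) L" using assms(2) by simp
  have eq: "grad L q = (\<lambda>x. \<Sum>i\<in>UNIV. wderiv L i q x *\<^sub>R axis i 1)"
    by (simp add: fun_eq_iff grad_def vec_eq_iff axis_def if_distrib sum.delta cong: if_cong)
  show "grad L q \<in> L2per L"
    unfolding eq by (intro L2per_sum L2per_scaleR_left Hper_Suc_wderiv[OF q])
  have "fcoef L m (grad L q) = (\<Sum>i\<in>UNIV. fcoef L m (wderiv L i q) *\<^sub>R axis i 1)"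
    unfolding eq by (subst fcoef_sum[OF assms(1)])
      (simp_all add: L2per_scaleR_left fcoef_scaleR_left assms(1) Hper_Suc_wderiv[OF q])
  also have "\<dots> = - fcoef L (- m) q *\<^sub>R wavevec L m"
    by (simp add: fcoef_wderiv[OF assms(1) q] vec_eq_iff axis_def if_distrib sum.delta cong: if_cong)
  finally show "fcoef L m (grad L q) = - fcoef L (- m) q *\<^sub>R wavevec L m" .
qed

lemma divergence_hartley_AE:
  fixes m :: "int^'n"
  assumes "L > 0"
  shows "AE x in lebesgue_on (cell L). divergence L (\<lambda>x. hartley L m x *\<^sub>R b) x = hartley L (- m) x *\<^sub>R (wavevec L m \<bullet> b)"
proof -
  have "AE x in lebesgue_on (cell L). \<forall>i\<in>UNIV. wderiv L i (\<lambda>x. hartley L m x *\<^sub>R b) x = hartley L (- m) x *\<^sub>R (wavevec L m $ i *\<^sub>R b)"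
    by (intro AE_finite_allI wderiv_hartley_AE assms) auto
  then show ?thesis
    by eventually_elim (simp add: divergence_def inner_vec_def sum_distrib_left mult.assoc)
qed

lemma divergence_L2per:
  fixes v :: "real^'n \<Rightarrow> real^'n"
  assumes "v \<in> Hper (Suc 0) L"
  shows "divergence L v \<in> L2per L"
proof -
  have "divergence L v = (\<lambda>x. \<Sum>i\<in>UNIV. wderiv L i v x \<bullet> axis i 1)"
    by (simp add: fun_eq_iff divergence_def inner_axis)
  then show ?thesis by (auto intro!: L2per_sum L2per_inner Hper_Suc_wderiv[OF assms])
qed

lemma grad_ip_hartley:
  fixes v :: "real^'n \<Rightarrow> 'b::euclidean_space"
  assumes "L > 0" "v \<in> Hper 1 L"
  shows "grad_ip L v (\<lambda>x. hartley L m x *\<^sub>R b) = stokes_ev L m * (fcoef L m v \<bullet> b)"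
proof -
  have v: "v \<in> Hper (Suc 0) L" using assms(2) by simp
  have "L2_ip L (wderiv L i v) (wderiv L i (\<lambda>x. hartley L m x *\<^sub>R b)) = (wavevec L m $ i)\<^sup>2 * (fcoef L m v \<bullet> b)" for i
  proof -
    have "L2_ip L (wderiv L i v) (wderiv L i (\<lambda>x. hartley L m x *\<^sub>R b))
        = L2_ip L (wderiv L i v) (\<lambda>x. hartley L (- m) x *\<^sub>R (wavevec L m $ i *\<^sub>R b))"
      by (intro L2_ip_cong_AE Hper_Suc_wderiv(1)[OF v] Hper_Suc_wderiv(1)[OF hartley_Hper_1[OF assms(1)]]
          hartley_L2per assms wderiv_hartley_AE)
    also have "\<dots> = fcoef L (- m) (wderiv L i v) \<bullet> (wavevec L m $ i *\<^sub>R b)"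
      by (rule L2_ip_hartley[OF assms(1) Hper_Suc_wderiv(1)[OF v]])
    also have "\<dots> = (wavevec L m $ i)\<^sup>2 * (fcoef L m v \<bullet> b)"
      by (simp add: fcoef_wderiv[OF assms(1) v] power2_eq_square)
    finally show ?thesis .
  qed
  then show ?thesis by (simp add: grad_ip_def stokes_ev_sum sum_distrib_right)
qed

text \<open>The gradient of mode \<open>- m\<close> is proportional to the wave vector times mode
  \<open>m\<close>. Testing with it shows that \<open>b\<close> and the gradient of
  \<open>\<xi>\<close> have the same component along the wave vector, and a gradient has no other
  component.\<close>

lemma projected_noise_coef:
  fixes b :: "real^'n \<Rightarrow> real^'n"
  assumes "L > 0" "\<xi> \<in> Hper 1 L" "b \<in> L2per L"
    and eq: "\<And>\<phi>. \<phi> \<in> Hper 1 L \<Longrightarrow> L2_ip L (grad L \<xi>) (grad L \<phi>) = L2_ip L b (grad L \<phi>)"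
  shows "fcoef L m (\<lambda>x. b x - grad L \<xi> x) = leray L m (fcoef L m b)"
proof -
  let ?\<phi> = "\<lambda>x. hartley L (- m) x *\<^sub>R (1::real)"
  have \<phi>: "?\<phi> \<in> Hper 1 L" using hartley_Hper_1[OF assms(1), of "- m" "1::real"] by simp
  note g\<xi> = grad_coef[OF assms(1,2)]
  have "AE x in lebesgue_on (cell L). grad L ?\<phi> x = hartley L m x *\<^sub>R (- wavevec L m)"
  proof (rule fcoef_eq_imp_AE_eq[OF assms(1) grad_coef(1)[OF assms(1) \<phi>] hartley_L2per[OF assms(1)]])
    fix n
    show "fcoef L n (grad L ?\<phi>) = fcoef L n (\<lambda>x. hartley L m x *\<^sub>R (- wavevec L m))"
      unfolding grad_coef(2)[OF assms(1) \<phi>] fcoef_hartley[OF assms(1)] by auto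
  qed
  from this have ip: "L2_ip L v (grad L ?\<phi>) = fcoef L m v \<bullet> (- wavevec L m)" if "v \<in> L2per L" for v
    unfolding L2_ip_hartley[OF assms(1) that, symmetric]
    by (rule L2_ip_cong_AE[OF that grad_coef(1)[OF assms(1) \<phi>] hartley_L2per[OF assms(1)]])
  have "fcoef L m (grad L \<xi>) \<bullet> wavevec L m = fcoef L m b \<bullet> wavevec L m"
    using eq[OF \<phi>] unfolding ip[OF g\<xi>(1)] ip[OF assms(3)] by simp
  then have orth: "wavevec L m \<bullet> (fcoef L m b - fcoef L m (grad L \<xi>)) = 0"
    by (simp add: inner_diff_right inner_commute)
  have d: "fcoef L m (\<lambda>x. b x - grad L \<xi> x) = fcoef L m b - fcoef L m (grad L \<xi>)"
    by (rule fcoef_diff[OF assms(1,3) g\<xi>(1)])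
  have "leray L m (fcoef L m b) = leray L m ((fcoef L m b - fcoef L m (grad L \<xi>)) + (- fcoef L (- m) \<xi>) *\<^sub>R wavevec L m)"
    by (simp add: g\<xi>(2))
  also have "\<dots> = fcoef L m b - fcoef L m (grad L \<xi>)"
    unfolding leray_add leray_ident[OF orth] leray_wavevec by simp
  finally show ?thesis unfolding d ..
qed

text \<open>Testing with mode \<open>m\<close> in every direction gives a vector equation in which
  the pressure is a multiple of the wave vector. Projecting removes it and leaves the recursion for
  the velocity; subtracting the recursion isolates the pressure. The noise is already projected and
  cancels from the second identity.\<close>

lemma scheme_step_coef:
  fixes u u' g b :: "real^'n \<Rightarrow> real^'n"
  assumes L: "L > 0" and k: "k > 0" and u: "u \<in> Vdiv L" and u': "u' \<in> Vdiv L" and r: "r \<in> L2per L"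
    and g: "g \<in> L2per L" and b: "b \<in> L2per L" and \<xi>: "\<xi> \<in> Hper 1 L"
    and eq1: "\<And>\<phi>. \<phi> \<in> Hper 1 L \<Longrightarrow> L2_ip L (grad L \<xi>) (grad L \<phi>) = L2_ip L b (grad L \<phi>)"
    and eq2: "\<And>v. v \<in> Hper 1 L \<Longrightarrow> L2_ip L u' v + k * grad_ip L u' v - k * L2_ip L (divergence L v) r
        = L2_ip L u v + k * L2_ip L g v + L2_ip L (\<lambda>x. w *\<^sub>R (b x - grad L \<xi> x)) v"
  shows "(1 + k * stokes_ev L m) *\<^sub>R fcoef L m u'
      = fcoef L m u + k *\<^sub>R leray L m (fcoef L m g) + w *\<^sub>R leray L m (fcoef L m b)"
    and "- fcoef L (- m) r *\<^sub>R wavevec L m = fcoef L m g - leray L m (fcoef L m g)"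
proof -
  have uH: "u \<in> Hdiv L" "u' \<in> Hdiv L" using u u' Vdiv_Hdiv by auto
  then have uL: "u \<in> L2per L" "u' \<in> L2per L" by (auto simp: Hdiv_def)
  have u'1: "u' \<in> Hper 1 L" using u' by (simp add: Vdiv_def)
  note du = fcoef_div_free[OF L uH(1)] and du' = fcoef_div_free[OF L uH(2)]
  have \<eta>: "(\<lambda>x. w *\<^sub>R (b x - grad L \<xi> x)) \<in> L2per L"
    by (intro L2per_scaleR L2per_diff b grad_coef(1)[OF L \<xi>])
  have \<eta>c: "fcoef L m (\<lambda>x. w *\<^sub>R (b x - grad L \<xi> x)) = w *\<^sub>R leray L m (fcoef L m b)"
  proof -
    have "fcoef L m (\<lambda>x. b x - grad L \<xi> x) = leray L m (fcoef L m b)"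
      by (rule projected_noise_coef[OF L \<xi> b]) (rule eq1)
    then show ?thesis by (simp only: fcoef_scaleR)
  qed
  have main: "(1 + k * stokes_ev L m) *\<^sub>R fcoef L m u' - (k * fcoef L (- m) r) *\<^sub>R wavevec L m
      = fcoef L m u + k *\<^sub>R fcoef L m g + w *\<^sub>R leray L m (fcoef L m b)" (is "?l = ?r")
  proof -
    have "?l \<bullet> a = ?r \<bullet> a" for a
    proof -
      let ?v = "\<lambda>x. hartley L m x *\<^sub>R a"
      have v: "?v \<in> Hper (Suc 0) L" by (rule hartley_Hper_1[OF L])
      have "L2_ip L (divergence L ?v) r = L2_ip L r (divergence L ?v)" by (rule L2_ip_commute)
      also have "\<dots> = L2_ip L r (\<lambda>x. hartley L (- m) x *\<^sub>R (wavevec L m \<bullet> a))"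
        by (intro L2_ip_cong_AE r divergence_L2per v hartley_L2per L divergence_hartley_AE)
      also have "\<dots> = fcoef L (- m) r * (wavevec L m \<bullet> a)"
        by (simp only: L2_ip_hartley[OF L r] inner_real_def)
      finally have dv: "L2_ip L (divergence L ?v) r = fcoef L (- m) r * (wavevec L m \<bullet> a)" .
      have "?v \<in> Hper 1 L" using v by simp
      from eq2[OF this] show ?thesis
        unfolding L2_ip_hartley[OF L uL(1)] L2_ip_hartley[OF L uL(2)] L2_ip_hartley[OF L g] L2_ip_hartley[OF L \<eta>]
          grad_ip_hartley[OF L u'1] dv \<eta>c
        by (simp add: inner_diff_left inner_add_left algebra_simps)
    qed
    then show ?thesis using inner_eq_zero_iff[of "?l - ?r"] by (simp add: inner_diff_left)
  qed
  have "leray L m ((1 + k * stokes_ev L m) *\<^sub>R fcoef L m u' + (- (k * fcoef L (- m) r)) *\<^sub>R wavevec L m)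
      = leray L m (fcoef L m u + k *\<^sub>R fcoef L m g + w *\<^sub>R leray L m (fcoef L m b))"
    using main by simp
  then show c: "(1 + k * stokes_ev L m) *\<^sub>R fcoef L m u'
      = fcoef L m u + k *\<^sub>R leray L m (fcoef L m g) + w *\<^sub>R leray L m (fcoef L m b)"
    unfolding leray_add leray_scaleR leray_wavevec leray_ident[OF du] leray_ident[OF du'] leray_ident[OF inner_leray]
    by (simp add: leray_wavevec[of L m 1, unfolded scaleR_one])
  have "k *\<^sub>R (- fcoef L (- m) r *\<^sub>R wavevec L m) = k *\<^sub>R (fcoef L m g - leray L m (fcoef L m g))"
    using main unfolding c by (simp add: algebra_simps)
  then show "- fcoef L (- m) r *\<^sub>R wavevec L m = fcoef L m g - leray L m (fcoef L m g)"
    using k unfolding scaleR_cancel_left by blast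
qed

lemma norm_sum3_power2:
  fixes a b c :: "'a::real_inner"
  shows "(norm (a + b + c))\<^sup>2 \<le> 3 * ((norm a)\<^sup>2 + (norm b)\<^sup>2 + (norm c)\<^sup>2)"
proof -
  have "(norm (a + b + c))\<^sup>2 \<le> (norm a + norm b + norm c)\<^sup>2"
    by (intro power_mono norm_triangle_mono order_refl norm_triangle_ineq) (auto intro: norm_triangle_le)
  also have "\<dots> \<le> 3 * ((norm a)\<^sup>2 + (norm b)\<^sup>2 + (norm c)\<^sup>2)"
    using zero_le_power2[of "norm a - norm b"] zero_le_power2[of "norm a - norm c"] zero_le_power2[of "norm b - norm c"]
    by (simp add: power2_eq_square algebra_simps)
  finally show ?thesis .
qed

text \<open>The implicit step gains two derivatives, as
  \<open>(k \<lambda>)^2 \<le> (1 + k \<lambda>)^2\<close>. The constants in the H2 part blow up as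
  \<open>k\<close> tends to 0, but only finiteness is wanted there. The pressure estimate, in
  contrast, is free of \<open>k\<close>: the complement of a projection does not increase
  norms.\<close>

lemma scheme_step_regularity:
  fixes u u' g b :: "real^'n \<Rightarrow> real^'n"
  assumes L: "L > 0" and k: "k > 0" and u: "u \<in> L2per L" and u': "u' \<in> L2per L" and r: "r \<in> L2per L"
    and g: "g \<in> L2per L" and b: "b \<in> L2per L"
    and c: "\<And>m. (1 + k * stokes_ev L m) *\<^sub>R fcoef L m u'
      = fcoef L m u + k *\<^sub>R leray L m (fcoef L m g) + w *\<^sub>R leray L m (fcoef L m b)"
    and cr: "\<And>m. - fcoef L (- m) r *\<^sub>R wavevec L m = fcoef L m g - leray L m (fcoef L m g)"
  shows "u' \<in> Hper 2 L" "r \<in> Hper 1 L" "(grad_nrm L r)\<^sup>2 \<le> (L2_nrm L g)\<^sup>2"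
proof -
  \<comment> \<open>The recursion \<open>c\<close> bounds \<open>k \<lambda>\<close> times the new
    coefficient by three terms, each dominated by a coefficient of an L2 function.\<close>
  have bound: "(stokes_ev L m)\<^sup>2 * (norm (fcoef L m u'))\<^sup>2
      \<le> (3 / k\<^sup>2) * (norm (fcoef L m u))\<^sup>2 + (3 * (norm (fcoef L m g))\<^sup>2 + (3 * w\<^sup>2 / k\<^sup>2) * (norm (fcoef L m b))\<^sup>2)" for m
  proof -
    have "(k * stokes_ev L m)\<^sup>2 \<le> (1 + k * stokes_ev L m)\<^sup>2" using k by (intro power_mono) auto
    then have "(k * stokes_ev L m)\<^sup>2 * (norm (fcoef L m u'))\<^sup>2 \<le> (1 + k * stokes_ev L m)\<^sup>2 * (norm (fcoef L m u'))\<^sup>2"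
      by (rule mult_right_mono) simp
    also have "\<dots> = (norm ((1 + k * stokes_ev L m) *\<^sub>R fcoef L m u'))\<^sup>2"
      by (simp add: power_mult_distrib)
    also have "\<dots> \<le> 3 * ((norm (fcoef L m u))\<^sup>2 + (norm (k *\<^sub>R leray L m (fcoef L m g)))\<^sup>2 + (norm (w *\<^sub>R leray L m (fcoef L m b)))\<^sup>2)"
      unfolding c by (rule norm_sum3_power2)
    also have "\<dots> = 3 * ((norm (fcoef L m u))\<^sup>2 + k\<^sup>2 * (norm (leray L m (fcoef L m g)))\<^sup>2 + w\<^sup>2 * (norm (leray L m (fcoef L m b)))\<^sup>2)"
      by (simp add: power_mult_distrib)
    also have "\<dots> \<le> 3 * ((norm (fcoef L m u))\<^sup>2 + k\<^sup>2 * (norm (fcoef L m g))\<^sup>2 + w\<^sup>2 * (norm (fcoef L m b))\<^sup>2)"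
      by (intro mult_left_mono add_mono order_refl power_mono norm_leray_le) auto
    finally have "k\<^sup>2 * ((stokes_ev L m)\<^sup>2 * (norm (fcoef L m u'))\<^sup>2)
      \<le> 3 * ((norm (fcoef L m u))\<^sup>2 + k\<^sup>2 * (norm (fcoef L m g))\<^sup>2 + w\<^sup>2 * (norm (fcoef L m b))\<^sup>2)"
      by (simp only: power_mult_distrib mult.assoc)
    then have "(stokes_ev L m)\<^sup>2 * (norm (fcoef L m u'))\<^sup>2
      \<le> (3 * ((norm (fcoef L m u))\<^sup>2 + k\<^sup>2 * (norm (fcoef L m g))\<^sup>2 + w\<^sup>2 * (norm (fcoef L m b))\<^sup>2)) / k\<^sup>2"
      using k by (subst pos_le_divide_eq) (simp_all only: mult.commute zero_less_power)
    also have "\<dots> = (3 / k\<^sup>2) * (norm (fcoef L m u))\<^sup>2 + (3 * (norm (fcoef L m g))\<^sup>2 + (3 * w\<^sup>2 / k\<^sup>2) * (norm (fcoef L m b))\<^sup>2)"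
      using k by (simp add: field_simps)
    finally show ?thesis .
  qed
  show "u' \<in> Hper 2 L"
  proof (rule Hper_2I[OF L u'])
    have "(\<integral>\<^sup>+m. ennreal ((stokes_ev L m)\<^sup>2 * (norm (fcoef L m u'))\<^sup>2) \<partial>count_space UNIV)
      \<le> (\<integral>\<^sup>+m. ennreal (3 / k\<^sup>2) * ennreal ((norm (fcoef L m u))\<^sup>2) + (ennreal 3 * ennreal ((norm (fcoef L m g))\<^sup>2)
          + ennreal (3 * w\<^sup>2 / k\<^sup>2) * ennreal ((norm (fcoef L m b))\<^sup>2)) \<partial>count_space UNIV)"
    proof (rule nn_integral_mono)
      fix m
      show "ennreal ((stokes_ev L m)\<^sup>2 * (norm (fcoef L m u'))\<^sup>2)
        \<le> ennreal (3 / k\<^sup>2) * ennreal ((norm (fcoef L m u))\<^sup>2) + (ennreal 3 * ennreal ((norm (fcoef L m g))\<^sup>2)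
          + ennreal (3 * w\<^sup>2 / k\<^sup>2) * ennreal ((norm (fcoef L m b))\<^sup>2))"
        using ennreal_leI[OF bound[of m]]
        by (simp only: ennreal_plus ennreal_mult zero_le_power2 norm_ge_zero mult_nonneg_nonneg divide_nonneg_nonneg
            add_nonneg_nonneg zero_le_numeral)
    qed
    also have "\<dots> = ennreal (3 / k\<^sup>2) * ennreal ((L2_nrm L u)\<^sup>2) + (ennreal 3 * ennreal ((L2_nrm L g)\<^sup>2)
          + ennreal (3 * w\<^sup>2 / k\<^sup>2) * ennreal ((L2_nrm L b)\<^sup>2))"
      by (simp add: nn_integral_add nn_integral_cmult Parseval[OF L u] Parseval[OF L g] Parseval[OF L b])
    also have "\<dots> < \<infinity>" by (simp add: ennreal_mult_less_top)
    finally show "(\<integral>\<^sup>+m. ennreal ((stokes_ev L m)\<^sup>2 * (norm (fcoef L m u'))\<^sup>2) \<partial>count_space UNIV) < \<infinity>" .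
  qed
  have "(\<integral>\<^sup>+m. ennreal (stokes_ev L m * (norm (fcoef L m r))\<^sup>2) \<partial>count_space UNIV)
      = (\<integral>\<^sup>+m. ennreal (stokes_ev L (- m) * (norm (fcoef L (- m) r))\<^sup>2) \<partial>count_space UNIV)"
    by (rule nn_integral_uminus_mode[symmetric])
  also have "\<dots> \<le> (\<integral>\<^sup>+m. ennreal ((norm (fcoef L m g))\<^sup>2) \<partial>count_space UNIV)"
  proof (intro nn_integral_mono ennreal_leI)
    fix m
    have "stokes_ev L (- m) * (norm (fcoef L (- m) r))\<^sup>2 = (norm (- fcoef L (- m) r *\<^sub>R wavevec L m))\<^sup>2"
      by (simp add: power_mult_distrib mult.commute)
    also have "\<dots> \<le> (norm (fcoef L m g))\<^sup>2" unfolding cr by (intro power_mono norm_leray_le) simp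
    finally show "stokes_ev L (- m) * (norm (fcoef L (- m) r))\<^sup>2 \<le> (norm (fcoef L m g))\<^sup>2" .
  qed
  also have "\<dots> = ennreal ((L2_nrm L g)\<^sup>2)" by (rule Parseval[OF L g])
  finally have fin: "(\<integral>\<^sup>+m. ennreal (stokes_ev L m * (norm (fcoef L m r))\<^sup>2) \<partial>count_space UNIV) \<le> ennreal ((L2_nrm L g)\<^sup>2)" .
  show r1: "r \<in> Hper 1 L"
    by (rule Hper_1I[OF L r le_less_trans[OF fin]]) simp
  show "(grad_nrm L r)\<^sup>2 \<le> (L2_nrm L g)\<^sup>2"
    using fin unfolding Parseval_grad[OF L r1, symmetric] by (subst (asm) ennreal_le_iff) auto
qed

section \<open>Random coefficients\<close>

text \<open>\<open>U\<close> is only almost everywhere a limit of \<open>G\<close>-simple functions,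
  so its coefficients are replaced by versions that are measurable for \<open>G\<close> at every
  point: coefficients are continuous in the norm, and those of simple functions are simple.\<close>

lemma strongly_measurable_coef:
  fixes U :: "'w \<Rightarrow> real^'n \<Rightarrow> 'b::euclidean_space"
  assumes L: "L > 0" and sm: "strongly_measurable M G X nrm U" and X: "X \<subseteq> L2per L"
    and nrm: "\<And>v. L2_nrm L v \<le> nrm v" and sp: "space G = space M"
  obtains Y where "\<And>m. Y m \<in> borel_measurable G" "AE \<omega> in M. U \<omega> \<in> X \<and> (\<forall>m. fcoef L m (U \<omega>) = Y m \<omega>)"
proof -
  obtain s where s: "\<And>j. simple_function G (s j)" "\<And>j. s j ` space M \<subseteq> X"
    and lim: "AE \<omega> in M. (\<lambda>j::nat. nrm (s j \<omega> - U \<omega>)) \<longlonglongrightarrow> 0" and UX: "AE \<omega> in M. U \<omega> \<in> X"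
    using sm unfolding strongly_measurable_def by blast
  define Y where "Y m \<omega> = lim (\<lambda>j. fcoef L m (s j \<omega>))" for m \<omega>
  show ?thesis
  proof (rule that)
    show "Y m \<in> borel_measurable G" for m
      unfolding Y_def
      by (intro borel_measurable_lim_metric borel_measurable_simple_function simple_function_compose1[OF s(1)])
    show "AE \<omega> in M. U \<omega> \<in> X \<and> (\<forall>m. fcoef L m (U \<omega>) = Y m \<omega>)"
      using lim UX AE_space
    proof eventually_elim
      case (elim \<omega>)
      have U: "U \<omega> \<in> L2per L" and S: "s j \<omega> \<in> L2per L" for j using elim X s(2) by auto
      have "(\<lambda>j. fcoef L m (s j \<omega>)) \<longlonglongrightarrow> fcoef L m (U \<omega>)" for m
      proof -
        have "norm (fcoef L m (s j \<omega>) - fcoef L m (U \<omega>)) \<le> nrm (s j \<omega> - U \<omega>)" for j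
        proof -
          have "norm (fcoef L m (\<lambda>x. s j \<omega> x - U \<omega> x)) \<le> L2_nrm L (\<lambda>x. s j \<omega> x - U \<omega> x)"
            by (rule norm_fcoef_le[OF L L2per_diff[OF S U]])
          also have "\<dots> \<le> nrm (s j \<omega> - U \<omega>)" unfolding fun_diff_def by (rule nrm)
          finally show ?thesis by (simp only: fcoef_diff[OF L S U])
        qed
        then have "eventually (\<lambda>j. norm (fcoef L m (s j \<omega>) - fcoef L m (U \<omega>)) \<le> nrm (s j \<omega> - U \<omega>)) sequentially"
          by (intro always_eventually allI)
        from Lim_null_comparison[OF this elim(1)] show ?thesis by (rule LIM_zero_cancel)
      qed
      then show ?case using elim(2) by (auto simp: Y_def intro!: limI[symmetric])
    qed
  qed
qed

lemma simple_function_hartley_sum: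
  fixes a :: "int^'n \<Rightarrow> 'w \<Rightarrow> 'b::euclidean_space"
  assumes "finite A" "\<And>m. simple_function G (a m)"
  shows "simple_function G (\<lambda>\<omega> x. \<Sum>m\<in>A. hartley L m x *\<^sub>R a m \<omega>)"
  using assms(1)
proof (induction A rule: finite_induct)
  case (insert m A)
  from simple_function_compose2[OF assms(2)[of m] insert.IH, of "\<lambda>c v x. hartley L m x *\<^sub>R c + v x"]
  show ?case by (simp add: sum.insert[OF insert.hyps])
qed simp

text \<open>\<open>B\<close> is only known to be Lipschitz on \<open>L\<^sup>2\<close>; measurability of \<open>B(U)\<close> is obtained by truncating \<open>U\<close>
  to finitely many modes and approximating the random coefficients by simple functions.\<close>

lemma lipschitz_coef_measurable:
  fixes B :: "(real^'n \<Rightarrow> 'b::euclidean_space) \<Rightarrow> real^'n \<Rightarrow> 'c::euclidean_space"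
  assumes L: "L > 0" and B: "\<And>v. v \<in> L2per L \<Longrightarrow> B v \<in> L2per L"
    and lip: "\<And>v w. v \<in> L2per L \<Longrightarrow> w \<in> L2per L \<Longrightarrow> L2_nrm L (\<lambda>x. B v x - B w x) \<le> C * L2_nrm L (\<lambda>x. v x - w x)"
    and X: "\<And>m. X m \<in> borel_measurable G" and sp: "space G = space M"
    and U: "AE \<omega> in M. U \<omega> \<in> L2per L \<and> (\<forall>m. fcoef L m (U \<omega>) = X m \<omega>)"
  obtains Z where "\<And>m. Z m \<in> borel_measurable G" "AE \<omega> in M. \<forall>m. fcoef L m (B (U \<omega>)) = Z m \<omega>"
proof -
  have "\<forall>m. \<exists>F. (\<forall>i. simple_function G (F i)) \<and> (\<forall>\<omega>\<in>space G. (\<lambda>i. F i \<omega>) \<longlonglongrightarrow> X m \<omega>)"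
    using borel_measurable_implies_sequence_metric[OF X] by blast
  then obtain s where s: "\<And>m i. simple_function G (s m i)"
    and slim: "\<And>m \<omega>. \<omega> \<in> space G \<Longrightarrow> (\<lambda>i. s m i \<omega>) \<longlonglongrightarrow> X m \<omega>" by metis
  define V where "V K i \<omega> = psum L K (\<lambda>m. s m i \<omega>)" for K i \<omega>
  \<comment> \<open>Any map of a simple function is simple, so \<open>B\<close> may be applied
    before limits are taken. The inner limit refines the random coefficients with finitely many
    modes fixed; the outer one adds the remaining modes.\<close>
  define Z where "Z m \<omega> = lim (\<lambda>K. lim (\<lambda>i. fcoef L m (B (V K i \<omega>))))" for m \<omega>
  have Vsimple: "simple_function G (V K i)" for K i
    unfolding V_def psum_def[abs_def] by (rule simple_function_hartley_sum[OF finite_cube s])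
  have P: "psum L K a \<in> L2per L" for K and a :: "int^'n \<Rightarrow> 'b" by (rule psum_L2per[OF L])
  have clip: "norm (fcoef L m (B v) - fcoef L m (B w)) \<le> C * L2_nrm L (\<lambda>x. v x - w x)"
    if "v \<in> L2per L" "w \<in> L2per L" for m v w
  proof -
    have "norm (fcoef L m (\<lambda>x. B v x - B w x)) \<le> C * L2_nrm L (\<lambda>x. v x - w x)"
      using norm_fcoef_le[OF L L2per_diff[OF B[OF that(1)] B[OF that(2)]]] lip[OF that] by (rule order_trans)
    then show ?thesis by (simp only: fcoef_diff[OF L B[OF that(1)] B[OF that(2)]])
  qed
  have clim: "(\<lambda>j. fcoef L m (B (v j))) \<longlonglongrightarrow> fcoef L m (B w)"
    if "\<And>j. v j \<in> L2per L" "w \<in> L2per L" "(\<lambda>j::nat. L2_nrm L (\<lambda>x. v j x - w x)) \<longlonglongrightarrow> 0" for m v w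
  proof -
    have "(\<lambda>j. C * L2_nrm L (\<lambda>x. v j x - w x)) \<longlonglongrightarrow> 0" using tendsto_mult_right_zero[OF that(3)] .
    then have "(\<lambda>j. fcoef L m (B (v j)) - fcoef L m (B w)) \<longlonglongrightarrow> 0"
      by (rule Lim_null_comparison[rotated]) (intro always_eventually allI clip that)
    then show ?thesis by (rule LIM_zero_cancel)
  qed
  have inner: "(\<lambda>i. fcoef L m (B (V K i \<omega>))) \<longlonglongrightarrow> fcoef L m (B (psum L K (\<lambda>m. X m \<omega>)))"
    if "\<omega> \<in> space G" for K m \<omega>
    unfolding V_def
  proof (rule clim[OF P P])
    have "(L2_nrm L (\<lambda>x. psum L K (\<lambda>m. s m i \<omega>) x - psum L K (\<lambda>m. X m \<omega>) x))\<^sup>2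
        = (\<Sum>m\<in>cube K. (norm (s m i \<omega> - X m \<omega>))\<^sup>2)" for i
      unfolding psum_def sum_subtractf[symmetric] scaleR_diff_right[symmetric]
      by (rule L2_nrm_hartley_sum[OF L finite_cube])
    moreover have "(\<lambda>i. \<Sum>m\<in>cube K. (norm (s m i \<omega> - X m \<omega>))\<^sup>2) \<longlonglongrightarrow> (\<Sum>m\<in>(cube K :: (int^'n) set). (norm (X m \<omega> - X m \<omega>))\<^sup>2)"
      by (intro tendsto_sum tendsto_power tendsto_norm tendsto_diff slim[OF that] tendsto_const)
    ultimately have "(\<lambda>i. (L2_nrm L (\<lambda>x. psum L K (\<lambda>m. s m i \<omega>) x - psum L K (\<lambda>m. X m \<omega>) x))\<^sup>2) \<longlonglongrightarrow> 0"
      by simp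
    from tendsto_real_sqrt[OF this]
    show "(\<lambda>i. L2_nrm L (\<lambda>x. psum L K (\<lambda>m. s m i \<omega>) x - psum L K (\<lambda>m. X m \<omega>) x)) \<longlonglongrightarrow> 0" by simp
  qed
  show ?thesis
  proof (rule that)
    show "Z m \<in> borel_measurable G" for m
      unfolding Z_def
      by (intro borel_measurable_lim_metric borel_measurable_simple_function simple_function_compose1[OF Vsimple])
    show "AE \<omega> in M. \<forall>m. fcoef L m (B (U \<omega>)) = Z m \<omega>"
      using U AE_space
    proof eventually_elim
      case (elim \<omega>)
      then have U\<omega>: "U \<omega> \<in> L2per L" and c: "(\<lambda>m. fcoef L m (U \<omega>)) = (\<lambda>m. X m \<omega>)" and \<omega>: "\<omega> \<in> space G"
        using sp by auto
      have "(\<lambda>K. L2_nrm L (\<lambda>x. U \<omega> x - psum L K (\<lambda>m. X m \<omega>) x)) \<longlonglongrightarrow> 0"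
        using psum_fcoef_tendsto[OF L U\<omega>] unfolding c .
      moreover have "L2_nrm L (\<lambda>x. U \<omega> x - v x) = L2_nrm L (\<lambda>x. v x - U \<omega> x)" for v
        by (simp add: L2_nrm_def L2_ip_def power2_norm_eq_inner[symmetric] norm_minus_commute)
      ultimately have "(\<lambda>K. L2_nrm L (\<lambda>x. psum L K (\<lambda>m. X m \<omega>) x - U \<omega> x)) \<longlonglongrightarrow> 0" by simp
      from clim[OF P U\<omega> this] have "(\<lambda>K. fcoef L m (B (psum L K (\<lambda>m. X m \<omega>)))) \<longlonglongrightarrow> fcoef L m (B (U \<omega>))" for m .
      then show ?case
        unfolding Z_def limI[OF inner[OF \<omega>]] by (auto intro!: limI[symmetric])
    qed
  qed
qed

section \<open>Independence, second moments and exchange of sums with expectations\<close>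

lemma (in prob_space) indep_var_of_indep_set:
  assumes G: "subalgebra M G" and ind: "indep_set (sets G) {w -` A \<inter> space M | A. A \<in> sets borel}"
    and X: "X \<in> borel_measurable G" and w: "w \<in> borel_measurable M"
  shows "indep_var borel X borel w"
proof -
  have sp: "space G = space M" "sets G \<subseteq> sets M" using G by (auto simp: subalgebra_def)
  let ?W = "{w -` A \<inter> space M | A. A \<in> sets borel}"
  have stable: "Int_stable ?W"
  proof (rule Int_stableI)
    fix a b assume "a \<in> ?W" "b \<in> ?W"
    then obtain A B where "A \<in> sets borel" "B \<in> sets borel" "a = w -` A \<inter> space M" "b = w -` B \<inter> space M" by blast
    then have "a \<inter> b = w -` (A \<inter> B) \<inter> space M \<and> A \<inter> B \<in> sets borel" by auto
    then show "a \<inter> b \<in> ?W" by blast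
  qed
  have GG: "sigma_sets (space M) (sets G) = sets G"
    unfolding sp(1)[symmetric] by (rule sets.sigma_sets_eq)
  have 1: "indep_set (sets G) (sigma_sets (space M) ?W)"
    using indep_set_sigma_sets[OF ind sets.Int_stable stable] unfolding GG .
  have "sigma_sets (space M) {X -` A \<inter> space M | A. A \<in> sets borel} \<subseteq> sets G"
    unfolding sp(1)[symmetric] by (rule sets.sigma_sets_subset) (use measurable_sets[OF X] in auto)
  with 1 have "indep_set (sigma_sets (space M) {X -` A \<inter> space M | A. A \<in> sets borel}) (sigma_sets (space M) ?W)"
    unfolding indep_sets2_eq by blast
  then show ?thesis
    unfolding indep_var_eq using measurable_from_subalg[OF G X] w by simp
qed

lemma nn_integral_finite_imp_integrable:
  assumes "f \<in> borel_measurable M" "\<And>x. f x \<ge> (0::real)" "(\<integral>\<^sup>+x. ennreal (f x) \<partial>M) < \<infinity>"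
  shows "integrable M f"
  by (rule integrableI_bounded) (use assms in auto)

text \<open>The cross term is the inner product of \<open>X\<close> and \<open>H\<close> times
  \<open>w\<close>, and has mean zero by independence and centredness of \<open>w\<close>. Finite
  second moments are assumed so that this term is integrable.\<close>

lemma (in prob_space) gaussian_increment_second_moment:
  fixes X H :: "'a \<Rightarrow> real^'n"
  assumes G: "subalgebra M G" and ind: "indep_set (sets G) {w -` A \<inter> space M | A. A \<in> sets borel}"
    and w: "distributed M lborel w (normal_density 0 (sqrt k))" and k: "k > 0"
    and X: "X \<in> borel_measurable G" "(\<integral>\<^sup>+\<omega>. ennreal ((norm (X \<omega>))\<^sup>2) \<partial>M) < \<infinity>"
    and H: "H \<in> borel_measurable G" "(\<integral>\<^sup>+\<omega>. ennreal ((norm (H \<omega>))\<^sup>2) \<partial>M) < \<infinity>"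
  shows "(\<integral>\<^sup>+\<omega>. ennreal ((norm (X \<omega> + w \<omega> *\<^sub>R H \<omega>))\<^sup>2) \<partial>M)
    = (\<integral>\<^sup>+\<omega>. ennreal ((norm (X \<omega>))\<^sup>2) \<partial>M) + ennreal k * (\<integral>\<^sup>+\<omega>. ennreal ((norm (H \<omega>))\<^sup>2) \<partial>M)"
proof -
  have wm: "w \<in> borel_measurable M" using w by (auto simp: distributed_def)
  have XM: "X \<in> borel_measurable M" and HM: "H \<in> borel_measurable M"
    using measurable_from_subalg[OF G] X(1) H(1) by auto
  have iX: "integrable M (\<lambda>\<omega>. (norm (X \<omega>))\<^sup>2)" and iH: "integrable M (\<lambda>\<omega>. (norm (H \<omega>))\<^sup>2)"
    using XM HM X(2) H(2) by (auto intro!: nn_integral_finite_imp_integrable)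
  have sk: "sqrt k > 0" using k by simp
  have Ew: "expectation w = 0" by (rule normal_distributed_expectation[OF sk w])
  have iw: "integrable M w"
    by (rule distributed_integrable_var[OF w]) (auto intro: integrable_normal_moment_nz_1[OF sk])
  have "integrable lborel (\<lambda>x. normal_density 0 (sqrt k) x * (x - 0)\<^sup>2)" by (rule integrable_normal_moment[OF sk])
  then have iw2: "integrable M (\<lambda>\<omega>. (w \<omega>)\<^sup>2)"
    using distributed_integrable[OF w, of "\<lambda>x. x\<^sup>2"] by simp
  have Ew2: "expectation (\<lambda>\<omega>. (w \<omega>)\<^sup>2) = k"
    using normal_distributed_variance[OF sk w] k by (simp add: Ew)
  have iXH: "integrable M (\<lambda>\<omega>. X \<omega> \<bullet> H \<omega>)" by (rule integrable_inner_square[OF XM HM iX iH])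
  have wms: "(\<lambda>\<omega>. (w \<omega>)\<^sup>2) \<in> borel_measurable M" using wm by measurable
  have ind1: "indep_var borel (\<lambda>\<omega>. X \<omega> \<bullet> H \<omega>) borel w"
    using X(1) H(1) by (intro indep_var_of_indep_set[OF G ind _ wm]) measurable
  have "indep_var borel (\<lambda>\<omega>. (norm (H \<omega>))\<^sup>2) borel w"
    using H(1) by (intro indep_var_of_indep_set[OF G ind _ wm]) measurable
  then have "indep_var borel ((\<lambda>x. x) \<circ> (\<lambda>\<omega>. (norm (H \<omega>))\<^sup>2)) borel ((\<lambda>x. x\<^sup>2) \<circ> w)"
    by (rule indep_var_compose) auto
  then have ind2: "indep_var borel (\<lambda>\<omega>. (norm (H \<omega>))\<^sup>2) borel (\<lambda>\<omega>. (w \<omega>)\<^sup>2)" by (simp add: o_def)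
  note c1 = indep_var_lebesgue_integral[OF ind1 iXH iw] indep_var_integrable[OF ind1 iXH iw]
  note c2 = indep_var_lebesgue_integral[OF ind2 iH iw2] indep_var_integrable[OF ind2 iH iw2]
  have eq: "(norm (X \<omega> + w \<omega> *\<^sub>R H \<omega>))\<^sup>2 = (norm (X \<omega>))\<^sup>2 + (2 * ((X \<omega> \<bullet> H \<omega>) * w \<omega>) + (norm (H \<omega>))\<^sup>2 * (w \<omega>)\<^sup>2)" for \<omega>
    unfolding power2_norm_eq_inner by (simp add: inner_add_left inner_add_right inner_commute power2_eq_square algebra_simps)
  have int: "integrable M (\<lambda>\<omega>. (norm (X \<omega> + w \<omega> *\<^sub>R H \<omega>))\<^sup>2)"
    unfolding eq using iX c1(2) c2(2) by simp
  have "expectation (\<lambda>\<omega>. (norm (X \<omega> + w \<omega> *\<^sub>R H \<omega>))\<^sup>2)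
      = expectation (\<lambda>\<omega>. (norm (X \<omega>))\<^sup>2) + k * expectation (\<lambda>\<omega>. (norm (H \<omega>))\<^sup>2)"
    unfolding eq using iX c1 c2 by (simp add: Ew Ew2 mult.commute)
  moreover have "0 \<le> expectation (\<lambda>\<omega>. (norm (X \<omega>))\<^sup>2)" "0 \<le> expectation (\<lambda>\<omega>. (norm (H \<omega>))\<^sup>2)"
    by (auto intro!: Bochner_Integration.integral_nonneg)
  ultimately show ?thesis
    using k by (simp add: nn_integral_eq_integral[OF int] nn_integral_eq_integral[OF iX] nn_integral_eq_integral[OF iH] ennreal_mult)
qed

text \<open>Monotone convergence along the cubes, in place of Tonelli's theorem on a product space.
  Measurability of the sum over all modes comes from writing it as a \<open>liminf\<close>.\<close>

lemma nn_integral_mode_swap: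
  fixes f :: "int^'n \<Rightarrow> 'a \<Rightarrow> ennreal"
  assumes "\<And>m. f m \<in> borel_measurable M"
  shows "(\<integral>\<^sup>+\<omega>. (\<integral>\<^sup>+m. f m \<omega> \<partial>count_space UNIV) \<partial>M) = (\<integral>\<^sup>+m. (\<integral>\<^sup>+\<omega>. f m \<omega> \<partial>M) \<partial>count_space UNIV)"
    "(\<lambda>\<omega>. \<integral>\<^sup>+m. f m \<omega> \<partial>count_space UNIV) \<in> borel_measurable M"
proof -
  have lim: "(\<lambda>K. \<Sum>m\<in>cube K. f m \<omega>) \<longlonglongrightarrow> (\<integral>\<^sup>+m. f m \<omega> \<partial>count_space UNIV)" for \<omega>
    by (rule sum_cube_tendsto_nn_integral)
  show "(\<lambda>\<omega>. \<integral>\<^sup>+m. f m \<omega> \<partial>count_space UNIV) \<in> borel_measurable M"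
  proof -
    have "(\<lambda>\<omega>. \<integral>\<^sup>+m. f m \<omega> \<partial>count_space UNIV) = (\<lambda>\<omega>. liminf (\<lambda>K. \<Sum>m\<in>cube K. f m \<omega>))"
      using lim_imp_Liminf[OF trivial_limit_sequentially lim] by (simp add: fun_eq_iff)
    then show ?thesis using assms by (simp add: borel_measurable_liminf)
  qed
  have "(\<lambda>K. \<integral>\<^sup>+\<omega>. (\<Sum>m\<in>cube K. f m \<omega>) \<partial>M) \<longlonglongrightarrow> (\<integral>\<^sup>+\<omega>. (\<integral>\<^sup>+m. f m \<omega> \<partial>count_space UNIV) \<partial>M)"
    by (rule nn_integral_LIMSEQ[OF _ _ lim])
      (use assms in \<open>auto simp: incseq_def le_fun_def intro!: sum_mono2 dest: cube_mono\<close>)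
  moreover have "(\<integral>\<^sup>+\<omega>. (\<Sum>m\<in>cube K. f m \<omega>) \<partial>M) = (\<Sum>m\<in>cube K. \<integral>\<^sup>+\<omega>. f m \<omega> \<partial>M)" for K
    using assms by (intro nn_integral_sum) auto
  ultimately have "(\<lambda>K. \<Sum>m\<in>cube K. \<integral>\<^sup>+\<omega>. f m \<omega> \<partial>M) \<longlonglongrightarrow> (\<integral>\<^sup>+\<omega>. (\<integral>\<^sup>+m. f m \<omega> \<partial>count_space UNIV) \<partial>M)" by simp
  then show "(\<integral>\<^sup>+\<omega>. (\<integral>\<^sup>+m. f m \<omega> \<partial>count_space UNIV) \<partial>M) = (\<integral>\<^sup>+m. (\<integral>\<^sup>+\<omega>. f m \<omega> \<partial>M) \<partial>count_space UNIV)"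
    using sum_cube_tendsto_nn_integral LIMSEQ_unique by blast
qed

section \<open>Comparison of norms\<close>

lemma H_seminorm_sq_nonneg: "H_seminorm_sq j L v \<ge> 0"
  by (induction j arbitrary: v) (auto intro: sum_nonneg)

lemma L2_nrm_le_H_nrm: "L2_nrm L v \<le> H_nrm l L v"
proof -
  have "H_seminorm_sq 0 L v \<le> (\<Sum>j\<le>l. H_seminorm_sq j L v)"
    by (rule member_le_sum) (auto simp: H_seminorm_sq_nonneg simp del: H_seminorm_sq.simps)
  then have "sqrt ((L2_nrm L v)\<^sup>2) \<le> H_nrm l L v"
    unfolding H_nrm_def by (intro real_sqrt_le_mono) simp
  then show ?thesis by simp
qed

lemma H_nrm_mono: "j \<le> l \<Longrightarrow> H_nrm j L v \<le> H_nrm l L v"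
  unfolding H_nrm_def by (intro real_sqrt_le_mono sum_mono2) (auto simp: H_seminorm_sq_nonneg)

lemma H_nrm_nonneg: "H_nrm l L v \<ge> 0"
  by (simp add: H_nrm_def sum_nonneg H_seminorm_sq_nonneg)

text \<open>A squared triangle inequality in H1. It goes through the coefficients, which are exactly
  linear, whereas \<open>wderiv\<close> is linear only up to null sets.\<close>

lemma Hper_1_add_bound:
  fixes v w :: "real^'n \<Rightarrow> 'b::euclidean_space"
  assumes "L > 0" "v \<in> Hper 1 L" "w \<in> Hper 1 L"
  shows "(H_nrm 1 L v)\<^sup>2 \<le> 2 * (H_nrm 1 L w)\<^sup>2 + 2 * (H_nrm 1 L (v - w))\<^sup>2"
    and "v - w \<in> Hper 1 L"
proof -
  have v: "v \<in> L2per L" and w: "w \<in> L2per L" using assms Hper_L2per by blast+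
  have c: "fcoef L m (v - w) = fcoef L m v - fcoef L m w" for m
    unfolding fun_diff_def by (rule fcoef_diff[OF assms(1) v w])
  have sq: "(norm (a - b))\<^sup>2 \<le> 2 * (norm a)\<^sup>2 + 2 * (norm b)\<^sup>2" "(norm a)\<^sup>2 \<le> 2 * (norm b)\<^sup>2 + 2 * (norm (a - b))\<^sup>2" for a b :: 'b
    using zero_le_power2[of "norm (a + b)"] zero_le_power2[of "norm (a - 2 *\<^sub>R b)"]
    unfolding power2_norm_eq_inner
    by (simp_all add: inner_add_left inner_add_right inner_diff_left inner_diff_right inner_commute)
  have "(\<integral>\<^sup>+m. ennreal (stokes_ev L m * (norm (fcoef L m (v - w)))\<^sup>2) \<partial>count_space UNIV)
      \<le> (\<integral>\<^sup>+m. ennreal 2 * ennreal (stokes_ev L m * (norm (fcoef L m v))\<^sup>2) + ennreal 2 * ennreal (stokes_ev L m * (norm (fcoef L m w))\<^sup>2) \<partial>count_space UNIV)"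
  proof (rule nn_integral_mono)
    fix m
    let ?l = "\<lambda>m. stokes_ev L m * (norm (fcoef L m (v - w)))\<^sup>2"
    let ?r = "\<lambda>m. 2 * (stokes_ev L m * (norm (fcoef L m v))\<^sup>2) + 2 * (stokes_ev L m * (norm (fcoef L m w))\<^sup>2)"
    have "?l m \<le> stokes_ev L m * (2 * (norm (fcoef L m v))\<^sup>2 + 2 * (norm (fcoef L m w))\<^sup>2)"
      unfolding c by (intro mult_left_mono sq) simp
    also have "\<dots> = 2 * (stokes_ev L m * (norm (fcoef L m v))\<^sup>2) + 2 * (stokes_ev L m * (norm (fcoef L m w))\<^sup>2)" by (simp only: distrib_left mult.left_commute)
    finally have le: "?l m \<le> ?r m" .
    from ennreal_leI[OF le] show "ennreal (stokes_ev L m * (norm (fcoef L m (v - w)))\<^sup>2)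
        \<le> ennreal 2 * ennreal (stokes_ev L m * (norm (fcoef L m v))\<^sup>2) + ennreal 2 * ennreal (stokes_ev L m * (norm (fcoef L m w))\<^sup>2)"
      by (simp only: ennreal_plus ennreal_mult zero_le_power2 mult_nonneg_nonneg add_nonneg_nonneg zero_le_numeral zero_le_one)
  qed
  also have "\<dots> < \<infinity>"
    by (simp add: nn_integral_add nn_integral_cmult Parseval_grad[OF assms(1,2), symmetric] Parseval_grad[OF assms(1,3), symmetric] ennreal_mult_less_top)
  finally show d: "v - w \<in> Hper 1 L"
    by (intro Hper_1I assms) (auto simp: fun_diff_def intro!: L2per_diff v w)
  have "ennreal ((H_nrm 1 L v)\<^sup>2) \<le> (\<integral>\<^sup>+m. ennreal 2 * ennreal ((1 + stokes_ev L m) * (norm (fcoef L m w))\<^sup>2)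
      + ennreal 2 * ennreal ((1 + stokes_ev L m) * (norm (fcoef L m (v - w)))\<^sup>2) \<partial>count_space UNIV)"
    unfolding Parseval_H1[OF assms(1,2)]
  proof (rule nn_integral_mono)
    fix m
    let ?l = "\<lambda>m. (1 + stokes_ev L m) * (norm (fcoef L m v))\<^sup>2"
    let ?r = "\<lambda>m. 2 * ((1 + stokes_ev L m) * (norm (fcoef L m w))\<^sup>2) + 2 * ((1 + stokes_ev L m) * (norm (fcoef L m (v - w)))\<^sup>2)"
    have "?l m \<le> (1 + stokes_ev L m) * (2 * (norm (fcoef L m w))\<^sup>2 + 2 * (norm (fcoef L m (v - w)))\<^sup>2)"
      unfolding c by (intro mult_left_mono sq) simp
    also have "\<dots> = 2 * ((1 + stokes_ev L m) * (norm (fcoef L m w))\<^sup>2) + 2 * ((1 + stokes_ev L m) * (norm (fcoef L m (v - w)))\<^sup>2)"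
      by (simp only: distrib_left mult.left_commute)
    finally have le: "?l m \<le> ?r m" .
    from ennreal_leI[OF le] show "ennreal ((1 + stokes_ev L m) * (norm (fcoef L m v))\<^sup>2) \<le> ennreal 2 * ennreal ((1 + stokes_ev L m) * (norm (fcoef L m w))\<^sup>2)
      + ennreal 2 * ennreal ((1 + stokes_ev L m) * (norm (fcoef L m (v - w)))\<^sup>2)"
      by (simp only: ennreal_plus ennreal_mult zero_le_power2 mult_nonneg_nonneg add_nonneg_nonneg zero_le_numeral zero_le_one)
  qed
  also have "\<dots> = ennreal 2 * ennreal ((H_nrm 1 L w)\<^sup>2) + ennreal 2 * ennreal ((H_nrm 1 L (v - w))\<^sup>2)"
    unfolding Parseval_H1[OF assms(1,3)] Parseval_H1[OF assms(1) d] by (simp add: nn_integral_add nn_integral_cmult)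
  also have "\<dots> = ennreal (2 * (H_nrm 1 L w)\<^sup>2 + 2 * (H_nrm 1 L (v - w))\<^sup>2)"
    by (simp only: ennreal_plus ennreal_mult zero_le_power2 mult_nonneg_nonneg zero_le_numeral)
  finally show "(H_nrm 1 L v)\<^sup>2 \<le> 2 * (H_nrm 1 L w)\<^sup>2 + 2 * (H_nrm 1 L (v - w))\<^sup>2"
    by (subst (asm) ennreal_le_iff) auto
qed

text \<open>Both suprema in the norm are over nonempty bounded sets of nonnegative numbers, so that
  \<open>Sup\<close> is not a junk value.\<close>

lemma H_nrm_le_holder_H1_nrm:
  assumes "L > 0" "T > 0" "g \<in> holder_H1 a T L" "a > 0" "t \<in> {0..T}"
  shows "H_nrm 1 L (g t) \<le> holder_H1_nrm a T L g"
proof -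
  obtain K where g: "\<And>t. t \<in> {0..T} \<Longrightarrow> g t \<in> Hper 1 L"
    and K: "\<And>s t. s \<in> {0..T} \<Longrightarrow> t \<in> {0..T} \<Longrightarrow> H_nrm 1 L (g t - g s) \<le> K * \<bar>t - s\<bar> powr a"
    using assms(3) unfolding holder_H1_def by blast
  have bdd1: "bdd_above ((\<lambda>t. H_nrm 1 L (g t)) ` {0..T})"
  proof (rule bdd_aboveI2)
    fix s assume s: "s \<in> {0..T}"
    have "\<bar>s - 0\<bar> powr a \<le> T powr a" using s assms(4) by (intro powr_mono2) auto
    then have "\<bar>K\<bar> * \<bar>s - 0\<bar> powr a \<le> \<bar>K\<bar> * T powr a" by (intro mult_left_mono) auto
    moreover have "K * \<bar>s - 0\<bar> powr a \<le> \<bar>K\<bar> * \<bar>s - 0\<bar> powr a" by (intro mult_right_mono) auto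
    moreover have "H_nrm 1 L (g s - g 0) \<le> K * \<bar>s - 0\<bar> powr a" using K[of 0 s] s assms(2) by simp
    ultimately have "H_nrm 1 L (g s - g 0) \<le> \<bar>K\<bar> * T powr a" by linarith
    then have "(H_nrm 1 L (g s - g 0))\<^sup>2 \<le> (\<bar>K\<bar> * T powr a)\<^sup>2" by (intro power_mono H_nrm_nonneg)
    moreover have "(H_nrm 1 L (g s))\<^sup>2 \<le> 2 * (H_nrm 1 L (g 0))\<^sup>2 + 2 * (H_nrm 1 L (g s - g 0))\<^sup>2"
      using s assms(2) by (intro Hper_1_add_bound(1)[OF assms(1)] g) auto
    ultimately have "(H_nrm 1 L (g s))\<^sup>2 \<le> 2 * (H_nrm 1 L (g 0))\<^sup>2 + 2 * (\<bar>K\<bar> * T powr a)\<^sup>2" by linarith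
    then show "H_nrm 1 L (g s) \<le> sqrt (2 * (H_nrm 1 L (g 0))\<^sup>2 + 2 * (\<bar>K\<bar> * T powr a)\<^sup>2)"
      by (rule real_le_rsqrt)
  qed
  let ?P = "{(s, t). s \<in> {0..T} \<and> t \<in> {0..T} \<and> s \<noteq> t}"
  let ?q = "\<lambda>(s, t). H_nrm 1 L (g t - g s) / \<bar>t - s\<bar> powr a"
  have bdd2: "bdd_above (?q ` ?P)"
  proof (rule bdd_aboveI2)
    fix p assume "p \<in> ?P"
    then obtain s t where p: "p = (s, t)" "s \<in> {0..T}" "t \<in> {0..T}" "s \<noteq> t" by blast
    then have "\<bar>t - s\<bar> powr a > 0" by simp
    then show "?q p \<le> K" using K[OF p(2,3)] p(1) by (simp add: pos_divide_le_eq)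
  qed
  have "(0, T) \<in> ?P" using assms(2) by auto
  then have "?q (0, T) \<le> (SUP p\<in>?P. ?q p)" by (intro cSUP_upper bdd2)
  moreover have "?q (0, T) \<ge> 0" by (simp add: H_nrm_nonneg)
  ultimately have "0 \<le> (SUP p\<in>?P. ?q p)" by linarith
  moreover have "H_nrm 1 L (g t) \<le> (SUP t\<in>{0..T}. H_nrm 1 L (g t))" by (intro cSUP_upper bdd1 assms)
  ultimately show ?thesis unfolding holder_H1_nrm_def by linarith
qed

section \<open>The energy estimate\<close>

text \<open>Young's inequality with weight \<open>k\<close>; the difference of the two sides is
  \<open>k |a - b|^2\<close>. The old value is enlarged only by the factor \<open>1 + k\<close>,
  which survives about \<open>T / k\<close> steps.\<close>

lemma norm_add_power2_weighted:
  fixes a b :: "'a::real_inner"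
  assumes "k > 0"
  shows "(norm (a + k *\<^sub>R b))\<^sup>2 \<le> (1 + k) * (norm a)\<^sup>2 + (k + k\<^sup>2) * (norm b)\<^sup>2"
proof -
  have "0 \<le> k * (norm (a - b))\<^sup>2" using assms by simp
  also have "\<dots> = (1 + k) * (norm a)\<^sup>2 + (k + k\<^sup>2) * (norm b)\<^sup>2 - (norm (a + k *\<^sub>R b))\<^sup>2"
    unfolding power2_norm_eq_inner
    by (simp add: inner_add_left inner_add_right inner_diff_left inner_diff_right inner_commute power2_eq_square algebra_simps)
  finally show ?thesis by simp
qed

lemma nn_integral_count_space_ge: "f m \<le> (\<integral>\<^sup>+m. f m \<partial>count_space UNIV)"
proof -
  have "f m = (\<integral>\<^sup>+n. f n * indicator {m} n \<partial>count_space UNIV)"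
    by (subst nn_integral_count_space'[of "{m}"]) auto
  also have "\<dots> \<le> (\<integral>\<^sup>+m. f m \<partial>count_space UNIV)" by (intro nn_integral_mono) (auto simp: indicator_def)
  finally show ?thesis .
qed

text \<open>The scheme with all function spaces removed: countably many finite-dimensional
  recursions, coupled only through \<open>Z_bound\<close>. \<open>X\<close>, \<open>Y\<close>,
  \<open>Z\<close> are versions of the coefficients of velocity, force and noise coefficient, and
  \<open>w\<close> are the Brownian increments.\<close>

locale coefficient_scheme = prob_space M for M :: "'w measure" +
  fixes L T k K \<Phi> Y0 :: real and N :: nat and G :: "nat \<Rightarrow> 'w measure"
    and X Y Z :: "nat \<Rightarrow> int^'n \<Rightarrow> 'w \<Rightarrow> real^'n" and w :: "nat \<Rightarrow> 'w \<Rightarrow> real"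
  assumes L: "L > 0" and k: "k > 0" "k \<le> T" and kN: "real N * k = T"
    and nonneg: "K \<ge> 0" "\<Phi> \<ge> 0" "Y0 \<ge> 0"
    and G: "\<And>n. n \<le> N \<Longrightarrow> subalgebra M (G n)"
    and X: "\<And>n m. n \<le> N \<Longrightarrow> X n m \<in> borel_measurable (G n)"
    and Z: "\<And>n m. n < N \<Longrightarrow> Z n m \<in> borel_measurable (G n)"
    and Y: "\<And>n m. n \<le> N \<Longrightarrow> Y n m \<in> borel_measurable M"
    and w: "\<And>n. n < N \<Longrightarrow> distributed M lborel (w n) (normal_density 0 (sqrt k))"
    and ind: "\<And>n. n < N \<Longrightarrow> indep_set (sets (G n)) {w n -` A \<inter> space M | A. A \<in> sets borel}"
    and rec: "\<And>n. n < N \<Longrightarrow> AE \<omega> in M. \<forall>m. (1 + k * stokes_ev L m) *\<^sub>R X (Suc n) m \<omega>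
        = X n m \<omega> + k *\<^sub>R leray L m (Y (Suc n) m \<omega>) + w n \<omega> *\<^sub>R leray L m (Z n m \<omega>)"
    and Z_bound: "\<And>n. n < N \<Longrightarrow>
        (\<integral>\<^sup>+m. ennreal (1 + stokes_ev L m) * (\<integral>\<^sup>+\<omega>. ennreal ((norm (Z n m \<omega>))\<^sup>2) \<partial>M) \<partial>count_space UNIV)
        \<le> ennreal K * (1 + (\<integral>\<^sup>+m. ennreal (1 + stokes_ev L m) * (\<integral>\<^sup>+\<omega>. ennreal ((norm (X n m \<omega>))\<^sup>2) \<partial>M) \<partial>count_space UNIV))"
    and Y_bound: "\<And>n. n < N \<Longrightarrow>
        (\<integral>\<^sup>+m. ennreal (1 + stokes_ev L m) * (\<integral>\<^sup>+\<omega>. ennreal ((norm (Y (Suc n) m \<omega>))\<^sup>2) \<partial>M) \<partial>count_space UNIV) \<le> ennreal \<Phi>"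
    and X0_bound: "(\<integral>\<^sup>+m. ennreal (1 + stokes_ev L m) * (\<integral>\<^sup>+\<omega>. ennreal ((norm (X 0 m \<omega>))\<^sup>2) \<partial>M) \<partial>count_space UNIV) \<le> ennreal Y0"
begin


definition "eX n m = (\<integral>\<^sup>+\<omega>. ennreal ((norm (X n m \<omega>))\<^sup>2) \<partial>M)"
definition "eY n m = (\<integral>\<^sup>+\<omega>. ennreal ((norm (Y n m \<omega>))\<^sup>2) \<partial>M)"
definition "eZ n m = (\<integral>\<^sup>+\<omega>. ennreal ((norm (Z n m \<omega>))\<^sup>2) \<partial>M)"

definition "energy n = (\<integral>\<^sup>+m. ennreal (1 + stokes_ev L m) * eX n m \<partial>count_space UNIV)"
text \<open>The second factor of the weight is \<open>(1 + k \<lambda>)^2 - 1\<close>, the surplus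
  of the implicit step. Its linear term controls the Stokes operator, its quadratic term the
  increments.\<close>

definition "dissipation n = (\<integral>\<^sup>+m. ennreal ((1 + stokes_ev L m) * (2 * k * stokes_ev L m + k\<^sup>2 * (stokes_ev L m)\<^sup>2)) * eX n m \<partial>count_space UNIV)"

text \<open>Rates of the one-step inequality: a step multiplies the energy by
  \<open>1 + \<alpha> k\<close> and adds \<open>\<beta> k\<close>, once the factor
  \<open>1 + k\<close> from Young's inequality is estimated by \<open>1 + T\<close>.
  \<open>bound\<close> is the resulting Gronwall constant and contains no \<open>k\<close>.\<close>

definition "\<alpha> = 1 + (1 + T) * K"
definition "\<beta> = (1 + T) * (K + \<Phi>)"
definition "bound = exp (\<alpha> * T) * (Y0 + T * \<beta>)"

lemma T_pos: "T > 0" using k by linarith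

lemma \<alpha>_pos: "\<alpha> > 0" and \<beta>_nonneg: "\<beta> \<ge> 0" and bound_nonneg: "bound \<ge> 0"
proof -
  show a: "\<alpha> > 0" "\<beta> \<ge> 0" using T_pos nonneg by (auto simp: \<alpha>_def \<beta>_def add_pos_nonneg)
  then show "bound \<ge> 0" using T_pos nonneg by (auto simp: bound_def)
qed

lemma X_M: "n \<le> N \<Longrightarrow> X n m \<in> borel_measurable M"
  using measurable_from_subalg[OF G X] .

lemma Z_M: "n < N \<Longrightarrow> Z n m \<in> borel_measurable M"
  using measurable_from_subalg[OF G Z] by simp

lemma w_M: "n < N \<Longrightarrow> w n \<in> borel_measurable M"
  using w by (auto simp: distributed_def)

lemma leray_le: "(\<integral>\<^sup>+\<omega>. ennreal ((norm (leray L m (V \<omega>)))\<^sup>2) \<partial>M) \<le> (\<integral>\<^sup>+\<omega>. ennreal ((norm (V \<omega>))\<^sup>2) \<partial>M)"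
  by (intro nn_integral_mono ennreal_leI power_mono norm_leray_le) auto

lemma eZ_bound: "n < N \<Longrightarrow> (\<integral>\<^sup>+m. ennreal (1 + stokes_ev L m) * eZ n m \<partial>count_space UNIV) \<le> ennreal K * (1 + energy n)"
  using Z_bound[of n] by (simp only: eZ_def energy_def eX_def)

lemma eY_bound: "n < N \<Longrightarrow> (\<integral>\<^sup>+m. ennreal (1 + stokes_ev L m) * eY (Suc n) m \<partial>count_space UNIV) \<le> ennreal \<Phi>"
  using Y_bound[of n] by (simp only: eY_def)

text \<open>All weights are at least 1, so finite energy bounds every single mode. The Gaussian
  identity needs these moments, which is why finiteness of the energy is carried along the induction
  in time.\<close>

lemma finite_modes:
  assumes "n < N" "energy n < \<infinity>"
  shows "eX n m < \<infinity>" "eZ n m < \<infinity>"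
proof -
  have ge: "e m \<le> (\<integral>\<^sup>+m. ennreal (1 + stokes_ev L m) * e m \<partial>count_space UNIV)" for e :: "int^'n \<Rightarrow> ennreal"
  proof -
    have "1 \<le> ennreal (1 + stokes_ev L m)" by simp
    from mult_right_mono[OF this, of "e m"] have "e m \<le> ennreal (1 + stokes_ev L m) * e m" by simp
    also have "\<dots> \<le> (\<integral>\<^sup>+m. ennreal (1 + stokes_ev L m) * e m \<partial>count_space UNIV)"
      by (rule nn_integral_count_space_ge[of "\<lambda>m. ennreal (1 + stokes_ev L m) * e m"])
    finally show ?thesis .
  qed
  have "eX n m \<le> energy n" unfolding energy_def by (rule ge)
  then show "eX n m < \<infinity>" using assms(2) by (rule le_less_trans)
  have "eZ n m \<le> (\<integral>\<^sup>+m. ennreal (1 + stokes_ev L m) * eZ n m \<partial>count_space UNIV)"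
    by (rule ge)
  also have "\<dots> \<le> ennreal K * (1 + energy n)" by (rule eZ_bound[OF assms(1)])
  also have "\<dots> < \<infinity>" using assms(2) by (simp add: ennreal_mult_less_top)
  finally show "eZ n m < \<infinity>" .
qed

lemma increment_moment:
  assumes "n < N" "eX n m < \<infinity>" "eZ n m < \<infinity>"
  shows "(\<integral>\<^sup>+\<omega>. ennreal ((norm (X n m \<omega> + w n \<omega> *\<^sub>R leray L m (Z n m \<omega>)))\<^sup>2) \<partial>M) \<le> eX n m + ennreal k * eZ n m"
    and "(\<integral>\<^sup>+\<omega>. ennreal ((norm (w n \<omega> *\<^sub>R leray L m (Z n m \<omega>)))\<^sup>2) \<partial>M) \<le> ennreal k * eZ n m"
proof -
  have n: "n \<le> N" using assms(1) by simp
  have PZ: "(\<lambda>\<omega>. leray L m (Z n m \<omega>)) \<in> borel_measurable (G n)"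
    using measurable_compose[OF Z[OF assms(1)] leray_measurable] .
  have PZ_le: "(\<integral>\<^sup>+\<omega>. ennreal ((norm (leray L m (Z n m \<omega>)))\<^sup>2) \<partial>M) \<le> eZ n m"
    unfolding eZ_def by (rule leray_le)
  then have PZ_fin: "(\<integral>\<^sup>+\<omega>. ennreal ((norm (leray L m (Z n m \<omega>)))\<^sup>2) \<partial>M) < \<infinity>" using assms(3) by (rule le_less_trans)
  have "(\<integral>\<^sup>+\<omega>. ennreal ((norm (X n m \<omega> + w n \<omega> *\<^sub>R leray L m (Z n m \<omega>)))\<^sup>2) \<partial>M)
      = eX n m + ennreal k * (\<integral>\<^sup>+\<omega>. ennreal ((norm (leray L m (Z n m \<omega>)))\<^sup>2) \<partial>M)"
    unfolding eX_def
    by (rule gaussian_increment_second_moment[OF G[OF n] ind[OF assms(1)] w[OF assms(1)] k(1) X[OF n] assms(2)[unfolded eX_def] PZ PZ_fin])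
  also have "\<dots> \<le> eX n m + ennreal k * eZ n m" by (intro add_left_mono mult_left_mono PZ_le) simp
  finally show "(\<integral>\<^sup>+\<omega>. ennreal ((norm (X n m \<omega> + w n \<omega> *\<^sub>R leray L m (Z n m \<omega>)))\<^sup>2) \<partial>M) \<le> eX n m + ennreal k * eZ n m" .
  \<comment> \<open>The second claim is the case \<open>X = 0\<close> of the same identity.\<close>
  have "(\<integral>\<^sup>+\<omega>. ennreal ((norm ((\<lambda>_. 0) \<omega> + w n \<omega> *\<^sub>R leray L m (Z n m \<omega>)))\<^sup>2) \<partial>M)
      = (\<integral>\<^sup>+\<omega>. ennreal ((norm ((\<lambda>_. 0 :: real^'n) \<omega>))\<^sup>2) \<partial>M) + ennreal k * (\<integral>\<^sup>+\<omega>. ennreal ((norm (leray L m (Z n m \<omega>)))\<^sup>2) \<partial>M)"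
    by (rule gaussian_increment_second_moment[OF G[OF n] ind[OF assms(1)] w[OF assms(1)] k(1) _ _ PZ PZ_fin]) auto
  then have "(\<integral>\<^sup>+\<omega>. ennreal ((norm (w n \<omega> *\<^sub>R leray L m (Z n m \<omega>)))\<^sup>2) \<partial>M)
      = ennreal k * (\<integral>\<^sup>+\<omega>. ennreal ((norm (leray L m (Z n m \<omega>)))\<^sup>2) \<partial>M)" by simp
  also have "\<dots> \<le> ennreal k * eZ n m" by (intro mult_left_mono PZ_le) simp
  finally show "(\<integral>\<^sup>+\<omega>. ennreal ((norm (w n \<omega> *\<^sub>R leray L m (Z n m \<omega>)))\<^sup>2) \<partial>M) \<le> ennreal k * eZ n m" .
qed

lemma mode_step:
  assumes "n < N" "eX n m < \<infinity>" "eZ n m < \<infinity>"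
  shows "ennreal ((1 + k * stokes_ev L m)\<^sup>2) * eX (Suc n) m
    \<le> ennreal (1 + k) * (eX n m + ennreal k * eZ n m) + ennreal (k + k\<^sup>2) * eY (Suc n) m"
proof -
  let ?A = "\<lambda>\<omega>. X n m \<omega> + w n \<omega> *\<^sub>R leray L m (Z n m \<omega>)"
  have n: "n \<le> N" "Suc n \<le> N" using assms(1) by auto
  note m1 = X_M[OF n(1)] and m2 = X_M[OF n(2)] and m3 = Z_M[OF assms(1)] and m4 = Y[OF n(2)] and m5 = w_M[OF assms(1)]
  have A: "?A \<in> borel_measurable M" using m1 m3 m5 by measurable
  have PY: "(\<lambda>\<omega>. leray L m (Y (Suc n) m \<omega>)) \<in> borel_measurable M" using m4 by measurable
  have "ennreal ((1 + k * stokes_ev L m)\<^sup>2) * eX (Suc n) m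
      = (\<integral>\<^sup>+\<omega>. ennreal ((1 + k * stokes_ev L m)\<^sup>2) * ennreal ((norm (X (Suc n) m \<omega>))\<^sup>2) \<partial>M)"
    unfolding eX_def using m2 by (intro nn_integral_cmult[symmetric]) measurable
  also have "\<dots> \<le> (\<integral>\<^sup>+\<omega>. ennreal (1 + k) * ennreal ((norm (?A \<omega>))\<^sup>2) + ennreal (k + k\<^sup>2) * ennreal ((norm (leray L m (Y (Suc n) m \<omega>)))\<^sup>2) \<partial>M)"
  proof (rule nn_integral_mono_AE)
    show "AE \<omega> in M. ennreal ((1 + k * stokes_ev L m)\<^sup>2) * ennreal ((norm (X (Suc n) m \<omega>))\<^sup>2)
      \<le> ennreal (1 + k) * ennreal ((norm (?A \<omega>))\<^sup>2) + ennreal (k + k\<^sup>2) * ennreal ((norm (leray L m (Y (Suc n) m \<omega>)))\<^sup>2)"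
      using rec[OF assms(1)]
    proof eventually_elim
      case (elim \<omega>)
      have "(1 + k * stokes_ev L m)\<^sup>2 * (norm (X (Suc n) m \<omega>))\<^sup>2 = (norm ((1 + k * stokes_ev L m) *\<^sub>R X (Suc n) m \<omega>))\<^sup>2"
        by (simp add: power_mult_distrib)
      also have "(1 + k * stokes_ev L m) *\<^sub>R X (Suc n) m \<omega> = ?A \<omega> + k *\<^sub>R leray L m (Y (Suc n) m \<omega>)"
        using elim by (simp add: algebra_simps)
      also have "(norm (?A \<omega> + k *\<^sub>R leray L m (Y (Suc n) m \<omega>)))\<^sup>2
          \<le> (1 + k) * (norm (?A \<omega>))\<^sup>2 + (k + k\<^sup>2) * (norm (leray L m (Y (Suc n) m \<omega>)))\<^sup>2"
        by (rule norm_add_power2_weighted[OF k(1)])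
      finally have le: "(1 + k * stokes_ev L m)\<^sup>2 * (norm (X (Suc n) m \<omega>))\<^sup>2
          \<le> (1 + k) * (norm (?A \<omega>))\<^sup>2 + (k + k\<^sup>2) * (norm (leray L m (Y (Suc n) m \<omega>)))\<^sup>2" .
      from ennreal_leI[OF this] show ?case
        using k(1) by (subst (asm) ennreal_plus) (auto simp: ennreal_mult simp del: ennreal_plus)
    qed
  qed
  also have "\<dots> = ennreal (1 + k) * (\<integral>\<^sup>+\<omega>. ennreal ((norm (?A \<omega>))\<^sup>2) \<partial>M)
      + ennreal (k + k\<^sup>2) * (\<integral>\<^sup>+\<omega>. ennreal ((norm (leray L m (Y (Suc n) m \<omega>)))\<^sup>2) \<partial>M)"
    using A PY by (simp add: nn_integral_add nn_integral_cmult)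
  also have "\<dots> \<le> ennreal (1 + k) * (eX n m + ennreal k * eZ n m) + ennreal (k + k\<^sup>2) * eY (Suc n) m"
    unfolding eY_def by (intro add_mono mult_left_mono increment_moment assms leray_le) auto
  finally show ?thesis .
qed

text \<open>Multiplied by \<open>1 + \<lambda>\<close> and summed, the left side of
  \<open>mode_step\<close> splits exactly into energy plus dissipation, while the right side is
  closed by the growth bound on \<open>Z\<close> and the bound on \<open>Y\<close>.\<close>

lemma energy_step:
  assumes "n < N" "energy n = ennreal \<eta>" "\<eta> \<ge> 0"
  shows "energy (Suc n) + dissipation (Suc n) \<le> ennreal ((1 + \<alpha> * k) * \<eta> + \<beta> * k)"
proof -
  have fin: "energy n < \<infinity>" using assms(2) by simp
  have "energy (Suc n) + dissipation (Suc n)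
      = (\<integral>\<^sup>+m. ennreal (1 + stokes_ev L m) * (ennreal ((1 + k * stokes_ev L m)\<^sup>2) * eX (Suc n) m) \<partial>count_space UNIV)"
    unfolding energy_def dissipation_def
  proof (subst nn_integral_add[symmetric], simp, simp, rule nn_integral_cong)
    fix m
    have "ennreal (1 + stokes_ev L m) * eX (Suc n) m + ennreal ((1 + stokes_ev L m) * (2 * k * stokes_ev L m + k\<^sup>2 * (stokes_ev L m)\<^sup>2)) * eX (Suc n) m
        = (ennreal (1 + stokes_ev L m) + ennreal ((1 + stokes_ev L m) * (2 * k * stokes_ev L m + k\<^sup>2 * (stokes_ev L m)\<^sup>2))) * eX (Suc n) m"
      by (simp only: distrib_right)
    also have "ennreal (1 + stokes_ev L m) + ennreal ((1 + stokes_ev L m) * (2 * k * stokes_ev L m + k\<^sup>2 * (stokes_ev L m)\<^sup>2))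
        = ennreal ((1 + stokes_ev L m) + (1 + stokes_ev L m) * (2 * k * stokes_ev L m + k\<^sup>2 * (stokes_ev L m)\<^sup>2))"
      using k(1) by (intro ennreal_plus[symmetric]) auto
    also have "(1 + stokes_ev L m) + (1 + stokes_ev L m) * (2 * k * stokes_ev L m + k\<^sup>2 * (stokes_ev L m)\<^sup>2) = (1 + stokes_ev L m) * (1 + k * stokes_ev L m)\<^sup>2"
      unfolding power2_sum by (simp add: power_mult_distrib algebra_simps)
    also have "ennreal ((1 + stokes_ev L m) * (1 + k * stokes_ev L m)\<^sup>2) = ennreal (1 + stokes_ev L m) * ennreal ((1 + k * stokes_ev L m)\<^sup>2)"
      by (intro ennreal_mult) auto
    finally show "ennreal (1 + stokes_ev L m) * eX (Suc n) m + ennreal ((1 + stokes_ev L m) * (2 * k * stokes_ev L m + k\<^sup>2 * (stokes_ev L m)\<^sup>2)) * eX (Suc n) m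
        = ennreal (1 + stokes_ev L m) * (ennreal ((1 + k * stokes_ev L m)\<^sup>2) * eX (Suc n) m)" by (simp only: mult.assoc)
  qed
  also have "\<dots> \<le> (\<integral>\<^sup>+m. ennreal (1 + k) * (ennreal (1 + stokes_ev L m) * eX n m + ennreal k * (ennreal (1 + stokes_ev L m) * eZ n m))
      + ennreal (k + k\<^sup>2) * (ennreal (1 + stokes_ev L m) * eY (Suc n) m) \<partial>count_space UNIV)"
  proof (rule nn_integral_mono)
    fix m
    have "ennreal (1 + stokes_ev L m) * (ennreal ((1 + k * stokes_ev L m)\<^sup>2) * eX (Suc n) m)
      \<le> ennreal (1 + stokes_ev L m) * (ennreal (1 + k) * (eX n m + ennreal k * eZ n m) + ennreal (k + k\<^sup>2) * eY (Suc n) m)"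
      by (intro mult_left_mono mode_step assms(1) finite_modes[OF assms(1) fin]) simp
    then show "ennreal (1 + stokes_ev L m) * (ennreal ((1 + k * stokes_ev L m)\<^sup>2) * eX (Suc n) m)
      \<le> ennreal (1 + k) * (ennreal (1 + stokes_ev L m) * eX n m + ennreal k * (ennreal (1 + stokes_ev L m) * eZ n m))
        + ennreal (k + k\<^sup>2) * (ennreal (1 + stokes_ev L m) * eY (Suc n) m)"
      by (simp only: distrib_left mult.left_commute mult.assoc)
  qed
  also have "\<dots> = ennreal (1 + k) * (energy n + ennreal k * (\<integral>\<^sup>+m. ennreal (1 + stokes_ev L m) * eZ n m \<partial>count_space UNIV))
      + ennreal (k + k\<^sup>2) * (\<integral>\<^sup>+m. ennreal (1 + stokes_ev L m) * eY (Suc n) m \<partial>count_space UNIV)"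
    unfolding energy_def by (simp only: nn_integral_add nn_integral_cmult borel_measurable_count_space)
  also have "\<dots> \<le> ennreal (1 + k) * (energy n + ennreal k * (ennreal K * (1 + energy n))) + ennreal (k + k\<^sup>2) * ennreal \<Phi>"
    by (intro add_mono mult_left_mono order_refl eZ_bound eY_bound assms(1)) simp_all
  also have "\<dots> = ennreal ((1 + k) * (\<eta> + k * (K * (1 + \<eta>))) + (k + k\<^sup>2) * \<Phi>)"
    unfolding assms(2) ennreal_1[symmetric] using assms(3) k(1) nonneg
    by (simp only: ennreal_plus ennreal_mult mult_nonneg_nonneg add_nonneg_nonneg zero_le_one less_imp_le zero_le_power2)
  also have "\<dots> \<le> ennreal ((1 + \<alpha> * k) * \<eta> + \<beta> * k)"
  proof (rule ennreal_leI)
    have "(1 + k) * (\<eta> + k * (K * (1 + \<eta>))) + (k + k\<^sup>2) * \<Phi>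
        = \<eta> + k * (\<eta> + (1 + k) * (K * (1 + \<eta>)) + (1 + k) * \<Phi>)"
      by (simp add: power2_eq_square algebra_simps)
    also have "\<dots> \<le> \<eta> + k * (\<eta> + (1 + T) * (K * (1 + \<eta>)) + (1 + T) * \<Phi>)"
      using k nonneg assms(3) by (intro add_left_mono mult_left_mono add_mono mult_right_mono) auto
    also have "\<dots> = (1 + \<alpha> * k) * \<eta> + \<beta> * k" by (simp add: \<alpha>_def \<beta>_def algebra_simps)
    finally show "(1 + k) * (\<eta> + k * (K * (1 + \<eta>))) + (k + k\<^sup>2) * \<Phi> \<le> (1 + \<alpha> * k) * \<eta> + \<beta> * k" .
  qed
  finally show ?thesis .
qed

theorem energy_estimate:
  assumes "n \<le> N"
  shows "energy n + (\<Sum>j=1..n. dissipation j) \<le> ennreal bound"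
proof -
  \<comment> \<open>A majorant with \<open>R (n+1) = (1 + \<alpha> k) R n + (1 + \<alpha> k)^(n+1) k
    \<beta>\<close>: the inhomogeneity is amplified more than necessary in exchange for a closed
    form.\<close>
  define R where "R n = (1 + \<alpha> * k) ^ n * (Y0 + real n * (k * \<beta>))" for n
  have ak: "1 + \<alpha> * k \<ge> 1" using \<alpha>_pos k(1) by simp
  have R0: "R n \<ge> 0" for n using ak nonneg \<beta>_nonneg k(1) by (simp add: R_def)
  have "energy n + (\<Sum>j=1..n. dissipation j) \<le> ennreal (R n)" using assms
  proof (induction n)
    case 0
    then show ?case using X0_bound by (simp add: R_def energy_def eX_def)
  next
    case (Suc n)
    then have IH: "energy n + (\<Sum>j=1..n. dissipation j) \<le> ennreal (R n)" and n: "n < N" by auto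
    have fin: "energy n + (\<Sum>j=1..n. dissipation j) < \<infinity>" using IH by (rule le_less_trans) simp
    then have "energy n < \<infinity>" "(\<Sum>j=1..n. dissipation j) < \<infinity>" by auto
    then obtain \<eta> s where \<eta>: "energy n = ennreal \<eta>" "\<eta> \<ge> 0" and s: "(\<Sum>j=1..n. dissipation j) = ennreal s" "s \<ge> 0"
      by (cases "energy n"; cases "\<Sum>j=1..n. dissipation j") auto
    have le: "\<eta> + s \<le> R n" using IH R0[of n] \<eta>(2) s(2) unfolding \<eta>(1) s(1)
      by (subst (asm) ennreal_plus[symmetric]) (auto simp del: ennreal_plus)
    have "energy (Suc n) + (\<Sum>j=1..Suc n. dissipation j)
        = (energy (Suc n) + dissipation (Suc n)) + (\<Sum>j=1..n. dissipation j)" by (simp add: ac_simps)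
    also have "\<dots> \<le> ennreal ((1 + \<alpha> * k) * \<eta> + \<beta> * k) + ennreal s"
      unfolding s(1) by (intro add_right_mono energy_step n \<eta>)
    also have "\<dots> = ennreal ((1 + \<alpha> * k) * \<eta> + \<beta> * k + s)"
      using ak \<eta>(2) s(2) \<beta>_nonneg k(1) by (intro ennreal_plus[symmetric]) auto
    also have "\<dots> \<le> ennreal (R (Suc n))"
    proof (rule ennreal_leI)
      have p: "1 \<le> (1 + \<alpha> * k) ^ Suc n" using ak by (rule one_le_power)
      \<comment> \<open>The dissipation accumulated so far is enlarged by the same factor, so that
        it merges with the energy and the induction hypothesis applies to their sum.\<close>
      have "(1 + \<alpha> * k) * \<eta> + \<beta> * k + s \<le> (1 + \<alpha> * k) * \<eta> + \<beta> * k + (1 + \<alpha> * k) * s"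
        using mult_right_mono[OF ak s(2)] by simp
      also have "\<dots> = (1 + \<alpha> * k) * (\<eta> + s) + \<beta> * k" by (simp add: algebra_simps)
      also have "\<dots> \<le> (1 + \<alpha> * k) * R n + (1 + \<alpha> * k) ^ Suc n * (k * \<beta>)"
        using le ak mult_right_mono[OF p, of "k * \<beta>"] \<beta>_nonneg k(1)
        by (intro add_mono mult_left_mono) (auto simp: mult.commute)
      also have "\<dots> = R (Suc n)" by (simp add: R_def algebra_simps)
      finally show "(1 + \<alpha> * k) * \<eta> + \<beta> * k + s \<le> R (Suc n)" .
    qed
    finally show ?case .
  qed
  also have "ennreal (R n) \<le> ennreal bound"
  proof (rule ennreal_leI)
    have nT: "real n * k \<le> T" using assms k(1) kN by (metis mult_right_mono of_nat_mono less_imp_le)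
    have "(1 + \<alpha> * k) ^ n \<le> exp (\<alpha> * k) ^ n" using ak by (intro power_mono exp_ge_add_one_self) auto
    also have "\<dots> = exp (\<alpha> * (real n * k))" by (simp add: exp_of_nat_mult[symmetric] mult.commute mult.left_commute)
    also have "\<dots> \<le> exp (\<alpha> * T)" using nT \<alpha>_pos by simp
    finally have 1: "(1 + \<alpha> * k) ^ n \<le> exp (\<alpha> * T)" .
    have "real n * (k * \<beta>) \<le> T * \<beta>" using mult_right_mono[OF nT \<beta>_nonneg] by (simp add: mult.assoc)
    then show "R n \<le> bound"
      unfolding R_def bound_def using 1 nonneg \<beta>_nonneg k(1) by (intro mult_mono) auto
  qed
  finally show ?thesis .
qed

lemma energy_le: "n \<le> N \<Longrightarrow> energy n \<le> ennreal bound"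
  using energy_estimate[of n] by (rule order_trans[rotated]) (simp_all add: add_increasing2)

lemma dissipation_sum_le: "(\<Sum>j=1..N. dissipation j) \<le> ennreal bound"
  using energy_estimate[of N] by (rule order_trans[rotated]) (simp_all add: add_increasing)

text \<open>By the recursion an increment equals \<open>- k \<lambda>\<close> times the new value
  plus force and noise. Weighted with \<open>\<lambda>\<close>, the first square is absorbed by the
  dissipation; the other two are of order \<open>k\<close> because the energy is already bounded, so
  they stay bounded after summation over \<open>N\<close> steps.\<close>

lemma increment_step:
  assumes "n < N"
  shows "(\<integral>\<^sup>+m. ennreal (stokes_ev L m) * (\<integral>\<^sup>+\<omega>. ennreal ((norm (X (Suc n) m \<omega> - X n m \<omega>))\<^sup>2) \<partial>M) \<partial>count_space UNIV)
    \<le> ennreal 3 * dissipation (Suc n) + ennreal (k * (3 * (T * \<Phi>) + 3 * (K * (1 + bound))))"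
proof -
  have n: "n \<le> N" "Suc n \<le> N" using assms by auto
  have fin: "energy n < \<infinity>" using energy_le[OF n(1)] by (rule le_less_trans) simp
  note m1 = X_M[OF n(1)] and m2 = X_M[OF n(2)] and m3 = Z_M[OF assms(1)] and m4 = Y[OF n(2)] and m5 = w_M[OF assms(1)]
  have mode: "ennreal (stokes_ev L m) * (\<integral>\<^sup>+\<omega>. ennreal ((norm (X (Suc n) m \<omega> - X n m \<omega>))\<^sup>2) \<partial>M)
      \<le> ennreal 3 * (ennreal ((1 + stokes_ev L m) * (2 * k * stokes_ev L m + k\<^sup>2 * (stokes_ev L m)\<^sup>2)) * eX (Suc n) m)
        + (ennreal (3 * k\<^sup>2) * (ennreal (1 + stokes_ev L m) * eY (Suc n) m) + ennreal (3 * k) * (ennreal (1 + stokes_ev L m) * eZ n m))" for m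
  proof -
    let ?P = "\<lambda>\<omega>. w n \<omega> *\<^sub>R leray L m (Z n m \<omega>)"
    have P: "?P \<in> borel_measurable M" using m3 m5 by measurable
    have "(\<integral>\<^sup>+\<omega>. ennreal ((norm (X (Suc n) m \<omega> - X n m \<omega>))\<^sup>2) \<partial>M)
        \<le> (\<integral>\<^sup>+\<omega>. ennreal (3 * (k\<^sup>2 * (stokes_ev L m)\<^sup>2)) * ennreal ((norm (X (Suc n) m \<omega>))\<^sup>2)
          + (ennreal (3 * k\<^sup>2) * ennreal ((norm (Y (Suc n) m \<omega>))\<^sup>2) + ennreal 3 * ennreal ((norm (?P \<omega>))\<^sup>2)) \<partial>M)"
    proof (rule nn_integral_mono_AE)
      show "AE \<omega> in M. ennreal ((norm (X (Suc n) m \<omega> - X n m \<omega>))\<^sup>2)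
        \<le> ennreal (3 * (k\<^sup>2 * (stokes_ev L m)\<^sup>2)) * ennreal ((norm (X (Suc n) m \<omega>))\<^sup>2)
          + (ennreal (3 * k\<^sup>2) * ennreal ((norm (Y (Suc n) m \<omega>))\<^sup>2) + ennreal 3 * ennreal ((norm (?P \<omega>))\<^sup>2))"
        using rec[OF assms]
      proof eventually_elim
        case (elim \<omega>)
        have "X (Suc n) m \<omega> + (k * stokes_ev L m) *\<^sub>R X (Suc n) m \<omega> = X n m \<omega> + k *\<^sub>R leray L m (Y (Suc n) m \<omega>) + ?P \<omega>"
          using elim by (simp add: scaleR_add_left)
        then have eq: "X (Suc n) m \<omega> - X n m \<omega>
            = (- (k * stokes_ev L m)) *\<^sub>R X (Suc n) m \<omega> + k *\<^sub>R leray L m (Y (Suc n) m \<omega>) + ?P \<omega>"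
          by (simp add: algebra_simps)
        have "(norm (X (Suc n) m \<omega> - X n m \<omega>))\<^sup>2
            \<le> 3 * ((norm ((- (k * stokes_ev L m)) *\<^sub>R X (Suc n) m \<omega>))\<^sup>2 + (norm (k *\<^sub>R leray L m (Y (Suc n) m \<omega>)))\<^sup>2 + (norm (?P \<omega>))\<^sup>2)"
          unfolding eq by (rule norm_sum3_power2)
        also have "\<dots> = 3 * (k\<^sup>2 * (stokes_ev L m)\<^sup>2 * (norm (X (Suc n) m \<omega>))\<^sup>2 + k\<^sup>2 * (norm (leray L m (Y (Suc n) m \<omega>)))\<^sup>2 + (norm (?P \<omega>))\<^sup>2)"
          by (simp add: power_mult_distrib)
        also have "\<dots> \<le> 3 * (k\<^sup>2 * (stokes_ev L m)\<^sup>2 * (norm (X (Suc n) m \<omega>))\<^sup>2 + k\<^sup>2 * (norm (Y (Suc n) m \<omega>))\<^sup>2 + (norm (?P \<omega>))\<^sup>2)"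
          by (intro mult_left_mono add_mono order_refl power_mono norm_leray_le) auto
        also have "\<dots> = 3 * (k\<^sup>2 * (stokes_ev L m)\<^sup>2) * (norm (X (Suc n) m \<omega>))\<^sup>2 + (3 * k\<^sup>2 * (norm (Y (Suc n) m \<omega>))\<^sup>2 + 3 * (norm (?P \<omega>))\<^sup>2)"
          by (simp only: distrib_left mult.assoc add.assoc)
        finally have le: "(norm (X (Suc n) m \<omega> - X n m \<omega>))\<^sup>2
          \<le> 3 * (k\<^sup>2 * (stokes_ev L m)\<^sup>2) * (norm (X (Suc n) m \<omega>))\<^sup>2 + (3 * k\<^sup>2 * (norm (Y (Suc n) m \<omega>))\<^sup>2 + 3 * (norm (?P \<omega>))\<^sup>2)" .
        from ennreal_leI[OF this] show ?case
          by (simp only: ennreal_plus ennreal_mult zero_le_power2 mult_nonneg_nonneg add_nonneg_nonneg zero_le_numeral norm_ge_zero)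
      qed
    qed
    also have "\<dots> = ennreal (3 * (k\<^sup>2 * (stokes_ev L m)\<^sup>2)) * eX (Suc n) m + (ennreal (3 * k\<^sup>2) * eY (Suc n) m
          + ennreal 3 * (\<integral>\<^sup>+\<omega>. ennreal ((norm (?P \<omega>))\<^sup>2) \<partial>M))"
    proof -
      have "(\<integral>\<^sup>+\<omega>. a * f \<omega> + (b * g \<omega> + c * h \<omega>) \<partial>M)
          = a * (\<integral>\<^sup>+\<omega>. f \<omega> \<partial>M) + (b * (\<integral>\<^sup>+\<omega>. g \<omega> \<partial>M) + c * (\<integral>\<^sup>+\<omega>. h \<omega> \<partial>M))"
        if "f \<in> borel_measurable M" "g \<in> borel_measurable M" "h \<in> borel_measurable M" for f g h :: "'w \<Rightarrow> ennreal" and a b c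
        using that by (simp add: nn_integral_add nn_integral_cmult)
      from this[of "\<lambda>\<omega>. ennreal ((norm (X (Suc n) m \<omega>))\<^sup>2)" "\<lambda>\<omega>. ennreal ((norm (Y (Suc n) m \<omega>))\<^sup>2)" "\<lambda>\<omega>. ennreal ((norm (?P \<omega>))\<^sup>2)"]
      show ?thesis unfolding eX_def eY_def using m2[of m] m4[of m] P by measurable
    qed
    also have "\<dots> \<le> ennreal (3 * (k\<^sup>2 * (stokes_ev L m)\<^sup>2)) * eX (Suc n) m + (ennreal (3 * k\<^sup>2) * eY (Suc n) m + ennreal 3 * (ennreal k * eZ n m))"
      by (intro add_left_mono mult_left_mono increment_moment assms finite_modes[OF assms fin]) auto
    finally have "ennreal (stokes_ev L m) * (\<integral>\<^sup>+\<omega>. ennreal ((norm (X (Suc n) m \<omega> - X n m \<omega>))\<^sup>2) \<partial>M)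
      \<le> ennreal (stokes_ev L m) * (ennreal (3 * (k\<^sup>2 * (stokes_ev L m)\<^sup>2)) * eX (Suc n) m + (ennreal (3 * k\<^sup>2) * eY (Suc n) m + ennreal 3 * (ennreal k * eZ n m)))"
      by (rule mult_left_mono) simp
    also have "\<dots> = ennreal (stokes_ev L m * (3 * (k\<^sup>2 * (stokes_ev L m)\<^sup>2))) * eX (Suc n) m + (ennreal (3 * k\<^sup>2) * (ennreal (stokes_ev L m) * eY (Suc n) m)
        + ennreal (3 * k) * (ennreal (stokes_ev L m) * eZ n m))"
    proof -
      have 1: "ennreal (stokes_ev L m) * (ennreal c * x) = ennreal (stokes_ev L m * c) * x" if "c \<ge> 0" for c x
        using that by (simp only: ennreal_mult zero_le_power2 mult.assoc)
      have 2: "ennreal (stokes_ev L m) * (ennreal 3 * (ennreal k * x)) = ennreal (3 * k) * (ennreal (stokes_ev L m) * x)" for x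
        using k(1) by (simp only: ennreal_mult zero_le_numeral less_imp_le mult.left_commute mult.assoc)
      have c: "0 \<le> 3 * (k\<^sup>2 * (stokes_ev L m)\<^sup>2)" by simp
      show ?thesis
        unfolding distrib_left 2 mult.left_commute[of "ennreal (stokes_ev L m)" "ennreal (3 * k\<^sup>2)"]
          1[OF c, of "eX (Suc n) m"] ..
    qed
    also have "\<dots> \<le> ennreal (3 * ((1 + stokes_ev L m) * (2 * k * stokes_ev L m + k\<^sup>2 * (stokes_ev L m)\<^sup>2))) * eX (Suc n) m + (ennreal (3 * k\<^sup>2) * (ennreal (1 + stokes_ev L m) * eY (Suc n) m)
        + ennreal (3 * k) * (ennreal (1 + stokes_ev L m) * eZ n m))"
    proof (intro add_mono mult_right_mono mult_left_mono ennreal_leI)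
      have "stokes_ev L m * (k\<^sup>2 * (stokes_ev L m)\<^sup>2) \<le> (1 + stokes_ev L m) * (2 * k * stokes_ev L m + k\<^sup>2 * (stokes_ev L m)\<^sup>2)"
        using k(1) by (intro mult_mono) auto
      then show "stokes_ev L m * (3 * (k\<^sup>2 * (stokes_ev L m)\<^sup>2)) \<le> 3 * ((1 + stokes_ev L m) * (2 * k * stokes_ev L m + k\<^sup>2 * (stokes_ev L m)\<^sup>2))" by simp
    qed auto
    also have "ennreal (3 * ((1 + stokes_ev L m) * (2 * k * stokes_ev L m + k\<^sup>2 * (stokes_ev L m)\<^sup>2))) * eX (Suc n) m
        = ennreal 3 * (ennreal ((1 + stokes_ev L m) * (2 * k * stokes_ev L m + k\<^sup>2 * (stokes_ev L m)\<^sup>2)) * eX (Suc n) m)"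
      using k(1) by (subst ennreal_mult) (auto simp: mult.assoc)
    finally show ?thesis .
  qed
  have "(\<integral>\<^sup>+m. ennreal (stokes_ev L m) * (\<integral>\<^sup>+\<omega>. ennreal ((norm (X (Suc n) m \<omega> - X n m \<omega>))\<^sup>2) \<partial>M) \<partial>count_space UNIV)
      \<le> (\<integral>\<^sup>+m. ennreal 3 * (ennreal ((1 + stokes_ev L m) * (2 * k * stokes_ev L m + k\<^sup>2 * (stokes_ev L m)\<^sup>2)) * eX (Suc n) m)
        + (ennreal (3 * k\<^sup>2) * (ennreal (1 + stokes_ev L m) * eY (Suc n) m) + ennreal (3 * k) * (ennreal (1 + stokes_ev L m) * eZ n m)) \<partial>count_space UNIV)"
    by (intro nn_integral_mono mode)
  also have "\<dots> = ennreal 3 * dissipation (Suc n) + (ennreal (3 * k\<^sup>2) * (\<integral>\<^sup>+m. ennreal (1 + stokes_ev L m) * eY (Suc n) m \<partial>count_space UNIV)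
      + ennreal (3 * k) * (\<integral>\<^sup>+m. ennreal (1 + stokes_ev L m) * eZ n m \<partial>count_space UNIV))"
    unfolding dissipation_def by (simp only: nn_integral_add nn_integral_cmult borel_measurable_count_space)
  also have "\<dots> \<le> ennreal 3 * dissipation (Suc n) + (ennreal (3 * k\<^sup>2) * ennreal \<Phi> + ennreal (3 * k) * (ennreal K * (1 + energy n)))"
    by (intro add_mono mult_left_mono order_refl eZ_bound eY_bound assms(1)) simp_all
  also have "\<dots> \<le> ennreal 3 * dissipation (Suc n) + (ennreal (3 * k\<^sup>2) * ennreal \<Phi> + ennreal (3 * k) * (ennreal K * (1 + ennreal bound)))"
    by (intro add_left_mono mult_left_mono energy_le n) auto
  also have "ennreal (3 * k\<^sup>2) * ennreal \<Phi> + ennreal (3 * k) * (ennreal K * (1 + ennreal bound))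
      = ennreal (3 * k\<^sup>2 * \<Phi> + 3 * k * (K * (1 + bound)))"
    unfolding ennreal_1[symmetric] using bound_nonneg k(1) nonneg
    by (simp only: ennreal_plus ennreal_mult mult_nonneg_nonneg add_nonneg_nonneg zero_le_one less_imp_le zero_le_power2 zero_le_numeral)
  also have "\<dots> \<le> ennreal (k * (3 * (T * \<Phi>) + 3 * (K * (1 + bound))))"
  proof (rule ennreal_leI)
    have "k * \<Phi> \<le> T * \<Phi>" using k(2) nonneg(2) by (rule mult_right_mono)
    then have "k * (3 * (k * \<Phi>)) \<le> k * (3 * (T * \<Phi>))" using k(1) by simp
    then show "3 * k\<^sup>2 * \<Phi> + 3 * k * (K * (1 + bound)) \<le> k * (3 * (T * \<Phi>) + 3 * (K * (1 + bound)))"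
      by (simp add: power2_eq_square algebra_simps)
  qed
  finally show ?thesis by (simp add: add_left_mono)
qed

end

section \<open>The scheme\<close>

text \<open>Nothing says that the norms \<open>q\<close> are measurable in the sample point. They
  are first replaced by the almost everywhere equal series over modes, for which sum and expectation
  may be exchanged.\<close>

lemma nn_integral_sum_modes:
  fixes X :: "'i \<Rightarrow> int^'n \<Rightarrow> 'w \<Rightarrow> 'b::euclidean_space"
  assumes "finite A" and X: "\<And>n m. n \<in> A \<Longrightarrow> X n m \<in> borel_measurable M"
    and c: "\<And>m. c m \<ge> 0" and q: "\<And>n \<omega>. n \<in> A \<Longrightarrow> q n \<omega> \<ge> 0"
    and eq: "\<And>n. n \<in> A \<Longrightarrow> AE \<omega> in M. ennreal (q n \<omega>) = (\<integral>\<^sup>+m. ennreal (c m * (norm (X n m \<omega>))\<^sup>2) \<partial>count_space UNIV)"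
  shows "(\<integral>\<^sup>+\<omega>. ennreal (\<Sum>n\<in>A. q n \<omega>) \<partial>M)
    = (\<Sum>n\<in>A. \<integral>\<^sup>+m. ennreal (c m) * (\<integral>\<^sup>+\<omega>. ennreal ((norm (X n m \<omega>))\<^sup>2) \<partial>M) \<partial>count_space UNIV)"
proof -
  let ?Q = "\<lambda>n \<omega>. \<integral>\<^sup>+m. ennreal (c m * (norm (X n m \<omega>))\<^sup>2) \<partial>count_space UNIV"
  have m: "(\<lambda>\<omega>. ennreal (c m * (norm (X n m \<omega>))\<^sup>2)) \<in> borel_measurable M" if "n \<in> A" for n m
    using X[OF that] by measurable
  have "AE \<omega> in M. \<forall>n\<in>A. ennreal (q n \<omega>) = ?Q n \<omega>"
    using assms(1) eq by (intro AE_finite_allI) auto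
  then have "(\<integral>\<^sup>+\<omega>. ennreal (\<Sum>n\<in>A. q n \<omega>) \<partial>M) = (\<integral>\<^sup>+\<omega>. (\<Sum>n\<in>A. ?Q n \<omega>) \<partial>M)"
  proof (intro nn_integral_cong_AE, eventually_elim)
    case (elim \<omega>)
    have "ennreal (\<Sum>n\<in>A. q n \<omega>) = (\<Sum>n\<in>A. ennreal (q n \<omega>))" using q by (intro sum_ennreal[symmetric]) auto
    then show ?case using elim by simp
  qed
  also have "\<dots> = (\<Sum>n\<in>A. \<integral>\<^sup>+\<omega>. ?Q n \<omega> \<partial>M)"
    by (intro nn_integral_sum nn_integral_mode_swap(2) m)
  also have "\<dots> = (\<Sum>n\<in>A. \<integral>\<^sup>+m. ennreal (c m) * (\<integral>\<^sup>+\<omega>. ennreal ((norm (X n m \<omega>))\<^sup>2) \<partial>M) \<partial>count_space UNIV)"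
  proof (intro sum.cong refl)
    fix n assume n: "n \<in> A"
    have "(\<integral>\<^sup>+\<omega>. ?Q n \<omega> \<partial>M) = (\<integral>\<^sup>+m. (\<integral>\<^sup>+\<omega>. ennreal (c m * (norm (X n m \<omega>))\<^sup>2) \<partial>M) \<partial>count_space UNIV)"
      by (rule nn_integral_mode_swap(1)[OF m[OF n]])
    also have "\<dots> = (\<integral>\<^sup>+m. ennreal (c m) * (\<integral>\<^sup>+\<omega>. ennreal ((norm (X n m \<omega>))\<^sup>2) \<partial>M) \<partial>count_space UNIV)"
    proof (rule nn_integral_cong)
      fix m
      have "(\<lambda>\<omega>. ennreal ((norm (X n m \<omega>))\<^sup>2)) \<in> borel_measurable M" using X[OF n, of m] by measurable
      from nn_integral_cmult[OF this, of "ennreal (c m)"]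
      show "(\<integral>\<^sup>+\<omega>. ennreal (c m * (norm (X n m \<omega>))\<^sup>2) \<partial>M) = ennreal (c m) * (\<integral>\<^sup>+\<omega>. ennreal ((norm (X n m \<omega>))\<^sup>2) \<partial>M)"
        using c[of m] by (simp only: ennreal_mult zero_le_power2)
    qed
    finally show "(\<integral>\<^sup>+\<omega>. ?Q n \<omega> \<partial>M) = (\<integral>\<^sup>+m. ennreal (c m) * (\<integral>\<^sup>+\<omega>. ennreal ((norm (X n m \<omega>))\<^sup>2) \<partial>M) \<partial>count_space UNIV)" .
  qed
  finally show ?thesis .
qed

lemma nn_integral_modes:
  fixes X :: "int^'n \<Rightarrow> 'w \<Rightarrow> 'b::euclidean_space"
  assumes "\<And>m. X m \<in> borel_measurable M" "\<And>m. c m \<ge> 0" "\<And>\<omega>. q \<omega> \<ge> 0"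
    and "AE \<omega> in M. ennreal (q \<omega>) = (\<integral>\<^sup>+m. ennreal (c m * (norm (X m \<omega>))\<^sup>2) \<partial>count_space UNIV)"
  shows "(\<integral>\<^sup>+\<omega>. ennreal (q \<omega>) \<partial>M)
    = (\<integral>\<^sup>+m. ennreal (c m) * (\<integral>\<^sup>+\<omega>. ennreal ((norm (X m \<omega>))\<^sup>2) \<partial>M) \<partial>count_space UNIV)"
  using nn_integral_sum_modes[of "{()}" "\<lambda>_. X" M c "\<lambda>_. q"] assms by simp

text \<open>The data are kept apart from a run of the scheme, so that all constants are chosen
  before the number of steps is known.\<close>

locale stokes_data = prob_space M for M :: "'w measure" +
  fixes L T :: real and F :: "real \<Rightarrow> 'w measure" and W :: "real \<Rightarrow> 'w \<Rightarrow> real"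
    and u0 :: "'w \<Rightarrow> real^'n \<Rightarrow> real^'n" and f :: "'w \<Rightarrow> real \<Rightarrow> real^'n \<Rightarrow> real^'n"
    and B :: "(real^'n \<Rightarrow> real^'n) \<Rightarrow> real^'n \<Rightarrow> real^'n"
  assumes L: "L > 0" and T: "T > 0"
    and filt: "continuous_filtration T M F"
    and wien: "wiener_process T M F W"
    and u0: "u0 \<in> L2_Omega M (Vdiv L \<inter> Hper 2 L) (H_nrm 2 L)"
    and u0_meas: "strongly_measurable M (F 0) (Vdiv L \<inter> Hper 2 L) (H_nrm 2 L) u0"
    and f: "f \<in> L2_Omega M (holder_H1 (1/2) T L) (holder_H1_nrm (1/2) T L)"
    and f_adapted: "\<forall>t\<in>{0..T}. strongly_measurable M (F t) (Hper 1 L) (H_nrm 1 L) (\<lambda>\<omega>. f \<omega> t)"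
    and B: "noise_coefficient M L B"
begin

lemma subalg: "t \<in> {0..T} \<Longrightarrow> subalgebra M (F t)"
  using filt by (auto simp: continuous_filtration_def)

lemma space_F: "t \<in> {0..T} \<Longrightarrow> space (F t) = space M"
  using subalg by (auto simp: subalgebra_def)

lemma F_mono: "s \<in> {0..T} \<Longrightarrow> t \<in> {0..T} \<Longrightarrow> s \<le> t \<Longrightarrow> g \<in> borel_measurable (F s) \<Longrightarrow> g \<in> borel_measurable (F t)"
  using measurable_from_subalg[of "F t" "F s" g borel] filt space_F
  by (auto simp: continuous_filtration_def subalgebra_def)

lemma W_measurable: "s \<in> {0..T} \<Longrightarrow> t \<in> {0..T} \<Longrightarrow> s \<le> t \<Longrightarrow> W s \<in> borel_measurable (F t)"
  using wien F_mono[of s t "W s"] by (auto simp: wiener_process_def)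

lemma W_increment:
  assumes "s \<in> {0..T}" "t \<in> {0..T}" "s < t"
  shows "distributed M lborel (\<lambda>\<omega>. W t \<omega> - W s \<omega>) (normal_density 0 (sqrt (t - s)))"
    "indep_set (sets (F s)) {(\<lambda>\<omega>. W t \<omega> - W s \<omega>) -` A \<inter> space M | A. A \<in> sets borel}"
  using wien assms unfolding wiener_process_def by blast+

lemma noise_growth:
  obtains K where "K \<ge> 0" "\<And>v. v \<in> Hper 1 L \<Longrightarrow> (H_nrm 1 L (B v))\<^sup>2 \<le> K * (1 + (H_nrm 1 L v)\<^sup>2)"
proof -
  \<comment> \<open>The Wiener process supplies the continuous random variable on which the growth
    argument relies; \<open>T > 0\<close> makes its variance positive.\<close>
  have "distributed M lborel (\<lambda>\<omega>. W T \<omega> - W 0 \<omega>) (normal_density 0 (sqrt (T - 0)))"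
    using T by (intro W_increment) auto
  from noise_coefficient_H1_growth[OF prob_space_axioms L B this] that show ?thesis by metis
qed

lemma noise_lipschitz:
  obtains C where "\<And>v w. v \<in> L2per L \<Longrightarrow> w \<in> L2per L \<Longrightarrow>
    L2_nrm L (\<lambda>x. B v x - B w x) \<le> C * L2_nrm L (\<lambda>x. v x - w x)"
  using B unfolding noise_coefficient_def by blast

lemma f_H1: "t \<in> {0..T} \<Longrightarrow> AE \<omega> in M. f \<omega> t \<in> Hper 1 L"
  using f_adapted by (auto simp: strongly_measurable_def)

text \<open>The supremum over time is inside the expectation, hence a single constant serves all
  times and so all meshes.\<close>

lemma f_moment:
  obtains \<Phi> where "\<Phi> \<ge> 0" "\<And>t. t \<in> {0..T} \<Longrightarrow> (\<integral>\<^sup>+\<omega>. ennreal ((H_nrm 1 L (f \<omega> t))\<^sup>2) \<partial>M) \<le> ennreal \<Phi>"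
proof -
  let ?I = "\<integral>\<^sup>+\<omega>. ennreal ((holder_H1_nrm (1/2) T L (f \<omega>))\<^sup>2) \<partial>M"
  have fin: "?I < \<infinity>" and AE: "AE \<omega> in M. f \<omega> \<in> holder_H1 (1/2) T L"
    using f by (auto simp: L2_Omega_def strongly_measurable_def)
  obtain \<Phi> where \<Phi>: "\<Phi> \<ge> 0" "?I = ennreal \<Phi>" using fin by (cases ?I) auto
  show ?thesis
  proof (rule that[OF \<Phi>(1)])
    fix t assume t: "t \<in> {0..T}"
    show "(\<integral>\<^sup>+\<omega>. ennreal ((H_nrm 1 L (f \<omega> t))\<^sup>2) \<partial>M) \<le> ennreal \<Phi>"
      unfolding \<Phi>(2)[symmetric]
    proof (rule nn_integral_mono_AE)
      show "AE \<omega> in M. ennreal ((H_nrm 1 L (f \<omega> t))\<^sup>2) \<le> ennreal ((holder_H1_nrm (1/2) T L (f \<omega>))\<^sup>2)"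
        using AE by eventually_elim
          (intro ennreal_leI power_mono H_nrm_nonneg H_nrm_le_holder_H1_nrm[OF L T _ _ t]; simp)
    qed
  qed
qed

lemma u0_moment:
  obtains Y0 where "Y0 \<ge> 0" "(\<integral>\<^sup>+\<omega>. ennreal ((H_nrm 1 L (u0 \<omega>))\<^sup>2) \<partial>M) \<le> ennreal Y0"
proof -
  let ?I = "\<integral>\<^sup>+\<omega>. ennreal ((H_nrm 2 L (u0 \<omega>))\<^sup>2) \<partial>M"
  have fin: "?I < \<infinity>" using u0 by (simp add: L2_Omega_def)
  obtain Y0 where Y0: "Y0 \<ge> 0" "?I = ennreal Y0" using fin by (cases ?I) auto
  have "(\<integral>\<^sup>+\<omega>. ennreal ((H_nrm 1 L (u0 \<omega>))\<^sup>2) \<partial>M) \<le> ?I"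
    by (intro nn_integral_mono ennreal_leI power_mono H_nrm_mono H_nrm_nonneg) auto
  then show ?thesis using that Y0 by simp
qed

end

locale stokes_run = stokes_data M L T F W u0 f B
  for M :: "'w measure" and L T F W and u0 :: "'w \<Rightarrow> real^'n \<Rightarrow> real^'n" and f B +
  fixes N :: nat and \<xi> :: "nat \<Rightarrow> 'w \<Rightarrow> real^'n \<Rightarrow> real" and u :: "nat \<Rightarrow> 'w \<Rightarrow> real^'n \<Rightarrow> real^'n"
    and r :: "nat \<Rightarrow> 'w \<Rightarrow> real^'n \<Rightarrow> real"
  assumes N: "N \<ge> 1" and alg: "algorithm1 M T L f B u0 W N \<xi> u r"
begin

definition "k = T / real N"
definition "tm n = real n * k"
definition "dW n \<omega> = W (tm (Suc n)) \<omega> - W (tm n) \<omega>"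

lemma k: "k > 0" "k \<le> T" "real N * k = T"
  using T N by (auto simp: k_def divide_le_eq)

lemma tm: "n \<le> N \<Longrightarrow> tm n \<in> {0..T}"
  using mult_right_mono[of "real n" "real N" k] k by (auto simp: tm_def)

lemma tm_Suc: "tm n < tm (Suc n)" "tm (Suc n) - tm n = k"
  using k by (auto simp: tm_def algebra_simps)

lemma u_0: "u 0 = u0"
  using alg by (simp add: algorithm1_def Let_def)

lemma alg_step:
  assumes "n < N"
  shows "AE \<omega> in M. \<xi> n \<omega> \<in> Hper 1 L"
    "AE \<omega> in M. \<forall>\<phi>\<in>Hper 1 L. L2_ip L (grad L (\<xi> n \<omega>)) (grad L \<phi>) = L2_ip L (B (u n \<omega>)) (grad L \<phi>)"
    "AE \<omega> in M. u (Suc n) \<omega> \<in> Vdiv L"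
    "AE \<omega> in M. r (Suc n) \<omega> \<in> L2per L"
    "AE \<omega> in M. \<forall>v\<in>Hper 1 L. \<forall>q\<in>L2per L.
       L2_ip L (u (Suc n) \<omega>) v + k * grad_ip L (u (Suc n) \<omega>) v - k * L2_ip L (divergence L v) (r (Suc n) \<omega>)
       = L2_ip L (u n \<omega>) v + k * L2_ip L (f \<omega> (tm (Suc n))) v
         + L2_ip L (\<lambda>x. dW n \<omega> *\<^sub>R (B (u n \<omega>) x - grad L (\<xi> n \<omega>) x)) v \<and>
       L2_ip L (divergence L (u (Suc n) \<omega>)) q = 0"
proof -
  note a = alg[unfolded algorithm1_def Let_def, folded k_def, folded tm_def, folded dW_def, THEN conjunct2, rule_format, OF assms]
  show "AE \<omega> in M. \<xi> n \<omega> \<in> Hper 1 L" "AE \<omega> in M. u (Suc n) \<omega> \<in> Vdiv L" "AE \<omega> in M. r (Suc n) \<omega> \<in> L2per L"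
    using a by (auto simp: L2_Omega_def strongly_measurable_def)
  show "AE \<omega> in M. \<forall>\<phi>\<in>Hper 1 L. L2_ip L (grad L (\<xi> n \<omega>)) (grad L \<phi>) = L2_ip L (B (u n \<omega>)) (grad L \<phi>)"
    using a by (elim conjE)
  show "AE \<omega> in M. \<forall>v\<in>Hper 1 L. \<forall>q\<in>L2per L.
       L2_ip L (u (Suc n) \<omega>) v + k * grad_ip L (u (Suc n) \<omega>) v - k * L2_ip L (divergence L v) (r (Suc n) \<omega>)
       = L2_ip L (u n \<omega>) v + k * L2_ip L (f \<omega> (tm (Suc n))) v
         + L2_ip L (\<lambda>x. dW n \<omega> *\<^sub>R (B (u n \<omega>) x - grad L (\<xi> n \<omega>) x)) v \<and>
       L2_ip L (divergence L (u (Suc n) \<omega>)) q = 0"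
    using a by (elim conjE)
qed

lemma u_Vdiv: "n \<le> N \<Longrightarrow> AE \<omega> in M. u n \<omega> \<in> Vdiv L"
proof (cases n)
  case 0
  then show ?thesis using u0 u_0 by (auto simp: L2_Omega_def strongly_measurable_def)
qed (use alg_step(3) in auto)

lemma step_AE:
  assumes "n < N"
  shows "AE \<omega> in M. (\<forall>m. (1 + k * stokes_ev L m) *\<^sub>R fcoef L m (u (Suc n) \<omega>)
      = fcoef L m (u n \<omega>) + k *\<^sub>R leray L m (fcoef L m (f \<omega> (tm (Suc n)))) + dW n \<omega> *\<^sub>R leray L m (fcoef L m (B (u n \<omega>))))
    \<and> u (Suc n) \<omega> \<in> Vdiv L \<inter> Hper 2 L \<and> r (Suc n) \<omega> \<in> Hper 1 L
    \<and> (grad_nrm L (r (Suc n) \<omega>))\<^sup>2 \<le> (L2_nrm L (f \<omega> (tm (Suc n))))\<^sup>2"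
  using alg_step[OF assms] u_Vdiv[OF less_imp_le[OF assms]] f_H1[OF tm[OF Suc_leI[OF assms]]]
proof eventually_elim
  case (elim \<omega>)
  have uL: "u n \<omega> \<in> L2per L" "u (Suc n) \<omega> \<in> L2per L" using elim(3,6) Vdiv_Hdiv by (auto simp: Hdiv_def)
  have fL: "f \<omega> (tm (Suc n)) \<in> L2per L" using elim(7) by (rule Hper_L2per)
  have BL: "B (u n \<omega>) \<in> L2per L" by (rule noise_coefficient_L2per[OF B uL(1)])
  have eq1: "L2_ip L (grad L (\<xi> n \<omega>)) (grad L \<phi>) = L2_ip L (B (u n \<omega>)) (grad L \<phi>)" if "\<phi> \<in> Hper 1 L" for \<phi>
    using elim(2) that by blast
  \<comment> \<open>The instance \<open>q = 0\<close> isolates the momentum equation.\<close>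
  have eq2: "L2_ip L (u (Suc n) \<omega>) v + k * grad_ip L (u (Suc n) \<omega>) v - k * L2_ip L (divergence L v) (r (Suc n) \<omega>)
       = L2_ip L (u n \<omega>) v + k * L2_ip L (f \<omega> (tm (Suc n))) v
         + L2_ip L (\<lambda>x. dW n \<omega> *\<^sub>R (B (u n \<omega>) x - grad L (\<xi> n \<omega>) x)) v" if "v \<in> Hper 1 L" for v
    using elim(5) that L2per_zero by blast
  have c: "(1 + k * stokes_ev L m) *\<^sub>R fcoef L m (u (Suc n) \<omega>)
      = fcoef L m (u n \<omega>) + k *\<^sub>R leray L m (fcoef L m (f \<omega> (tm (Suc n)))) + dW n \<omega> *\<^sub>R leray L m (fcoef L m (B (u n \<omega>)))" for m
    by (rule scheme_step_coef(1)[OF L k(1) elim(6) elim(3) elim(4) fL BL elim(1)]) (erule eq1, erule eq2)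
  have cr: "- fcoef L (- m) (r (Suc n) \<omega>) *\<^sub>R wavevec L m
      = fcoef L m (f \<omega> (tm (Suc n))) - leray L m (fcoef L m (f \<omega> (tm (Suc n))))" for m
    by (rule scheme_step_coef(2)[OF L k(1) elim(6) elim(3) elim(4) fL BL elim(1)]) (erule eq1, erule eq2)
  note reg = scheme_step_regularity[OF L k(1) uL elim(4) fL BL c cr]
  show ?case using c reg elim(3) by blast
qed

text \<open>The scheme states measurability of its solutions with respect to \<open>M\<close> only.
  Adaptedness, without which the increments would not be independent of the current iterate, follows
  by induction in time from the solved recursion.\<close>

lemma random_coefs:
  obtains X Y Z :: "nat \<Rightarrow> int^'n \<Rightarrow> 'w \<Rightarrow> real^'n" where
    "\<And>n m. n \<le> N \<Longrightarrow> X n m \<in> borel_measurable (F (tm n))" "\<And>n. n \<le> N \<Longrightarrow> AE \<omega> in M. \<forall>m. fcoef L m (u n \<omega>) = X n m \<omega>"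
    "\<And>n m. n \<le> N \<Longrightarrow> Y n m \<in> borel_measurable (F (tm n))" "\<And>n. n \<le> N \<Longrightarrow> AE \<omega> in M. \<forall>m. fcoef L m (f \<omega> (tm n)) = Y n m \<omega>"
    "\<And>n m. n < N \<Longrightarrow> Z n m \<in> borel_measurable (F (tm n))" "\<And>n. n < N \<Longrightarrow> AE \<omega> in M. \<forall>m. fcoef L m (B (u n \<omega>)) = Z n m \<omega>"
proof -
  obtain C where lip: "\<And>v w. v \<in> L2per L \<Longrightarrow> w \<in> L2per L \<Longrightarrow>
    L2_nrm L (\<lambda>x. B v x - B w x) \<le> C * L2_nrm L (\<lambda>x. v x - w x)" using noise_lipschitz by blast
  have exY: "\<exists>Y. (\<forall>m. Y m \<in> borel_measurable (F (tm n))) \<and> (AE \<omega> in M. \<forall>m. fcoef L m (f \<omega> (tm n)) = Y m \<omega>)" if n: "n \<le> N" for n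
  proof -
    have sm: "strongly_measurable M (F (tm n)) (Hper 1 L) (H_nrm 1 L) (\<lambda>\<omega>. f \<omega> (tm n))" using f_adapted tm[OF n] by blast
    have sub: "Hper 1 L \<subseteq> L2per L" using Hper_L2per by blast
    obtain Y where "\<And>m. Y m \<in> borel_measurable (F (tm n))"
      "AE \<omega> in M. f \<omega> (tm n) \<in> Hper 1 L \<and> (\<forall>m. fcoef L m (f \<omega> (tm n)) = Y m \<omega>)"
      by (rule strongly_measurable_coef[OF L sm sub L2_nrm_le_H_nrm space_F[OF tm[OF n]]]) (rule that)
    then show ?thesis by (intro exI[of _ Y]) (auto elim: eventually_mono)
  qed
  have exZ: "\<exists>Z. (\<forall>m. Z m \<in> borel_measurable (F (tm n))) \<and> (AE \<omega> in M. \<forall>m. fcoef L m (B (u n \<omega>)) = Z m \<omega>)"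
    if n: "n \<le> N" and X: "\<And>m. X m \<in> borel_measurable (F (tm n))" "AE \<omega> in M. \<forall>m. fcoef L m (u n \<omega>) = X m \<omega>" for n X
  proof -
    have U: "AE \<omega> in M. u n \<omega> \<in> L2per L \<and> (\<forall>m. fcoef L m (u n \<omega>) = X m \<omega>)"
      using X(2) u_Vdiv[OF n] by eventually_elim (use Vdiv_Hdiv in \<open>auto simp: Hdiv_def\<close>)
    obtain Z where "\<And>m. Z m \<in> borel_measurable (F (tm n))" "AE \<omega> in M. \<forall>m. fcoef L m (B (u n \<omega>)) = Z m \<omega>"
      by (rule lipschitz_coef_measurable[OF L noise_coefficient_L2per[OF B] lip X(1) space_F[OF tm[OF n]] U]) (assumption | rule that)+
    then show ?thesis by blast
  qed
  have exX: "\<exists>X. (\<forall>m. X m \<in> borel_measurable (F (tm n))) \<and> (AE \<omega> in M. \<forall>m. fcoef L m (u n \<omega>) = X m \<omega>)" if "n \<le> N" for n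
    using that
  proof (induction n)
    case 0
    have t0: "tm 0 = 0" by (simp add: tm_def)
    have sub: "Vdiv L \<inter> Hper 2 L \<subseteq> L2per L" using Vdiv_Hdiv by (auto simp: Hdiv_def)
    have sp: "space (F 0) = space M" using space_F[of 0] T by simp
    obtain X where "\<And>m. X m \<in> borel_measurable (F 0)"
      "AE \<omega> in M. u0 \<omega> \<in> Vdiv L \<inter> Hper 2 L \<and> (\<forall>m. fcoef L m (u0 \<omega>) = X m \<omega>)"
      by (rule strongly_measurable_coef[OF L u0_meas sub L2_nrm_le_H_nrm sp]) (rule that)
    then show ?case unfolding t0 u_0 by (intro exI[of _ X]) (auto elim: eventually_mono)
  next
    case (Suc n)
    then have n: "n < N" "n \<le> N" by auto
    obtain X where X: "\<And>m. X m \<in> borel_measurable (F (tm n))" "AE \<omega> in M. \<forall>m. fcoef L m (u n \<omega>) = X m \<omega>"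
      using Suc by auto
    obtain Z where Z: "\<And>m. Z m \<in> borel_measurable (F (tm n))" "AE \<omega> in M. \<forall>m. fcoef L m (B (u n \<omega>)) = Z m \<omega>"
      using exZ[OF n(2) X] by blast
    obtain Y where Y: "\<And>m. Y m \<in> borel_measurable (F (tm (Suc n)))" "AE \<omega> in M. \<forall>m. fcoef L m (f \<omega> (tm (Suc n))) = Y m \<omega>"
      using exY[OF Suc.prems] by blast
    have mono: "g \<in> borel_measurable (F (tm n)) \<Longrightarrow> g \<in> borel_measurable (F (tm (Suc n)))" for g :: "'w \<Rightarrow> real^'n"
      by (rule F_mono[OF tm[OF n(2)] tm[OF Suc.prems] less_imp_le[OF tm_Suc(1)]])
    have dWm: "dW n \<in> borel_measurable (F (tm (Suc n)))"
      unfolding dW_def using tm[OF n(2)] tm[OF Suc.prems] tm_Suc(1)[of n]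
      by (intro borel_measurable_diff W_measurable) auto
    \<comment> \<open>The implicit step solved for the new coefficient; every ingredient is
      measurable at the new time.\<close>
    let ?X = "\<lambda>m \<omega>. (1 / (1 + k * stokes_ev L m)) *\<^sub>R (X m \<omega> + k *\<^sub>R leray L m (Y m \<omega>) + dW n \<omega> *\<^sub>R leray L m (Z m \<omega>))"
    have m: "?X m \<in> borel_measurable (F (tm (Suc n)))" for m
      using mono[OF X(1)[of m]] mono[OF Z(1)[of m]] Y(1)[of m] dWm by measurable
    have ae: "AE \<omega> in M. \<forall>m. fcoef L m (u (Suc n) \<omega>) = ?X m \<omega>"
      using step_AE[OF n(1)] X(2) Y(2) Z(2)
    proof eventually_elim
      case (elim \<omega>)
      have "fcoef L m (u (Suc n) \<omega>) = ?X m \<omega>" for m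
      proof -
        have pos: "1 + k * stokes_ev L m > 0" using k(1) by (simp add: add_pos_nonneg)
        have "(1 + k * stokes_ev L m) *\<^sub>R fcoef L m (u (Suc n) \<omega>)
          = X m \<omega> + k *\<^sub>R leray L m (Y m \<omega>) + dW n \<omega> *\<^sub>R leray L m (Z m \<omega>)"
          using elim by simp
        then have "?X m \<omega> = (1 / (1 + k * stokes_ev L m)) *\<^sub>R ((1 + k * stokes_ev L m) *\<^sub>R fcoef L m (u (Suc n) \<omega>))"
          by (simp only:)
        then show ?thesis using pos by simp
      qed
      then show ?case by blast
    qed
    show ?case
    proof (intro exI[of _ ?X] conjI allI)
      show "?X m \<in> borel_measurable (F (tm (Suc n)))" for m by (rule m)
    qed (rule ae)
  qed
  let ?PX = "\<lambda>n X. (\<forall>m. X m \<in> borel_measurable (F (tm n))) \<and> (AE \<omega> in M. \<forall>m. fcoef L m (u n \<omega>) = X m \<omega>)"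
  let ?PY = "\<lambda>n Y. (\<forall>m. Y m \<in> borel_measurable (F (tm n))) \<and> (AE \<omega> in M. \<forall>m. fcoef L m (f \<omega> (tm n)) = Y m \<omega>)"
  let ?PZ = "\<lambda>n Z. (\<forall>m. Z m \<in> borel_measurable (F (tm n))) \<and> (AE \<omega> in M. \<forall>m. fcoef L m (B (u n \<omega>)) = Z m \<omega>)"
  have "\<forall>n. \<exists>X. n \<le> N \<longrightarrow> ?PX n X" "\<forall>n. \<exists>Y. n \<le> N \<longrightarrow> ?PY n Y" using exX exY by blast+
  from choice[OF this(1)] choice[OF this(2)]
  obtain X Y where X: "\<forall>n. n \<le> N \<longrightarrow> ?PX n (X n)" and Y: "\<forall>n. n \<le> N \<longrightarrow> ?PY n (Y n)" by (elim exE)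
  have "\<exists>Z. n < N \<longrightarrow> ?PZ n Z" for n
    using exZ[of n "X n"] X by (cases "n < N") auto
  then have "\<forall>n. \<exists>Z. n < N \<longrightarrow> ?PZ n Z" by blast
  from choice[OF this] obtain Z where Z: "\<forall>n. n < N \<longrightarrow> ?PZ n (Z n)" by (elim exE)
  show ?thesis by (rule that[of X Y Z]) (use X Y Z in auto)
qed

lemma run_regularity: "n \<in> {1..N} \<Longrightarrow> AE \<omega> in M. u n \<omega> \<in> Vdiv L \<inter> Hper 2 L \<and> r n \<omega> \<in> Hper 1 L"
proof (cases n)
  case (Suc j)
  assume "n \<in> {1..N}"
  then have "j < N" using Suc by simp
  from step_AE[OF this] show ?thesis unfolding Suc by eventually_elim blast
qed simp

text \<open>Path by path the pressure gradient is dominated by the force at the same time, and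
  \<open>N\<close> contributions of size \<open>k \<Phi>\<close> add up to \<open>T \<Phi>\<close>.
  The coefficients \<open>Y\<close> enter to justify exchanging the sum over time with the
  expectation.\<close>

lemma pressure_bound:
  assumes \<Phi>: "\<Phi> \<ge> 0" "\<And>t. t \<in> {0..T} \<Longrightarrow> (\<integral>\<^sup>+\<omega>. ennreal ((H_nrm 1 L (f \<omega> t))\<^sup>2) \<partial>M) \<le> ennreal \<Phi>"
    and Y: "\<And>n m. n \<le> N \<Longrightarrow> Y n m \<in> borel_measurable (F (tm n))"
      "\<And>n. n \<le> N \<Longrightarrow> AE \<omega> in M. \<forall>m. fcoef L m (f \<omega> (tm n)) = Y n m \<omega>"
  shows "(\<integral>\<^sup>+\<omega>. ennreal (k * (\<Sum>n=1..N. (grad_nrm L (r n \<omega>))\<^sup>2)) \<partial>M) \<le> ennreal (T * \<Phi>)"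
proof -
  have H1: "AE \<omega> in M. ennreal ((H_nrm 1 L (f \<omega> (tm n)))\<^sup>2) = (\<integral>\<^sup>+m. ennreal ((1 + stokes_ev L m) * (norm (Y n m \<omega>))\<^sup>2) \<partial>count_space UNIV)"
    if "n \<in> {1..N}" for n
  proof -
    have n: "n \<le> N" using that by simp
    show ?thesis using Y(2)[OF n] f_H1[OF tm[OF n]] by eventually_elim (simp only: Parseval_H1[OF L])
  qed
  have YM: "Y n m \<in> borel_measurable M" if "n \<in> {1..N}" for n m
    using that by (intro measurable_from_subalg[OF subalg[OF tm] Y(1)]) auto
  have "AE \<omega> in M. \<forall>n\<in>{1..N}. (grad_nrm L (r n \<omega>))\<^sup>2 \<le> (H_nrm 1 L (f \<omega> (tm n)))\<^sup>2"
  proof (intro AE_finite_allI)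
    fix n assume "n \<in> {1..N}"
    then obtain j where j: "n = Suc j" "j < N" by (cases n) auto
    show "AE \<omega> in M. (grad_nrm L (r n \<omega>))\<^sup>2 \<le> (H_nrm 1 L (f \<omega> (tm n)))\<^sup>2"
      using step_AE[OF j(2)] unfolding j(1)
    proof eventually_elim
      case (elim \<omega>)
      have "(L2_nrm L (f \<omega> (tm (Suc j))))\<^sup>2 \<le> (H_nrm 1 L (f \<omega> (tm (Suc j))))\<^sup>2"
        by (intro power_mono L2_nrm_le_H_nrm) simp
      then show ?case using elim by linarith
    qed
  qed simp
  then have "(\<integral>\<^sup>+\<omega>. ennreal (k * (\<Sum>n=1..N. (grad_nrm L (r n \<omega>))\<^sup>2)) \<partial>M)
      \<le> (\<integral>\<^sup>+\<omega>. ennreal (\<Sum>n=1..N. k * (H_nrm 1 L (f \<omega> (tm n)))\<^sup>2) \<partial>M)"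
  proof (intro nn_integral_mono_AE, eventually_elim)
    case (elim \<omega>)
    then have "(\<Sum>n=1..N. (grad_nrm L (r n \<omega>))\<^sup>2) \<le> (\<Sum>n=1..N. (H_nrm 1 L (f \<omega> (tm n)))\<^sup>2)" by (intro sum_mono) auto
    from mult_left_mono[OF this less_imp_le[OF k(1)]] show ?case
      unfolding sum_distrib_left by (rule ennreal_leI)
  qed
  also have "\<dots> = (\<Sum>n=1..N. \<integral>\<^sup>+m. ennreal (k * (1 + stokes_ev L m)) * (\<integral>\<^sup>+\<omega>. ennreal ((norm (Y n m \<omega>))\<^sup>2) \<partial>M) \<partial>count_space UNIV)"
  proof (rule nn_integral_sum_modes[OF _ YM])
    fix n assume n: "n \<in> {1..N}"
    show "AE \<omega> in M. ennreal (k * (H_nrm 1 L (f \<omega> (tm n)))\<^sup>2)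
        = (\<integral>\<^sup>+m. ennreal (k * (1 + stokes_ev L m) * (norm (Y n m \<omega>))\<^sup>2) \<partial>count_space UNIV)"
      using H1[OF n]
    proof eventually_elim
      case (elim \<omega>)
      have "ennreal (k * (H_nrm 1 L (f \<omega> (tm n)))\<^sup>2) = ennreal k * ennreal ((H_nrm 1 L (f \<omega> (tm n)))\<^sup>2)"
        using k(1) by (intro ennreal_mult) auto
      also have "\<dots> = (\<integral>\<^sup>+m. ennreal k * ennreal ((1 + stokes_ev L m) * (norm (Y n m \<omega>))\<^sup>2) \<partial>count_space UNIV)"
        unfolding elim by (rule nn_integral_cmult[symmetric]) simp
      also have "\<dots> = (\<integral>\<^sup>+m. ennreal (k * (1 + stokes_ev L m) * (norm (Y n m \<omega>))\<^sup>2) \<partial>count_space UNIV)"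
        using k(1) by (intro nn_integral_cong) (simp only: ennreal_mult[symmetric] mult_nonneg_nonneg less_imp_le add_nonneg_nonneg zero_le_one zero_le_power2 mult.assoc)
      finally show ?case .
    qed
  qed (use k(1) in \<open>auto\<close>)
  also have "\<dots> = (\<Sum>n=1..N. ennreal k * (\<integral>\<^sup>+\<omega>. ennreal ((H_nrm 1 L (f \<omega> (tm n)))\<^sup>2) \<partial>M))"
  proof (intro sum.cong refl)
    fix n assume n: "n \<in> {1..N}"
    have "(\<integral>\<^sup>+\<omega>. ennreal ((H_nrm 1 L (f \<omega> (tm n)))\<^sup>2) \<partial>M)
        = (\<integral>\<^sup>+m. ennreal (1 + stokes_ev L m) * (\<integral>\<^sup>+\<omega>. ennreal ((norm (Y n m \<omega>))\<^sup>2) \<partial>M) \<partial>count_space UNIV)"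
      by (rule nn_integral_modes[OF YM[OF n] _ _ H1[OF n]]) auto
    then have "ennreal k * (\<integral>\<^sup>+\<omega>. ennreal ((H_nrm 1 L (f \<omega> (tm n)))\<^sup>2) \<partial>M)
      = (\<integral>\<^sup>+m. ennreal k * (ennreal (1 + stokes_ev L m) * (\<integral>\<^sup>+\<omega>. ennreal ((norm (Y n m \<omega>))\<^sup>2) \<partial>M)) \<partial>count_space UNIV)"
      by (simp only: nn_integral_cmult borel_measurable_count_space)
    also have "\<dots> = (\<integral>\<^sup>+m. ennreal (k * (1 + stokes_ev L m)) * (\<integral>\<^sup>+\<omega>. ennreal ((norm (Y n m \<omega>))\<^sup>2) \<partial>M) \<partial>count_space UNIV)"
      using k(1) by (intro nn_integral_cong) (simp only: ennreal_mult less_imp_le add_nonneg_nonneg zero_le_one zero_le_power2 mult.assoc)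
    finally show "(\<integral>\<^sup>+m. ennreal (k * (1 + stokes_ev L m)) * (\<integral>\<^sup>+\<omega>. ennreal ((norm (Y n m \<omega>))\<^sup>2) \<partial>M) \<partial>count_space UNIV)
      = ennreal k * (\<integral>\<^sup>+\<omega>. ennreal ((H_nrm 1 L (f \<omega> (tm n)))\<^sup>2) \<partial>M)" by simp
  qed
  also have "\<dots> \<le> (\<Sum>n=1..N. ennreal k * ennreal \<Phi>)"
    by (intro sum_mono mult_left_mono \<Phi>(2) tm) auto
  also have "\<dots> = ennreal (T * \<Phi>)"
  proof -
    have "(\<Sum>n=1..N. ennreal k * ennreal \<Phi>) = (\<Sum>n=1..N. ennreal (k * \<Phi>))"
      using k(1) \<Phi>(1) by (simp only: ennreal_mult less_imp_le)
    also have "\<dots> = ennreal (\<Sum>n=1..N. k * \<Phi>)" using k(1) \<Phi>(1) by (intro sum_ennreal) simp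
    also have "(\<Sum>n=1..N. k * \<Phi>) = T * \<Phi>" using k(3) by simp
    finally show ?thesis .
  qed
  finally show ?thesis .
qed

text \<open>The constant \<open>bound\<close> of the coefficient recursion written out, which makes
  its independence of \<open>k\<close> and \<open>N\<close> visible.\<close>

definition velocity_bound :: "real \<Rightarrow> real \<Rightarrow> real \<Rightarrow> real" where
  "velocity_bound K \<Phi> Y0 = exp ((1 + (1 + T) * K) * T) * (Y0 + T * ((1 + T) * (K + \<Phi>)))"

lemma velocity_bounds:
  assumes nonneg: "K \<ge> 0" "\<Phi> \<ge> 0" "Y0 \<ge> 0"
    and K: "\<And>v. v \<in> Hper 1 L \<Longrightarrow> (H_nrm 1 L (B v))\<^sup>2 \<le> K * (1 + (H_nrm 1 L v)\<^sup>2)"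
    and \<Phi>: "\<And>t. t \<in> {0..T} \<Longrightarrow> (\<integral>\<^sup>+\<omega>. ennreal ((H_nrm 1 L (f \<omega> t))\<^sup>2) \<partial>M) \<le> ennreal \<Phi>"
    and Y0: "(\<integral>\<^sup>+\<omega>. ennreal ((H_nrm 1 L (u0 \<omega>))\<^sup>2) \<partial>M) \<le> ennreal Y0"
    and X: "\<And>n m. n \<le> N \<Longrightarrow> X n m \<in> borel_measurable (F (tm n))"
      "\<And>n. n \<le> N \<Longrightarrow> AE \<omega> in M. \<forall>m. fcoef L m (u n \<omega>) = X n m \<omega>"
    and Y: "\<And>n m. n \<le> N \<Longrightarrow> Y n m \<in> borel_measurable (F (tm n))"
      "\<And>n. n \<le> N \<Longrightarrow> AE \<omega> in M. \<forall>m. fcoef L m (f \<omega> (tm n)) = Y n m \<omega>"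
    and Z: "\<And>n m. n < N \<Longrightarrow> Z n m \<in> borel_measurable (F (tm n))"
      "\<And>n. n < N \<Longrightarrow> AE \<omega> in M. \<forall>m. fcoef L m (B (u n \<omega>)) = Z n m \<omega>"
  defines "R \<equiv> velocity_bound K \<Phi> Y0"
  shows "R \<ge> 0"
    and "n \<in> {1..N} \<Longrightarrow> (\<integral>\<^sup>+\<omega>. ennreal ((grad_nrm L (u n \<omega>))\<^sup>2) \<partial>M) \<le> ennreal R"
    and "(\<integral>\<^sup>+\<omega>. ennreal (\<Sum>n=1..N. (grad_nrm L (\<lambda>x. u n \<omega> x - u (n - 1) \<omega> x))\<^sup>2) \<partial>M)
      \<le> ennreal (3 * R + T * (3 * (T * \<Phi>) + 3 * (K * (1 + R))))"
    and "(\<integral>\<^sup>+\<omega>. ennreal (k * (\<Sum>n=1..N. (L2_nrm L (stokes L (u n \<omega>)))\<^sup>2)) \<partial>M) \<le> ennreal R"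
proof -
  have XM: "X n m \<in> borel_measurable M" if "n \<le> N" for n m
    by (rule measurable_from_subalg[OF subalg[OF tm[OF that]] X(1)[OF that]])
  have YM: "Y n m \<in> borel_measurable M" if "n \<le> N" for n m
    by (rule measurable_from_subalg[OF subalg[OF tm[OF that]] Y(1)[OF that]])
  have ZM: "Z n m \<in> borel_measurable M" if "n < N" for n m
    using measurable_from_subalg[OF subalg[OF tm] Z(1)] that by simp
  have u1: "AE \<omega> in M. u n \<omega> \<in> Hper 1 L" if "n \<le> N" for n
    using u_Vdiv[OF that] by eventually_elim (simp add: Vdiv_def)
  have HX: "AE \<omega> in M. ennreal ((H_nrm 1 L (u n \<omega>))\<^sup>2) = (\<integral>\<^sup>+m. ennreal ((1 + stokes_ev L m) * (norm (X n m \<omega>))\<^sup>2) \<partial>count_space UNIV)"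
    if "n \<le> N" for n
    using X(2)[OF that] u1[OF that] by eventually_elim (simp only: Parseval_H1[OF L])
  have HY: "AE \<omega> in M. ennreal ((H_nrm 1 L (f \<omega> (tm n)))\<^sup>2) = (\<integral>\<^sup>+m. ennreal ((1 + stokes_ev L m) * (norm (Y n m \<omega>))\<^sup>2) \<partial>count_space UNIV)"
    if "n \<le> N" for n
    using Y(2)[OF that] f_H1[OF tm[OF that]] by eventually_elim (simp only: Parseval_H1[OF L])
  have HZ: "AE \<omega> in M. ennreal ((H_nrm 1 L (B (u n \<omega>)))\<^sup>2) = (\<integral>\<^sup>+m. ennreal ((1 + stokes_ev L m) * (norm (Z n m \<omega>))\<^sup>2) \<partial>count_space UNIV)"
    if "n < N" for n
    using Z(2)[OF that] u1[OF less_imp_le[OF that]]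
    by eventually_elim (simp only: Parseval_H1[OF L noise_coefficient_Hper_1[OF prob_space_axioms L B]])
  interpret C: coefficient_scheme M L T k K \<Phi> Y0 N "\<lambda>n. F (tm n)" X Y Z dW
  proof unfold_locales
    show "L > 0" by (rule L)
    show "k > 0" "k \<le> T" "real N * k = T" by (rule k)+
    show "K \<ge> 0" "\<Phi> \<ge> 0" "Y0 \<ge> 0" by (rule nonneg)+
    show "subalgebra M (F (tm n))" if "n \<le> N" for n by (rule subalg[OF tm[OF that]])
    show "X n m \<in> borel_measurable (F (tm n))" if "n \<le> N" for n m by (rule X(1)[OF that])
    show "Z n m \<in> borel_measurable (F (tm n))" if "n < N" for n m by (rule Z(1)[OF that])
    show "Y n m \<in> borel_measurable M" if "n \<le> N" for n m by (rule YM[OF that])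
    show "distributed M lborel (dW n) (normal_density 0 (sqrt k))" if "n < N" for n
      using W_increment(1)[OF tm tm tm_Suc(1)] that unfolding tm_Suc(2) dW_def[abs_def] by simp
    show "indep_set (sets (F (tm n))) {dW n -` A \<inter> space M | A. A \<in> sets borel}" if "n < N" for n
      using W_increment(2)[OF tm tm tm_Suc(1)] that unfolding dW_def[abs_def] by simp
    show "AE \<omega> in M. \<forall>m. (1 + k * stokes_ev L m) *\<^sub>R X (Suc n) m \<omega>
        = X n m \<omega> + k *\<^sub>R leray L m (Y (Suc n) m \<omega>) + dW n \<omega> *\<^sub>R leray L m (Z n m \<omega>)" if n: "n < N" for n
      using step_AE[OF n] X(2)[OF less_imp_le[OF n]] X(2)[OF Suc_leI[OF n]] Y(2)[OF Suc_leI[OF n]] Z(2)[OF n]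
      by eventually_elim simp
    show "(\<integral>\<^sup>+m. ennreal (1 + stokes_ev L m) * (\<integral>\<^sup>+\<omega>. ennreal ((norm (Y (Suc n) m \<omega>))\<^sup>2) \<partial>M) \<partial>count_space UNIV) \<le> ennreal \<Phi>"
      if n: "n < N" for n
    proof -
      have n': "Suc n \<le> N" using n by simp
      have "(\<integral>\<^sup>+\<omega>. ennreal ((H_nrm 1 L (f \<omega> (tm (Suc n))))\<^sup>2) \<partial>M)
          = (\<integral>\<^sup>+m. ennreal (1 + stokes_ev L m) * (\<integral>\<^sup>+\<omega>. ennreal ((norm (Y (Suc n) m \<omega>))\<^sup>2) \<partial>M) \<partial>count_space UNIV)"
        by (rule nn_integral_modes[OF YM[OF n'] _ _ HY[OF n']]) auto
      then show ?thesis using \<Phi>[OF tm[OF n']] by (simp only:)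
    qed
    show "(\<integral>\<^sup>+m. ennreal (1 + stokes_ev L m) * (\<integral>\<^sup>+\<omega>. ennreal ((norm (X 0 m \<omega>))\<^sup>2) \<partial>M) \<partial>count_space UNIV) \<le> ennreal Y0"
    proof -
      have n': "0 \<le> N" by simp
      have "(\<integral>\<^sup>+\<omega>. ennreal ((H_nrm 1 L (u 0 \<omega>))\<^sup>2) \<partial>M)
          = (\<integral>\<^sup>+m. ennreal (1 + stokes_ev L m) * (\<integral>\<^sup>+\<omega>. ennreal ((norm (X 0 m \<omega>))\<^sup>2) \<partial>M) \<partial>count_space UNIV)"
        by (rule nn_integral_modes[OF XM[OF n'] _ _ HX[OF n']]) auto
      then show ?thesis using Y0 unfolding u_0 by (simp only:)
    qed
    \<comment> \<open>The growth bound holds for every field in H1, so it is applied path by path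
      and then translated into moments of the modes.\<close>
    show "(\<integral>\<^sup>+m. ennreal (1 + stokes_ev L m) * (\<integral>\<^sup>+\<omega>. ennreal ((norm (Z n m \<omega>))\<^sup>2) \<partial>M) \<partial>count_space UNIV)
        \<le> ennreal K * (1 + (\<integral>\<^sup>+m. ennreal (1 + stokes_ev L m) * (\<integral>\<^sup>+\<omega>. ennreal ((norm (X n m \<omega>))\<^sup>2) \<partial>M) \<partial>count_space UNIV))"
      if n: "n < N" for n
    proof -
      have n': "n \<le> N" using n by simp
      let ?Q = "\<lambda>\<omega>. \<integral>\<^sup>+m. ennreal ((1 + stokes_ev L m) * (norm (X n m \<omega>))\<^sup>2) \<partial>count_space UNIV"
      have Qm: "?Q \<in> borel_measurable M"
        by (rule nn_integral_mode_swap(2)) (use XM[OF n'] in measurable)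
      have "(\<integral>\<^sup>+m. ennreal (1 + stokes_ev L m) * (\<integral>\<^sup>+\<omega>. ennreal ((norm (Z n m \<omega>))\<^sup>2) \<partial>M) \<partial>count_space UNIV)
          = (\<integral>\<^sup>+\<omega>. ennreal ((H_nrm 1 L (B (u n \<omega>)))\<^sup>2) \<partial>M)"
        by (rule nn_integral_modes[OF ZM[OF n] _ _ HZ[OF n], symmetric]) auto
      also have "\<dots> \<le> (\<integral>\<^sup>+\<omega>. ennreal K * (1 + ?Q \<omega>) \<partial>M)"
      proof (rule nn_integral_mono_AE)
        show "AE \<omega> in M. ennreal ((H_nrm 1 L (B (u n \<omega>)))\<^sup>2) \<le> ennreal K * (1 + ?Q \<omega>)"
          using u1[OF n'] HX[OF n']
        proof eventually_elim
          case (elim \<omega>)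
          have "ennreal ((H_nrm 1 L (B (u n \<omega>)))\<^sup>2) \<le> ennreal (K * (1 + (H_nrm 1 L (u n \<omega>))\<^sup>2))"
            by (intro ennreal_leI K elim(1))
          also have "\<dots> = ennreal K * (ennreal 1 + ennreal ((H_nrm 1 L (u n \<omega>))\<^sup>2))"
            using nonneg(1) by (simp only: ennreal_mult ennreal_plus add_nonneg_nonneg zero_le_one zero_le_power2)
          finally show ?case unfolding elim(2) by (simp only: ennreal_1)
        qed
      qed
      also have "\<dots> = ennreal K * (1 + (\<integral>\<^sup>+\<omega>. ?Q \<omega> \<partial>M))"
        using Qm by (simp add: nn_integral_cmult nn_integral_add emeasure_space_1)
      also have "(\<integral>\<^sup>+\<omega>. ?Q \<omega> \<partial>M) = (\<integral>\<^sup>+\<omega>. ennreal ((H_nrm 1 L (u n \<omega>))\<^sup>2) \<partial>M)"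
        using HX[OF n'] by (intro nn_integral_cong_AE) (auto elim: eventually_mono)
      also have "\<dots> = (\<integral>\<^sup>+m. ennreal (1 + stokes_ev L m) * (\<integral>\<^sup>+\<omega>. ennreal ((norm (X n m \<omega>))\<^sup>2) \<partial>M) \<partial>count_space UNIV)"
        by (rule nn_integral_modes[OF XM[OF n'] _ _ HX[OF n']]) auto
      finally show ?thesis .
    qed
  qed
  have R: "C.bound = R"
    by (simp add: C.bound_def C.\<alpha>_def C.\<beta>_def R_def velocity_bound_def)
  show "R \<ge> 0" using C.bound_nonneg unfolding R .
  show "(\<integral>\<^sup>+\<omega>. ennreal ((grad_nrm L (u n \<omega>))\<^sup>2) \<partial>M) \<le> ennreal R" if "n \<in> {1..N}" for n
  proof -
    have n: "n \<le> N" using that by simp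
    have "(\<integral>\<^sup>+\<omega>. ennreal ((grad_nrm L (u n \<omega>))\<^sup>2) \<partial>M) \<le> (\<integral>\<^sup>+\<omega>. ennreal ((H_nrm 1 L (u n \<omega>))\<^sup>2) \<partial>M)"
      unfolding H_nrm_1_power2 by (intro nn_integral_mono ennreal_leI) simp
    also have "\<dots> = C.energy n" unfolding C.energy_def C.eX_def
      by (rule nn_integral_modes[OF XM[OF n] _ _ HX[OF n]]) auto
    also have "\<dots> \<le> ennreal R" using C.energy_le[OF n] unfolding R .
    finally show ?thesis .
  qed
  show "(\<integral>\<^sup>+\<omega>. ennreal (k * (\<Sum>n=1..N. (L2_nrm L (stokes L (u n \<omega>)))\<^sup>2)) \<partial>M) \<le> ennreal R"
  proof -
    have "(\<integral>\<^sup>+\<omega>. ennreal (k * (\<Sum>n=1..N. (L2_nrm L (stokes L (u n \<omega>)))\<^sup>2)) \<partial>M)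
        = (\<Sum>n=1..N. \<integral>\<^sup>+m. ennreal (k * (stokes_ev L m)\<^sup>2) * (\<integral>\<^sup>+\<omega>. ennreal ((norm (X n m \<omega>))\<^sup>2) \<partial>M) \<partial>count_space UNIV)"
      unfolding sum_distrib_left
    proof (rule nn_integral_sum_modes)
      fix n assume n: "n \<in> {1..N}"
      then have n': "n \<le> N" by simp
      show "X n m \<in> borel_measurable M" for m by (rule XM[OF n'])
      show "AE \<omega> in M. ennreal (k * (L2_nrm L (stokes L (u n \<omega>)))\<^sup>2)
          = (\<integral>\<^sup>+m. ennreal (k * (stokes_ev L m)\<^sup>2 * (norm (X n m \<omega>))\<^sup>2) \<partial>count_space UNIV)"
        using run_regularity[OF n] X(2)[OF n']
      proof eventually_elim
        case (elim \<omega>)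
        then have st: "ennreal ((L2_nrm L (stokes L (u n \<omega>)))\<^sup>2)
            = (\<integral>\<^sup>+m. ennreal ((stokes_ev L m)\<^sup>2 * (norm (X n m \<omega>))\<^sup>2) \<partial>count_space UNIV)"
          by (simp only: Parseval_stokes[OF L])
        have "ennreal (k * (L2_nrm L (stokes L (u n \<omega>)))\<^sup>2) = ennreal k * ennreal ((L2_nrm L (stokes L (u n \<omega>)))\<^sup>2)"
          using k(1) by (intro ennreal_mult) auto
        also have "\<dots> = (\<integral>\<^sup>+m. ennreal k * ennreal ((stokes_ev L m)\<^sup>2 * (norm (X n m \<omega>))\<^sup>2) \<partial>count_space UNIV)"
          unfolding st by (rule nn_integral_cmult[symmetric]) simp
        also have "\<dots> = (\<integral>\<^sup>+m. ennreal (k * (stokes_ev L m)\<^sup>2 * (norm (X n m \<omega>))\<^sup>2) \<partial>count_space UNIV)"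
          using k(1) by (intro nn_integral_cong) (simp only: ennreal_mult[symmetric] mult_nonneg_nonneg less_imp_le zero_le_power2 mult.assoc)
        finally show ?case .
      qed
    qed (use k(1) in auto)
    also have "\<dots> \<le> (\<Sum>n=1..N. C.dissipation n)"
      unfolding C.dissipation_def C.eX_def
    proof (intro sum_mono nn_integral_mono mult_right_mono ennreal_leI)
      fix m
      \<comment> \<open>The part of the dissipation weight that is linear in \<open>k\<close>
        already dominates the Stokes term.\<close>
      have "k * (stokes_ev L m)\<^sup>2 \<le> stokes_ev L m * (2 * k * stokes_ev L m)"
      proof -
        have "k * x\<^sup>2 \<le> x * (2 * k * x)" for x :: real
        proof -
          have "0 \<le> k * x\<^sup>2" using k(1) by simp
          moreover have "x * (2 * k * x) = 2 * (k * x\<^sup>2)" by (simp add: power2_eq_square)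
          ultimately show ?thesis by linarith
        qed
        then show ?thesis .
      qed
      also have "\<dots> \<le> (1 + stokes_ev L m) * (2 * k * stokes_ev L m + k\<^sup>2 * (stokes_ev L m)\<^sup>2)"
        using k(1) by (intro mult_mono) auto
      finally show "k * (stokes_ev L m)\<^sup>2 \<le> (1 + stokes_ev L m) * (2 * k * stokes_ev L m + k\<^sup>2 * (stokes_ev L m)\<^sup>2)" .
    qed auto
    also have "\<dots> \<le> ennreal R" using C.dissipation_sum_le unfolding R .
    finally show ?thesis .
  qed
  show "(\<integral>\<^sup>+\<omega>. ennreal (\<Sum>n=1..N. (grad_nrm L (\<lambda>x. u n \<omega> x - u (n - 1) \<omega> x))\<^sup>2) \<partial>M)
      \<le> ennreal (3 * R + T * (3 * (T * \<Phi>) + 3 * (K * (1 + R))))"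
  proof -
    let ?c = "3 * (T * \<Phi>) + 3 * (K * (1 + R))"
    have c0: "?c \<ge> 0" using T nonneg C.bound_nonneg unfolding R by simp
    have "(\<integral>\<^sup>+\<omega>. ennreal (\<Sum>n=1..N. (grad_nrm L (\<lambda>x. u n \<omega> x - u (n - 1) \<omega> x))\<^sup>2) \<partial>M)
        = (\<Sum>n=1..N. \<integral>\<^sup>+m. ennreal (stokes_ev L m) * (\<integral>\<^sup>+\<omega>. ennreal ((norm (X n m \<omega> - X (n - 1) m \<omega>))\<^sup>2) \<partial>M) \<partial>count_space UNIV)"
    proof (rule nn_integral_sum_modes)
      fix n assume n: "n \<in> {1..N}"
      then have n': "n \<le> N" "n - 1 \<le> N" by auto
      show "(\<lambda>\<omega>. X n m \<omega> - X (n - 1) m \<omega>) \<in> borel_measurable M" for m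
        by (intro borel_measurable_diff XM n')
      show "AE \<omega> in M. ennreal ((grad_nrm L (\<lambda>x. u n \<omega> x - u (n - 1) \<omega> x))\<^sup>2)
          = (\<integral>\<^sup>+m. ennreal (stokes_ev L m * (norm (X n m \<omega> - X (n - 1) m \<omega>))\<^sup>2) \<partial>count_space UNIV)"
        using u1[OF n'(1)] u1[OF n'(2)] X(2)[OF n'(1)] X(2)[OF n'(2)]
      proof eventually_elim
        case (elim \<omega>)
        have d: "(\<lambda>x. u n \<omega> x - u (n - 1) \<omega> x) \<in> Hper 1 L"
          using Hper_1_add_bound(2)[OF L elim(1,2)] by (simp only: fun_diff_def)
        show ?case
          unfolding Parseval_grad[OF L d] fcoef_diff[OF L Hper_L2per[OF elim(1)] Hper_L2per[OF elim(2)]]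
          using elim(3,4) by simp
      qed
    qed auto
    also have "\<dots> \<le> (\<Sum>n=1..N. ennreal 3 * C.dissipation n + ennreal (k * ?c))"
    proof (rule sum_mono)
      fix n assume "n \<in> {1..N}"
      then obtain j where j: "n = Suc j" "j < N" by (cases n) auto
      show "(\<integral>\<^sup>+m. ennreal (stokes_ev L m) * (\<integral>\<^sup>+\<omega>. ennreal ((norm (X n m \<omega> - X (n - 1) m \<omega>))\<^sup>2) \<partial>M) \<partial>count_space UNIV)
        \<le> ennreal 3 * C.dissipation n + ennreal (k * ?c)"
        using C.increment_step[OF j(2)] unfolding j(1) R diff_Suc_1 .
    qed
    also have "\<dots> = ennreal 3 * (\<Sum>n=1..N. C.dissipation n) + (\<Sum>n=1..N. ennreal (k * ?c))"
      by (simp only: sum.distrib sum_distrib_left)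
    also have "(\<Sum>n=1..N. ennreal (k * ?c)) = ennreal (T * ?c)"
    proof -
      have "(\<Sum>n=1..N. ennreal (k * ?c)) = ennreal (\<Sum>n=1..N. k * ?c)"
        using k(1) c0 by (intro sum_ennreal mult_nonneg_nonneg) auto
      also have "(\<Sum>n=1..N. k * ?c) = (real N * k) * ?c" by simp
      finally show ?thesis unfolding k(3) .
    qed
    also have "ennreal 3 * (\<Sum>n=1..N. C.dissipation n) + ennreal (T * ?c) \<le> ennreal 3 * ennreal R + ennreal (T * ?c)"
      using C.dissipation_sum_le unfolding R by (intro add_right_mono mult_left_mono) auto
    also have "\<dots> = ennreal (3 * R + T * ?c)"
      using C.bound_nonneg c0 T unfolding R by (simp only: ennreal_mult ennreal_plus zero_le_numeral mult_nonneg_nonneg less_imp_le)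
    finally show ?thesis .
  qed
qed

end

theorem lemma3p1:
  fixes L T :: real
    and M :: "'w measure"
    and F :: "real \<Rightarrow> 'w measure"
    and W :: "real \<Rightarrow> 'w \<Rightarrow> real"
    and u0 :: "'w \<Rightarrow> real^'n \<Rightarrow> real^'n"
    and f :: "'w \<Rightarrow> real \<Rightarrow> real^'n \<Rightarrow> real^'n"
    and B :: "(real^'n \<Rightarrow> real^'n) \<Rightarrow> real^'n \<Rightarrow> real^'n"
  assumes dim: "CARD('n) \<in> {2, 3}"
    and "L > 0" and "T > 0"
    and "prob_space M"
    and "continuous_filtration T M F"
    and "wiener_process T M F W"
    and u0: "u0 \<in> L2_Omega M (Vdiv L \<inter> Hper 2 L) (H_nrm 2 L)"
    and u0_meas: "strongly_measurable M (F 0) (Vdiv L \<inter> Hper 2 L) (H_nrm 2 L) u0"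
    and f: "f \<in> L2_Omega M (holder_H1 (1/2) T L) (holder_H1_nrm (1/2) T L)"
    and f_adapted: "\<forall>t\<in>{0..T}. strongly_measurable M (F t) (Hper 1 L) (H_nrm 1 L) (\<lambda>\<omega>. f \<omega> t)"
    and B: "noise_coefficient M L B"
  shows "\<exists>C::real. C > 0 \<and> (\<forall>N\<ge>1. \<forall>\<xi> u r. algorithm1 M T L f B u0 W N \<xi> u r \<longrightarrow>
           (let k = T / real N in
             (\<forall>n\<in>{1..N}. AE \<omega> in M. u n \<omega> \<in> Vdiv L \<inter> Hper 2 L \<and> r n \<omega> \<in> Hper 1 L) \<and>
             (MAX n\<in>{1..N}. \<integral>\<^sup>+\<omega>. ennreal ((grad_nrm L (u n \<omega>))\<^sup>2) \<partial>M)
               + (\<integral>\<^sup>+\<omega>. ennreal (\<Sum>n=1..N. (grad_nrm L (\<lambda>x. u n \<omega> x - u (n - 1) \<omega> x))\<^sup>2) \<partial>M)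
               + (\<integral>\<^sup>+\<omega>. ennreal (k * (\<Sum>n=1..N. (L2_nrm L (stokes L (u n \<omega>)))\<^sup>2)) \<partial>M)
               \<le> ennreal C \<and>
             (\<integral>\<^sup>+\<omega>. ennreal (k * (\<Sum>n=1..N. (grad_nrm L (r n \<omega>))\<^sup>2)) \<partial>M) \<le> ennreal C))"
proof -
  interpret D: stokes_data M L T F W u0 f B
    by (intro stokes_data.intro stokes_data_axioms.intro assms)
  obtain K where K: "K \<ge> 0" "\<And>v. v \<in> Hper 1 L \<Longrightarrow> (H_nrm 1 L (B v))\<^sup>2 \<le> K * (1 + (H_nrm 1 L v)\<^sup>2)"
    by (rule D.noise_growth) (rule that)
  obtain \<Phi> where \<Phi>: "\<Phi> \<ge> 0" "\<And>t. t \<in> {0..T} \<Longrightarrow> (\<integral>\<^sup>+\<omega>. ennreal ((H_nrm 1 L (f \<omega> t))\<^sup>2) \<partial>M) \<le> ennreal \<Phi>"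
    by (rule D.f_moment) (rule that)
  obtain Y0 where Y0: "Y0 \<ge> 0" "(\<integral>\<^sup>+\<omega>. ennreal ((H_nrm 1 L (u0 \<omega>))\<^sup>2) \<partial>M) \<le> ennreal Y0"
    by (rule D.u0_moment) (rule that)
  define R where "R = exp ((1 + (1 + T) * K) * T) * (Y0 + T * ((1 + T) * (K + \<Phi>)))"
  define I where "I = 3 * R + T * (3 * (T * \<Phi>) + 3 * (K * (1 + R)))"
  \<comment> \<open>Fixed before \<open>N\<close>: \<open>R\<close> serves the gradient and the
    Stokes term, \<open>I\<close> the increments, the last summand the pressure, and the 1 ensures
    positivity.\<close>
  define C where "C = 1 + R + I + R + T * \<Phi>"
  have R0: "R \<ge> 0" using \<open>T > 0\<close> K(1) \<Phi>(1) Y0(1) by (simp add: R_def)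
  have I0: "I \<ge> 0" using \<open>T > 0\<close> K(1) \<Phi>(1) R0 by (simp add: I_def)
  have T\<Phi>: "T * \<Phi> \<ge> 0" using \<open>T > 0\<close> \<Phi>(1) by simp
  have C0: "C > 0" using R0 I0 T\<Phi> unfolding C_def by linarith
  show ?thesis
    unfolding Let_def
  proof (intro exI[of _ C] conjI allI impI C0)
    fix N :: nat and \<xi> u r assume N: "N \<ge> 1" and alg: "algorithm1 M T L f B u0 W N \<xi> u r"
    interpret S: stokes_run M L T F W u0 f B N \<xi> u r
      by (intro stokes_run.intro stokes_run_axioms.intro D.stokes_data_axioms N alg)
    obtain X Y Z where X: "\<And>n m. n \<le> N \<Longrightarrow> X n m \<in> borel_measurable (F (S.tm n))"
        "\<And>n. n \<le> N \<Longrightarrow> AE \<omega> in M. \<forall>m. fcoef L m (u n \<omega>) = X n m \<omega>"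
      and Y: "\<And>n m. n \<le> N \<Longrightarrow> Y n m \<in> borel_measurable (F (S.tm n))"
        "\<And>n. n \<le> N \<Longrightarrow> AE \<omega> in M. \<forall>m. fcoef L m (f \<omega> (S.tm n)) = Y n m \<omega>"
      and Z: "\<And>n m. n < N \<Longrightarrow> Z n m \<in> borel_measurable (F (S.tm n))"
        "\<And>n. n < N \<Longrightarrow> AE \<omega> in M. \<forall>m. fcoef L m (B (u n \<omega>)) = Z n m \<omega>"
      by (rule S.random_coefs) (rule that)
    have R: "S.velocity_bound K \<Phi> Y0 = R" by (simp add: S.velocity_bound_def R_def)
    have kN: "S.k = T / real N" by (rule S.k_def)
    note vb = S.velocity_bounds[OF K(1) \<Phi>(1) Y0(1) K(2) \<Phi>(2) Y0(2) X Y Z, unfolded R kN, folded I_def]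
    show "\<forall>n\<in>{1..N}. AE \<omega> in M. u n \<omega> \<in> Vdiv L \<inter> Hper 2 L \<and> r n \<omega> \<in> Hper 1 L"
      using S.run_regularity by blast
    \<comment> \<open>\<open>N \<ge> 1\<close> makes the index set nonempty, so the maximum is a
      genuine one.\<close>
    have "(MAX n\<in>{1..N}. \<integral>\<^sup>+\<omega>. ennreal ((grad_nrm L (u n \<omega>))\<^sup>2) \<partial>M) \<le> ennreal R"
      using N vb(2) by (intro Max.boundedI) auto
    then have "(MAX n\<in>{1..N}. \<integral>\<^sup>+\<omega>. ennreal ((grad_nrm L (u n \<omega>))\<^sup>2) \<partial>M)
               + (\<integral>\<^sup>+\<omega>. ennreal (\<Sum>n=1..N. (grad_nrm L (\<lambda>x. u n \<omega> x - u (n - 1) \<omega> x))\<^sup>2) \<partial>M)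
               + (\<integral>\<^sup>+\<omega>. ennreal (T / real N * (\<Sum>n=1..N. (L2_nrm L (stokes L (u n \<omega>)))\<^sup>2)) \<partial>M)
               \<le> ennreal R + ennreal I + ennreal R"
      by (intro add_mono vb)
    also have "\<dots> = ennreal (R + I + R)" using R0 I0 by (simp only: ennreal_plus add_nonneg_nonneg)
    also have "\<dots> \<le> ennreal C" using T\<Phi> by (intro ennreal_leI) (simp add: C_def)
    finally show "(MAX n\<in>{1..N}. \<integral>\<^sup>+\<omega>. ennreal ((grad_nrm L (u n \<omega>))\<^sup>2) \<partial>M)
               + (\<integral>\<^sup>+\<omega>. ennreal (\<Sum>n=1..N. (grad_nrm L (\<lambda>x. u n \<omega> x - u (n - 1) \<omega> x))\<^sup>2) \<partial>M)
               + (\<integral>\<^sup>+\<omega>. ennreal (T / real N * (\<Sum>n=1..N. (L2_nrm L (stokes L (u n \<omega>)))\<^sup>2)) \<partial>M)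
               \<le> ennreal C" .
    have "(\<integral>\<^sup>+\<omega>. ennreal (T / real N * (\<Sum>n=1..N. (grad_nrm L (r n \<omega>))\<^sup>2)) \<partial>M) \<le> ennreal (T * \<Phi>)"
      using S.pressure_bound[OF \<Phi> Y] unfolding kN .
    also have "\<dots> \<le> ennreal C" using R0 I0 by (intro ennreal_leI) (simp add: C_def)
    finally show "(\<integral>\<^sup>+\<omega>. ennreal (T / real N * (\<Sum>n=1..N. (grad_nrm L (r n \<omega>))\<^sup>2)) \<partial>M) \<le> ennreal C" .
  qed
qed

end
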